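(* Let $\mu_X,\mu_Y\in\mathbb{R}$, $\sigma_X,\sigma_Y>0$, $-1<\rho<1$ and let $n\geq1$ be an integer. Let $S_n=\sum_{i=1}^n Z_i$, where $Z_1,\ldots,Z_n$ are independent copies of $Z=XY$ and $(X,Y)$ is bivariate normal with mean vector $(\mu_X,\mu_Y)$, variances $(\sigma_X^2,\sigma_Y^2)$ and correlation coefficient $\rho$. Let $F(x)=\mathbb{P}(S_n\leq x)$ and $\bar F(x)=1-F(x)=\mathbb{P}(S_n>x)$. Let $r_X,r_Y,s,C_n$, the coefficients $c_\ell$ and $d_k$, the symbols $(v)_j$ and $\binom{v}{k}$, and $\sim$ be as defined in the context. 1. Suppose that $r_X+r_Y\neq0$. Then, as $x\rightarrow\infty$, $$\bar{F}(x)\sim\frac{(1+\rho)C_n}{2\sqrt{2\pi }}\bigg(\frac{1+\rho}{|r_X+r_Y|\sqrt{n}}\bigg)^{(n-1)/2}\exp\bigg(\frac{n}{8}\bigg(\frac{1+\rho}{1-\rho}\bigg)(r_X-r_Y)^2\bigg)\bigg(\frac{x}{s}\bigg)^{(n-3)/4}\exp\bigg(\frac{|r_X+r_Y|}{1+\rho}\sqrt{\frac{nx}{s}}-\frac{x}{s(1+\rho)}\bigg)\sum_{p=0}^\infty \gamma_p(r_X,r_Y,\rho,n)\frac{s^{p/2}}{x^{p/2}},$$ where $\gamma_0(r_X,r_Y,\rho,n)=1$ and, for $p\geq1$, $$\gamma_p(r_X,r_Y,\rho,n)=\sum_{\substack{i,j,k,\ell\geq0 \\ i+2j+k+\ell=p}}(-1)^{j+i}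 c_\ell(r_X,r_Y,\rho,n) \binom{(n-1)/2-\ell}{k}\binom{(n-3)/2-\ell-k-2j}{i}\bigg(\frac{\ell+k}{2}-\frac{n-3}{4}\bigg)_j(1+\rho)^j\bigg(\frac{|r_X+r_Y|\sqrt{n}}{2}\bigg)^{k+i}.$$ 2. Suppose that $r_X+r_Y=0$. Then, as $x\rightarrow\infty$, $$\bar{F}(x)\sim \frac{1+\rho}{2^{n/2}\Gamma(n/2)}\bigg(\frac{x}{s}\bigg)^{n/2-1}\exp\bigg(-\frac{nr_X^2}{2}-\frac{x}{s(1+\rho)}\bigg)\sum_{k=0}^\infty \delta_k(r_X,\rho,n)\frac{s^k}{x^k},$$ where $\delta_0(r_X,\rho,n)=1$ and, for $k\geq1$, $$\delta_k(r_X,\rho,n)=\sum_{j=0}^k (-1)^{k-j}d_j(r_X,\rho,n)\, \bigg(k+1-\frac n2\bigg)_{k-j}(1+\rho)^{k-j}.$$ 3. Suppose that $r_X-r_Y\neq0$. Then, as $x\rightarrow-\infty$, $$F(x)\sim\frac{(1-\rho)C_n}{2\sqrt{2\pi }}\bigg(\frac{1-\rho}{|r_X-r_Y|\sqrt{n}}\bigg)^{(n-1)/2}\exp\bigg(\frac{n}{8}\bigg(\frac{1-\rho}{1+\rho}\bigg)(r_X+r_Y)^2\bigg)\bigg(\frac{|x|}{s}\bigg)^{(n-3)/4}\exp\bigg(\frac{|r_X-r_Y|}{1-\rho}\sqrt{\frac{n|x|}{s}}+\frac{x}{s(1-\rho)}\bigg)\sum_{p=0}^\infty \gamma_p(r_X,-r_Y,-\rho,n)\frac{s^{p/2}}{|x|^{p/2}},$$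 where $\gamma_p(r_X,-r_Y,-\rho,n)$ is given by the formulas in part 1 with $(r_Y,\rho)$ replaced by $(-r_Y,-\rho)$. 4. Suppose that $r_X-r_Y=0$. Then, as $x\rightarrow-\infty$, $$F(x)\sim \frac{1-\rho}{2^{n/2}\Gamma(n/2)}\bigg(\frac{|x|}{s}\bigg)^{n/2-1}\exp\bigg(-\frac{nr_X^2}{2}+\frac{x}{s(1-\rho)}\bigg)\sum_{k=0}^\infty \delta_k(r_X,-\rho,n)\frac{s^k}{|x|^k},$$ where $\delta_k(r_X,-\rho,n)$ is given by the formulas in part 2 with $\rho$ replaced by $-\rho$.
   Context: Notation: $r_X=\mu_X/\sigma_X$, $r_Y=\mu_Y/\sigma_Y$, $s=\sigma_X\sigma_Y$, and $$C_n=\exp\bigg\{-\frac{n(r_X^2+r_Y^2-2\rho r_X r_Y)}{2(1-\rho^2)}\bigg\}.$$ The Pochhammer symbol is $(v)_j=v(v+1)\cdots(v+j-1)$, $(v)_0=1$; the generalised binomial coefficient is $\binom{v}{k}=v(v-1)\cdots(v-k+1)/k!$ for $v\in\mathbb{R}$, with $\binom v0=1$. $\lceil\cdot\rceil$ is the ceiling function. $M(a,b,x)=\sum_{j=0}^\infty\frac{(a)_j}{(b)_j}\frac{x^j}{j!}$ is the confluent hypergeometric function of the first kind. For $a,b\in\mathbb{R}$ and integers $i,j\geq 0$, $g_{i,j}(a,b)$ is the coefficient of $u^iy^{j/2}$ in the Puiseux series expansion about $y=0$: $$(1+uy)^a\exp(by^{-1/2}(\sqrt{1+uy}-1))=\sum_{j=0}^\infty\bigg(\sum_{i=\lceil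 j/2\rceil}^j g_{i,j}(a,b)u^i\bigg)y^{j/2}.$$ Coefficients $c_\ell$ (for $r_X+r_Y\neq0$): $c_0(r_X,r_Y,\rho,n)=1$ and, for $\ell\geq1$, $$c_\ell(r_X,r_Y,\rho,n)=\exp\bigg(-\frac{n}{8}\bigg(\frac{1+\rho}{1-\rho}\bigg)(r_X-r_Y)^2\bigg)\sum_{j=0}^\ell h_{j,\ell}(r_X,r_Y,\rho,n),$$ $$h_{j,\ell}(r_X,r_Y,\rho,n)=\frac{((3-n)/2)_{\ell-j}((n-1)/2)_{\ell-j}}{(\ell-j)!\,2^{\ell-j}n^{(\ell-j)/2}}\bigg(\frac{1+\rho}{|r_X+r_Y|}\bigg)^{\ell-j}\sum_{i=\lceil j/2\rceil}^j\bigg(\frac{n}{2}\bigg)_i\bigg(\frac{1-\rho^2}{2}\bigg)^i M\bigg(\frac{n}{2}+i,\frac{n}{2},\frac{n}{8}\bigg(\frac{1+\rho}{1-\rho}\bigg)(r_X-r_Y)^2\bigg)\, g_{i,j}\bigg(\frac{n-3}{4}-\frac{\ell-j}{2},\frac{|r_X+r_Y|}{1+\rho}\sqrt{n}\bigg).$$ Coefficients $d_k$: $d_0(r_X,\rho,n)=1$ and, for $k\geq1$, $$d_k(r_X,\rho,n)=(-1)^k\frac{(1-n/2)_k(n/2)_k}{k!}\bigg(\frac{1-\rho^2}{2}\bigg)^k\sum_{j=0}^k\frac{(n/2)^j}{(n/2)_j}\binom{k}{j}\bigg(\frac{1+\rho}{1-\rho}\bigg)^jr_X^{2j}.$$ Asymptotic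 expansions are in the sense of Poincaré: $G(x)\sim\phi(x)\sum_{\ell=0}^\infty a_\ell |x|^{-\ell\kappa}$ as $x\to\pm\infty$ (with $\kappa=1/2$ or $\kappa=1$) means that, for every integer $N\geq1$, $G(x)=\phi(x)\big(\sum_{\ell=0}^{N-1}a_\ell|x|^{-\ell\kappa}+O(|x|^{-N\kappa})\big)$ in that limit.
   Formalization: In δ_k (parts 2 and 4) the Pochhammer factor (k+1−n/2)_{k−j} is corrected to (j+1−n/2)_{k−j}; as printed the claim fails, e.g. for n=2, μ_X=μ_Y=0, ρ=0, where the right tail is exactly e^{−x/s}/2 but the printed δ_1 is −1. *)

theory Defs
  imports "HOL-Probability.Probability" "HOL-Complex_Analysis.Complex_Analysis"
begin

definition bivariate_normal_density ::
    "real \<Rightarrow> real \<Rightarrow> real \<Rightarrow> real \<Rightarrow> real \<Rightarrow> real \<times> real \<Rightarrow> real" where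
  "bivariate_normal_density \<mu>X \<mu>Y \<sigma>X \<sigma>Y \<rho> = (\<lambda>(x, y).
     exp (- (((x - \<mu>X) / \<sigma>X)\<^sup>2 - 2 * \<rho> * ((x - \<mu>X) / \<sigma>X) * ((y - \<mu>Y) / \<sigma>Y) + ((y - \<mu>Y) / \<sigma>Y)\<^sup>2)
            / (2 * (1 - \<rho>\<^sup>2)))
       / (2 * pi * \<sigma>X * \<sigma>Y * sqrt (1 - \<rho>\<^sup>2)))"

text \<open>Only meant for the nondegenerate case \<open>\<sigma>X, \<sigma>Y > 0\<close> and \<open>-1 < \<rho> < 1\<close>;
  \<open>\<sigma>X\<close>, \<open>\<sigma>Y\<close> are standard deviations.\<close>

definition bivariate_normal ::
    "'a measure \<Rightarrow> ('a \<Rightarrow> real) \<Rightarrow> ('a \<Rightarrow> real) \<Rightarrow> real \<Rightarrow> real \<Rightarrow> real \<Rightarrow> real \<Rightarrow> real \<Rightarrow> bool" where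
  "bivariate_normal M X Y \<mu>X \<mu>Y \<sigma>X \<sigma>Y \<rho> \<longleftrightarrow>
     distributed M (lborel \<Otimes>\<^sub>M lborel) (\<lambda>\<omega>. (X \<omega>, Y \<omega>))
       (\<lambda>z. ennreal (bivariate_normal_density \<mu>X \<mu>Y \<sigma>X \<sigma>Y \<rho> z))"

text \<open>\<open>G(x) \<sim> \<phi>(x) \<Sum>\<^sub>l a\<^sub>l |x|\<^bsup>-l\<kappa>\<^esup>\<close> in the sense of Poincare, as \<open>x\<close> tends along the filter \<open>L\<close>.\<close>

definition poincare_expansion ::
    "(real \<Rightarrow> real) \<Rightarrow> (real \<Rightarrow> real) \<Rightarrow> (nat \<Rightarrow> real) \<Rightarrow> real \<Rightarrow> real filter \<Rightarrow> bool" where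
  "poincare_expansion G \<phi> a \<kappa> L \<longleftrightarrow>
     (\<forall>N\<ge>1. \<exists>R. R \<in> O[L](\<lambda>x. \<bar>x\<bar> powr (- (real N * \<kappa>))) \<and>
        (\<forall>\<^sub>F x in L. G x = \<phi> x * ((\<Sum>l<N. a l * \<bar>x\<bar> powr (- (real l * \<kappa>))) + R x)))"

definition kummer_M :: "real \<Rightarrow> real \<Rightarrow> real \<Rightarrow> real" where
  "kummer_M a b x = (\<Sum>j. pochhammer a j / pochhammer b j * (x ^ j / fact j))"

text \<open>The family \<open>g\<close> consists of the coefficients \<open>g i j\<close> of \<open>u\<^bsup>i\<^esup> y\<^bsup>j/2\<^esup>\<close> in the Puiseux expansion
  about \<open>y = 0\<close> of \<open>(1 + u y)\<^bsup>a\<^esup> exp (b y\<^bsup>-1/2\<^esup> (sqrt (1 + u y) - 1))\<close>. How small \<open>y > 0\<close> has to be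
  may depend on \<open>u\<close>.\<close>

definition puiseux_coeffs :: "real \<Rightarrow> real \<Rightarrow> (nat \<Rightarrow> nat \<Rightarrow> real) \<Rightarrow> bool" where
  "puiseux_coeffs a b g \<longleftrightarrow>
     (\<forall>i j. i \<notin> {nat \<lceil>real j / 2\<rceil>..j} \<longrightarrow> g i j = 0) \<and>
     (\<forall>u. \<forall>\<^sub>F y in at_right 0.
        (\<lambda>j. (\<Sum>i = nat \<lceil>real j / 2\<rceil>..j. g i j * u ^ i) * y powr (real j / 2)) sums
          ((1 + u * y) powr a * exp (b * y powr (- 1 / 2) * (sqrt (1 + u * y) - 1))))"

definition g_coeff :: "nat \<Rightarrow> nat \<Rightarrow> real \<Rightarrow> real \<Rightarrow> real" where
  "g_coeff i j a b = (THE g. puiseux_coeffs a b g) i j"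

context
begin

private definition graded :: "(real \<Rightarrow> complex fps) \<Rightarrow> bool" where
  "graded F \<longleftrightarrow> (\<exists>p :: nat \<Rightarrow> real poly.
     (\<forall>i j. coeff (p j) i \<noteq> 0 \<longrightarrow> i \<le> j \<and> j \<le> 2 * i) \<and>
     (\<forall>u j. fps_nth (F u) j = of_real (poly (p j) u)))"

private lemma graded_const: "graded (\<lambda>u. fps_const (of_real c))"
  unfolding graded_def
  by (rule exI[of _ "\<lambda>j. if j = 0 then [:c:] else 0"])
     (auto simp: coeff_pCons split: nat.splits)

private lemma graded_X: "graded (\<lambda>u. fps_const (of_real u) * fps_X)"
  unfolding graded_def
  by (rule exI[of _ "\<lambda>j. if j = 1 then [:0, 1:] else 0"])
     (auto simp: coeff_pCons fps_X_def split: nat.splits)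

private lemma graded_X2: "graded (\<lambda>u. fps_const (of_real u) * fps_X ^ 2)"
  unfolding graded_def
  by (rule exI[of _ "\<lambda>j. if j = 2 then [:0, 1:] else 0"])
     (auto simp: coeff_pCons fps_X_power_nth split: nat.splits)

private lemma graded_mult:
  assumes "graded F" "graded G"
  shows "graded (\<lambda>u. F u * G u)"
proof -
  obtain p where p: "\<And>i j. coeff (p j) i \<noteq> 0 \<Longrightarrow> i \<le> j \<and> j \<le> 2 * i"
      "\<And>u j. fps_nth (F u) j = of_real (poly (p j) u)"
    using assms(1) unfolding graded_def by blast
  obtain q where q: "\<And>i j. coeff (q j) i \<noteq> 0 \<Longrightarrow> i \<le> j \<and> j \<le> 2 * i"
      "\<And>u j. fps_nth (G u) j = of_real (poly (q j) u)"
    using assms(2) unfolding graded_def by blast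
  define r where "r = (\<lambda>j. \<Sum>k=0..j. p k * q (j - k))"
  have "i \<le> j \<and> j \<le> 2 * i" if nz: "coeff (r j) i \<noteq> 0" for i j
  proof -
    have "(\<Sum>k=0..j. coeff (p k * q (j - k)) i) \<noteq> 0"
      using nz by (simp add: r_def coeff_sum)
    then obtain k where k: "k \<in> {0..j}" "coeff (p k * q (j - k)) i \<noteq> 0"
      by (meson sum.neutral)
    then have "(\<Sum>m\<le>i. coeff (p k) m * coeff (q (j - k)) (i - m)) \<noteq> 0"
      by (simp add: coeff_mult)
    then obtain m where m: "m \<le> i" "coeff (p k) m * coeff (q (j - k)) (i - m) \<noteq> 0"
      by (metis (no_types, lifting) atMost_iff sum.neutral)
    then have "m \<le> k \<and> k \<le> 2 * m" "i - m \<le> j - k \<and> j - k \<le> 2 * (i - m)"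
      using p(1)[of k m] q(1)[of "j - k" "i - m"] by auto
    with k m show ?thesis by auto
  qed
  moreover have "fps_nth (F u * G u) j = of_real (poly (r j) u)" for u j
    by (simp add: fps_mult_nth p q r_def poly_sum)
  ultimately show ?thesis unfolding graded_def by blast
qed

private lemma graded_power: "graded F \<Longrightarrow> graded (\<lambda>u. F u ^ n)"
proof (induction n)
  case 0
  show ?case using graded_const[of 1] by simp
next
  case (Suc n)
  then show ?case using graded_mult[of F "\<lambda>u. F u ^ n"] by simp
qed

private lemma graded_compose:
  assumes "graded F" and A: "\<And>n. fps_nth A n \<in> \<real>"
  shows "graded (\<lambda>u. A oo F u)"
proof -
  have "\<forall>n. \<exists>p. (\<forall>i j. coeff (p j) i \<noteq> 0 \<longrightarrow> i \<le> j \<and> j \<le> 2 * i) \<and>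
      (\<forall>u j. fps_nth (F u ^ n) j = of_real (poly (p j) u))"
    using graded_power[OF assms(1)] unfolding graded_def by blast
  then obtain p where p: "\<And>n i j. coeff (p n j) i \<noteq> 0 \<Longrightarrow> i \<le> j \<and> j \<le> 2 * i"
      "\<And>n u j. fps_nth (F u ^ n) j = of_real (poly (p n j) u)"
    by metis
  define r where "r = (\<lambda>j. \<Sum>n=0..j. smult (Re (fps_nth A n)) (p n j))"
  have "i \<le> j \<and> j \<le> 2 * i" if nz: "coeff (r j) i \<noteq> 0" for i j
  proof -
    have "(\<Sum>n=0..j. Re (fps_nth A n) * coeff (p n j) i) \<noteq> 0"
      using nz by (simp add: r_def coeff_sum)
    then obtain n where "coeff (p n j) i \<noteq> 0"
      by (metis (no_types, lifting) mult_zero_right sum.neutral)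
    then show ?thesis by (rule p(1))
  qed
  moreover have "fps_nth (A oo F u) j = of_real (poly (r j) u)" for u j
    using A by (simp add: fps_compose_nth p r_def poly_sum)
  ultimately show ?thesis unfolding graded_def by blast
qed

private lemma puiseux_coeffs_exists: "\<exists>g. puiseux_coeffs a b g"
proof -
  define G where "G = (\<lambda>u::real. fps_const (complex_of_real u) * fps_X ^ 2)"
  define K where "K = fps_shift 1 (fps_binomial (1/2) - 1 :: complex fps)"
  define W where "W = (\<lambda>u::real. fps_const (complex_of_real u) * fps_X * (K oo G u))"
  define F where "F = (\<lambda>u. (fps_binomial (complex_of_real a) oo G u) * (fps_exp (complex_of_real b) oo W u))"
  have gbr: "(complex_of_real c gchoose n) \<in> \<real>" for c n
  proof -
    have "(complex_of_real c gchoose n) = of_real (c gchoose n)"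
      by (simp add: gbinomial_prod_rev)
    then show ?thesis by simp
  qed
  have gbr2: "((1/2 :: complex) gchoose n) \<in> \<real>" for n
    using gbr[of "1/2" n] by simp
  have gG: "graded G" unfolding G_def by (rule graded_X2)
  have gK: "graded (\<lambda>u. K oo G u)"
    by (rule graded_compose[OF gG]) (simp add: K_def gbr2)
  have gW: "graded W"
    unfolding W_def by (rule graded_mult[OF graded_X gK])
  have "fps_nth (fps_exp (complex_of_real b)) n \<in> \<real>" for n
    using Reals_of_real[of "b ^ n / fact n", where 'a = complex] by simp
  then have "graded F"
    unfolding F_def by (intro graded_mult graded_compose gG gW) (simp_all add: gbr)
  then obtain p where p: "\<And>i j. coeff (p j) i \<noteq> 0 \<Longrightarrow> i \<le> j \<and> j \<le> 2 * i"
      "\<And>u j. fps_nth (F u) j = of_real (poly (p j) u)"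
    unfolding graded_def by blast
  have coeff0: "coeff (p j) i = 0" if "i \<notin> {nat \<lceil>real j / 2\<rceil>..j}" for i j
  proof (rule ccontr)
    assume "coeff (p j) i \<noteq> 0"
    from p(1)[OF this] have "i \<le> j" "nat \<lceil>real j / 2\<rceil> \<le> i"
      by (auto simp: nat_le_iff ceiling_le_iff)
    with that show False by auto
  qed
  have polyp: "(\<Sum>i = nat \<lceil>real j / 2\<rceil>..j. coeff (p j) i * u ^ i) = poly (p j) u" for j u
  proof -
    have "degree (p j) \<le> j"
      by (rule degree_le) (use coeff0 in auto)
    then have "poly (p j) u = (\<Sum>i\<le>j. coeff (p j) i * u ^ i)"
      unfolding poly_altdef by (intro sum.mono_neutral_left) (auto simp: coeff_eq_0)
    also have "\<dots> = (\<Sum>i = nat \<lceil>real j / 2\<rceil>..j. coeff (p j) i * u ^ i)"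
      by (rule sum.mono_neutral_right) (use coeff0 in auto)
    finally show ?thesis ..
  qed
  have "\<forall>\<^sub>F y in at_right 0.
        (\<lambda>j. poly (p j) u * y powr (real j / 2)) sums
          ((1 + u * y) powr a * exp (b * y powr (- 1 / 2) * (sqrt (1 + u * y) - 1)))" for u
  proof -
    define k where "k = (\<lambda>x::complex. if x = 0 then 1/2 else ((1 + x) powr (1/2) - 1) / x ^ 1)"
    have K: "k has_fps_expansion K"
      unfolding k_def K_def
    proof (rule has_fps_expansion_shift)
      show "(\<lambda>x. (1 + x) powr (1/2) - 1) has_fps_expansion fps_binomial (1/2 :: complex) - 1"
        by (intro fps_expansion_intros)
      have "fps_nth (fps_binomial (1/2 :: complex) - 1) 1 \<noteq> 0" by simp
      then have "fps_binomial (1/2 :: complex) - 1 \<noteq> 0" by force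
      then show "1 \<le> subdegree (fps_binomial (1/2 :: complex) - 1)"
        by (intro subdegree_geI) auto
    qed simp
    have G: "(\<lambda>z. of_real u * z ^ 2) has_fps_expansion G u"
      unfolding G_def by (intro fps_expansion_intros)
    have G0: "fps_nth (G u) 0 = 0" by (simp add: G_def)
    have W: "(\<lambda>z. of_real u * z * (k \<circ> (\<lambda>z. of_real u * z ^ 2)) z) has_fps_expansion W u"
      unfolding W_def by (intro fps_expansion_intros K G G0)
    have W0: "fps_nth (W u) 0 = 0" by (simp add: W_def)
    define f where "f = (\<lambda>z. ((\<lambda>x. (1 + x) powr complex_of_real a) \<circ> (\<lambda>z. of_real u * z ^ 2)) z *
        ((\<lambda>x. exp (complex_of_real b * x)) \<circ> (\<lambda>z. of_real u * z * (k \<circ> (\<lambda>z. of_real u * z ^ 2)) z)) z)"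
    have "f has_fps_expansion F u"
      unfolding f_def F_def by (intro has_fps_expansion_mult has_fps_expansion_compose
          has_fps_expansion_binomial_complex has_fps_expansion_exp G G0 W W0)
    then have ev: "\<forall>\<^sub>F z in nhds 0. eval_fps (F u) z = f z" and rad: "fps_conv_radius (F u) > 0"
      by (auto simp: has_fps_expansion_def)
    have "\<forall>\<^sub>F z in nhds 0. z \<in> eball 0 (fps_conv_radius (F u))"
      using rad by (intro eventually_nhds_in_open) (auto simp: zero_ereal_def)
    with ev have "\<forall>\<^sub>F z in nhds 0. (\<lambda>j. fps_nth (F u) j * z ^ j) sums f z"
    proof eventually_elim
      case (elim z)
      then show ?case using sums_eval_fps[of z "F u"] by (auto simp: in_eball_iff)
    qed
    moreover have "filterlim (\<lambda>y. complex_of_real (sqrt y)) (nhds 0) (at_right 0)"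
      by (auto intro!: tendsto_eq_intros)
    ultimately have "\<forall>\<^sub>F y in at_right 0. (\<lambda>j. fps_nth (F u) j * complex_of_real (sqrt y) ^ j)
        sums f (complex_of_real (sqrt y))"
      by (rule eventually_compose_filterlim)
    moreover have "\<forall>\<^sub>F y in at_right 0. \<bar>u * y\<bar> < 1"
    proof -
      have "((\<lambda>y. \<bar>u * y\<bar>) \<longlongrightarrow> 0) (at_right 0)"
        by (auto intro!: tendsto_eq_intros)
      then show ?thesis by (rule order_tendstoD) simp
    qed
    moreover have "\<forall>\<^sub>F y in at_right (0::real). y > 0"
      by (rule eventually_at_right_less)
    ultimately show ?thesis
    proof eventually_elim
      case (elim y)
      have pos: "1 + u * y > 0" using elim by auto
      have t2: "(complex_of_real (sqrt y))\<^sup>2 = of_real y"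
        using elim by (simp flip: of_real_power)
      have s: "(1 + of_real u * of_real y) powr c' = complex_of_real ((1 + u * y) powr c)"
        if "c' = of_real c" for c c'
        using powr_of_real[of "1 + u * y" c] pos that by simp
      have tinv: "y powr (- 1 / 2) = 1 / sqrt y"
        using elim by (simp add: powr_minus_divide powr_half_sqrt)
      have kk: "of_real u * of_real (sqrt y) * k (of_real u * of_real y)
          = complex_of_real (y powr (- 1 / 2) * (sqrt (1 + u * y) - 1))"
      proof (cases "u = 0")
        case False
        have h: "(1 + of_real u * of_real y) powr (1/2) = complex_of_real (sqrt (1 + u * y))"
          using s[of "1/2" "1/2"] pos by (simp add: powr_half_sqrt)
        have yy: "complex_of_real y = of_real (sqrt y) * of_real (sqrt y)"
          using t2 by (simp add: power2_eq_square)
        have nz: "complex_of_real (sqrt y) \<noteq> 0" using elim by simp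
        have "k (of_real u * of_real y) = (complex_of_real (sqrt (1 + u * y)) - 1) / (of_real u * of_real y)"
          using False elim by (simp add: k_def h)
        also have "of_real u * complex_of_real (sqrt y) * \<dots> = (complex_of_real (sqrt (1 + u * y)) - 1) / of_real (sqrt y)"
          unfolding yy using False nz by simp
        finally show ?thesis
          unfolding tinv by simp
      qed simp
      have "f (complex_of_real (sqrt y)) = (1 + of_real u * of_real y) powr of_real a
          * exp (of_real b * (of_real u * of_real (sqrt y) * k (of_real u * of_real y)))"
        by (simp only: f_def t2 o_def)
      also have "\<dots> = of_real ((1 + u * y) powr a * exp (b * y powr (- 1 / 2) * (sqrt (1 + u * y) - 1)))"
        unfolding kk s[OF refl] by (simp only: exp_of_real of_real_mult[symmetric] mult.assoc)
      finally have "f (complex_of_real (sqrt y)) =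
          of_real ((1 + u * y) powr a * exp (b * y powr (- 1 / 2) * (sqrt (1 + u * y) - 1)))" .
      moreover have "fps_nth (F u) j * complex_of_real (sqrt y) ^ j
          = of_real (poly (p j) u * y powr (real j / 2))" for j
      proof -
        have "sqrt y ^ j = y powr (real j / 2)"
          using elim by (simp add: powr_half_sqrt[symmetric] powr_power)
        then show ?thesis by (simp add: p(2) flip: of_real_power)
      qed
      ultimately show ?case using elim by (simp only: sums_of_real_iff)
    qed
  qed
  then have "puiseux_coeffs a b (\<lambda>i j. coeff (p j) i)"
    unfolding puiseux_coeffs_def using coeff0 by (simp add: polyp)
  then show ?thesis by blast
qed

private lemma powser_eq_0:
  fixes c :: "nat \<Rightarrow> real"
  assumes "\<forall>\<^sub>F y in at_right 0. (\<lambda>j. c j * y powr (real j / 2)) sums 0"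
  shows "c j = 0"
proof -
  obtain e where e: "e > 0" "\<And>y. 0 < y \<Longrightarrow> y < e \<Longrightarrow> (\<lambda>j. c j * y powr (real j / 2)) sums 0"
    using assms unfolding eventually_at_right_field by auto
  define r where "r = sqrt (e / 2)"
  have r: "r > 0" "r\<^sup>2 < e" using e by (auto simp: r_def)
  have z: "(\<lambda>j. c j * t ^ j) sums 0" if "0 < t" "t \<le> r" for t
  proof -
    have "t\<^sup>2 \<le> r\<^sup>2" using that by (intro power_mono) auto
    then have "(\<lambda>j. c j * (t\<^sup>2) powr (real j / 2)) sums 0"
      using that r by (intro e(2) le_less_trans[OF _ r(2)]) auto
    moreover have "(t\<^sup>2) powr (real j / 2) = t ^ j" for j
      using that by (simp add: powr_powr powr_realpow flip: powr_numeral)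
    ultimately show ?thesis by simp
  qed
  define f where "f = (\<lambda>t. suminf (\<lambda>j. c j * t ^ j))"
  have sm: "(\<lambda>j. c j * t ^ j) sums f t" if "norm t < r" for t
    unfolding f_def using powser_inside[of c r t] z[of r] r that
    by (auto simp: sums_iff)
  have f0: "f t = 0" if "0 < t" "t < r" for t
    using z[of t] that by (simp add: f_def sums_iff)
  have "c 0 = 0"
  proof -
    have "summable (\<lambda>j. c j * r ^ j)" using z[of r] r by (simp add: sums_iff)
    then have "isCont f 0" unfolding f_def using r by (intro isCont_powser) auto
    then have "f \<midarrow>0\<rightarrow> f 0" by (simp add: isCont_def)
    then have "(f \<longlongrightarrow> f 0) (at_right 0)" by (rule filterlim_mono) (auto simp: at_le)
    moreover have "\<forall>\<^sub>F t in at_right 0. f t = 0"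
      unfolding eventually_at_right_field using f0 r by blast
    then have "(f \<longlongrightarrow> 0) (at_right 0)" by (rule tendsto_eventually)
    ultimately have "f 0 = 0" by (intro tendsto_unique[of "at_right (0::real)" f]) auto
    then show ?thesis by (simp add: f_def powser_zero)
  qed
  show "c j = 0"
  proof (rule ccontr)
    assume nz: "c j \<noteq> 0"
    with \<open>c 0 = 0\<close> have "j > 0" by (cases j) auto
    have "f 0 = 0" using \<open>c 0 = 0\<close> by (simp add: f_def powser_zero)
    then obtain s where s: "0 < s" "\<And>t. t \<in> cball 0 s - {0} \<Longrightarrow> f t \<noteq> 0"
      using powser_0_nonzero[of r 0 c f j] sm r nz \<open>j > 0\<close> by auto
    have "f (min s (r/2)) \<noteq> 0" using s r by (intro s(2)) auto
    moreover have "f (min s (r/2)) = 0" using s r by (intro f0) auto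
    ultimately show False by simp
  qed
qed

lemma puiseux_coeffs_unique_existence: "\<exists>!g. puiseux_coeffs a b g"
proof (rule ex_ex1I[OF puiseux_coeffs_exists])
  fix g h
  assume g: "puiseux_coeffs a b g" and h: "puiseux_coeffs a b h"
  have *: "(\<Sum>i = nat \<lceil>real j / 2\<rceil>..j. (g i j - h i j) * u ^ i) = 0" for j u
  proof (rule powser_eq_0)
    have "\<forall>\<^sub>F y in at_right 0. (\<lambda>j. (\<Sum>i = nat \<lceil>real j / 2\<rceil>..j. g i j * u ^ i) * y powr (real j / 2)) sums
          ((1 + u * y) powr a * exp (b * y powr (- 1 / 2) * (sqrt (1 + u * y) - 1)))"
      using g unfolding puiseux_coeffs_def by blast
    moreover have "\<forall>\<^sub>F y in at_right 0. (\<lambda>j. (\<Sum>i = nat \<lceil>real j / 2\<rceil>..j. h i j * u ^ i) * y powr (real j / 2)) sums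
          ((1 + u * y) powr a * exp (b * y powr (- 1 / 2) * (sqrt (1 + u * y) - 1)))"
      using h unfolding puiseux_coeffs_def by blast
    ultimately show "\<forall>\<^sub>F y in at_right 0.
        (\<lambda>j. (\<Sum>i = nat \<lceil>real j / 2\<rceil>..j. (g i j - h i j) * u ^ i) * y powr (real j / 2)) sums 0"
    proof eventually_elim
      case (elim y)
      show ?case using sums_diff[OF elim]
        by (simp add: sum_subtractf left_diff_distrib)
    qed
  qed
  have z: "g i j = 0" "h i j = 0" if "i \<notin> {nat \<lceil>real j / 2\<rceil>..j}" for i j
    using g h that unfolding puiseux_coeffs_def by blast+
  have "g i j = h i j" for i j
  proof (cases "i \<le> j")
    case True
    have "(\<Sum>i\<le>j. (g i j - h i j) * u ^ i) = 0" for u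
    proof -
      have "(\<Sum>i\<le>j. (g i j - h i j) * u ^ i) = (\<Sum>i = nat \<lceil>real j / 2\<rceil>..j. (g i j - h i j) * u ^ i)"
        by (rule sum.mono_neutral_right) (auto simp: z)
      then show ?thesis using * by simp
    qed
    then have "\<forall>i\<le>j. g i j - h i j = 0"
      using polyfun_eq_0[of "\<lambda>i. g i j - h i j" j] by simp
    with True show ?thesis by simp
  qed (auto simp: z)
  then show "g = h" by blast
qed

end

lemma puiseux_coeffs_g_coeff: "puiseux_coeffs a b (\<lambda>i j. g_coeff i j a b)"
  unfolding g_coeff_def using theI'[OF puiseux_coeffs_unique_existence] by simp

definition C_const :: "real \<Rightarrow> real \<Rightarrow> real \<Rightarrow> nat \<Rightarrow> real" where
  "C_const rX rY \<rho> n = exp (- (real n * (rX\<^sup>2 + rY\<^sup>2 - 2 * \<rho> * rX * rY) / (2 * (1 - \<rho>\<^sup>2))))"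

definition h_coeff :: "nat \<Rightarrow> nat \<Rightarrow> real \<Rightarrow> real \<Rightarrow> real \<Rightarrow> nat \<Rightarrow> real" where
  "h_coeff j l rX rY \<rho> n =
     pochhammer ((3 - real n) / 2) (l - j) * pochhammer ((real n - 1) / 2) (l - j)
       / (fact (l - j) * 2 ^ (l - j) * real n powr (real (l - j) / 2))
     * ((1 + \<rho>) / \<bar>rX + rY\<bar>) ^ (l - j)
     * (\<Sum>i = nat \<lceil>real j / 2\<rceil>..j.
          pochhammer (real n / 2) i * ((1 - \<rho>\<^sup>2) / 2) ^ i
          * kummer_M (real n / 2 + real i) (real n / 2)
              (real n / 8 * ((1 + \<rho>) / (1 - \<rho>)) * (rX - rY)\<^sup>2)
          * g_coeff i j ((real n - 3) / 4 - real (l - j) / 2) (\<bar>rX + rY\<bar> / (1 + \<rho>) * sqrt (real n)))"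

definition c_coeff :: "nat \<Rightarrow> real \<Rightarrow> real \<Rightarrow> real \<Rightarrow> nat \<Rightarrow> real" where
  "c_coeff l rX rY \<rho> n = (if l = 0 then 1 else
     exp (- (real n / 8 * ((1 + \<rho>) / (1 - \<rho>)) * (rX - rY)\<^sup>2)) * (\<Sum>j=0..l. h_coeff j l rX rY \<rho> n))"

definition d_coeff :: "nat \<Rightarrow> real \<Rightarrow> real \<Rightarrow> nat \<Rightarrow> real" where
  "d_coeff k rX \<rho> n = (if k = 0 then 1 else
     (- 1) ^ k * (pochhammer (1 - real n / 2) k * pochhammer (real n / 2) k / fact k)
     * ((1 - \<rho>\<^sup>2) / 2) ^ k
     * (\<Sum>j=0..k. (real n / 2) ^ j / pochhammer (real n / 2) j * real (k choose j)
          * ((1 + \<rho>) / (1 - \<rho>)) ^ j * rX ^ (2 * j)))"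

definition gamma_coeff :: "nat \<Rightarrow> real \<Rightarrow> real \<Rightarrow> real \<Rightarrow> nat \<Rightarrow> real" where
  "gamma_coeff p rX rY \<rho> n = (if p = 0 then 1 else
     (\<Sum>(i, j, k, l) \<in> {(i, j, k, l). i + 2 * j + k + l = p}.
        (- 1) ^ (j + i) * c_coeff l rX rY \<rho> n
        * (((real n - 1) / 2 - real l) gchoose k)
        * (((real n - 3) / 2 - real l - real k - 2 * real j) gchoose i)
        * pochhammer ((real l + real k) / 2 - (real n - 3) / 4) j
        * (1 + \<rho>) ^ j * (\<bar>rX + rY\<bar> * sqrt (real n) / 2) ^ (k + i)))"

lemma finite_gamma_coeff_indices: "finite {(i, j, k, l). i + 2 * j + k + l = (p :: nat)}"
  by (rule finite_subset[of _ "{..p} \<times> {..p} \<times> {..p} \<times> {..p}"]) auto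

text \<open>The Pochhammer factor comes from integrating the expansion of the density termwise,
  \<open>\<integral>\<^sub>x\<^sup>\<infinity> t\<^bsup>n/2-1-j\<^esup> e\<^bsup>-t/(1+\<rho>)\<^esup> dt \<sim> (1+\<rho>) x\<^bsup>n/2-1-j\<^esup> e\<^bsup>-x/(1+\<rho>)\<^esup> \<Sum>\<^sub>m (-1)\<^bsup>m\<^esup> (j+1-n/2)\<^sub>m (1+\<rho>)\<^bsup>m\<^esup> x\<^bsup>-m\<^esup>\<close>,
  taken at \<open>m = k - j\<close>. The source prints \<open>(k+1-n/2)\<^sub>m\<close> in place of \<open>(j+1-n/2)\<^sub>m\<close>. That is a misprint:
  for \<open>n = 2\<close>, \<open>rX = rY = \<rho> = 0\<close> the sum of the products is Laplace distributed with right tail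
  exactly \<open>e\<^bsup>-x/s\<^esup> / 2\<close>, so all coefficients with \<open>k \<ge> 1\<close> vanish, while the printed
  formula gives \<open>-1\<close> for \<open>k = 1\<close>.\<close>

definition delta_coeff :: "nat \<Rightarrow> real \<Rightarrow> real \<Rightarrow> nat \<Rightarrow> real" where
  "delta_coeff k rX \<rho> n = (if k = 0 then 1 else
     (\<Sum>j=0..k. (- 1) ^ (k - j) * d_coeff j rX \<rho> n
        * pochhammer (real j + 1 - real n / 2) (k - j) * (1 + \<rho>) ^ (k - j)))"

end

theory Submission
  imports Defs "HOL-Real_Asymp.Real_Asymp"
begin

text \<open>With \<open>U = (X + Y) / 2\<close> and \<open>V = (X - Y) / 2\<close> in standardised coordinates, \<open>X Y = U\<^sup>2 - V\<^sup>2\<close> with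
  independent normal \<open>U\<close>, \<open>V\<close>. Hence \<open>S\<^sub>n / s = P - Q\<close> with independent scaled noncentral gamma variables
  \<open>P\<close>, \<open>Q\<close>, whose densities are Poisson mixtures of gamma densities and so add up under convolution.
  Laplace's method applied to the convolution of a one-dimensional noncentral density with a central one
  expands the density of \<open>P\<close> (this is the large argument expansion of the modified Bessel function).
  Averaging its shift over \<open>Q\<close> brings in the Puiseux coefficients, and the moments of \<open>Q\<close> under an
  exponential tilt produce Kummer's function. Finally the tail integrals
  \<open>\<integral>\<^sub>x\<^sup>\<infinity> t\<^bsup>\<beta>\<^esup> e\<^bsup>b \<surd>t - t/\<kappa>\<^esup> dt\<close> are expanded after completing the square,
  \<open>t = (\<surd>v + m)\<^sup>2\<close> with \<open>m = b \<kappa> / 2\<close>, which turns them into incomplete gamma integrals.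
  The left tail is the right tail with the roles of \<open>P\<close> and \<open>Q\<close> exchanged.\<close>

subsection \<open>Expansions in powers of the inverse square root\<close>

text \<open>Two obstacles shape the proof. The Puiseux series behind \<open>g_coeff\<close>
  converges only for y below a bound depending on u, while averaging over Q needs one remainder for
  all q \<ge> 0. So a Taylor bound uniform in q is proved with unknown coefficients, and uniqueness
  of asymptotic coefficients identifies these with the Puiseux ones. Second,
  \<open>gamma_coeff\<close> comes from expansions nested inside each other (Bessel, shift by q,
  binomial Jacobian, incomplete gamma, return from v to x), each in powers of 1 / sqrt x. Every
  nesting is an instance of the one rule \<open>asy_diagonal\<close>, and a factor x powr (- k / 2)
  is always moved into the exponent of the model density; all shifts by half integers in the
  coefficients originate there. The Bessel function itself never appears: in shape 1/2 the
  noncentral density is elementary, a hyperbolic cosine, and the remaining shape is central. The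
  scales of P and Q are 1 + \<rho> and 1 - \<rho>; their sum 2 makes the tilt of Q by the decay rate
  of P a rescaling by (1 + \<rho>) / 2.\<close>

definition asy :: "(real \<Rightarrow> real) \<Rightarrow> (nat \<Rightarrow> real) \<Rightarrow> bool" where
  "asy f a \<longleftrightarrow> (\<forall>N. (\<lambda>x. f x - (\<Sum>l<N. a l * inverse (sqrt x) ^ l)) \<in> O(\<lambda>x. inverse (sqrt x) ^ N))"

lemma asyD: "asy f a \<Longrightarrow> (\<lambda>x. f x - (\<Sum>l<N. a l * inverse (sqrt x) ^ l)) \<in> O(\<lambda>x. inverse (sqrt x) ^ N)"
  by (simp add: asy_def)

text \<open>The order N = 0 of the definition, whose sum is empty. It supplies the bounded factors
  by which remainders are multiplied later on.\<close>

lemma asy_bounded: "asy f a \<Longrightarrow> f \<in> O(\<lambda>_. 1)"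
  using asyD[of f a 0] by simp

lemma asy_cong:
  assumes "asy f a" "\<forall>\<^sub>F x in at_top. f x = g x"
  shows "asy g a"
  unfolding asy_def
proof
  fix N
  have "\<forall>\<^sub>F x in at_top. f x - (\<Sum>l<N. a l * inverse (sqrt x) ^ l) = g x - (\<Sum>l<N. a l * inverse (sqrt x) ^ l)"
    using assms(2) by eventually_elim simp
  from landau_o.big.in_cong[OF this] asyD[OF assms(1), of N]
  show "(\<lambda>x. g x - (\<Sum>l<N. a l * inverse (sqrt x) ^ l)) \<in> O(\<lambda>x. inverse (sqrt x) ^ N)"
    by simp
qed

lemma asy_cmult:
  assumes "asy f a"
  shows "asy (\<lambda>x. c * f x) (\<lambda>l. c * a l)"
  unfolding asy_def
proof
  fix N
  show "(\<lambda>x. c * f x - (\<Sum>l<N. (c * a l) * inverse (sqrt x) ^ l)) \<in> O(\<lambda>x. inverse (sqrt x) ^ N)"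
    using landau_o.big.cmult_in_iff[of c "\<lambda>x. f x - (\<Sum>l<N. a l * inverse (sqrt x) ^ l)"]
      asyD[OF assms(1), of N]
    by (cases "c = 0") (auto simp: right_diff_distrib sum_distrib_left mult.assoc)
qed

text \<open>With t = 1 / sqrt x, the factor t^k already supplies k orders, so only the first N - k
  terms of \<open>F k\<close> are visible up to order N. Collecting the double sum over k + l < N
  along diagonals gives the coefficient of t^p.\<close>

lemma asy_diagonal:
  assumes f: "\<And>N. (\<lambda>x. f x - (\<Sum>k<N. F k x * inverse (sqrt x) ^ k)) \<in> O(\<lambda>x. inverse (sqrt x) ^ N)"
    and F: "\<And>k. asy (F k) (A k)"
  shows "asy f (\<lambda>p. \<Sum>k\<le>p. A k (p - k))"
  unfolding asy_def
proof
  fix N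
  define t where "t = (\<lambda>x::real. inverse (sqrt x))"
  have 1: "(\<lambda>x. (F k x - (\<Sum>l<N-k. A k l * t x ^ l)) * t x ^ k) \<in> O(\<lambda>x. t x ^ N)" if "k < N" for k
  proof -
    have "(\<lambda>x. (F k x - (\<Sum>l<N-k. A k l * t x ^ l)) * t x ^ k) \<in> O(\<lambda>x. t x ^ (N - k) * t x ^ k)"
      unfolding t_def by (intro landau_o.big.mult asyD[OF F] landau_o.big_refl)
    then show ?thesis using that by (simp flip: power_add)
  qed
  have "(\<lambda>x. \<Sum>k<N. (F k x - (\<Sum>l<N-k. A k l * t x ^ l)) * t x ^ k) \<in> O(\<lambda>x. t x ^ N)"
    by (rule big_sum_in_bigo) (use 1 in auto)
  moreover have "(\<lambda>x. f x - (\<Sum>k<N. F k x * t x ^ k)) \<in> O(\<lambda>x. t x ^ N)"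
    using f[of N] by (simp add: t_def)
  ultimately have "(\<lambda>x. (f x - (\<Sum>k<N. F k x * t x ^ k)) +
      (\<Sum>k<N. (F k x - (\<Sum>l<N-k. A k l * t x ^ l)) * t x ^ k)) \<in> O(\<lambda>x. t x ^ N)"
    by (intro sum_in_bigo(1))
  then
  have "(\<lambda>x. f x - (\<Sum>k<N. \<Sum>l<N-k. A k l * t x ^ l * t x ^ k)) \<in> O(\<lambda>x. t x ^ N)"
    by (simp add: left_diff_distrib sum_subtractf sum_distrib_right)
  also have "(\<lambda>x. f x - (\<Sum>k<N. \<Sum>l<N-k. A k l * t x ^ l * t x ^ k)) =
      (\<lambda>x. f x - (\<Sum>p<N. (\<Sum>k\<le>p. A k (p - k)) * t x ^ p))"
  proof
    fix x
    have "(\<Sum>k<N. \<Sum>l<N-k. A k l * t x ^ l * t x ^ k) =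
        (\<Sum>(k, l)\<in>{(k, l). k + l < N}. A k l * t x ^ (k + l))"
      by (subst sum.Sigma) (auto intro!: sum.cong simp: power_add)
    also have "\<dots> = (\<Sum>p<N. \<Sum>k\<le>p. A k (p - k) * t x ^ (k + (p - k)))"
      by (rule sum.triangle_reindex)
    also have "\<dots> = (\<Sum>p<N. (\<Sum>k\<le>p. A k (p - k)) * t x ^ p)"
      by (intro sum.cong refl) (auto simp: sum_distrib_right intro!: sum.cong)
    finally show "f x - (\<Sum>k<N. \<Sum>l<N-k. A k l * t x ^ l * t x ^ k) =
      f x - (\<Sum>p<N. (\<Sum>k\<le>p. A k (p - k)) * t x ^ p)" by simp
  qed
  finally show "(\<lambda>x. f x - (\<Sum>p<N. (\<Sum>k\<le>p. A k (p - k)) * inverse (sqrt x) ^ p)) \<in> O(\<lambda>x. inverse (sqrt x) ^ N)"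
    by (simp add: t_def)
qed

text \<open>Growth in the parameter \<open>q\<close> that is still integrable against \<open>e\<^bsup>-q/\<kappa>\<^esup>\<close>; closure of
  \<open>smooth\<close> under products yields Taylor remainders that are uniform up to such a factor, without computing any derivative.\<close>

definition subexp :: "(real \<Rightarrow> real \<Rightarrow> real) \<Rightarrow> bool" where
  "subexp f \<longleftrightarrow> (\<exists>M K. \<forall>q\<ge>0. \<forall>t\<in>{0..1}. \<bar>f q t\<bar> \<le> K * (1 + q) ^ M * exp (K * sqrt q))"

lemma subexpE:
  assumes "subexp f"
  obtains M K where "K \<ge> 0" "\<And>q t. q \<ge> 0 \<Longrightarrow> t \<in> {0..1} \<Longrightarrow> \<bar>f q t\<bar> \<le> K * (1 + q) ^ M * exp (K * sqrt q)"
proof -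
  from assms obtain M K where *: "\<And>q t. q \<ge> 0 \<Longrightarrow> t \<in> {0..1} \<Longrightarrow> \<bar>f q t\<bar> \<le> K * (1 + q) ^ M * exp (K * sqrt q)"
    unfolding subexp_def by blast
  have "K * (1 + q) ^ M * exp (K * sqrt q) \<le> \<bar>K\<bar> * (1 + q) ^ M * exp (\<bar>K\<bar> * sqrt q)" if "q \<ge> 0" for q
    using that by (intro mult_mono) (auto intro!: mult_right_mono)
  with * show ?thesis by (intro that[of "\<bar>K\<bar>" M]) (simp, blast intro: order_trans)
qed

lemma subexpI:
  "(\<And>q t. q \<ge> 0 \<Longrightarrow> t \<in> {0..1} \<Longrightarrow> \<bar>f q t\<bar> \<le> K * (1 + q) ^ M * exp (K * sqrt q)) \<Longrightarrow> subexp f"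
  unfolding subexp_def by blast

lemma subexp_add: assumes "subexp f" "subexp g" shows "subexp (\<lambda>q t. f q t + g q t)"
proof -
  obtain M K where 1: "K \<ge> 0" "\<And>q t. q \<ge> 0 \<Longrightarrow> t \<in> {0..1} \<Longrightarrow> \<bar>f q t\<bar> \<le> K * (1 + q) ^ M * exp (K * sqrt q)"
    using subexpE[OF assms(1)] by metis
  obtain M' K' where 2: "K' \<ge> 0" "\<And>q t. q \<ge> 0 \<Longrightarrow> t \<in> {0..1} \<Longrightarrow> \<bar>g q t\<bar> \<le> K' * (1 + q) ^ M' * exp (K' * sqrt q)"
    using subexpE[OF assms(2)] by metis
  have "\<bar>f q t + g q t\<bar> \<le> (K + K') * (1 + q) ^ (M + M') * exp ((K + K') * sqrt q)" if q: "q \<ge> 0" "t \<in> {0..1}" for q t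
  proof -
    have "K * (1 + q) ^ M * exp (K * sqrt q) \<le> K * (1 + q) ^ (M + M') * exp ((K + K') * sqrt q)"
      using q 1(1) 2(1) by (intro mult_mono power_increasing) (auto intro!: mult_right_mono)
    moreover have "K' * (1 + q) ^ M' * exp (K' * sqrt q) \<le> K' * (1 + q) ^ (M + M') * exp ((K + K') * sqrt q)"
      using q 1(1) 2(1) by (intro mult_mono power_increasing) (auto intro!: mult_right_mono)
    ultimately show ?thesis using 1(2)[OF q] 2(2)[OF q] by (simp add: distrib_right)
  qed
  then show ?thesis unfolding subexp_def by blast
qed

lemma subexp_mult: assumes "subexp f" "subexp g" shows "subexp (\<lambda>q t. f q t * g q t)"
proof -
  obtain M K where 1: "K \<ge> 0" "\<And>q t. q \<ge> 0 \<Longrightarrow> t \<in> {0..1} \<Longrightarrow> \<bar>f q t\<bar> \<le> K * (1 + q) ^ M * exp (K * sqrt q)"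
    using subexpE[OF assms(1)] by metis
  obtain M' K' where 2: "K' \<ge> 0" "\<And>q t. q \<ge> 0 \<Longrightarrow> t \<in> {0..1} \<Longrightarrow> \<bar>g q t\<bar> \<le> K' * (1 + q) ^ M' * exp (K' * sqrt q)"
    using subexpE[OF assms(2)] by metis
  \<comment> \<open>The same constant has to serve as prefactor and as exponent, hence the maximum
    of the product and the sum.\<close>
  define L where "L = max (K * K') (K + K')"
  have "\<bar>f q t * g q t\<bar> \<le> L * (1 + q) ^ (M + M') * exp (L * sqrt q)" if q: "q \<ge> 0" "t \<in> {0..1}" for q t
  proof -
    have "\<bar>f q t * g q t\<bar> \<le> (K * (1 + q) ^ M * exp (K * sqrt q)) * (K' * (1 + q) ^ M' * exp (K' * sqrt q))"
      unfolding abs_mult using q 1 by (intro mult_mono 1(2) 2(2)) auto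
    also have "\<dots> = (K * K') * (1 + q) ^ (M + M') * exp ((K + K') * sqrt q)"
      by (simp add: power_add exp_add distrib_right)
    also have "\<dots> \<le> L * (1 + q) ^ (M + M') * exp (L * sqrt q)"
      using q 1(1) 2(1) by (intro mult_mono) (auto simp: L_def intro!: mult_right_mono)
    finally show ?thesis .
  qed
  then show ?thesis unfolding subexp_def by blast
qed

text \<open>The derivative is existentially quantified, so that a closure rule only has to exhibit
  one. It is one-sided at t = 0, the end that corresponds to y going to infinity under t = 1 / sqrt
  y.\<close>

primrec smooth :: "nat \<Rightarrow> (real \<Rightarrow> real \<Rightarrow> real) \<Rightarrow> bool" where
  "smooth 0 f \<longleftrightarrow> subexp f"
| "smooth (Suc N) f \<longleftrightarrow> subexp f \<and>
     (\<exists>f'. smooth N f' \<and> (\<forall>q\<ge>0. \<forall>t\<in>{0..1}. (f q has_real_derivative f' q t) (at t within {0..1})))"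

lemma smooth_subexp: "smooth N f \<Longrightarrow> subexp f"
  by (cases N) auto

lemma smooth_Suc: "smooth (Suc N) f \<Longrightarrow> smooth N f"
proof (induction N arbitrary: f)
  case (Suc N)
  then obtain f' where "smooth (Suc N) f'" "\<forall>q\<ge>0. \<forall>t\<in>{0..1}. (f q has_real_derivative f' q t) (at t within {0..1})"
    by auto
  with Suc show ?case by (auto simp: smooth_subexp)
qed simp

lemma smooth_add: "smooth N f \<Longrightarrow> smooth N g \<Longrightarrow> smooth N (\<lambda>q t. f q t + g q t)"
proof (induction N arbitrary: f g)
  case 0
  then show ?case by (simp add: subexp_add)
next
  case (Suc N)
  obtain f' where f: "smooth N f'" "\<forall>q\<ge>0. \<forall>t\<in>{0..1}. (f q has_real_derivative f' q t) (at t within {0..1})"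
    using Suc by auto
  obtain g' where g: "smooth N g'" "\<forall>q\<ge>0. \<forall>t\<in>{0..1}. (g q has_real_derivative g' q t) (at t within {0..1})"
    using Suc by auto
  have "\<forall>q\<ge>0. \<forall>t\<in>{0..1}. ((\<lambda>t. f q t + g q t) has_real_derivative f' q t + g' q t) (at t within {0..1})"
    using f g by (auto intro!: DERIV_add)
  with Suc.IH[OF f(1) g(1)] Suc.prems show ?case by (auto simp: subexp_add)
qed

lemma smooth_mult: "smooth N f \<Longrightarrow> smooth N g \<Longrightarrow> smooth N (\<lambda>q t. f q t * g q t)"
proof (induction N arbitrary: f g)
  case 0
  then show ?case by (simp add: subexp_mult)
next
  case (Suc N)
  obtain f' where f: "smooth N f'" "\<forall>q\<ge>0. \<forall>t\<in>{0..1}. (f q has_real_derivative f' q t) (at t within {0..1})"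
    using Suc by auto
  obtain g' where g: "smooth N g'" "\<forall>q\<ge>0. \<forall>t\<in>{0..1}. (g q has_real_derivative g' q t) (at t within {0..1})"
    using Suc by auto
  have "\<forall>q\<ge>0. \<forall>t\<in>{0..1}. ((\<lambda>t. f q t * g q t) has_real_derivative f' q t * g q t + f q t * g' q t) (at t within {0..1})"
    using f g by (auto intro!: derivative_eq_intros)
  moreover have "smooth N (\<lambda>q t. f' q t * g q t + f q t * g' q t)"
    using Suc.prems f g by (intro smooth_add Suc.IH) (auto dest: smooth_Suc simp del: smooth.simps)
  ultimately show ?case using Suc.prems by (auto simp: subexp_mult)
qed

lemma smooth_const: "smooth N (\<lambda>q t. c)"
proof (induction N arbitrary: c)
  have 1: "subexp (\<lambda>q t. c)" for c
    by (rule subexpI[where M = 0 and K = "\<bar>c\<bar>"]) (auto simp: mult_le_cancel_left1)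
  case 0
  show ?case using 1 by simp
  case (Suc N)
  show ?case using 1 Suc[of 0] by (auto intro!: exI[of _ "\<lambda>_ _. 0"])
qed

lemma smooth_param: "smooth N (\<lambda>q t. q)"
proof -
  have 1: "subexp (\<lambda>q t. q)"
  proof (rule subexpI[where M = 1 and K = 1])
    fix q t :: real assume "q \<ge> 0"
    then have "(1 + q) * 1 \<le> (1 + q) * exp (sqrt q)" by (intro mult_left_mono) auto
    moreover have "\<bar>q\<bar> \<le> (1 + q) * 1" using \<open>q \<ge> 0\<close> by simp
    ultimately show "\<bar>q\<bar> \<le> 1 * (1 + q) ^ 1 * exp (1 * sqrt q)" by simp
  qed
  show ?thesis
    using 1 smooth_const[of _ 0] by (cases N) (auto intro!: exI[of _ "\<lambda>_ _. 0"])
qed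

lemma smooth_var: "smooth N (\<lambda>q t. t)"
proof -
  have 1: "subexp (\<lambda>q t. t)"
  proof (rule subexpI[where M = 0 and K = 1])
    fix q t :: real assume "q \<ge> 0" "t \<in> {0..1}"
    have "\<bar>t\<bar> \<le> 1" using \<open>t \<in> _\<close> by auto
    also have "1 \<le> exp (sqrt q)" using \<open>q \<ge> 0\<close> by auto
    finally show "\<bar>t\<bar> \<le> 1 * (1 + q) ^ 0 * exp (1 * sqrt q)" by simp
  qed
  show ?thesis
    using 1 smooth_const[of _ 1] by (cases N) (auto intro!: exI[of _ "\<lambda>_ _. 1"])
qed

text \<open>Induction on the order by integrating the expansion of the derivative: a mean value
  bound raises the remainder from t^N to t^(N+1) without changing the constant. The coefficients
  stay unspecified; where they matter they are identified by uniqueness.\<close>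

lemma smooth_taylor:
  "smooth N f \<Longrightarrow> \<exists>c M K. K \<ge> 0 \<and> (\<forall>q\<ge>0. \<forall>t\<in>{0..1}.
      \<bar>f q t - (\<Sum>j<N. c j q * t ^ j)\<bar> \<le> K * (1 + q) ^ M * exp (K * sqrt q) * t ^ N)"
proof (induction N arbitrary: f)
  case 0
  then have "subexp f" by simp
  then obtain M K where "K \<ge> 0"
    "\<And>q t. q \<ge> 0 \<Longrightarrow> t \<in> {0..1} \<Longrightarrow> \<bar>f q t\<bar> \<le> K * (1 + q) ^ M * exp (K * sqrt q)" by (rule subexpE) blast
  then show "\<exists>c M K. K \<ge> 0 \<and> (\<forall>q\<ge>0. \<forall>t\<in>{0..1}.
      \<bar>f q t - (\<Sum>j<(0::nat). c j q * t ^ j)\<bar> \<le> K * (1 + q) ^ M * exp (K * sqrt q) * t ^ 0)"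
    by (intro exI[of _ undefined] exI[of _ M] exI[of _ K]) simp
next
  case (Suc N)
  obtain f' where f: "smooth N f'" "\<And>q t. q \<ge> 0 \<Longrightarrow> t \<in> {0..1} \<Longrightarrow> (f q has_real_derivative f' q t) (at t within {0..1})"
    using Suc by auto
  obtain c M K where K: "K \<ge> 0" "\<And>q t. q\<ge>0 \<Longrightarrow> t\<in>{0..1} \<Longrightarrow>
      \<bar>f' q t - (\<Sum>j<N. c j q * t ^ j)\<bar> \<le> K * (1 + q) ^ M * exp (K * sqrt q) * t ^ N"
    using Suc.IH[OF f(1)] by blast
  define d where "d = (\<lambda>j q. if j = 0 then f q 0 else c (j - 1) q / real j)"
  have "\<bar>f q t - (\<Sum>j<Suc N. d j q * t ^ j)\<bar> \<le> K * (1 + q) ^ M * exp (K * sqrt q) * t ^ Suc N"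
    if q: "q \<ge> 0" and t: "t \<in> {0..1}" for q t
  proof -
    define g where "g = (\<lambda>s. f q s - (\<Sum>j<Suc N. d j q * s ^ j))"
    have g': "(g has_real_derivative (f' q s - (\<Sum>j<N. c j q * s ^ j))) (at s within {0..t})" if s: "s \<in> {0..t}" for s
    proof -
      have "(\<lambda>s. (\<Sum>j<Suc N. d j q * s ^ j)) = (\<lambda>s. d 0 q + (\<Sum>j<N. d (Suc j) q * s ^ Suc j))"
        by (subst sum.lessThan_Suc_shift) simp
      moreover have "((\<lambda>s. d 0 q + (\<Sum>j<N. d (Suc j) q * s ^ Suc j)) has_real_derivative (\<Sum>j<N. c j q * s ^ j)) (at s within {0..t})"
        by (auto intro!: derivative_eq_intros sum.cong simp: d_def simp del: power_Suc)
      moreover have "(f q has_real_derivative f' q s) (at s within {0..t})"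
        by (rule DERIV_subset[OF f(2)]) (use q s t in auto)
      ultimately show ?thesis unfolding g_def by (simp only: DERIV_diff)
    qed
    have "norm (g t - g 0) \<le> K * (1 + q) ^ M * exp (K * sqrt q) * t ^ N * norm (t - 0)"
    proof (rule field_differentiable_bound[OF _ g'])
      fix s assume s: "s \<in> {0..t}"
      have "\<bar>f' q s - (\<Sum>j<N. c j q * s ^ j)\<bar> \<le> K * (1 + q) ^ M * exp (K * sqrt q) * s ^ N"
        using s t q by (intro K(2)) auto
      also have "\<dots> \<le> K * (1 + q) ^ M * exp (K * sqrt q) * t ^ N"
        using s t q K(1) by (intro mult_left_mono power_mono) auto
      finally show "norm (f' q s - (\<Sum>j<N. c j q * s ^ j)) \<le> K * (1 + q) ^ M * exp (K * sqrt q) * t ^ N" by simp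
    qed (use t in auto)
    moreover have "g 0 = 0"
      unfolding g_def by (subst sum.lessThan_Suc_shift) (simp add: d_def)
    ultimately show ?thesis using t by (simp add: g_def mult.assoc mult.commute)
  qed
  with K(1) show ?case by blast
qed

section \<open>Smoothness of the factors of the tilt\<close>

lemma has_derivative_sqrt_one_plus:
  assumes "q \<ge> (0::real)"
  shows "((\<lambda>t. sqrt (1 + q * t\<^sup>2)) has_real_derivative q * t * (1 / sqrt (1 + q * t\<^sup>2))) (at t within S)"
proof -
  have "1 + q * t\<^sup>2 > 0" using assms by (simp add: add_pos_nonneg)
  then show ?thesis
    by (auto intro!: derivative_eq_intros simp: field_simps)
qed

lemma subexp_le_one:
  assumes "\<And>q t. q \<ge> 0 \<Longrightarrow> t \<in> {0..1} \<Longrightarrow> \<bar>f q t\<bar> \<le> 1"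
  shows "subexp f"
  proof (rule subexpI[where M = 0 and K = 1])
  fix q t :: real assume *: "q \<ge> 0" "t \<in> {0..1}"
  have "\<bar>f q t\<bar> \<le> 1" using assms * by auto
  also have "1 \<le> exp (sqrt q)" using * by auto
  finally show "\<bar>f q t\<bar> \<le> 1 * (1 + q) ^ 0 * exp (1 * sqrt q)" by simp
qed

text \<open>With r = 1 / sqrt (1 + q t^2), the derivative of r in t is - q t r^3, a polynomial in q,
  t and r. So the induction hypothesis and the product rule close the step. The next three functions
  are treated in the same way.\<close>

lemma smooth_inverse_sqrt: "smooth N (\<lambda>q t. 1 / sqrt (1 + q * t\<^sup>2))"
proof (induction N)
  have 1: "subexp (\<lambda>q t. 1 / sqrt (1 + q * t\<^sup>2))"
    by (rule subexp_le_one) (simp add: divide_le_eq_1 add_pos_nonneg)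
  case 0
  show ?case using 1 by simp
  case (Suc N)
  let ?r = "\<lambda>q t. 1 / sqrt (1 + q * t\<^sup>2) :: real"
  have "smooth N (\<lambda>q t. (- 1) * (q * (t * (?r q t * (?r q t * ?r q t)))))"
    by (intro smooth_mult smooth_const smooth_param smooth_var Suc.IH)
  moreover have "(?r q has_real_derivative (- 1) * (q * (t * (?r q t * (?r q t * ?r q t))))) (at t within {0..1})"
    if "q \<ge> 0" for q t
  proof -
    have "1 + q * t\<^sup>2 > 0" using that by (simp add: add_pos_nonneg)
    then have "sqrt (1 + q * t\<^sup>2) \<noteq> 0" by simp
    then show ?thesis
      by (intro DERIV_cong[OF DERIV_divide[OF DERIV_const has_derivative_sqrt_one_plus[OF that]]])
         (simp_all add: field_simps)
  qed
  ultimately show ?case using 1 by auto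
qed

lemma smooth_inverse_sqrt_plus_one: "smooth N (\<lambda>q t. 1 / (sqrt (1 + q * t\<^sup>2) + 1))"
proof (induction N)
  have 1: "subexp (\<lambda>q t. 1 / (sqrt (1 + q * t\<^sup>2) + 1))"
    by (rule subexp_le_one) (simp add: divide_le_eq_1 add_nonneg_pos)
  case 0
  show ?case using 1 by simp
  case (Suc N)
  let ?r = "\<lambda>q t. 1 / sqrt (1 + q * t\<^sup>2) :: real"
  let ?s = "\<lambda>q t. 1 / (sqrt (1 + q * t\<^sup>2) + 1) :: real"
  have "smooth N (\<lambda>q t. (- 1) * (q * (t * (?r q t * (?s q t * ?s q t)))))"
    by (intro smooth_mult smooth_const smooth_param smooth_var smooth_inverse_sqrt Suc.IH)
  moreover have "(?s q has_real_derivative (- 1) * (q * (t * (?r q t * (?s q t * ?s q t))))) (at t within {0..1})"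
    if "q \<ge> 0" for q t
  proof -
    have "0 < sqrt (1 + q * t\<^sup>2)" using that by (simp add: add_pos_nonneg)
    then have "sqrt (1 + q * t\<^sup>2) + 1 \<noteq> 0" "sqrt (1 + q * t\<^sup>2) \<noteq> 0" by linarith+
    then show ?thesis
      by (intro DERIV_cong[OF DERIV_divide[OF DERIV_const DERIV_add[OF has_derivative_sqrt_one_plus[OF that] DERIV_const]]])
         (simp_all add: field_simps)
  qed
  ultimately show ?case using 1 by auto
qed

lemma smooth_powr: "smooth N (\<lambda>q t. (1 + q * t\<^sup>2) powr a)"
proof (induction N)
  have 1: "subexp (\<lambda>q t. (1 + q * t\<^sup>2) powr a)"
    proof (rule subexpI[where M = "nat \<lceil>\<bar>a\<bar>\<rceil>" and K = 1])
    fix q t :: real assume q: "q \<ge> 0" "t \<in> {0..1}"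
    have t: "t\<^sup>2 \<le> 1" using q by (auto simp: power_le_one)
    have "(1 + q * t\<^sup>2) powr a \<le> (1 + q * t\<^sup>2) powr (nat \<lceil>\<bar>a\<bar>\<rceil>)"
      using q by (intro powr_mono) (auto, linarith)
    also have "\<dots> \<le> (1 + q) powr (nat \<lceil>\<bar>a\<bar>\<rceil>)"
      using q t by (intro powr_mono2) (auto intro: mult_left_le)
    also have "\<dots> = (1 + q) ^ (nat \<lceil>\<bar>a\<bar>\<rceil>)" using q by (subst powr_realpow) auto
    also have "\<dots> * 1 \<le> \<dots> * exp (sqrt q)" using q by (intro mult_left_mono) auto
    finally show "\<bar>(1 + q * t\<^sup>2) powr a\<bar> \<le> 1 * (1 + q) ^ (nat \<lceil>\<bar>a\<bar>\<rceil>) * exp (1 * sqrt q)" by simp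
  qed
  case 0
  show ?case using 1 by simp
  case (Suc N)
  let ?r = "\<lambda>q t. 1 / sqrt (1 + q * t\<^sup>2) :: real"
  let ?s = "\<lambda>q t. (1 + q * t\<^sup>2) powr a :: real"
  have "smooth N (\<lambda>q t. 2 * a * (q * (t * (?r q t * (?r q t * ?s q t)))))"
    by (intro smooth_mult smooth_const smooth_param smooth_var smooth_inverse_sqrt Suc.IH)
  moreover have "(?s q has_real_derivative 2 * a * (q * (t * (?r q t * (?r q t * ?s q t))))) (at t within {0..1})"
    if "q \<ge> 0" for q t
  proof -
    have p: "1 + q * t\<^sup>2 > 0" using that by (simp add: add_pos_nonneg)
    have "?r q t * ?r q t = inverse (1 + q * t\<^sup>2)" using p by (simp add: divide_simps)
    moreover have "(1 + q * t\<^sup>2) powr (a - 1) = (1 + q * t\<^sup>2) powr a * inverse (1 + q * t\<^sup>2)"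
      using p by (simp add: powr_diff divide_inverse)
    moreover have "(?s q has_real_derivative a * (1 + q * t\<^sup>2) powr (a - 1) * (q * (2 * t))) (at t within {0..1})"
      using p by (auto intro!: derivative_eq_intros simp: powr_diff field_simps)
    moreover have "2 * a * (q * (t * (?r q t * (?r q t * ?s q t)))) = a * (?s q t * (?r q t * ?r q t)) * (q * (2 * t))"
      by (simp only: mult_ac)
    ultimately show ?thesis by (simp only:)
  qed
  ultimately show ?case using 1 by auto
qed

text \<open>The quotient q t / (sqrt (1 + q t^2) + 1) is (sqrt (1 + q t^2) - 1) / t with the
  singularity at t = 0 removed. It is at most sqrt q for all t in the unit interval, which is why
  the growth class contains the factor exp (K sqrt q).\<close>

lemma smooth_exp_sqrt: "smooth N (\<lambda>q t. exp (b * (q * t / (sqrt (1 + q * t\<^sup>2) + 1))))"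
proof (induction N)
  let ?p = "\<lambda>q t. q * t / (sqrt (1 + q * t\<^sup>2) + 1) :: real"
  have bd: "0 \<le> ?p q t \<and> ?p q t \<le> sqrt q" if q: "q \<ge> 0" "t \<in> {0..1}" for q t
  proof -
    have "sqrt q * t = sqrt (q * t\<^sup>2)" using q by (simp add: real_sqrt_mult)
    also have "\<dots> \<le> sqrt (1 + q * t\<^sup>2) + 1"
      by (rule order_trans[of _ "sqrt (1 + q * t\<^sup>2)"]) simp_all
    finally have "sqrt q * (sqrt q * t) \<le> sqrt q * (sqrt (1 + q * t\<^sup>2) + 1)"
      using q by (intro mult_left_mono) auto
    moreover have "sqrt q * (sqrt q * t) = q * t" using q by (simp flip: mult.assoc)
    moreover have "sqrt (1 + q * t\<^sup>2) + 1 > 0" using q by (simp add: add_nonneg_pos)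
    ultimately have "?p q t \<le> sqrt q" by (simp add: divide_le_eq)
    then show ?thesis using q by auto
  qed
  have 1: "subexp (\<lambda>q t. exp (b * ?p q t))"
    proof (rule subexpI[where M = 0 and K = "max 1 \<bar>b\<bar>"])
    fix q t :: real assume q: "q \<ge> 0" "t \<in> {0..1}"
    have "b * ?p q t \<le> \<bar>b\<bar> * ?p q t" using bd[OF q] by (intro mult_right_mono) auto
    also have "\<dots> \<le> max 1 \<bar>b\<bar> * sqrt q" using bd[OF q] by (intro mult_mono) auto
    finally have "exp (b * ?p q t) \<le> 1 * exp (max 1 \<bar>b\<bar> * sqrt q)" by simp
    also have "\<dots> \<le> max 1 \<bar>b\<bar> * exp (max 1 \<bar>b\<bar> * sqrt q)" by (intro mult_right_mono) auto
    finally show "\<bar>exp (b * ?p q t)\<bar> \<le> max 1 \<bar>b\<bar> * (1 + q) ^ 0 * exp (max 1 \<bar>b\<bar> * sqrt q)" by simp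
  qed
  case 0
  show ?case using 1 by simp
  case (Suc N)
  let ?r = "\<lambda>q t. 1 / sqrt (1 + q * t\<^sup>2) :: real"
  let ?s = "\<lambda>q t. 1 / (sqrt (1 + q * t\<^sup>2) + 1) :: real"
  have "smooth N (\<lambda>q t. b * (q * (?r q t * (?s q t * exp (b * ?p q t)))))"
    by (intro smooth_mult smooth_const smooth_param smooth_inverse_sqrt smooth_inverse_sqrt_plus_one Suc.IH)
  moreover have "((\<lambda>t. exp (b * ?p q t)) has_real_derivative b * (q * (?r q t * (?s q t * exp (b * ?p q t))))) (at t within {0..1})"
    if "q \<ge> 0" for q t
  proof -
    let ?R = "sqrt (1 + q * t\<^sup>2)"
    have R: "?R > 0" "?R + 1 > 0" using that by (simp_all add: add_pos_nonneg add_nonneg_pos)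
    have RR: "?R * ?R = 1 + q * t\<^sup>2" using that by simp
    have "((\<lambda>t. ?p q t) has_real_derivative (q * (?R + 1) - q * t * (q * t * (1 / ?R))) / ((?R + 1) * (?R + 1))) (at t within {0..1})"
      using R by (intro DERIV_cong[OF DERIV_divide[OF DERIV_cmult[OF DERIV_ident]
        DERIV_add[OF has_derivative_sqrt_one_plus[OF that] DERIV_const]]]) auto
    moreover have "(q * (?R + 1) - q * t * (q * t * (1 / ?R))) = q * (?R + 1) / ?R"
    proof -
      have "?R * (q * (?R + 1) - q * t * (q * t * (1 / ?R))) = q * ((?R * ?R) + ?R) - q * (q * t\<^sup>2)"
        using R(1) by (simp add: field_simps power2_eq_square del: real_sqrt_mult_self real_sqrt_pow2_iff)
      also have "\<dots> = q * (?R + 1)" unfolding RR by (simp add: algebra_simps)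
      finally show ?thesis using R(1) by (simp add: field_simps)
    qed
    ultimately have "((\<lambda>t. ?p q t) has_real_derivative q * (?r q t * ?s q t)) (at t within {0..1})"
      using R by simp
    from DERIV_chain2[OF DERIV_exp DERIV_cmult[OF this, of b]] show ?thesis
      by (simp add: mult_ac)
  qed
  ultimately show ?case using 1 by auto
qed

section \<open>Uniqueness of coefficients and termwise integration\<close>

lemma bigo_at_right_cancel:
  fixes f g :: "real \<Rightarrow> real"
  assumes "(\<lambda>t. f t * t) \<in> O[at_right 0](\<lambda>t. g t * t)"
  shows "f \<in> O[at_right 0](g)"
proof -
  obtain C where C: "\<forall>\<^sub>F t in at_right 0. norm (f t * t) \<le> C * norm (g t * t)"
    using assms by (rule landau_o.bigE)
  have "\<forall>\<^sub>F t in at_right (0::real). t > 0" by (rule eventually_at_right_less)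
  with C have "\<forall>\<^sub>F t in at_right 0. norm (f t) \<le> C * norm (g t)"
  proof eventually_elim
    case (elim t)
    from elim(1) have "norm (f t) * norm t \<le> C * norm (g t) * norm t" by (simp only: norm_mult mult.assoc)
    then show ?case using elim(2) by (simp add: mult_le_cancel_right)
  qed
  then show ?thesis by (rule bigoI)
qed

text \<open>The constant term vanishes on letting t tend to 0; dividing by t then lowers the degree
  and the order together.\<close>

lemma poly_bigo_unique:
  fixes d :: "nat \<Rightarrow> real"
  assumes "(\<lambda>t. \<Sum>j<N. d j * t ^ j) \<in> O[at_right 0](\<lambda>t. t ^ N)" "j < N"
  shows "d j = 0"
  using assms
proof (induction N arbitrary: d j)
  case 0
  from 0(2) show ?case by simp
next
  case (Suc N)
  have S: "(\<Sum>j<Suc N. d j * t ^ j) = d 0 + (\<Sum>j<N. d (Suc j) * t ^ j) * t" for t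
    unfolding sum.lessThan_Suc_shift sum_distrib_right by (simp add: mult_ac)
  have pr: "(\<lambda>t. d 0 + (\<Sum>j<N. d (Suc j) * t ^ j) * t) \<in> O[at_right 0](\<lambda>t. t ^ Suc N)"
    using Suc.prems(1) unfolding S .
  have "((\<lambda>t. d 0 + (\<Sum>j<N. d (Suc j) * t ^ j) * t) \<longlongrightarrow> d 0 + (\<Sum>j<N. d (Suc j) * 0 ^ j) * 0) (at_right 0)"
    by (intro tendsto_intros)
  moreover have "((\<lambda>t. d 0 + (\<Sum>j<N. d (Suc j) * t ^ j) * t) \<longlongrightarrow> 0) (at_right 0)"
  proof -
    have "((\<lambda>t::real. t ^ Suc N) \<longlongrightarrow> 0 ^ Suc N) (at_right 0)" by (intro tendsto_intros)
    then have "((\<lambda>t::real. t ^ Suc N / 1) \<longlongrightarrow> 0) (at_right 0)" by simp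
    then have "(\<lambda>t::real. t ^ Suc N) \<in> o[at_right 0](\<lambda>_. 1)"
      by (rule smalloI_tendsto) simp
    from smalloD_tendsto[OF landau_o.big_small_trans[OF pr this]]
    show ?thesis by (simp only: div_by_1)
  qed
  ultimately have "d 0 + (\<Sum>j<N. d (Suc j) * 0 ^ j) * 0 = 0"
    by (rule tendsto_unique[rotated 1]) simp
  then have d0: "d 0 = 0" by simp
  have "(\<lambda>t. (\<Sum>j<N. d (Suc j) * t ^ j) * t) \<in> O[at_right 0](\<lambda>t. t ^ N * t)"
    using pr unfolding d0 power_Suc2 by (simp only: add_0)
  then have "(\<lambda>t. (\<Sum>j<N. d (Suc j) * t ^ j)) \<in> O[at_right 0](\<lambda>t. t ^ N)"
    by (rule bigo_at_right_cancel)
  note IH = Suc.IH[OF this]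
  show ?case
  proof (cases j)
    case (Suc i)
    then show ?thesis using IH[of i] Suc.prems(2) by simp
  qed (use d0 in simp)
qed

lemma power_series_remainder_bigo:
  fixes a :: "nat \<Rightarrow> real"
  assumes "\<forall>\<^sub>F t in at_right 0. (\<lambda>j. a j * t ^ j) sums f t"
  shows "(\<lambda>t. f t - (\<Sum>j<N. a j * t ^ j)) \<in> O[at_right 0](\<lambda>t. t ^ N)"
proof -
  obtain e where e: "e > 0" "\<And>t. 0 < t \<Longrightarrow> t < e \<Longrightarrow> (\<lambda>j. a j * t ^ j) sums f t"
    using assms unfolding eventually_at_right_field by auto
  define r where "r = e / 2"
  have r: "r > 0" "r < e" using e by (auto simp: r_def)
  have "summable (\<lambda>j. a j * r ^ j)" using e(2)[of r] r by (auto simp: sums_iff)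
  then have "Bseq (\<lambda>j. a j * r ^ j)" by (intro convergent_imp_Bseq convergentI[OF summable_LIMSEQ_zero])
  then obtain B where B: "B > 0" "\<And>j. \<bar>a j * r ^ j\<bar> \<le> B" by (auto elim: BseqE)
  \<comment> \<open>The terms are bounded at r, so for t below r / 2 the tail of the series is
    dominated by a geometric series with ratio 1/2. Its sum is the factor 2 in the constant.\<close>
  show ?thesis
  proof (rule bigoI[of _ "2 * B / r ^ N"])
    have "\<forall>\<^sub>F t in at_right 0. 0 < t \<and> t < r / 2"
      unfolding eventually_at_right_field using r by (intro exI[of _ "r/2"]) auto
    then show "\<forall>\<^sub>F t in at_right 0. norm (f t - (\<Sum>j<N. a j * t ^ j)) \<le> 2 * B / r ^ N * norm (t ^ N)"
    proof eventually_elim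
      case (elim t)
      have s: "(\<lambda>j. a j * t ^ j) sums f t" using e(2)[of t] elim r by auto
      then have s': "(\<lambda>j. a (j + N) * t ^ (j + N)) sums (f t - (\<Sum>j<N. a j * t ^ j))"
        by (subst sums_iff_shift) simp
      have bd: "norm (a (j + N) * t ^ (j + N)) \<le> B * (t / r) ^ N * (1 / 2) ^ j" for j
      proof -
        have "norm (a (j + N) * t ^ (j + N)) = \<bar>a (j + N) * r ^ (j + N)\<bar> * (t / r) ^ (j + N)"
          using elim r by (simp add: abs_mult power_divide)
        also have "\<dots> \<le> B * (t / r) ^ (j + N)" using elim r by (intro mult_right_mono B) auto
        also have "\<dots> = B * (t / r) ^ N * (t / r) ^ j" by (simp add: power_add)
        also have "\<dots> \<le> B * (t / r) ^ N * (1 / 2) ^ j"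
          using elim r B by (intro mult_left_mono power_mono) (auto simp: field_simps)
        finally show ?thesis .
      qed
      have "norm (f t - (\<Sum>j<N. a j * t ^ j)) \<le> (\<Sum>j. B * (t / r) ^ N * (1 / 2) ^ j)"
        unfolding sums_unique[OF s'] using bd
        by (intro norm_suminf_le) (auto intro!: summable_mult summable_geometric)
      also have "\<dots> = B * (t / r) ^ N * 2"
        by (subst suminf_mult) (auto simp: suminf_geometric summable_geometric)
      finally show ?case using elim by (simp add: power_divide mult_ac)
    qed
  qed
qed

text \<open>Two remainders are played against each other. The one from \<open>smooth_taylor\<close>
  is uniform in q but has unknown coefficients c; the one for the known coefficients P holds only
  for each q separately. Uniqueness gives c = P pointwise, so P inherits the uniform remainder, and
  that one can be integrated.\<close>

lemma asy_integral_smooth: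
  assumes sm: "\<And>N. smooth N f"
    and meas: "\<And>t. (\<lambda>q. f q t) \<in> borel_measurable \<nu>"
    and nn: "AE q in \<nu>. q \<ge> 0"
    and mom: "\<And>M K. integrable \<nu> (\<lambda>q. (1 + q) ^ M * exp (K * sqrt q))"
    and P: "\<And>q N. q \<ge> 0 \<Longrightarrow> (\<lambda>t. f q t - (\<Sum>j<N. P j q * t ^ j)) \<in> O[at_right 0](\<lambda>t. t ^ N)"
    and Pint: "\<And>j. integrable \<nu> (P j)"
  shows "asy (\<lambda>y. \<integral>q. f q (inverse (sqrt y)) \<partial>\<nu>) (\<lambda>j. \<integral>q. P j q \<partial>\<nu>)"
  unfolding asy_def
proof
  fix N
  obtain c M K where K: "K \<ge> 0" and c: "\<And>q t. q\<ge>0 \<Longrightarrow> t\<in>{0..1} \<Longrightarrow>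
      \<bar>f q t - (\<Sum>j<N. c j q * t ^ j)\<bar> \<le> K * (1 + q) ^ M * exp (K * sqrt q) * t ^ N"
    using smooth_taylor[OF sm[of N]] by blast
  have cP: "c j q = P j q" if "q \<ge> 0" "j < N" for q j
  proof -
    have "(\<lambda>t. f q t - (\<Sum>j<N. c j q * t ^ j)) \<in> O[at_right 0](\<lambda>t. t ^ N)"
    proof (rule bigoI[of _ "K * (1 + q) ^ M * exp (K * sqrt q)"])
      have "\<forall>\<^sub>F t in at_right (0::real). t \<in> {0<..<1}" by (rule eventually_at_right_real) simp
      then show "\<forall>\<^sub>F t in at_right 0. norm (f q t - (\<Sum>j<N. c j q * t ^ j)) \<le>
          K * (1 + q) ^ M * exp (K * sqrt q) * norm (t ^ N)"
        by eventually_elim (use c[OF that(1)] in auto)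
    qed
    from sum_in_bigo(2)[OF P[OF that(1), of N] this]
    have "(\<lambda>t. \<Sum>j<N. (c j q - P j q) * t ^ j) \<in> O[at_right 0](\<lambda>t. t ^ N)"
      by (simp add: sum_subtractf left_diff_distrib)
    from poly_bigo_unique[OF this that(2)] show ?thesis by simp
  qed
  obtain M' K' where f: "K' \<ge> 0" "\<And>q t. q \<ge> 0 \<Longrightarrow> t \<in> {0..1} \<Longrightarrow> \<bar>f q t\<bar> \<le> K' * (1 + q) ^ M' * exp (K' * sqrt q)"
    using subexpE[OF smooth_subexp[OF sm[of 0]]] by metis
  have fi: "integrable \<nu> (\<lambda>q. f q t)" if "t \<in> {0..1}" for t
  proof (rule Bochner_Integration.integrable_bound)
    show "integrable \<nu> (\<lambda>q. K' * ((1 + q) ^ M' * exp (K' * sqrt q)))"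
      by (intro integrable_mult_right mom)
    show "AE q in \<nu>. norm (f q t) \<le> norm (K' * ((1 + q) ^ M' * exp (K' * sqrt q)))"
      using nn by eventually_elim (use f that in \<open>fastforce simp: mult.assoc abs_mult\<close>)
  qed (rule meas)
  show "(\<lambda>x. (\<integral>q. f q (inverse (sqrt x)) \<partial>\<nu>) - (\<Sum>l<N. (\<integral>q. P l q \<partial>\<nu>) * inverse (sqrt x) ^ l)) \<in> O(\<lambda>x. inverse (sqrt x) ^ N)"
  proof (rule bigoI[of _ "K * (\<integral>q. (1 + q) ^ M * exp (K * sqrt q) \<partial>\<nu>)"])
    show "\<forall>\<^sub>F x in at_top. norm ((\<integral>q. f q (inverse (sqrt x)) \<partial>\<nu>) - (\<Sum>l<N. (\<integral>q. P l q \<partial>\<nu>) * inverse (sqrt x) ^ l))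
         \<le> K * (\<integral>q. (1 + q) ^ M * exp (K * sqrt q) \<partial>\<nu>) * norm (inverse (sqrt x) ^ N)"
      using eventually_ge_at_top[of 1]
    proof eventually_elim
      case (elim x)
      define t where "t = inverse (sqrt x)"
      have t: "t \<in> {0..1}" using elim by (simp add: t_def inverse_le_1_iff)
      have "(\<integral>q. f q t \<partial>\<nu>) - (\<Sum>l<N. (\<integral>q. P l q \<partial>\<nu>) * t ^ l) = (\<integral>q. f q t - (\<Sum>l<N. P l q * t ^ l) \<partial>\<nu>)"
        using fi[OF t] Pint by simp
      also have "norm \<dots> \<le> (\<integral>q. norm (f q t - (\<Sum>l<N. P l q * t ^ l)) \<partial>\<nu>)"
        by (rule integral_norm_bound)
      also have "\<dots> \<le> (\<integral>q. K * t ^ N * ((1 + q) ^ M * exp (K * sqrt q)) \<partial>\<nu>)"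
      proof (rule integral_mono_AE)
        show "integrable \<nu> (\<lambda>q. norm (f q t - (\<Sum>l<N. P l q * t ^ l)))"
          by (intro integrable_norm Bochner_Integration.integrable_diff Bochner_Integration.integrable_sum
              integrable_mult_left fi t Pint)
        show "integrable \<nu> (\<lambda>q. K * t ^ N * ((1 + q) ^ M * exp (K * sqrt q)))"
          by (intro integrable_mult_right mom)
        show "AE q in \<nu>. norm (f q t - (\<Sum>l<N. P l q * t ^ l)) \<le> K * t ^ N * ((1 + q) ^ M * exp (K * sqrt q))"
          using nn
        proof eventually_elim
          case (elim q)
          have "(\<Sum>l<N. P l q * t ^ l) = (\<Sum>l<N. c l q * t ^ l)" using cP[OF elim] by simp
          then show ?case using c[OF elim t] by (simp add: mult_ac)
        qed
      qed
      finally show ?case using t by (simp add: t_def mult_ac)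
    qed
  qed
qed

text \<open>The generating function of \<open>g_coeff\<close> at u = q and y = t^2, written so that
  it also makes sense at t = 0. For t = 1 / sqrt y it is, apart from exp (- q / \<kappa>), the
  factor by which the model density changes when its argument moves from y to y + q; see
  \<open>dens_add\<close>.\<close>

definition tilt :: "real \<Rightarrow> real \<Rightarrow> real \<Rightarrow> real \<Rightarrow> real" where
  "tilt a b q t = (1 + q * t\<^sup>2) powr a * exp (b * (q * t / (sqrt (1 + q * t\<^sup>2) + 1)))"

lemma smooth_tilt: "smooth N (tilt a b)"
proof -
  have "tilt a b = (\<lambda>q t. (1 + q * t\<^sup>2) powr a * exp (b * (q * t / (sqrt (1 + q * t\<^sup>2) + 1))))"
    by (simp add: tilt_def fun_eq_iff)
  then show ?thesis by (simp only: smooth_mult[OF smooth_powr smooth_exp_sqrt])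
qed

lemma tilt_measurable [measurable]: "(\<lambda>q. tilt a b q t) \<in> borel_measurable borel"
  unfolding tilt_def by measurable

lemma tilt_nonneg: "tilt a b q t \<ge> 0"
  by (simp add: tilt_def)

lemma tilt_expansion:
  assumes "q \<ge> 0"
  shows "(\<lambda>t. tilt a b q t - (\<Sum>j<N. (\<Sum>i = nat \<lceil>real j / 2\<rceil>..j. g_coeff i j a b * q ^ i) * t ^ j))
    \<in> O[at_right 0](\<lambda>t. t ^ N)"
proof (rule power_series_remainder_bigo)
  have "\<forall>\<^sub>F y in at_right 0. (\<lambda>j. (\<Sum>i = nat \<lceil>real j / 2\<rceil>..j. g_coeff i j a b * q ^ i) * y powr (real j / 2)) sums
          ((1 + q * y) powr a * exp (b * y powr (- 1 / 2) * (sqrt (1 + q * y) - 1)))"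
    using puiseux_coeffs_g_coeff[of a b] unfolding puiseux_coeffs_def by blast
  moreover have "filterlim (\<lambda>t::real. t\<^sup>2) (at_right 0) (at_right 0)"
    unfolding filterlim_at by (auto intro!: tendsto_eq_intros simp: eventually_at_filter)
  ultimately have "\<forall>\<^sub>F t in at_right 0. (\<lambda>j. (\<Sum>i = nat \<lceil>real j / 2\<rceil>..j. g_coeff i j a b * q ^ i) * (t\<^sup>2) powr (real j / 2)) sums
          ((1 + q * t\<^sup>2) powr a * exp (b * (t\<^sup>2) powr (- 1 / 2) * (sqrt (1 + q * t\<^sup>2) - 1)))"
    by (rule eventually_compose_filterlim)
  moreover have "\<forall>\<^sub>F t in at_right (0::real). t > 0" by (rule eventually_at_right_less)
  ultimately show "\<forall>\<^sub>F t in at_right 0. (\<lambda>j. (\<Sum>i = nat \<lceil>real j / 2\<rceil>..j. g_coeff i j a b * q ^ i) * t ^ j) sums tilt a b q t"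
  proof eventually_elim
    case (elim t)
    have *: "(t\<^sup>2) powr (real j / 2) = t ^ j" for j
      using elim by (simp add: powr_powr powr_realpow flip: powr_numeral)
    have "(t\<^sup>2) powr (- 1 / 2) = 1 / t"
      using elim by (simp add: powr_powr powr_minus_divide flip: powr_numeral)
    moreover have "1 / t * (sqrt (1 + q * t\<^sup>2) - 1) = q * t / (sqrt (1 + q * t\<^sup>2) + 1)"
    proof -
      have R: "sqrt (1 + q * t\<^sup>2) > 0" "sqrt (1 + q * t\<^sup>2) * sqrt (1 + q * t\<^sup>2) = 1 + q * t\<^sup>2"
        using assms by (simp_all add: add_pos_nonneg)
      have "(sqrt (1 + q * t\<^sup>2) - 1) * (sqrt (1 + q * t\<^sup>2) + 1) = q * t * t"
        using R(2) by (simp add: algebra_simps power2_eq_square del: real_sqrt_mult_self)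
      then have "sqrt (1 + q * t\<^sup>2) - 1 = q * t * t / (sqrt (1 + q * t\<^sup>2) + 1)"
        using R(1) by (intro eq_divide_imp) auto
      then show ?thesis using elim by simp
    qed
    ultimately have "b * (t\<^sup>2) powr (- 1 / 2) * (sqrt (1 + q * t\<^sup>2) - 1) = b * (q * t / (sqrt (1 + q * t\<^sup>2) + 1))"
      by (simp only: mult.assoc)
    with elim(1) show ?case unfolding * by (simp only: tilt_def)
  qed
qed

section \<open>Averages over measures with subexponential moments\<close>

locale subexp_measure =
  fixes \<nu> :: "real measure"
  assumes sets_nu [measurable_cong]: "sets \<nu> = sets borel"
    and nonneg_AE: "AE q in \<nu>. q \<ge> 0"
    and moments: "\<And>M K. integrable \<nu> (\<lambda>q. (1 + q) ^ M * exp (K * sqrt q))"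
begin

lemma integrable_subexp:
  assumes "subexp f" "t \<in> {0..1}" and [measurable]: "(\<lambda>q. f q t) \<in> borel_measurable \<nu>"
  shows "integrable \<nu> (\<lambda>q. f q t)"
proof -
  obtain M K where f: "K \<ge> 0" "\<And>q t. q \<ge> 0 \<Longrightarrow> t \<in> {0..1} \<Longrightarrow> \<bar>f q t\<bar> \<le> K * (1 + q) ^ M * exp (K * sqrt q)"
    using subexpE[OF assms(1)] by metis
  show ?thesis
  proof (rule Bochner_Integration.integrable_bound)
    show "integrable \<nu> (\<lambda>q. K * ((1 + q) ^ M * exp (K * sqrt q)))"
      by (intro integrable_mult_right moments)
    show "AE q in \<nu>. norm (f q t) \<le> norm (K * ((1 + q) ^ M * exp (K * sqrt q)))"
      using nonneg_AE by eventually_elim (use f assms(2) in \<open>fastforce simp: mult.assoc abs_mult\<close>)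
  qed (rule assms(3))
qed

lemma integrable_power: "integrable \<nu> (\<lambda>q. q ^ i)"
proof -
  have "smooth 0 (\<lambda>q t. q ^ i)"
  proof (induction i)
    case (Suc i)
    then show ?case using smooth_mult[OF smooth_param[of 0] Suc] by (simp del: smooth.simps)
  qed (simp add: smooth_const del: smooth.simps)
  then have "subexp (\<lambda>q t. q ^ i)" by simp
  from integrable_subexp[OF this, of 0] show ?thesis by simp
qed

lemma asy_tilt:
  "asy (\<lambda>y. \<integral>q. tilt a b q (inverse (sqrt y)) \<partial>\<nu>)
     (\<lambda>j. \<Sum>i = nat \<lceil>real j / 2\<rceil>..j. g_coeff i j a b * (\<integral>q. q ^ i \<partial>\<nu>))"
proof -
  have "asy (\<lambda>y. \<integral>q. tilt a b q (inverse (sqrt y)) \<partial>\<nu>)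
     (\<lambda>j. \<integral>q. (\<Sum>i = nat \<lceil>real j / 2\<rceil>..j. g_coeff i j a b * q ^ i) \<partial>\<nu>)"
    by (rule asy_integral_smooth[OF smooth_tilt _ nonneg_AE moments tilt_expansion])
       (auto intro!: integrable_power)
  then show ?thesis by (simp add: integrable_power)
qed

text \<open>With t = 1 / sqrt y, each term (y + q) powr (- m / 2) of the expansion of f splits into
  (1 + q t^2) powr (- m / 2) and t^m. The first factor lowers the exponent in \<open>tilt\<close>,
  so that \<open>asy_tilt\<close> applies with \<beta> - m / 2; the second is the power that the
  diagonal rule expects.\<close>

lemma asy_average:
  assumes A: "asy f A" and [measurable]: "f \<in> borel_measurable borel"
  shows "asy (\<lambda>y. \<integral>q. tilt \<beta> b q (inverse (sqrt y)) * f (y + q) \<partial>\<nu>)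
     (\<lambda>l. \<Sum>m\<le>l. A m * (\<Sum>i = nat \<lceil>real (l - m) / 2\<rceil>..l - m. g_coeff i (l - m) (\<beta> - real m / 2) b * (\<integral>q. q ^ i \<partial>\<nu>)))"
proof (rule asy_diagonal[where F = "\<lambda>k y. A k * (\<integral>q. tilt (\<beta> - real k / 2) b q (inverse (sqrt y)) \<partial>\<nu>)"])
  show "asy (\<lambda>y. A k * (\<integral>q. tilt (\<beta> - real k / 2) b q (inverse (sqrt y)) \<partial>\<nu>))
      (\<lambda>j. A k * (\<Sum>i = nat \<lceil>real j / 2\<rceil>..j. g_coeff i j (\<beta> - real k / 2) b * (\<integral>q. q ^ i \<partial>\<nu>)))" for k
    by (intro asy_cmult asy_tilt)
  fix N
  obtain C where C: "C > 0" "\<forall>\<^sub>F x in at_top. norm (f x - (\<Sum>l<N. A l * inverse (sqrt x) ^ l)) \<le> C * norm (inverse (sqrt x) ^ N)"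
    using asyD[OF A, of N] by (rule landau_o.bigE)
  obtain C0 where C0: "C0 > 0" "\<forall>\<^sub>F x in at_top. norm (f x) \<le> C0 * norm (1::real)"
    using asy_bounded[OF A] by (rule landau_o.bigE)
  have "\<forall>\<^sub>F x in at_top. norm (f x - (\<Sum>l<N. A l * inverse (sqrt x) ^ l)) \<le> C * norm (inverse (sqrt x) ^ N) \<and> norm (f x) \<le> C0"
    using C(2) C0(2) by eventually_elim simp
  \<comment> \<open>Since q \<ge> 0 almost everywhere, y + q lies beyond x0 as soon as y does. So
    the bounds on f near infinity hold for all shifted arguments at once.\<close>
  then obtain x0 where x0: "\<And>x. x \<ge> x0 \<Longrightarrow> \<bar>f x - (\<Sum>l<N. A l * inverse (sqrt x) ^ l)\<bar> \<le> C * \<bar>inverse (sqrt x) ^ N\<bar>"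
      "\<And>x. x \<ge> x0 \<Longrightarrow> \<bar>f x\<bar> \<le> C0"
    unfolding eventually_at_top_linorder by auto
  have ti: "integrable \<nu> (\<lambda>q. tilt a b q t)" if "t \<in> {0..1}" for a t
    by (rule integrable_subexp[OF smooth_subexp[OF smooth_tilt[of 0]] that]) measurable
  obtain D where D: "D > 0" "\<forall>\<^sub>F y in at_top. norm (\<integral>q. tilt (\<beta> - real N / 2) b q (inverse (sqrt y)) \<partial>\<nu>) \<le> D * norm (1::real)"
    using asy_bounded[OF asy_tilt[of "\<beta> - real N / 2" b]] by (rule landau_o.bigE)
  show "(\<lambda>y. (\<integral>q. tilt \<beta> b q (inverse (sqrt y)) * f (y + q) \<partial>\<nu>) -
        (\<Sum>k<N. A k * (\<integral>q. tilt (\<beta> - real k / 2) b q (inverse (sqrt y)) \<partial>\<nu>) * inverse (sqrt y) ^ k))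
      \<in> O(\<lambda>y. inverse (sqrt y) ^ N)"
  proof (rule bigoI[of _ "C * D"])
    show "\<forall>\<^sub>F y in at_top. norm ((\<integral>q. tilt \<beta> b q (inverse (sqrt y)) * f (y + q) \<partial>\<nu>) -
        (\<Sum>k<N. A k * (\<integral>q. tilt (\<beta> - real k / 2) b q (inverse (sqrt y)) \<partial>\<nu>) * inverse (sqrt y) ^ k))
       \<le> C * D * norm (inverse (sqrt y) ^ N)"
      using eventually_ge_at_top[of 1] eventually_ge_at_top[of x0] D(2)
    proof eventually_elim
      case (elim y)
      define t where "t = inverse (sqrt y)"
      have t: "t \<in> {0..1}" "t > 0" using elim by (auto simp: t_def inverse_le_1_iff)
      have shift: "tilt \<beta> b q t * inverse (sqrt (y + q)) ^ k = tilt (\<beta> - real k / 2) b q t * t ^ k"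
        if "q \<ge> 0" for q k
      proof -
        have p: "1 + q * t\<^sup>2 > 0" using that by (simp add: add_pos_nonneg)
        have "y + q = (1 + q * t\<^sup>2) * y" using elim by (simp add: t_def field_simps)
        then have "inverse (sqrt (y + q)) = inverse (sqrt (1 + q * t\<^sup>2)) * t"
          by (simp add: t_def real_sqrt_mult)
        moreover have "inverse (sqrt (1 + q * t\<^sup>2)) ^ k = (1 + q * t\<^sup>2) powr (- (real k / 2))"
        proof -
          have "inverse (sqrt (1 + q * t\<^sup>2)) = (1 + q * t\<^sup>2) powr (- (1 / 2))"
            using p by (simp add: powr_minus powr_half_sqrt)
          then show ?thesis using p by (simp add: powr_power mult.commute)
        qed
        moreover have "(1 + q * t\<^sup>2) powr (\<beta> - real k / 2) = (1 + q * t\<^sup>2) powr \<beta> * (1 + q * t\<^sup>2) powr (- (real k / 2))"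
          using p by (simp flip: powr_add)
        ultimately show ?thesis by (simp add: tilt_def power_mult_distrib)
      qed
      let ?r = "\<lambda>q. tilt \<beta> b q t * (f (y + q) - (\<Sum>k<N. A k * inverse (sqrt (y + q)) ^ k))"
      have fi: "integrable \<nu> (\<lambda>q. tilt \<beta> b q t * f (y + q))"
      proof (rule Bochner_Integration.integrable_bound)
        show "integrable \<nu> (\<lambda>q. C0 * tilt \<beta> b q t)" by (intro integrable_mult_right ti t)
        show "AE q in \<nu>. norm (tilt \<beta> b q t * f (y + q)) \<le> norm (C0 * tilt \<beta> b q t)"
          using nonneg_AE
        proof eventually_elim
          case (elim q)
          have "\<bar>f (y + q)\<bar> \<le> C0" using elim \<open>x0 \<le> y\<close> by (intro x0) auto
          then have "tilt \<beta> b q t * \<bar>f (y + q)\<bar> \<le> tilt \<beta> b q t * C0"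
            by (intro mult_left_mono tilt_nonneg)
          moreover have "norm (tilt \<beta> b q t * f (y + q)) = tilt \<beta> b q t * \<bar>f (y + q)\<bar>"
            using tilt_nonneg[of \<beta> b q t] by (simp add: abs_mult)
          moreover have "norm (C0 * tilt \<beta> b q t) = tilt \<beta> b q t * C0"
            using tilt_nonneg[of \<beta> b q t] C0(1) by (simp add: abs_mult)
          ultimately show ?case by (simp only:)
        qed
      qed measurable
      have "(\<integral>q. tilt \<beta> b q t * f (y + q) \<partial>\<nu>) - (\<Sum>k<N. A k * (\<integral>q. tilt (\<beta> - real k / 2) b q t \<partial>\<nu>) * t ^ k)
          = (\<integral>q. tilt \<beta> b q t * f (y + q) - (\<Sum>k<N. A k * tilt (\<beta> - real k / 2) b q t * t ^ k) \<partial>\<nu>)"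
        using fi ti[OF t(1)] by simp
      also have "\<dots> = (\<integral>q. ?r q \<partial>\<nu>)"
      proof (rule integral_cong_AE)
        show "AE q in \<nu>. tilt \<beta> b q t * f (y + q) - (\<Sum>k<N. A k * tilt (\<beta> - real k / 2) b q t * t ^ k) = ?r q"
          using nonneg_AE
        proof eventually_elim
          case (elim q)
          have "A k * tilt (\<beta> - real k / 2) b q t * t ^ k = tilt \<beta> b q t * (A k * inverse (sqrt (y + q)) ^ k)" for k
            using shift[OF elim, of k] by (simp add: mult_ac del: power_inverse)
          then show ?case by (simp only: right_diff_distrib sum_distrib_left)
        qed
      qed measurable
      also have "norm \<dots> \<le> (\<integral>q. C * t ^ N * tilt (\<beta> - real N / 2) b q t \<partial>\<nu>)"
      proof (rule order_trans[OF integral_norm_bound integral_mono_AE'])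
        show "integrable \<nu> (\<lambda>q. C * t ^ N * tilt (\<beta> - real N / 2) b q t)" by (intro integrable_mult_right ti t)
        show "AE q in \<nu>. norm (?r q) \<le> C * t ^ N * tilt (\<beta> - real N / 2) b q t"
          using nonneg_AE
        proof eventually_elim
          case (elim q)
          have "norm (?r q) \<le> tilt \<beta> b q t * (C * inverse (sqrt (y + q)) ^ N)"
            unfolding real_norm_def abs_mult using x0(1)[of "y + q"] elim \<open>x0 \<le> y\<close> \<open>1 \<le> y\<close>
            by (intro mult_mono) (auto simp: tilt_nonneg)
          also have "\<dots> = C * t ^ N * tilt (\<beta> - real N / 2) b q t"
            using shift[OF elim, of N] by (simp add: mult_ac del: power_inverse)
          finally show ?case .
        qed
      qed (use C t in \<open>auto intro!: AE_I2 mult_nonneg_nonneg tilt_nonneg\<close>)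
      also have "\<dots> \<le> C * t ^ N * D"
        using elim(3) C t by (auto simp: t_def intro!: mult_left_mono)
      finally show ?case using t by (simp add: t_def mult_ac)
    qed
  qed
qed

end

subsection \<open>Tail integrals of the model density\<close>

lemma eventually_at_top_ge_oneE:
  assumes "\<forall>\<^sub>F x :: real in at_top. P x"
  obtains x0 where "x0 \<ge> 1" "\<And>x. x \<ge> x0 \<Longrightarrow> P x"
proof -
  obtain x1 where "\<And>x. x \<ge> x1 \<Longrightarrow> P x" using assms unfolding eventually_at_top_linorder by blast
  then show ?thesis by (intro that[of "max 1 x1"]) auto
qed

definition dens :: "real \<Rightarrow> real \<Rightarrow> real \<Rightarrow> real \<Rightarrow> real" where
  "dens \<beta> b \<kappa> x = x powr \<beta> * exp (b * sqrt x - x / \<kappa>)"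

lemma dens_pos: "x > 0 \<Longrightarrow> dens \<beta> b \<kappa> x > 0"
  by (simp add: dens_def)

lemma dens_nonneg: "dens \<beta> b \<kappa> x \<ge> 0"
  by (simp add: dens_def)

lemma dens_measurable [measurable]: "dens \<beta> b \<kappa> \<in> borel_measurable borel"
  unfolding dens_def[abs_def] by measurable

lemma dens_tendsto_0:
  assumes "\<kappa> > 0"
  shows "(dens \<beta> b \<kappa> \<longlongrightarrow> 0) at_top"
  unfolding dens_def using assms by real_asymp

lemma dens_shift: "x > 0 \<Longrightarrow> dens (\<beta> - real k / 2) b \<kappa> x = dens \<beta> b \<kappa> x * inverse (sqrt x) ^ k"
proof -
  assume "x > 0"
  have "inverse (sqrt x) ^ k = x powr (- (real k / 2))"
  proof -
    have "inverse (sqrt x) = x powr (- (1 / 2))"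
      using \<open>x > 0\<close> by (simp add: powr_minus powr_half_sqrt)
    then show ?thesis using \<open>x > 0\<close> by (simp add: powr_power mult.commute)
  qed
  moreover have "x powr (\<beta> - real k / 2) = x powr \<beta> * x powr (- (real k / 2))"
    by (simp flip: powr_add)
  ultimately show ?thesis by (simp only: dens_def mult_ac)
qed

lemma has_derivative_dens:
  assumes "x > 0" "\<kappa> > 0"
  shows "(dens \<beta> b \<kappa> has_real_derivative dens \<beta> b \<kappa> x * (\<beta> / x + b / 2 * inverse (sqrt x) - 1 / \<kappa>)) (at x)"
  unfolding dens_def[abs_def] using assms
  by (auto intro!: derivative_eq_intros simp: powr_diff field_simps)

text \<open>The tail integral, encoded by what characterises it on the positive axis. Linearity,
  comparison and change of variables become rules about derivatives, and Lebesgue integrals enter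
  only through \<open>set_integral_dens\<close>.\<close>

definition tail :: "(real \<Rightarrow> real) \<Rightarrow> (real \<Rightarrow> real) \<Rightarrow> bool" where
  "tail f F \<longleftrightarrow> (\<forall>x>0. (F has_real_derivative - f x) (at x)) \<and> (F \<longlongrightarrow> 0) at_top"

lemma tail_nonneg_ge:
  assumes F: "(F \<longlongrightarrow> 0) at_top" and d: "\<And>x. x \<ge> x0 \<Longrightarrow> \<exists>F'. (F has_real_derivative F') (at x) \<and> F' \<le> 0"
    and x: "x \<ge> x0"
  shows "F x \<ge> (0::real)"
proof (rule tendsto_upperbound[OF F])
  show "\<forall>\<^sub>F y in at_top. F y \<le> F x"
    using eventually_ge_at_top[of x]
  proof eventually_elim
    case (elim y)
    show ?case by (rule DERIV_nonpos_imp_nonincreasing[OF elim]) (use d x in auto)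
  qed
qed simp

text \<open>Both G - F and G + F are nonincreasing from x on and tend to 0, hence they are
  nonnegative at x.\<close>

lemma tail_le:
  assumes F: "tail f F" and G: "tail g G" and fg: "\<And>x. x \<ge> x0 \<Longrightarrow> \<bar>f x\<bar> \<le> g x" and x: "x \<ge> x0" "x > 0"
  shows "\<bar>F x\<bar> \<le> G x"
proof -
  have l: "((\<lambda>x. G x - F x) \<longlongrightarrow> 0) at_top" "((\<lambda>x. G x + F x) \<longlongrightarrow> 0) at_top"
    using F G tendsto_diff[of G 0 at_top F 0] tendsto_add[of G 0 at_top F 0] by (auto simp: tail_def)
  have "0 \<le> G x - F x"
  proof (rule tail_nonneg_ge[OF l(1)])
    fix y assume "y \<ge> x"
    then have "(G has_real_derivative - g y) (at y)" "(F has_real_derivative - f y) (at y)" "\<bar>f y\<bar> \<le> g y"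
      using F G x fg[of y] by (auto simp: tail_def)
    from DERIV_diff[OF this(1,2)] this(3)
    show "\<exists>F'. ((\<lambda>x. G x - F x) has_real_derivative F') (at y) \<and> F' \<le> 0"
      by (intro exI[of _ "- g y - (- f y)"]) auto
  qed simp
  moreover have "0 \<le> G x + F x"
  proof (rule tail_nonneg_ge[OF l(2)])
    fix y assume "y \<ge> x"
    then have "(G has_real_derivative - g y) (at y)" "(F has_real_derivative - f y) (at y)" "\<bar>f y\<bar> \<le> g y"
      using F G x fg[of y] by (auto simp: tail_def)
    from DERIV_add[OF this(1,2)] this(3)
    show "\<exists>F'. ((\<lambda>x. G x + F x) has_real_derivative F') (at y) \<and> F' \<le> 0"
      by (intro exI[of _ "- g y + (- f y)"]) auto
  qed simp
  ultimately show ?thesis by auto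
qed

lemma tail_unique: "tail f F \<Longrightarrow> tail f G \<Longrightarrow> x > 0 \<Longrightarrow> F x = G x"
proof -
  assume *: "tail f F" "tail f G" "x > 0"
  have "tail (\<lambda>_. 0) (\<lambda>x. F x - G x)"
    using * tendsto_diff[of F 0 at_top G 0] unfolding tail_def
    by (auto intro!: DERIV_cong[OF DERIV_diff])
  moreover have "tail (\<lambda>_. 0) (\<lambda>x. 0)" by (simp add: tail_def)
  ultimately have "\<bar>F x - G x\<bar> \<le> 0" using tail_le[of "\<lambda>_. 0" "\<lambda>x. F x - G x" "\<lambda>_. 0" "\<lambda>_. 0" x x] \<open>x > 0\<close> by simp
  then show ?thesis by simp
qed

lemma tail_cmult: "tail f F \<Longrightarrow> tail (\<lambda>x. c * f x) (\<lambda>x. c * F x)"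
  unfolding tail_def using tendsto_mult_right_zero by (auto intro!: DERIV_cong[OF DERIV_cmult])

lemma tail_diff: "tail f F \<Longrightarrow> tail g G \<Longrightarrow> tail (\<lambda>x. f x - g x) (\<lambda>x. F x - G x)"
  unfolding tail_def using tendsto_diff[of F 0 at_top G 0] by (auto intro!: DERIV_cong[OF DERIV_diff])

lemma tail_add: "tail f F \<Longrightarrow> tail g G \<Longrightarrow> tail (\<lambda>x. f x + g x) (\<lambda>x. F x + G x)"
  unfolding tail_def using tendsto_add[of F 0 at_top G 0] by (auto intro!: DERIV_cong[OF DERIV_add])

lemma tail_sum: "(\<And>k. k < (N::nat) \<Longrightarrow> tail (f k) (F k)) \<Longrightarrow> tail (\<lambda>x. \<Sum>k<N. f k x) (\<lambda>x. \<Sum>k<N. F k x)"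
proof (induction N)
  case 0
  show ?case by (simp add: tail_def)
next
  case (Suc N)
  then show ?case using tail_add[OF Suc.IH Suc.prems[of N]] by simp
qed

lemma tail_dens_exists:
  assumes "\<kappa> > 0"
  shows "\<exists>F. tail (dens \<beta> b \<kappa>) F"
proof -
  have "\<exists>G. \<forall>x. ereal 0 < ereal x \<longrightarrow> ereal x < \<infinity> \<longrightarrow> (G has_vector_derivative dens \<beta> b \<kappa> x) (at x)"
  proof (rule einterval_antiderivative)
    fix x :: real assume "ereal 0 < ereal x"
    then show "isCont (dens \<beta> b \<kappa>) x" using has_derivative_dens[of x \<kappa> \<beta> b] assms by (auto intro: DERIV_isCont)
  qed auto
  then obtain G where G: "\<And>x. x > 0 \<Longrightarrow> (G has_real_derivative dens \<beta> b \<kappa> x) (at x)"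
    by (auto simp: has_real_derivative_iff_has_vector_derivative)
  \<comment> \<open>Half of the exponential decay absorbs the power and the factor exp (b sqrt x);
    the other half bounds the density by an integrable exponential.\<close>
  have "\<forall>\<^sub>F x in at_top. dens \<beta> b (2 * \<kappa>) x < 1"
    using assms by (intro order_tendstoD[OF dens_tendsto_0]) auto
  then obtain x0 where x0: "x0 \<ge> 1" "\<And>x. x \<ge> x0 \<Longrightarrow> dens \<beta> b (2 * \<kappa>) x < 1"
    by (rule eventually_at_top_ge_oneE) blast
  have le: "dens \<beta> b \<kappa> x \<le> exp (- (x / (2 * \<kappa>)))" if "x \<ge> x0" for x
  proof -
    have "dens \<beta> b \<kappa> x = dens \<beta> b (2 * \<kappa>) x * exp (- (x / (2 * \<kappa>)))"
      by (simp add: dens_def mult.assoc flip: exp_add)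
    with x0(2)[OF that] show ?thesis by (simp add: mult_le_cancel_right1)
  qed
  have mono: "G x \<le> G y" if "x0 \<le> x" "x \<le> y" for x y
  proof (rule DERIV_nonneg_imp_nondecreasing[OF that(2)])
    fix z assume "x \<le> z"
    then have "z > 0" using that x0(1) by simp
    from G[OF this] show "\<exists>d. (G has_real_derivative d) (at z) \<and> 0 \<le> d" using dens_nonneg by blast
  qed
  have bd: "G x \<le> G x0 + 2 * \<kappa> * exp (- (x0 / (2 * \<kappa>)))" if "x \<ge> x0" for x
  proof -
    have "(\<lambda>x. G x + 2 * \<kappa> * exp (- (x / (2 * \<kappa>)))) x \<le> (\<lambda>x. G x + 2 * \<kappa> * exp (- (x / (2 * \<kappa>)))) x0"
    proof (rule DERIV_nonpos_imp_nonincreasing[OF that])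
      fix y assume y: "x0 \<le> y" "y \<le> x"
      have "((\<lambda>x. G x + 2 * \<kappa> * exp (- (x / (2 * \<kappa>)))) has_real_derivative dens \<beta> b \<kappa> y - exp (- (y / (2 * \<kappa>)))) (at y)"
        using y x0 assms by (auto intro!: derivative_eq_intros G)
      then show "\<exists>d. ((\<lambda>x. G x + 2 * \<kappa> * exp (- (x / (2 * \<kappa>)))) has_real_derivative d) (at y) \<and> d \<le> 0"
        using le[OF y(1)] by (intro exI conjI) auto
    qed
    moreover have "0 \<le> 2 * \<kappa> * exp (- (x / (2 * \<kappa>)))" using assms by simp
    ultimately show ?thesis by simp
  qed
  define L where "L = (SUP x\<in>{x0..}. G x)"
  have bdd: "bdd_above (G ` {x0..})" using bd by (intro bdd_aboveI2) auto
  have "(G \<longlongrightarrow> L) at_top"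
  proof (rule increasing_tendsto)
    show "\<forall>\<^sub>F x in at_top. G x \<le> L"
      using eventually_ge_at_top[of x0] by eventually_elim (auto simp: L_def intro!: cSUP_upper bdd)
    fix y assume "y < L"
    then obtain x where x: "x \<ge> x0" "y < G x"
      unfolding L_def by (subst (asm) less_cSUP_iff) (auto intro: bdd)
    show "\<forall>\<^sub>F x in at_top. y < G x"
      using eventually_ge_at_top[of x] by eventually_elim (rule less_le_trans[OF x(2) mono[OF x(1)]])
  qed
  then have "((\<lambda>x. L - G x) \<longlongrightarrow> L - L) at_top" by (intro tendsto_intros)
  then have "tail (dens \<beta> b \<kappa>) (\<lambda>x. L - G x)"
    unfolding tail_def using G by (auto intro!: derivative_eq_intros)
  then show ?thesis by blast
qed

definition dens_tail :: "real \<Rightarrow> real \<Rightarrow> real \<Rightarrow> real \<Rightarrow> real" where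
  "dens_tail \<beta> b \<kappa> = (SOME F. tail (dens \<beta> b \<kappa>) F)"

lemma tail_dens_tail: "\<kappa> > 0 \<Longrightarrow> tail (dens \<beta> b \<kappa>) (dens_tail \<beta> b \<kappa>)"
  unfolding dens_tail_def by (rule someI_ex[OF tail_dens_exists])

lemma dens_tail_nonneg:
  assumes "\<kappa> > 0" "x > 0"
  shows "dens_tail \<beta> b \<kappa> x \<ge> 0"
  using tail_le[OF tail_dens_tail[OF assms(1), of \<beta> b] tail_dens_tail[OF assms(1), of \<beta> b], of x x] assms
  by (simp add: dens_nonneg abs_le_iff)

text \<open>The logarithmic derivative of \<open>dens\<close> tends to - 1 / \<kappa>. Once it is
  below - 1 / (2 \<kappa>), the difference of the two sides is monotone with limit 0. The factor 2
  is slack; the sharp constant is \<kappa>.\<close>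

lemma dens_tail_le:
  assumes "\<kappa> > 0"
  shows "\<forall>\<^sub>F x in at_top. dens_tail \<beta> b \<kappa> x \<le> 2 * \<kappa> * dens \<beta> b \<kappa> x"
proof -
  have "((\<lambda>x. \<beta> / x + b / 2 * inverse (sqrt x) - 1 / \<kappa>) \<longlongrightarrow> - (1 / \<kappa>)) at_top"
    by real_asymp
  then have "\<forall>\<^sub>F x in at_top. \<beta> / x + b / 2 * inverse (sqrt x) - 1 / \<kappa> < - (1 / (2 * \<kappa>))"
    by (rule order_tendstoD) (use assms in \<open>simp add: field_simps\<close>)
  then obtain x0 where x0: "x0 \<ge> 1" "\<And>x. x \<ge> x0 \<Longrightarrow> \<beta> / x + b / 2 * inverse (sqrt x) - 1 / \<kappa> < - (1 / (2 * \<kappa>))"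
    by (rule eventually_at_top_ge_oneE) blast
  show ?thesis
    using eventually_ge_at_top[of x0]
  proof eventually_elim
    case (elim x)
    have "0 \<le> 2 * \<kappa> * dens \<beta> b \<kappa> x - dens_tail \<beta> b \<kappa> x"
    proof (rule tail_nonneg_ge[OF _ _ elim])
      show "((\<lambda>x. 2 * \<kappa> * dens \<beta> b \<kappa> x - dens_tail \<beta> b \<kappa> x) \<longlongrightarrow> 0) at_top"
        using tail_dens_tail[OF assms, of \<beta> b] dens_tendsto_0[OF assms, of \<beta> b]
        by (auto simp: tail_def intro!: tendsto_eq_intros)
      fix y assume y: "y \<ge> x0"
      define r where "r = \<beta> / y + b / 2 * inverse (sqrt y) - 1 / \<kappa>"
      have "((\<lambda>x. 2 * \<kappa> * dens \<beta> b \<kappa> x - dens_tail \<beta> b \<kappa> x) has_real_derivative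
          2 * \<kappa> * (dens \<beta> b \<kappa> y * r) - (- dens \<beta> b \<kappa> y)) (at y)"
        unfolding r_def using y x0(1) assms tail_dens_tail[OF assms, of \<beta> b]
        by (intro DERIV_diff DERIV_cmult has_derivative_dens) (auto simp: tail_def)
      moreover have "2 * \<kappa> * (dens \<beta> b \<kappa> y * r) - (- dens \<beta> b \<kappa> y) \<le> 0"
      proof -
        have "r \<le> - (1 / (2 * \<kappa>))" using x0(2)[OF y] by (simp add: r_def)
        then have "2 * \<kappa> * r + 1 \<le> 0" using assms by (simp add: field_simps)
        then have "dens \<beta> b \<kappa> y * (2 * \<kappa> * r + 1) \<le> 0" using dens_nonneg by (simp add: mult_nonneg_nonpos)
        then show ?thesis by (simp add: algebra_simps)
      qed
      ultimately show "\<exists>F'. ((\<lambda>x. 2 * \<kappa> * dens \<beta> b \<kappa> x - dens_tail \<beta> b \<kappa> x) has_real_derivative F') (at y) \<and> F' \<le> 0"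
        by blast
    qed
    then show ?case by simp
  qed
qed

section \<open>Incomplete gamma integrals\<close>

lemma filterlim_inverse_sqrt: "filterlim (\<lambda>x::real. inverse (sqrt x)) (at_right 0) at_top"
  by real_asymp

lemma asy_one_plus_powr:
  "asy (\<lambda>x. (1 + m * inverse (sqrt x)) powr a) (\<lambda>k. (a gchoose k) * m ^ k)"
  unfolding asy_def
proof
  fix N
  have "((\<lambda>t. \<bar>m * t\<bar>) \<longlongrightarrow> 0) (at_right 0)" by (auto intro!: tendsto_eq_intros)
  then have "\<forall>\<^sub>F t in at_right 0. \<bar>m * t\<bar> < 1" by (rule order_tendstoD) simp
  then have "\<forall>\<^sub>F t in at_right 0. (\<lambda>k. (a gchoose k) * m ^ k * t ^ k) sums ((1 + m * t) powr a)"
    by eventually_elim (drule gen_binomial_real[where a = a], simp add: power_mult_distrib mult.assoc)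
  from power_series_remainder_bigo[OF this, of N]
  show "(\<lambda>x. (1 + m * inverse (sqrt x)) powr a - (\<Sum>l<N. (a gchoose l) * m ^ l * inverse (sqrt x) ^ l))
      \<in> O(\<lambda>x. inverse (sqrt x) ^ N)"
    by (rule landau_o.big.compose[OF _ filterlim_inverse_sqrt])
qed

text \<open>Integration by parts, verified by differentiating the boundary term
  \<open>\<kappa> * dens \<beta> 0 \<kappa>\<close>, whose derivative produces both
  densities.\<close>

lemma dens_tail_rec:
  assumes "\<kappa> > 0" "x > 0"
  shows "dens_tail \<beta> 0 \<kappa> x = \<kappa> * dens \<beta> 0 \<kappa> x + \<kappa> * \<beta> * dens_tail (\<beta> - 1) 0 \<kappa> x"
proof (rule tail_unique[OF tail_dens_tail[OF assms(1)] _ assms(2)])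
  have t: "tail (\<lambda>x. \<kappa> * \<beta> * dens (\<beta> - 1) 0 \<kappa> x) (\<lambda>x. \<kappa> * \<beta> * dens_tail (\<beta> - 1) 0 \<kappa> x)"
    by (rule tail_cmult[OF tail_dens_tail[OF assms(1)]])
  have "tail (\<lambda>x. dens \<beta> 0 \<kappa> x - \<kappa> * \<beta> * dens (\<beta> - 1) 0 \<kappa> x) (\<lambda>x. \<kappa> * dens \<beta> 0 \<kappa> x)"
    unfolding tail_def
  proof (intro conjI allI impI)
    fix x :: real assume x: "x > 0"
    have "dens (\<beta> - 1) 0 \<kappa> x = dens \<beta> 0 \<kappa> x / x" using x by (simp add: dens_def powr_diff)
    then show "((\<lambda>x. \<kappa> * dens \<beta> 0 \<kappa> x) has_real_derivative - (dens \<beta> 0 \<kappa> x - \<kappa> * \<beta> * dens (\<beta> - 1) 0 \<kappa> x)) (at x)"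
      using assms x by (intro DERIV_cong[OF DERIV_cmult[OF has_derivative_dens]]) (auto simp: field_simps)
  next
    show "((\<lambda>x. \<kappa> * dens \<beta> 0 \<kappa> x) \<longlongrightarrow> 0) at_top"
      using tendsto_mult_right_zero[OF dens_tendsto_0[OF assms(1)]] .
  qed
  from tail_add[OF this t]
  show "tail (dens \<beta> 0 \<kappa>) (\<lambda>x. \<kappa> * dens \<beta> 0 \<kappa> x + \<kappa> * \<beta> * dens_tail (\<beta> - 1) 0 \<kappa> x)"
    by simp
qed

definition tail_ratio :: "real \<Rightarrow> real \<Rightarrow> real \<Rightarrow> real \<Rightarrow> real" where
  "tail_ratio \<beta> b \<kappa> x = dens_tail \<beta> b \<kappa> x / (\<kappa> * dens \<beta> b \<kappa> x)"

lemma tail_ratio_bigo_1: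
  assumes "\<kappa> > 0"
  shows "tail_ratio \<beta> b \<kappa> \<in> O(\<lambda>_. 1)"
proof (rule bigoI[of _ 2])
  show "\<forall>\<^sub>F x in at_top. norm (tail_ratio \<beta> b \<kappa> x) \<le> 2 * norm (1::real)"
    using dens_tail_le[OF assms, of \<beta> b] eventually_gt_at_top[of 0]
  proof eventually_elim
    case (elim x)
    then show ?case using dens_tail_nonneg[OF assms, of x \<beta> b] dens_pos[of x \<beta> b \<kappa>] assms
      by (simp add: tail_ratio_def abs_mult divide_le_eq)
  qed
qed

text \<open>Iterated integration by parts: each step lowers \<beta> by 1 and brings out the factor
  \<kappa> \<beta> / x. The product (-1)^j (- \<beta>)_j is the falling factorial \<beta> (\<beta> -
  1) ... (\<beta> - j + 1).\<close>

lemma tail_ratio_zero_expansion: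
  assumes \<kappa>: "\<kappa> > 0"
  shows "(\<lambda>x. tail_ratio \<beta> 0 \<kappa> x - (\<Sum>j<N. (- 1) ^ j * pochhammer (- \<beta>) j * \<kappa> ^ j * inverse x ^ j))
    \<in> O(\<lambda>x. inverse x ^ N)"
proof (induction N arbitrary: \<beta>)
  case 0
  show ?case using tail_ratio_bigo_1[OF \<kappa>, of \<beta> 0] by simp
next
  case (Suc N)
  let ?c = "\<lambda>\<beta> j. (- 1) ^ j * pochhammer (- \<beta>) j * \<kappa> ^ j"
  obtain C where C: "\<forall>\<^sub>F x in at_top. norm (tail_ratio (\<beta> - 1) 0 \<kappa> x - (\<Sum>j<N. ?c (\<beta> - 1) j * inverse x ^ j))
      \<le> C * norm (inverse x ^ N)"
    using Suc.IH[of "\<beta> - 1"] by (rule landau_o.bigE)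
  show ?case
  proof (rule bigoI[of _ "\<bar>\<kappa> * \<beta>\<bar> * C"])
    show "\<forall>\<^sub>F x in at_top. norm (tail_ratio \<beta> 0 \<kappa> x - (\<Sum>j<Suc N. ?c \<beta> j * inverse x ^ j))
        \<le> \<bar>\<kappa> * \<beta>\<bar> * C * norm (inverse x ^ Suc N)"
      using C eventually_gt_at_top[of 0]
    proof eventually_elim
      case (elim x)
      have "dens (\<beta> - 1) 0 \<kappa> x = dens \<beta> 0 \<kappa> x * inverse x" using elim by (simp add: dens_def powr_diff divide_inverse)
      then have 1: "tail_ratio \<beta> 0 \<kappa> x = 1 + \<kappa> * \<beta> * inverse x * tail_ratio (\<beta> - 1) 0 \<kappa> x"
        using dens_tail_rec[OF \<kappa>, of x \<beta>] dens_pos[of x \<beta> 0 \<kappa>] elim \<kappa>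
        by (simp add: tail_ratio_def field_simps)
      have 2: "?c \<beta> (Suc j) * inverse x ^ Suc j = \<kappa> * \<beta> * inverse x * (?c (\<beta> - 1) j * inverse x ^ j)" for j
        by (simp add: pochhammer_rec[of "- \<beta>"])
      have "(\<Sum>j<Suc N. ?c \<beta> j * inverse x ^ j) = 1 + \<kappa> * \<beta> * inverse x * (\<Sum>j<N. ?c (\<beta> - 1) j * inverse x ^ j)"
        unfolding sum.lessThan_Suc_shift 2 by (simp add: sum_distrib_left)
      then have "tail_ratio \<beta> 0 \<kappa> x - (\<Sum>j<Suc N. ?c \<beta> j * inverse x ^ j)
          = \<kappa> * \<beta> * inverse x * (tail_ratio (\<beta> - 1) 0 \<kappa> x - (\<Sum>j<N. ?c (\<beta> - 1) j * inverse x ^ j))"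
        unfolding 1 by (simp only: right_diff_distrib add_diff_cancel_left)
      also have "norm \<dots> = \<bar>\<kappa> * \<beta>\<bar> * inverse x * norm (tail_ratio (\<beta> - 1) 0 \<kappa> x - (\<Sum>j<N. ?c (\<beta> - 1) j * inverse x ^ j))"
        using elim by (simp add: abs_mult)
      also have "\<dots> \<le> \<bar>\<kappa> * \<beta>\<bar> * inverse x * (C * norm (inverse x ^ N))"
        using elim by (intro mult_left_mono) auto
      finally show ?case using elim by (simp add: mult_ac abs_mult)
    qed
  qed
qed

section \<open>The tail of the model density after completing the square\<close>

lemma sum_even_reindex:
  "(\<Sum>k<N. if even k then f (k div 2) else 0) = (\<Sum>j<(N + 1) div 2. f j)"
  for f :: "nat \<Rightarrow> 'a :: comm_monoid_add"
proof (induction N)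
  case (Suc N)
  show ?case
  proof (cases "even N")
    case True
    then have "(Suc N + 1) div 2 = Suc ((N + 1) div 2)" "(N + 1) div 2 = N div 2" by presburger+
    with Suc True show ?thesis by simp
  next
    case False
    then have "(Suc N + 1) div 2 = (N + 1) div 2" by presburger
    with Suc False show ?thesis by simp
  qed
qed simp

text \<open>With v = (sqrt x - m)^2 one has v^(-j) = x^(-j) (1 - m / sqrt x)^(-2 j). The index r = 2
  j counts half powers of x, so odd r contribute nothing; the remaining factors come from the
  binomial series of (1 - m / sqrt x) powr (2 \<beta> - r).\<close>

definition shift_coeff :: "real \<Rightarrow> real \<Rightarrow> real \<Rightarrow> nat \<Rightarrow> real" where
  "shift_coeff \<beta> m \<kappa> p = (\<Sum>r\<le>p. (if even r then (- 1) ^ (r div 2) * pochhammer (- \<beta>) (r div 2) * \<kappa> ^ (r div 2) else 0)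
      * ((2 * \<beta> - real r) gchoose (p - r)) * (- m) ^ (p - r))"

lemma asy_tail_ratio_shifted:
  assumes \<kappa>: "\<kappa> > 0"
  shows "asy (\<lambda>x. tail_ratio \<beta> 0 \<kappa> ((sqrt x - m)\<^sup>2) * (1 - m * inverse (sqrt x)) powr (2 * \<beta>)) (shift_coeff \<beta> m \<kappa>)"
proof -
  define c where "c = (\<lambda>j::nat. (- 1) ^ j * pochhammer (- \<beta>) j * \<kappa> ^ j)"
  have F: "asy (\<lambda>x. (if even r then c (r div 2) else 0) * (1 - m * inverse (sqrt x)) powr (2 * \<beta> - real r))
      (\<lambda>i. (if even r then c (r div 2) else 0) * (((2 * \<beta> - real r) gchoose i) * (- m) ^ i))" for r
    using asy_cmult[OF asy_one_plus_powr[of "- m" "2 * \<beta> - real r"]] by simp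
  have "asy (\<lambda>x. tail_ratio \<beta> 0 \<kappa> ((sqrt x - m)\<^sup>2) * (1 - m * inverse (sqrt x)) powr (2 * \<beta>))
     (\<lambda>p. \<Sum>r\<le>p. (if even r then c (r div 2) else 0) * (((2 * \<beta> - real r) gchoose (p - r)) * (- m) ^ (p - r)))"
  proof (rule asy_diagonal[OF _ F])
    fix N :: nat
    \<comment> \<open>The number of even indices below N, that is, the least J with 2 J \<ge> N. An
      error of order J in 1 / v is therefore of order N in 1 / sqrt x.\<close>
    define J where "J = (N + 1) div 2"
    have V: "filterlim (\<lambda>x. (sqrt x - m)\<^sup>2) at_top at_top" by real_asymp
    obtain C where C: "C > 0" "\<forall>\<^sub>F x in at_top. norm (tail_ratio \<beta> 0 \<kappa> x - (\<Sum>j<J. c j * inverse x ^ j)) \<le> C * norm (inverse x ^ J)"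
      using tail_ratio_zero_expansion[OF \<kappa>, of \<beta> J] unfolding c_def by (rule landau_o.bigE)
    have C': "\<forall>\<^sub>F x in at_top. norm (tail_ratio \<beta> 0 \<kappa> ((sqrt x - m)\<^sup>2) - (\<Sum>j<J. c j * inverse ((sqrt x - m)\<^sup>2) ^ j))
        \<le> C * norm (inverse ((sqrt x - m)\<^sup>2) ^ J)"
      using eventually_compose_filterlim[OF C(2) V] .
    have lim: "((\<lambda>x. 1 - m * inverse (sqrt x)) \<longlongrightarrow> 1) at_top" by real_asymp
    have "\<forall>\<^sub>F x in at_top. 1 - m * inverse (sqrt x) > 0" by (rule order_tendstoD[OF lim]) simp
    obtain D where D: "D > 0" "\<forall>\<^sub>F x in at_top. norm ((1 - m * inverse (sqrt x)) powr (2 * \<beta> - real (2 * J))) \<le> D * norm (1::real)"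
      using asy_bounded[OF asy_one_plus_powr[of "- m" "2 * \<beta> - real (2 * J)"]] by (rule landau_o.bigE) simp
    show "(\<lambda>x. tail_ratio \<beta> 0 \<kappa> ((sqrt x - m)\<^sup>2) * (1 - m * inverse (sqrt x)) powr (2 * \<beta>) -
        (\<Sum>k<N. (if even k then c (k div 2) else 0) * (1 - m * inverse (sqrt x)) powr (2 * \<beta> - real k) * inverse (sqrt x) ^ k))
        \<in> O(\<lambda>x. inverse (sqrt x) ^ N)"
    proof (rule bigoI[of _ "C * D"])
      show "\<forall>\<^sub>F x in at_top. norm (tail_ratio \<beta> 0 \<kappa> ((sqrt x - m)\<^sup>2) * (1 - m * inverse (sqrt x)) powr (2 * \<beta>) -
        (\<Sum>k<N. (if even k then c (k div 2) else 0) * (1 - m * inverse (sqrt x)) powr (2 * \<beta> - real k) * inverse (sqrt x) ^ k))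
        \<le> C * D * norm (inverse (sqrt x) ^ N)"
        using C' D(2) \<open>\<forall>\<^sub>F x in at_top. 1 - m * inverse (sqrt x) > 0\<close> eventually_ge_at_top[of 1]
      proof eventually_elim
        case (elim x)
        define t where "t = inverse (sqrt x)"
        define u where "u = 1 - m * t"
        have t: "0 < t" "t \<le> 1" using elim by (auto simp: t_def inverse_le_1_iff)
        have u: "u > 0" using elim by (simp add: u_def t_def)
        have "sqrt x - m = u / t" using t elim by (simp add: u_def t_def field_simps)
        then have V: "inverse ((sqrt x - m)\<^sup>2) = t\<^sup>2 / u\<^sup>2" by (simp add: power_divide)
        have pw: "u powr (2 * \<beta>) * (t\<^sup>2 / u\<^sup>2) ^ j = u powr (2 * \<beta> - real (2 * j)) * t ^ (2 * j)" for j
        proof -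
          have "u powr (2 * \<beta> - real (2 * j)) = u powr (2 * \<beta>) / u ^ (2 * j)"
            using u by (simp only: powr_diff powr_realpow)
          then show ?thesis by (simp add: power_divide power_mult)
        qed
        let ?r = "tail_ratio \<beta> 0 \<kappa> ((sqrt x - m)\<^sup>2)"
        have "(\<Sum>k<N. (if even k then c (k div 2) else 0) * u powr (2 * \<beta> - real k) * t ^ k)
            = (\<Sum>k<N. if even k then c (k div 2) * u powr (2 * \<beta> - real (2 * (k div 2))) * t ^ (2 * (k div 2)) else 0)"
          by (intro sum.cong) auto
        also have "\<dots> = (\<Sum>j<J. c j * u powr (2 * \<beta> - real (2 * j)) * t ^ (2 * j))"
          unfolding J_def by (rule sum_even_reindex)
        also have "\<dots> = u powr (2 * \<beta>) * (\<Sum>j<J. c j * (t\<^sup>2 / u\<^sup>2) ^ j)"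
          unfolding sum_distrib_left using pw by (intro sum.cong) (auto simp: mult_ac)
        finally have "?r * u powr (2 * \<beta>) - (\<Sum>k<N. (if even k then c (k div 2) else 0) * u powr (2 * \<beta> - real k) * t ^ k)
            = u powr (2 * \<beta>) * (?r - (\<Sum>j<J. c j * (t\<^sup>2 / u\<^sup>2) ^ j))"
          by (simp add: algebra_simps)
        also have "norm \<dots> \<le> u powr (2 * \<beta>) * (C * (t\<^sup>2 / u\<^sup>2) ^ J)"
          using elim(1) unfolding V by (simp add: abs_mult mult_left_mono)
        also have "\<dots> = C * (u powr (2 * \<beta> - real (2 * J)) * t ^ (2 * J))"
          using pw[of J] by (simp add: mult_ac)
        also have "\<dots> \<le> C * (D * t ^ N)"
        proof (intro mult_left_mono mult_mono)
          show "t ^ (2 * J) \<le> t ^ N" using t by (intro power_decreasing) (auto simp: J_def)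
        qed (use elim(2) C D t in \<open>auto simp: u_def t_def\<close>)
        finally show ?case using t by (simp add: u_def t_def mult.assoc)
      qed
    qed
  qed
  then show ?thesis unfolding c_def shift_coeff_def[abs_def] mult.assoc .
qed

text \<open>The index k runs over the binomial series of (1 + m / sqrt v) powr (2 \<beta> + 1),
  whose k-th term lowers \<beta> by k / 2 in the variable v; \<open>shift_coeff\<close> then returns
  from v to x.\<close>

definition tail_coeff :: "real \<Rightarrow> real \<Rightarrow> real \<Rightarrow> nat \<Rightarrow> real" where
  "tail_coeff \<beta> m \<kappa> p = (\<Sum>k\<le>p. ((2 * \<beta> + 1) gchoose k) * m ^ k * shift_coeff (\<beta> - real k / 2) m \<kappa> (p - k))"

text \<open>In the exponent 2 \<beta> + 1, the part 2 \<beta> comes from the power and the 1 from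
  the Jacobian dt/dv = 1 + m / sqrt v. Since b = 2 m / \<kappa>, completing the square leaves the
  constant m^2 / \<kappa>, which the exponential in front cancels. As a statement on
  \<open>tail\<close> the change of variables is the chain rule.\<close>

lemma tail_dens_substituted:
  assumes \<kappa>: "\<kappa> > 0" and m: "m \<ge> 0"
  shows "tail (\<lambda>v. dens \<beta> 0 \<kappa> v * (1 + m * inverse (sqrt v)) powr (2 * \<beta> + 1))
    (\<lambda>v. exp (- (m\<^sup>2 / \<kappa>)) * dens_tail \<beta> (2 * m / \<kappa>) \<kappa> ((sqrt v + m)\<^sup>2))"
  unfolding tail_def
proof (intro conjI allI impI)
  fix v :: real assume v: "v > 0"
  define w where "w = sqrt v"
  have w: "w > 0" "v = w\<^sup>2" using v by (auto simp: w_def)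
  have wm: "w + m > 0" using w m by simp
  have T: "(dens_tail \<beta> (2 * m / \<kappa>) \<kappa> has_real_derivative - dens \<beta> (2 * m / \<kappa>) \<kappa> y) (at y)" if "y > 0" for y
    using tail_dens_tail[OF \<kappa>] that by (auto simp: tail_def)
  have "((\<lambda>v. (sqrt v + m)\<^sup>2) has_real_derivative (w + m) / w) (at v)"
    using v w(1) by (auto intro!: derivative_eq_intros simp: w_def[symmetric] field_simps)
  moreover have "(dens_tail \<beta> (2 * m / \<kappa>) \<kappa> has_real_derivative - dens \<beta> (2 * m / \<kappa>) \<kappa> ((w + m)\<^sup>2)) (at ((\<lambda>v. (sqrt v + m)\<^sup>2) v))"
    using T[of "(w + m)\<^sup>2"] wm by (simp add: w_def)
  ultimately have "((\<lambda>v. exp (- (m\<^sup>2 / \<kappa>)) * dens_tail \<beta> (2 * m / \<kappa>) \<kappa> ((sqrt v + m)\<^sup>2)) has_real_derivative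
      exp (- (m\<^sup>2 / \<kappa>)) * (- dens \<beta> (2 * m / \<kappa>) \<kappa> ((w + m)\<^sup>2) * ((w + m) / w))) (at v)"
    by (intro DERIV_cmult DERIV_chain2)
  also have "exp (- (m\<^sup>2 / \<kappa>)) * (- dens \<beta> (2 * m / \<kappa>) \<kappa> ((w + m)\<^sup>2) * ((w + m) / w)) =
      - (dens \<beta> 0 \<kappa> v * (1 + m * inverse (sqrt v)) powr (2 * \<beta> + 1))"
  proof -
    have e: "exp (- (m\<^sup>2 / \<kappa>)) * exp (2 * m / \<kappa> * (w + m) - (w + m)\<^sup>2 / \<kappa>) = exp (- (v / \<kappa>))"
      using \<kappa> unfolding w(2) by (simp add: field_simps power2_eq_square flip: exp_add)
    have f: "1 + m * inverse (sqrt v) = (w + m) / w" using w by (simp add: w_def[symmetric] field_simps)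
    have p1: "((w + m)\<^sup>2) powr \<beta> = (w + m) powr (2 * \<beta>)" and p2: "v powr \<beta> = w powr (2 * \<beta>)"
      using w wm by (simp_all add: powr_powr flip: powr_numeral)
    have p3: "((w + m) / w) powr (2 * \<beta> + 1) = (w + m) powr (2 * \<beta>) / w powr (2 * \<beta>) * ((w + m) / w)"
      using w wm by (simp add: powr_add powr_divide)
    have "dens \<beta> (2 * m / \<kappa>) \<kappa> ((w + m)\<^sup>2) = (w + m) powr (2 * \<beta>) * exp (2 * m / \<kappa> * (w + m) - (w + m)\<^sup>2 / \<kappa>)"
      using wm by (simp add: dens_def p1)
    then have "exp (- (m\<^sup>2 / \<kappa>)) * (- dens \<beta> (2 * m / \<kappa>) \<kappa> ((w + m)\<^sup>2) * ((w + m) / w)) =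
        - ((w + m) powr (2 * \<beta>) * exp (- (v / \<kappa>)) * ((w + m) / w))"
      unfolding e[symmetric] by (simp only: mult_ac mult_minus_left mult_minus_right)
    also have "\<dots> = - (dens \<beta> 0 \<kappa> v * (1 + m * inverse (sqrt v)) powr (2 * \<beta> + 1))"
      unfolding f p3 dens_def p2 using w by simp
    finally show ?thesis .
  qed
  finally show "((\<lambda>v. exp (- (m\<^sup>2 / \<kappa>)) * dens_tail \<beta> (2 * m / \<kappa>) \<kappa> ((sqrt v + m)\<^sup>2)) has_real_derivative
      - (dens \<beta> 0 \<kappa> v * (1 + m * inverse (sqrt v)) powr (2 * \<beta> + 1))) (at v)" .
next
  have "filterlim (\<lambda>v. (sqrt v + m)\<^sup>2) at_top at_top" by real_asymp
  from filterlim_compose[OF _ this, of "dens_tail \<beta> (2 * m / \<kappa>) \<kappa>" "nhds 0"]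
  have "((\<lambda>v. dens_tail \<beta> (2 * m / \<kappa>) \<kappa> ((sqrt v + m)\<^sup>2)) \<longlongrightarrow> 0) at_top"
    using tail_dens_tail[OF \<kappa>, of \<beta> "2 * m / \<kappa>"] by (simp add: tail_def)
  then show "((\<lambda>v. exp (- (m\<^sup>2 / \<kappa>)) * dens_tail \<beta> (2 * m / \<kappa>) \<kappa> ((sqrt v + m)\<^sup>2)) \<longlongrightarrow> 0) at_top"
    by (rule tendsto_mult_right_zero)
qed

lemma asy_tail_ratio:
  assumes \<kappa>: "\<kappa> > 0" and m: "m \<ge> 0"
  shows "asy (tail_ratio \<beta> (2 * m / \<kappa>) \<kappa>) (tail_coeff \<beta> m \<kappa>)"
proof -
  let ?B = "\<lambda>k. (2 * \<beta> + 1) gchoose k"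
  let ?\<psi> = "\<lambda>\<beta> x. tail_ratio \<beta> 0 \<kappa> ((sqrt x - m)\<^sup>2) * (1 - m * inverse (sqrt x)) powr (2 * \<beta>)"
  have "asy (tail_ratio \<beta> (2 * m / \<kappa>) \<kappa>) (\<lambda>p. \<Sum>k\<le>p. ?B k * m ^ k * shift_coeff (\<beta> - real k / 2) m \<kappa> (p - k))"
  proof (rule asy_diagonal[OF _ asy_cmult[OF asy_tail_ratio_shifted[OF \<kappa>]]])
    fix N :: nat
    obtain C where C: "C > 0" "\<forall>\<^sub>F v in at_top. norm ((1 + m * inverse (sqrt v)) powr (2 * \<beta> + 1) - (\<Sum>k<N. ?B k * m ^ k * inverse (sqrt v) ^ k))
        \<le> C * norm (inverse (sqrt v) ^ N)"
      using asyD[OF asy_one_plus_powr[of m "2 * \<beta> + 1"], of N] by (rule landau_o.bigE)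
    have "\<forall>\<^sub>F v in at_top. norm ((1 + m * inverse (sqrt v)) powr (2 * \<beta> + 1) - (\<Sum>k<N. ?B k * m ^ k * inverse (sqrt v) ^ k))
        \<le> C * norm (inverse (sqrt v) ^ N) \<and> dens_tail (\<beta> - real N / 2) 0 \<kappa> v \<le> 2 * \<kappa> * dens (\<beta> - real N / 2) 0 \<kappa> v"
      using C(2) dens_tail_le[OF \<kappa>] by eventually_elim blast
    then obtain v0 where v0: "v0 \<ge> 1" "\<And>v. v \<ge> v0 \<Longrightarrow> norm ((1 + m * inverse (sqrt v)) powr (2 * \<beta> + 1) - (\<Sum>k<N. ?B k * m ^ k * inverse (sqrt v) ^ k))
        \<le> C * norm (inverse (sqrt v) ^ N) \<and> dens_tail (\<beta> - real N / 2) 0 \<kappa> v \<le> 2 * \<kappa> * dens (\<beta> - real N / 2) 0 \<kappa> v"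
      by (rule eventually_at_top_ge_oneE) blast
    have T1: "tail (\<lambda>v. dens \<beta> 0 \<kappa> v * (1 + m * inverse (sqrt v)) powr (2 * \<beta> + 1) - (\<Sum>k<N. ?B k * m ^ k * dens (\<beta> - real k / 2) 0 \<kappa> v))
       (\<lambda>v. exp (- (m\<^sup>2 / \<kappa>)) * dens_tail \<beta> (2 * m / \<kappa>) \<kappa> ((sqrt v + m)\<^sup>2) - (\<Sum>k<N. ?B k * m ^ k * dens_tail (\<beta> - real k / 2) 0 \<kappa> v))"
      by (intro tail_diff tail_sum tail_cmult tail_dens_tail tail_dens_substituted \<kappa> m)
    have T2: "tail (\<lambda>v. C * dens (\<beta> - real N / 2) 0 \<kappa> v) (\<lambda>v. C * dens_tail (\<beta> - real N / 2) 0 \<kappa> v)"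
      by (intro tail_cmult tail_dens_tail \<kappa>)
    \<comment> \<open>The error of the truncated binomial series is carried from densities to tails
      by \<open>tail_le\<close>, and the tail of the error is then bounded by its density. All of
      this happens in the variable v.\<close>
    have K: "\<bar>exp (- (m\<^sup>2 / \<kappa>)) * dens_tail \<beta> (2 * m / \<kappa>) \<kappa> ((sqrt v + m)\<^sup>2) - (\<Sum>k<N. ?B k * m ^ k * dens_tail (\<beta> - real k / 2) 0 \<kappa> v)\<bar>
        \<le> C * (2 * \<kappa> * dens (\<beta> - real N / 2) 0 \<kappa> v)" if v: "v \<ge> v0" for v
    proof -
      have "\<bar>exp (- (m\<^sup>2 / \<kappa>)) * dens_tail \<beta> (2 * m / \<kappa>) \<kappa> ((sqrt v + m)\<^sup>2) - (\<Sum>k<N. ?B k * m ^ k * dens_tail (\<beta> - real k / 2) 0 \<kappa> v)\<bar>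
        \<le> C * dens_tail (\<beta> - real N / 2) 0 \<kappa> v"
      proof (rule tail_le[OF T1 T2 _ v])
        fix y assume y: "y \<ge> v0"
        then have y0: "y > 0" using v0(1) by simp
        have "dens \<beta> 0 \<kappa> y * (1 + m * inverse (sqrt y)) powr (2 * \<beta> + 1) - (\<Sum>k<N. ?B k * m ^ k * dens (\<beta> - real k / 2) 0 \<kappa> y)
          = dens \<beta> 0 \<kappa> y * ((1 + m * inverse (sqrt y)) powr (2 * \<beta> + 1) - (\<Sum>k<N. ?B k * m ^ k * inverse (sqrt y) ^ k))"
          unfolding dens_shift[OF y0] right_diff_distrib sum_distrib_left by (simp only: mult_ac)
        also have "\<bar>\<dots>\<bar> \<le> dens \<beta> 0 \<kappa> y * (C * norm (inverse (sqrt y) ^ N))"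
          unfolding abs_mult using v0(2)[OF y] dens_nonneg[of \<beta> 0 \<kappa> y] by (intro mult_mono) auto
        also have "\<dots> = C * dens (\<beta> - real N / 2) 0 \<kappa> y"
          unfolding dens_shift[OF y0] using y0 by simp
        finally show "\<bar>dens \<beta> 0 \<kappa> y * (1 + m * inverse (sqrt y)) powr (2 * \<beta> + 1) - (\<Sum>k<N. ?B k * m ^ k * dens (\<beta> - real k / 2) 0 \<kappa> y)\<bar>
            \<le> C * dens (\<beta> - real N / 2) 0 \<kappa> y" .
      qed (use v0 v in auto)
      also have "\<dots> \<le> C * (2 * \<kappa> * dens (\<beta> - real N / 2) 0 \<kappa> v)"
        using v0(2)[OF v] C by (intro mult_left_mono) auto
      finally show ?thesis .
    qed
    obtain D where D: "D > 0" "\<forall>\<^sub>F x in at_top. norm ((1 - m * inverse (sqrt x)) powr (2 * \<beta> - real N)) \<le> D * norm (1::real)"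
      using asy_bounded[OF asy_one_plus_powr[of "- m" "2 * \<beta> - real N"]] by (rule landau_o.bigE) simp
    have V: "filterlim (\<lambda>x. (sqrt x - m)\<^sup>2) at_top at_top" by real_asymp
    then have V': "\<forall>\<^sub>F x in at_top. (sqrt x - m)\<^sup>2 \<ge> v0" by (simp add: filterlim_at_top)
    have lim: "((\<lambda>x. 1 - m * inverse (sqrt x)) \<longlongrightarrow> 1) at_top" by real_asymp
    have U: "\<forall>\<^sub>F x in at_top. 1 - m * inverse (sqrt x) > 0" by (rule order_tendstoD[OF lim]) simp
    show "(\<lambda>x. tail_ratio \<beta> (2 * m / \<kappa>) \<kappa> x - (\<Sum>k<N. ?B k * m ^ k * ?\<psi> (\<beta> - real k / 2) x * inverse (sqrt x) ^ k))
        \<in> O(\<lambda>x. inverse (sqrt x) ^ N)"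
    proof (rule bigoI[of _ "2 * C * D"])
      show "\<forall>\<^sub>F x in at_top. norm (tail_ratio \<beta> (2 * m / \<kappa>) \<kappa> x - (\<Sum>k<N. ?B k * m ^ k * ?\<psi> (\<beta> - real k / 2) x * inverse (sqrt x) ^ k))
        \<le> 2 * C * D * norm (inverse (sqrt x) ^ N)"
        using D(2) V' U eventually_ge_at_top[of 1]
      proof eventually_elim
        case (elim x)
        define t where "t = inverse (sqrt x)"
        define u where "u = 1 - m * t"
        define v where "v = (sqrt x - m)\<^sup>2"
        have t: "0 < t" "t \<le> 1" using elim by (auto simp: t_def inverse_le_1_iff)
        have u: "u > 0" using elim by (simp add: u_def t_def)
        have sx: "sqrt x - m = u / t" using t elim by (simp add: u_def t_def field_simps)
        then have sxm: "sqrt x - m > 0" using u t by simp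
        have vm: "(sqrt v + m)\<^sup>2 = x" using sxm elim by (simp add: v_def)
        have v0': "v > 0" using sxm by (simp add: v_def)
        \<comment> \<open>A common denominator for all ratios: times exp (m^2 / \<kappa>) it is the
          denominator of the tail ratio at x, and times u powr (2 \<beta> - k) t^k it is the one at
          v for the exponent \<beta> - k / 2.\<close>
        define E where "E = \<kappa> * (x powr \<beta> * exp (- (v / \<kappa>)))"
        have E: "E > 0" using \<kappa> elim by (simp add: E_def)
        have d: "dens (\<beta> - real k / 2) 0 \<kappa> v * \<kappa> = E * (u powr (2 * \<beta> - real k) * t ^ k)" for k
        proof -
          have xt: "x = (1 / t)\<^sup>2" using elim by (simp add: t_def inverse_eq_divide)
          have "v powr (\<beta> - real k / 2) = (u / t) powr (2 * \<beta> - real k)"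
            using u t unfolding v_def sx by (simp add: powr_powr right_diff_distrib flip: powr_numeral)
          also have "\<dots> = u powr (2 * \<beta> - real k) * (1 / t) powr (2 * \<beta> - real k)"
            using u t by (simp flip: powr_mult)
          also have "(1 / t) powr (2 * \<beta> - real k) = (1 / t) powr (2 * \<beta>) / (1 / t) ^ k"
            using t by (simp only: powr_diff powr_realpow zero_less_divide_1_iff)
          also have "(1 / t) powr (2 * \<beta>) = x powr \<beta>"
            unfolding xt using t by (simp add: powr_powr flip: powr_numeral)
          finally show ?thesis by (simp add: dens_def E_def power_divide mult_ac)
        qed
        have d0: "exp (m\<^sup>2 / \<kappa>) * E = \<kappa> * dens \<beta> (2 * m / \<kappa>) \<kappa> x"
        proof -
          have "x = (sqrt x)\<^sup>2" using elim by simp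
          then have "m\<^sup>2 / \<kappa> + - (v / \<kappa>) = 2 * m / \<kappa> * sqrt x - x / \<kappa>"
            using \<kappa> unfolding v_def by (simp add: field_simps power2_eq_square)
          then have "exp (m\<^sup>2 / \<kappa>) * exp (- (v / \<kappa>)) = exp (2 * m / \<kappa> * sqrt x - x / \<kappa>)"
            by (simp only: exp_add[symmetric])
          then show ?thesis unfolding E_def dens_def by (simp only: mult.left_commute)
        qed
        have r0: "tail_ratio \<beta> (2 * m / \<kappa>) \<kappa> x = exp (- (m\<^sup>2 / \<kappa>)) * dens_tail \<beta> (2 * m / \<kappa>) \<kappa> x / E"
          unfolding tail_ratio_def d0[symmetric] by (simp add: exp_minus divide_simps)
        have rk: "?\<psi> (\<beta> - real k / 2) x * t ^ k = dens_tail (\<beta> - real k / 2) 0 \<kappa> v / E" for k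
        proof -
          have "\<kappa> * dens (\<beta> - real k / 2) 0 \<kappa> v = E * (u powr (2 * \<beta> - real k) * t ^ k)" using d by (simp add: mult.commute)
          then have "tail_ratio (\<beta> - real k / 2) 0 \<kappa> v = dens_tail (\<beta> - real k / 2) 0 \<kappa> v / (E * (u powr (2 * \<beta> - real k) * t ^ k))"
            by (simp add: tail_ratio_def)
          moreover have "u powr (2 * \<beta> - real k) * t ^ k > 0" using u t by simp
          ultimately show ?thesis using E u t
            by (simp add: v_def[symmetric] u_def[symmetric] t_def[symmetric] right_diff_distrib)
        qed
        have "tail_ratio \<beta> (2 * m / \<kappa>) \<kappa> x - (\<Sum>k<N. ?B k * m ^ k * ?\<psi> (\<beta> - real k / 2) x * t ^ k)
          = (exp (- (m\<^sup>2 / \<kappa>)) * dens_tail \<beta> (2 * m / \<kappa>) \<kappa> ((sqrt v + m)\<^sup>2) - (\<Sum>k<N. ?B k * m ^ k * dens_tail (\<beta> - real k / 2) 0 \<kappa> v)) / E"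
        proof -
          have "?B k * m ^ k * ?\<psi> (\<beta> - real k / 2) x * t ^ k = ?B k * m ^ k * dens_tail (\<beta> - real k / 2) 0 \<kappa> v / E" for k
            using rk[of k] by (simp only: mult.assoc times_divide_eq_right)
          then show ?thesis unfolding r0 vm diff_divide_distrib sum_divide_distrib by (simp only:)
        qed
        also have "norm \<dots> \<le> C * (2 * \<kappa> * dens (\<beta> - real N / 2) 0 \<kappa> v) / E"
          using K[of v] elim(2) E by (simp add: v_def divide_right_mono)
        also have "C * (2 * \<kappa> * dens (\<beta> - real N / 2) 0 \<kappa> v) = C * (2 * (dens (\<beta> - real N / 2) 0 \<kappa> v * \<kappa>))"
          by (simp only: mult_ac)
        also have "\<dots> / E = 2 * C * (u powr (2 * \<beta> - real N) * t ^ N)"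
          unfolding d using E by simp
        also have "\<dots> \<le> 2 * C * (D * t ^ N)"
          using elim(1) C D t by (intro mult_left_mono mult_right_mono) (auto simp: u_def t_def)
        finally show ?case using t by (simp add: t_def mult.assoc)
      qed
    qed
  qed
  then show ?thesis by (simp add: tail_coeff_def[abs_def])
qed

section \<open>Tail integrals of the model density times an expandable factor\<close>

lemma set_integral_dens:
  assumes \<kappa>: "\<kappa> > 0" and x: "x > 0"
  shows "set_integrable lborel {x..} (dens \<beta> b \<kappa>)"
    and "set_lebesgue_integral lborel {x..} (dens \<beta> b \<kappa>) = dens_tail \<beta> b \<kappa> x"
proof -
  have "(\<integral>\<^sup>+y. ennreal (dens \<beta> b \<kappa> y) * indicator {x..} y \<partial>lborel) = 0 - (- dens_tail \<beta> b \<kappa> x)"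
  proof (rule nn_integral_FTC_atLeast)
    fix y assume "x \<le> y"
    then show "((\<lambda>y. - dens_tail \<beta> b \<kappa> y) has_real_derivative dens \<beta> b \<kappa> y) (at y)"
      using tail_dens_tail[OF \<kappa>, of \<beta> b] x DERIV_minus[of "dens_tail \<beta> b \<kappa>" "- dens \<beta> b \<kappa> y" y UNIV] by (auto simp: tail_def)
  next
    show "((\<lambda>y. - dens_tail \<beta> b \<kappa> y) \<longlongrightarrow> 0) at_top"
      using tail_dens_tail[OF \<kappa>, of \<beta> b] tendsto_minus[of "dens_tail \<beta> b \<kappa>" 0 at_top] by (simp add: tail_def)
  qed (auto simp: dens_nonneg)
  then have *: "(\<integral>\<^sup>+y. ennreal (indicator {x..} y *\<^sub>R dens \<beta> b \<kappa> y) \<partial>lborel) = ennreal (dens_tail \<beta> b \<kappa> x)"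
    by (simp add: ennreal_mult' ennreal_indicator dens_nonneg mult.commute)
  have "has_bochner_integral lborel (\<lambda>y. indicator {x..} y *\<^sub>R dens \<beta> b \<kappa> y) (dens_tail \<beta> b \<kappa> x)"
    by (rule has_bochner_integral_nn_integral[OF _ _ _ *]) (auto simp: dens_nonneg dens_tail_nonneg[OF \<kappa> x])
  then show "set_integrable lborel {x..} (dens \<beta> b \<kappa>)"
    "set_lebesgue_integral lborel {x..} (dens \<beta> b \<kappa>) = dens_tail \<beta> b \<kappa> x"
    by (auto simp: set_integrable_def set_lebesgue_integral_def has_bochner_integral_iff)
qed

lemma tail_ratio_shift:
  assumes "x > 0" "\<kappa> > 0"
  shows "dens_tail (\<beta> - real k / 2) b \<kappa> x / (\<kappa> * dens \<beta> b \<kappa> x) = tail_ratio (\<beta> - real k / 2) b \<kappa> x * inverse (sqrt x) ^ k"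
  unfolding tail_ratio_def dens_shift[OF assms(1)] using assms dens_pos[of x \<beta> b \<kappa>] by (simp add: field_simps)

text \<open>Termwise integration: a power y powr (- l / 2) from the expansion of B is absorbed into
  the exponent \<beta> - l / 2 of the model density, whose tail is already expanded. Since
  \<open>asy\<close> controls B only near infinity, integrability is claimed only for large
  x.\<close>

lemma asy_set_integral_dens:
  assumes \<kappa>: "\<kappa> > 0" and m: "m \<ge> 0" and B: "asy B c" and [measurable]: "B \<in> borel_measurable borel"
  shows "asy (\<lambda>x. (LBINT y:{x..}. dens \<beta> (2 * m / \<kappa>) \<kappa> y * B y) / (\<kappa> * dens \<beta> (2 * m / \<kappa>) \<kappa> x))
    (\<lambda>p. \<Sum>l\<le>p. c l * tail_coeff (\<beta> - real l / 2) m \<kappa> (p - l))"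
    and "\<forall>\<^sub>F x in at_top. set_integrable lborel {x..} (\<lambda>y. dens \<beta> (2 * m / \<kappa>) \<kappa> y * B y)"
proof -
  define b where "b = 2 * m / \<kappa>"
  obtain C0 where C0: "C0 > 0" "\<forall>\<^sub>F x in at_top. norm (B x) \<le> C0 * norm (1::real)"
    using asy_bounded[OF B] by (rule landau_o.bigE)
  from C0(2) obtain y0 where y0: "y0 \<ge> 1" "\<And>x. x \<ge> y0 \<Longrightarrow> norm (B x) \<le> C0 * norm (1::real)"
    by (rule eventually_at_top_ge_oneE) blast
  have int: "set_integrable lborel {x..} (\<lambda>y. dens \<beta> b \<kappa> y * B y)" if x: "x \<ge> y0" for x
  proof (rule set_integrable_bound)
    show "set_integrable lborel {x..} (\<lambda>y. C0 * dens \<beta> b \<kappa> y)"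
      using set_integral_dens(1)[OF \<kappa>, of x \<beta> b] y0(1) x by (intro set_integrable_mult_right) auto
    show "AE y in lborel. y \<in> {x..} \<longrightarrow> norm (dens \<beta> b \<kappa> y * B y) \<le> norm (C0 * dens \<beta> b \<kappa> y)"
    proof (rule AE_I2, rule impI)
      fix y assume "y \<in> {x..}"
      then have "\<bar>B y\<bar> \<le> C0" using y0(2)[of y] x by auto
      from mult_left_mono[OF this dens_nonneg[of \<beta> b \<kappa> y]]
      show "norm (dens \<beta> b \<kappa> y * B y) \<le> norm (C0 * dens \<beta> b \<kappa> y)"
        using dens_nonneg[of \<beta> b \<kappa> y] C0(1) by (simp add: abs_mult mult.commute[of C0])
    qed
  qed (simp add: set_borel_measurable_def)
  then show "\<forall>\<^sub>F x in at_top. set_integrable lborel {x..} (\<lambda>y. dens \<beta> (2 * m / \<kappa>) \<kappa> y * B y)"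
    unfolding b_def eventually_at_top_linorder by blast
  have "asy (\<lambda>x. (LBINT y:{x..}. dens \<beta> b \<kappa> y * B y) / (\<kappa> * dens \<beta> b \<kappa> x))
    (\<lambda>p. \<Sum>l\<le>p. c l * tail_coeff (\<beta> - real l / 2) m \<kappa> (p - l))"
  proof (rule asy_diagonal[OF _ asy_cmult[OF asy_tail_ratio[OF \<kappa> m]], folded b_def])
    fix N :: nat
    obtain C where C: "C > 0" "\<forall>\<^sub>F x in at_top. norm (B x - (\<Sum>l<N. c l * inverse (sqrt x) ^ l)) \<le> C * norm (inverse (sqrt x) ^ N)"
      using asyD[OF B, of N] by (rule landau_o.bigE)
    from C(2) obtain x0 where x0: "x0 \<ge> 1" "\<And>x. x \<ge> x0 \<Longrightarrow> norm (B x - (\<Sum>l<N. c l * inverse (sqrt x) ^ l)) \<le> C * norm (inverse (sqrt x) ^ N)"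
      by (rule eventually_at_top_ge_oneE) blast
    obtain D where D: "D > 0" "\<forall>\<^sub>F x in at_top. norm (tail_ratio (\<beta> - real N / 2) b \<kappa> x) \<le> D * norm (1::real)"
      using tail_ratio_bigo_1[OF \<kappa>] by (rule landau_o.bigE)
    show "(\<lambda>x. (LBINT y:{x..}. dens \<beta> b \<kappa> y * B y) / (\<kappa> * dens \<beta> b \<kappa> x)
        - (\<Sum>l<N. c l * tail_ratio (\<beta> - real l / 2) b \<kappa> x * inverse (sqrt x) ^ l)) \<in> O(\<lambda>x. inverse (sqrt x) ^ N)"
    proof (rule bigoI[of _ "C * D"])
      show "\<forall>\<^sub>F x in at_top. norm ((LBINT y:{x..}. dens \<beta> b \<kappa> y * B y) / (\<kappa> * dens \<beta> b \<kappa> x)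
        - (\<Sum>l<N. c l * tail_ratio (\<beta> - real l / 2) b \<kappa> x * inverse (sqrt x) ^ l)) \<le> C * D * norm (inverse (sqrt x) ^ N)"
        using D(2) eventually_ge_at_top[of y0] eventually_ge_at_top[of x0]
      proof eventually_elim
        case (elim x)
        have xp: "x > 0" using elim x0 by simp
        have si: "set_integrable lborel {x..} (\<lambda>y. a * dens \<beta>' b \<kappa> y)" for a \<beta>'
          by (intro set_integrable_mult_right set_integral_dens \<kappa> xp)
        have sis: "set_integrable lborel {x..} (\<lambda>y. \<Sum>l<N. c l * dens (\<beta> - real l / 2) b \<kappa> y)"
          unfolding set_integrable_def scaleR_sum_right
          by (rule Bochner_Integration.integrable_sum) (rule si[unfolded set_integrable_def])
        have "(LBINT y:{x..}. dens \<beta> b \<kappa> y * B y) - (\<Sum>l<N. c l * dens_tail (\<beta> - real l / 2) b \<kappa> x)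
            = (LBINT y:{x..}. dens \<beta> b \<kappa> y * B y - (\<Sum>l<N. c l * dens (\<beta> - real l / 2) b \<kappa> y))"
        proof -
          have "(LBINT y:{x..}. (\<Sum>l<N. c l * dens (\<beta> - real l / 2) b \<kappa> y)) = (\<Sum>l<N. LBINT y:{x..}. c l * dens (\<beta> - real l / 2) b \<kappa> y)"
            unfolding set_lebesgue_integral_def scaleR_sum_right using si unfolding set_integrable_def
            by (rule Bochner_Integration.integral_sum)
          then show ?thesis by (simp add: set_integral_diff(2)[OF int[OF elim(2)] sis] set_integral_dens(2)[OF \<kappa> xp])
        qed
        also have "norm \<dots> \<le> (LBINT y:{x..}. C * dens (\<beta> - real N / 2) b \<kappa> y)"
        proof (rule order_trans[OF set_integral_norm_bound set_integral_mono])
          show "set_integrable lborel {x..} (\<lambda>y. dens \<beta> b \<kappa> y * B y - (\<Sum>l<N. c l * dens (\<beta> - real l / 2) b \<kappa> y))"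
            by (rule set_integral_diff(1)[OF int[OF elim(2)] sis])
          then show "set_integrable lborel {x..} (\<lambda>y. norm (dens \<beta> b \<kappa> y * B y - (\<Sum>l<N. c l * dens (\<beta> - real l / 2) b \<kappa> y)))"
            by (rule set_integrable_norm)
          fix y assume "y \<in> {x..}"
          then have y: "y > 0" "y \<ge> x0" using elim x0 by auto
          have "dens \<beta> b \<kappa> y * B y - (\<Sum>l<N. c l * dens (\<beta> - real l / 2) b \<kappa> y)
              = dens \<beta> b \<kappa> y * (B y - (\<Sum>l<N. c l * inverse (sqrt y) ^ l))"
            unfolding dens_shift[OF y(1)] right_diff_distrib sum_distrib_left by (simp only: mult_ac)
          also have "norm \<dots> \<le> dens \<beta> b \<kappa> y * (C * norm (inverse (sqrt y) ^ N))"
            using x0(2)[OF y(2)] dens_nonneg[of \<beta> b \<kappa> y] by (simp add: abs_mult mult_left_mono)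
          also have "\<dots> = C * dens (\<beta> - real N / 2) b \<kappa> y"
            unfolding dens_shift[OF y(1)] using y by simp
          finally show "norm (dens \<beta> b \<kappa> y * B y - (\<Sum>l<N. c l * dens (\<beta> - real l / 2) b \<kappa> y)) \<le> C * dens (\<beta> - real N / 2) b \<kappa> y" .
        qed (rule si)
        also have "\<dots> = C * dens_tail (\<beta> - real N / 2) b \<kappa> x"
          by (simp add: set_integral_dens(2)[OF \<kappa> xp])
        finally have le: "\<bar>(LBINT y:{x..}. dens \<beta> b \<kappa> y * B y) - (\<Sum>l<N. c l * dens_tail (\<beta> - real l / 2) b \<kappa> x)\<bar>
            \<le> C * dens_tail (\<beta> - real N / 2) b \<kappa> x" by simp
        define E where "E = \<kappa> * dens \<beta> b \<kappa> x"
        have E: "E > 0" using \<kappa> xp by (simp add: E_def dens_pos)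
        have sh: "tail_ratio (\<beta> - real k / 2) b \<kappa> x * inverse (sqrt x) ^ k = dens_tail (\<beta> - real k / 2) b \<kappa> x / E" for k
          unfolding E_def by (rule tail_ratio_shift[OF xp \<kappa>, symmetric])
        have "(LBINT y:{x..}. dens \<beta> b \<kappa> y * B y) / E - (\<Sum>l<N. c l * tail_ratio (\<beta> - real l / 2) b \<kappa> x * inverse (sqrt x) ^ l)
          = ((LBINT y:{x..}. dens \<beta> b \<kappa> y * B y) - (\<Sum>l<N. c l * dens_tail (\<beta> - real l / 2) b \<kappa> x)) / E"
          unfolding mult.assoc sh by (simp add: diff_divide_distrib sum_divide_distrib)
        also have "norm \<dots> \<le> C * dens_tail (\<beta> - real N / 2) b \<kappa> x / E"
          using le E by (simp add: divide_right_mono)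
        also have "\<dots> = C * (tail_ratio (\<beta> - real N / 2) b \<kappa> x * inverse (sqrt x) ^ N)"
          unfolding sh by simp
        also have "\<dots> \<le> C * (D * inverse (sqrt x) ^ N)"
          using elim(1) C xp by (intro mult_left_mono mult_right_mono) auto
        finally show ?case using xp by (simp add: E_def mult.assoc)
      qed
    qed
  qed
  then show "asy (\<lambda>x. (LBINT y:{x..}. dens \<beta> (2 * m / \<kappa>) \<kappa> y * B y) / (\<kappa> * dens \<beta> (2 * m / \<kappa>) \<kappa> x))
    (\<lambda>p. \<Sum>l\<le>p. c l * tail_coeff (\<beta> - real l / 2) m \<kappa> (p - l))" unfolding b_def .
qed

subsection \<open>Noncentral gamma densities\<close>

definition gamma_dens :: "real \<Rightarrow> real \<Rightarrow> real" where
  "gamma_dens a x = (if x > 0 then x powr (a - 1) * exp (- x) / Gamma a else 0)"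

text \<open>\<open>ncg_dens a \<theta>\<close> is the density of \<open>\<chi>\<^sup>2 / 2\<close> for a noncentral \<open>\<chi>\<^sup>2\<close> with \<open>2 a\<close> degrees of freedom and
  noncentrality parameter \<open>2 \<theta>\<close>.\<close>

definition poisson_weight :: "real \<Rightarrow> nat \<Rightarrow> real" where
  "poisson_weight \<theta> k = exp (- \<theta>) * \<theta> ^ k / fact k"

definition ncg_dens :: "real \<Rightarrow> real \<Rightarrow> real \<Rightarrow> real" where
  "ncg_dens a \<theta> x = (\<Sum>k. poisson_weight \<theta> k * gamma_dens (a + real k) x)"

lemma gamma_dens_nonneg: "a > 0 \<Longrightarrow> gamma_dens a x \<ge> 0"
  by (simp add: gamma_dens_def Gamma_real_nonneg)

lemma gamma_dens_measurable [measurable]: "gamma_dens a \<in> borel_measurable borel"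
  unfolding gamma_dens_def[abs_def] by measurable

lemma poisson_weight_nonneg: "\<theta> \<ge> 0 \<Longrightarrow> poisson_weight \<theta> k \<ge> 0"
  by (simp add: poisson_weight_def)

lemma poisson_weight_sums: "poisson_weight \<theta> sums 1"
proof -
  have "(\<lambda>k. exp (- \<theta>) * (\<theta> ^ k /\<^sub>R fact k)) sums (exp (- \<theta>) * exp \<theta>)"
    by (intro sums_mult exp_converges)
  then show ?thesis unfolding poisson_weight_def[abs_def]
    by (simp add: exp_minus divide_inverse mult_ac)
qed

lemma poisson_weight_add:
  "(\<Sum>j\<le>N. poisson_weight \<theta> j * poisson_weight \<mu> (N - j)) = poisson_weight (\<theta> + \<mu>) N"
proof -
  have "poisson_weight (\<theta> + \<mu>) N = exp (- \<theta>) * exp (- \<mu>) * ((\<Sum>j\<le>N. of_nat (N choose j) * \<theta> ^ j * \<mu> ^ (N - j)) / fact N)"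
    unfolding poisson_weight_def binomial_ring by (simp flip: exp_add)
  also have "\<dots> = (\<Sum>j\<le>N. poisson_weight \<theta> j * poisson_weight \<mu> (N - j))"
    unfolding sum_divide_distrib sum_distrib_left
    by (intro sum.cong refl) (simp add: poisson_weight_def binomial_fact field_simps)
  finally show ?thesis ..
qed

lemma poisson_weight_0: "poisson_weight 0 k = (if k = 0 then 1 else 0)"
  by (simp add: poisson_weight_def)

lemma pochhammer_ge_power: "a \<ge> (0::real) \<Longrightarrow> pochhammer a k \<ge> a ^ k"
proof (induction k)
  case (Suc k)
  then have "a ^ k * a \<le> pochhammer a k * (a + real k)" by (intro mult_mono) (auto intro: order_trans[OF zero_le_power])
  then show ?case by (simp add: pochhammer_Suc mult.commute)
qed simp

lemma gamma_dens_add_nat: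
  assumes "a > 0" "x > 0"
  shows "gamma_dens (a + real k) x = gamma_dens a x * x ^ k / pochhammer a k"
proof -
  have "a \<notin> \<int>\<^sub>\<le>\<^sub>0" using assms by (auto elim!: nonpos_Ints_cases)
  then have "Gamma (a + real k) = pochhammer a k * Gamma a" 
    using Gamma_real_pos[OF assms(1)] by (simp add: pochhammer_Gamma)
  moreover have "x powr (a + real k - 1) = x powr (a - 1) * x ^ k"
    using assms by (simp add: powr_diff powr_add powr_realpow)
  ultimately show ?thesis using assms by (simp add: gamma_dens_def mult_ac)
qed

lemma summable_ncg:
  assumes "a > 0" "\<theta> \<ge> 0"
  shows "summable (\<lambda>k. poisson_weight \<theta> k * gamma_dens (a + real k) x)"
proof (cases "x > 0")
  case True
  show ?thesis
  proof (rule summable_comparison_test')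
    show "summable (\<lambda>k. exp (- \<theta>) * gamma_dens a x * (inverse (fact k) * (\<theta> * x / a) ^ k))"
      by (intro summable_mult summable_exp)
    fix k :: nat
    have p: "pochhammer a k > 0" using assms by (simp add: pochhammer_pos)
    have "norm (poisson_weight \<theta> k * gamma_dens (a + real k) x)
        = exp (- \<theta>) * gamma_dens a x * (\<theta> ^ k / fact k * x ^ k / pochhammer a k)"
      using assms True p gamma_dens_nonneg[of a x]
      by (simp add: gamma_dens_add_nat poisson_weight_def abs_mult)
    also have "\<dots> \<le> exp (- \<theta>) * gamma_dens a x * (\<theta> ^ k / fact k * x ^ k / a ^ k)"
      using assms True p gamma_dens_nonneg[of a x] pochhammer_ge_power[of a k]
      by (intro mult_left_mono divide_left_mono) auto
    also have "\<dots> = exp (- \<theta>) * gamma_dens a x * (inverse (fact k) * (\<theta> * x / a) ^ k)"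
      by (simp add: field_simps)
    finally show "norm (poisson_weight \<theta> k * gamma_dens (a + real k) x)
        \<le> exp (- \<theta>) * gamma_dens a x * (inverse (fact k) * (\<theta> * x / a) ^ k)" .
  qed
qed (simp add: gamma_dens_def)

lemma ncg_dens_measurable [measurable]: "ncg_dens a \<theta> \<in> borel_measurable borel"
  unfolding ncg_dens_def[abs_def] by measurable

lemma ncg_dens_nonneg: "a > 0 \<Longrightarrow> \<theta> \<ge> 0 \<Longrightarrow> ncg_dens a \<theta> x \<ge> 0"
  unfolding ncg_dens_def
  by (intro suminf_nonneg summable_ncg mult_nonneg_nonneg poisson_weight_nonneg gamma_dens_nonneg) auto

lemma ncg_dens_nonpos: "x \<le> 0 \<Longrightarrow> ncg_dens a \<theta> x = 0"
  by (simp add: ncg_dens_def gamma_dens_def)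

lemma ennreal_ncg_dens:
  assumes "a > 0" "\<theta> \<ge> 0"
  shows "ennreal (ncg_dens a \<theta> x) = (\<Sum>k. ennreal (poisson_weight \<theta> k) * ennreal (gamma_dens (a + real k) x))"
  unfolding ncg_dens_def using assms
  by (subst suminf_ennreal2[symmetric])
     (auto intro!: summable_ncg mult_nonneg_nonneg poisson_weight_nonneg gamma_dens_nonneg simp: ennreal_mult' poisson_weight_nonneg)

lemma ncg_dens_0: "ncg_dens a 0 x = gamma_dens a x"
proof -
  have "(\<lambda>k. poisson_weight 0 k * gamma_dens (a + real k) x) sums gamma_dens a x"
    using sums_single[of 0 "\<lambda>k. gamma_dens (a + real k) x"] by (simp add: poisson_weight_0 if_distrib[where f = "\<lambda>w. w * _"] cong: if_cong)
  then show ?thesis by (simp add: ncg_dens_def sums_iff)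
qed

section \<open>Convolution of gamma densities and of their Poisson mixtures\<close>

lemma nn_integral_gamma_dens:
  assumes "a > 0"
  shows "(\<integral>\<^sup>+x. ennreal (gamma_dens a x) \<partial>lborel) = 1"
proof -
  have "(\<integral>\<^sup>+x. ennreal (gamma_dens a x) \<partial>lborel) =
      (\<integral>\<^sup>+t. ennreal (inverse (Gamma a)) * ennreal (indicator {0..} t * t powr (a - 1) / exp t) \<partial>lborel)"
  proof (rule nn_integral_cong)
    fix x :: real
    show "ennreal (gamma_dens a x) = ennreal (inverse (Gamma a)) * ennreal (indicator {0..} x * x powr (a - 1) / exp x)"
      using Gamma_real_pos[OF assms]
      by (cases "x > 0"; cases "x = 0") (auto simp: gamma_dens_def ennreal_mult'[symmetric] exp_minus field_simps)
  qed
  also have "\<dots> = ennreal (inverse (Gamma a)) * ennreal (Gamma a)"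
    unfolding Gamma_conv_nn_integral_real[OF assms] by (rule nn_integral_cmult) measurable
  also have "\<dots> = 1" using Gamma_real_pos[OF assms] by (simp add: ennreal_mult'[symmetric])
  finally show ?thesis .
qed

lemma nn_integral_Beta:
  assumes "a > 0" "b > 0"
  shows "(\<integral>\<^sup>+t. ennreal (indicator {0..1} t * (t powr (a - 1) * (1 - t) powr (b - 1))) \<partial>lborel) = ennreal (Beta a b)"
  using nn_integral_has_integral_lebesgue[OF _ has_integral_Beta_real[OF assms]] by simp

text \<open>The substitution y = x u turns the integral into Euler's Beta integral.\<close>

lemma gamma_dens_convolution:
  assumes "a > 0" "b > 0"
  shows "(\<integral>\<^sup>+y. ennreal (gamma_dens a (x - y)) * ennreal (gamma_dens b y) \<partial>lborel) = ennreal (gamma_dens (a + b) x)"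
proof (cases "x > 0")
  case True
  have G: "Gamma a > 0" "Gamma b > 0" "Gamma (a + b) > 0" using assms by auto
  have "(\<integral>\<^sup>+y. ennreal (gamma_dens a (x - y)) * ennreal (gamma_dens b y) \<partial>lborel)
      = ennreal \<bar>x\<bar> * (\<integral>\<^sup>+u. ennreal (gamma_dens a (x - (0 + x * u))) * ennreal (gamma_dens b (0 + x * u)) \<partial>lborel)"
    using True by (intro nn_integral_real_affine) auto
  also have "(\<integral>\<^sup>+u. ennreal (gamma_dens a (x - (0 + x * u))) * ennreal (gamma_dens b (0 + x * u)) \<partial>lborel)
      = (\<integral>\<^sup>+u. ennreal (x powr (a + b - 2) * exp (- x) / (Gamma a * Gamma b)) *
          ennreal (indicator {0..1} u * (u powr (b - 1) * (1 - u) powr (a - 1))) \<partial>lborel)"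
  proof (rule nn_integral_cong_AE)
    have "AE u in lborel. u \<noteq> 0 \<and> u \<noteq> (1::real)"
      by (intro AE_conjI AE_lborel_singleton)
    then show "AE u in lborel. ennreal (gamma_dens a (x - (0 + x * u))) * ennreal (gamma_dens b (0 + x * u)) =
        ennreal (x powr (a + b - 2) * exp (- x) / (Gamma a * Gamma b)) *
          ennreal (indicator {0..1} u * (u powr (b - 1) * (1 - u) powr (a - 1)))"
    proof eventually_elim
      case (elim u)
      have xu: "x - x * u = x * (1 - u)" by (simp add: algebra_simps)
      show ?case
      proof (cases "0 < u \<and> u < 1")
        case u: True
        have "gamma_dens a (x - x * u) * gamma_dens b (x * u) =
            x powr (a - 1) * x powr (b - 1) * (exp (- (x * (1 - u))) * exp (- (x * u))) / (Gamma a * Gamma b) * (u powr (b - 1) * (1 - u) powr (a - 1))"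
          using u True unfolding xu by (simp add: gamma_dens_def powr_mult)
        also have "x powr (a - 1) * x powr (b - 1) = x powr (a + b - 2)" by (simp flip: powr_add)
        also have "exp (- (x * (1 - u))) * exp (- (x * u)) = exp (- x)" by (simp add: algebra_simps flip: exp_add)
        finally have *: "gamma_dens a (x - x * u) * gamma_dens b (x * u) =
          x powr (a + b - 2) * exp (- x) / (Gamma a * Gamma b) * (u powr (b - 1) * (1 - u) powr (a - 1))" .
        show ?thesis
          using u G by (simp add: ennreal_mult'[symmetric] gamma_dens_nonneg assms *)
      next
        case False
        then have "u < 0 \<or> u > 1" using elim by auto
        then have "\<not> 0 < x * u \<or> \<not> 0 < x - x * u" using True by (auto simp: xu zero_less_mult_iff)
        then have "ennreal (gamma_dens a (x - (0 + x * u))) * ennreal (gamma_dens b (0 + x * u)) = 0"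
          by (auto simp: gamma_dens_def)
        with \<open>u < 0 \<or> u > 1\<close> show ?thesis by auto
      qed
    qed
  qed
  also have "\<dots> = ennreal (x powr (a + b - 2) * exp (- x) / (Gamma a * Gamma b)) * ennreal (Beta b a)"
    unfolding nn_integral_Beta[OF assms(2,1), symmetric] by (rule nn_integral_cmult) measurable
  also have "ennreal \<bar>x\<bar> * (ennreal (x powr (a + b - 2) * exp (- x) / (Gamma a * Gamma b)) * ennreal (Beta b a))
      = ennreal (x * (x powr (a + b - 2) * exp (- x) / (Gamma a * Gamma b) * Beta b a))"
    using True G by (simp add: ennreal_mult'[symmetric])
  also have "x * (x powr (a + b - 2) * exp (- x) / (Gamma a * Gamma b) * Beta b a) = gamma_dens (a + b) x"
  proof -
    have "x powr (a + b - 2) * x = x powr (a + b - 1)"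
      using True powr_add[of x "a + b - 2" 1] by simp
    then show ?thesis using True G by (simp add: Beta_def gamma_dens_def add.commute field_simps)
  qed
  finally show ?thesis .
next
  case False
  have "(\<integral>\<^sup>+y. ennreal (gamma_dens a (x - y)) * ennreal (gamma_dens b y) \<partial>lborel) = (\<integral>\<^sup>+(y::real). 0 \<partial>lborel)"
    using False by (intro nn_integral_cong) (simp add: gamma_dens_def)
  then show ?thesis using False by (simp add: gamma_dens_def[of "a + b"])
qed

lemma sums_shift_nat:
  fixes f :: "nat \<Rightarrow> ennreal"
  assumes "f sums l"
  shows "(\<lambda>N. if j \<le> N then f (N - j) else 0) sums l"
proof (induction j)
  case (Suc j)
  let ?g = "\<lambda>N. if Suc j \<le> N then f (N - Suc j) else 0"
  have "(\<lambda>N. ?g (Suc N)) = (\<lambda>N. if j \<le> N then f (N - j) else 0)"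
    by (rule ext) (simp only: Suc_le_mono diff_Suc_Suc)
  with Suc have "(\<lambda>N. ?g (Suc N)) sums l" by (simp only:)
  from sums_Suc[OF this] have "?g sums (l + ?g 0)" .
  moreover have "?g 0 = 0" by simp
  ultimately show ?case by (simp only: add_0_right)
qed (use assms in simp)

lemma suminf_swap_ennreal:
  fixes h :: "nat \<Rightarrow> nat \<Rightarrow> ennreal"
  shows "(\<Sum>j. \<Sum>N. h j N) = (\<Sum>N. \<Sum>j. h j N)"
proof -
  have "(\<Sum>j. \<Sum>N. h j N) = (\<integral>\<^sup>+j. (\<Sum>N. h j N) \<partial>count_space UNIV)" by (rule nn_integral_count_space_nat[symmetric])
  also have "\<dots> = (\<Sum>N. \<integral>\<^sup>+j. h j N \<partial>count_space UNIV)" by (rule nn_integral_suminf) simp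
  finally show ?thesis by (simp add: nn_integral_count_space_nat)
qed

lemma suminf_diagonal_ennreal:
  fixes f :: "nat \<Rightarrow> nat \<Rightarrow> ennreal"
  shows "(\<Sum>j. \<Sum>k. f j k) = (\<Sum>N. \<Sum>j\<le>N. f j (N - j))"
proof -
  have "(\<Sum>j. \<Sum>k. f j k) = (\<Sum>j. \<Sum>N. if j \<le> N then f j (N - j) else 0)"
    by (intro suminf_cong sums_unique sums_shift_nat) auto
  also have "\<dots> = (\<Sum>N. \<Sum>j. if j \<le> N then f j (N - j) else 0)"
    by (rule suminf_swap_ennreal)
  also have "\<dots> = (\<Sum>N. \<Sum>j\<le>N. f j (N - j))"
  proof (rule suminf_cong)
    fix N
    have "(\<Sum>j. if j \<le> N then f j (N - j) else 0) = (\<Sum>j\<le>N. if j \<le> N then f j (N - j) else 0)"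
      by (rule suminf_finite) auto
    then show "(\<Sum>j. if j \<le> N then f j (N - j) else 0) = (\<Sum>j\<le>N. f j (N - j))" by simp
  qed
  finally show ?thesis .
qed

lemma nn_integral_ncg_dens:
  assumes "a > 0" "\<theta> \<ge> 0"
  shows "(\<integral>\<^sup>+x. ennreal (ncg_dens a \<theta> x) \<partial>lborel) = 1"
proof -
  have "(\<integral>\<^sup>+x. ennreal (ncg_dens a \<theta> x) \<partial>lborel) = (\<Sum>k. ennreal (poisson_weight \<theta> k))"
    using assms by (simp add: ennreal_ncg_dens nn_integral_suminf nn_integral_cmult nn_integral_gamma_dens)
  also have "\<dots> = ennreal 1"
    using poisson_weight_sums[of \<theta>] assms by (subst suminf_ennreal2) (auto simp: poisson_weight_nonneg sums_iff)
  finally show ?thesis by simp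
qed

text \<open>In \<open>ennreal\<close> sums and integrals may be interchanged freely. The convolution
  of the components j and k depends only on N = j + k, so summing along diagonals leaves the
  convolution of the two Poisson laws.\<close>

lemma ncg_dens_convolution:
  assumes "a > 0" "b > 0" "\<theta> \<ge> 0" "\<mu> \<ge> 0"
  shows "(\<integral>\<^sup>+y. ennreal (ncg_dens a \<theta> (x - y)) * ennreal (ncg_dens b \<mu> y) \<partial>lborel) = ennreal (ncg_dens (a + b) (\<theta> + \<mu>) x)"
proof -
  let ?w = "\<lambda>\<theta> k. ennreal (poisson_weight \<theta> k)"
  have "(\<integral>\<^sup>+y. ennreal (ncg_dens a \<theta> (x - y)) * ennreal (ncg_dens b \<mu> y) \<partial>lborel)
      = (\<integral>\<^sup>+y. (\<Sum>j. \<Sum>k. ?w \<theta> j * ?w \<mu> k * (ennreal (gamma_dens (a + real j) (x - y)) * ennreal (gamma_dens (b + real k) y))) \<partial>lborel)"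
    using assms by (intro nn_integral_cong) (simp add: ennreal_ncg_dens mult_ac flip: ennreal_suminf_cmult ennreal_suminf_multc)
  also have "\<dots> = (\<Sum>j. \<Sum>k. ?w \<theta> j * ?w \<mu> k * ennreal (gamma_dens (a + real j + (b + real k)) x))"
    using assms by (simp add: nn_integral_suminf nn_integral_cmult gamma_dens_convolution)
  also have "\<dots> = (\<Sum>N. \<Sum>j\<le>N. ?w \<theta> j * ?w \<mu> (N - j) * ennreal (gamma_dens (a + real j + (b + real (N - j))) x))"
    by (rule suminf_diagonal_ennreal)
  also have "\<dots> = (\<Sum>N. ?w (\<theta> + \<mu>) N * ennreal (gamma_dens (a + b + real N) x))"
  proof (rule suminf_cong)
    fix N
    have "(\<Sum>j\<le>N. ?w \<theta> j * ?w \<mu> (N - j) * ennreal (gamma_dens (a + real j + (b + real (N - j))) x))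
        = (\<Sum>j\<le>N. ?w \<theta> j * ?w \<mu> (N - j) * ennreal (gamma_dens (a + b + real N) x))"
      by (intro sum.cong refl) (auto simp: of_nat_diff algebra_simps)
    also have "\<dots> = (\<Sum>j\<le>N. ?w \<theta> j * ?w \<mu> (N - j)) * ennreal (gamma_dens (a + b + real N) x)"
      by (simp add: sum_distrib_right)
    also have "(\<Sum>j\<le>N. ?w \<theta> j * ?w \<mu> (N - j)) = ?w (\<theta> + \<mu>) N"
      using assms by (simp add: poisson_weight_add[symmetric] ennreal_mult'[symmetric] poisson_weight_nonneg)
    finally show "(\<Sum>j\<le>N. ?w \<theta> j * ?w \<mu> (N - j) * ennreal (gamma_dens (a + real j + (b + real (N - j))) x)) =
        ?w (\<theta> + \<mu>) N * ennreal (gamma_dens (a + b + real N) x)" .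
  qed
  also have "\<dots> = ennreal (ncg_dens (a + b) (\<theta> + \<mu>) x)"
    using assms by (simp add: ennreal_ncg_dens)
  finally show ?thesis .
qed

text \<open>One degree of freedom: since (2 k)! = 4^k (1/2)_k k!, the mixture series is the power
  series of the hyperbolic cosine.\<close>

lemma ncg_dens_half:
  assumes "y > 0" "\<theta> \<ge> 0"
  shows "ncg_dens (1 / 2) \<theta> y = exp (- \<theta> - y) * cosh (2 * sqrt (\<theta> * y)) / sqrt (pi * y)"
proof -
  have "(\<lambda>k. exp (- \<theta> - y) / sqrt (pi * y) * ((2 * sqrt (\<theta> * y)) ^ (2 * k) / fact (2 * k))) sums
      (exp (- \<theta> - y) / sqrt (pi * y) * cosh (2 * sqrt (\<theta> * y)))"
  proof (rule sums_mult)
    have "(\<lambda>n. if even n then (2 * sqrt (\<theta> * y)) ^ n /\<^sub>R fact n else 0) sums cosh (2 * sqrt (\<theta> * y))"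
      by (rule cosh_converges)
    then have "(\<lambda>k. (2 * sqrt (\<theta> * y)) ^ (2 * k) /\<^sub>R fact (2 * k)) sums cosh (2 * sqrt (\<theta> * y))"
      by (subst (asm) sums_mono_reindex[of "\<lambda>k. 2 * k", symmetric]) (auto simp: strict_mono_def elim!: evenE)
    then show "(\<lambda>k. (2 * sqrt (\<theta> * y)) ^ (2 * k) / fact (2 * k)) sums cosh (2 * sqrt (\<theta> * y))"
      by (simp add: divide_inverse mult.commute)
  qed
  moreover have "exp (- \<theta> - y) / sqrt (pi * y) * ((2 * sqrt (\<theta> * y)) ^ (2 * k) / fact (2 * k)) =
      poisson_weight \<theta> k * gamma_dens (1 / 2 + real k) y" for k
  proof -
    have 1: "(2 * sqrt (\<theta> * y)) ^ (2 * k) = 2 ^ (2 * k) * \<theta> ^ k * y ^ k"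
      using assms by (simp add: power_mult power_mult_distrib)
    have 2: "gamma_dens (1 / 2) y = exp (- y) / sqrt (pi * y)"
      using assms by (simp add: gamma_dens_def Gamma_one_half_real powr_minus_divide powr_half_sqrt real_sqrt_mult)
    have "pochhammer (1 / 2 :: real) k > 0" by (rule pochhammer_pos) simp
    then show ?thesis
      unfolding gamma_dens_add_nat[OF _ assms(1), of "1/2", simplified] 1 2 fact_double poisson_weight_def
      by (simp add: exp_diff exp_minus field_simps)
  qed
  ultimately show ?thesis by (simp add: ncg_dens_def sums_iff)
qed

subsection \<open>Asymptotics of the noncentral gamma density\<close>

lemma gamma_dens_moment:
  assumes "a > 0"
  shows "integrable lborel (\<lambda>q. gamma_dens a q * q ^ k)"
    and "(\<integral>q. gamma_dens a q * q ^ k \<partial>lborel) = pochhammer a k"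
proof -
  have p: "pochhammer a k > 0" using assms by (simp add: pochhammer_pos)
  have e: "gamma_dens a q * q ^ k = pochhammer a k * gamma_dens (a + real k) q" for q
    using gamma_dens_add_nat[OF assms, of q k] p by (cases "q > 0") (auto simp: gamma_dens_def)
  have "has_bochner_integral lborel (gamma_dens (a + real k)) 1"
    using assms by (intro has_bochner_integral_nn_integral)
      (auto simp: nn_integral_gamma_dens gamma_dens_nonneg ennreal_1[symmetric] simp del: ennreal_1)
  then show "integrable lborel (\<lambda>q. gamma_dens a q * q ^ k)" "(\<integral>q. gamma_dens a q * q ^ k \<partial>lborel) = pochhammer a k"
    unfolding e by (auto simp: has_bochner_integral_iff)
qed

text \<open>The cutoff at w = 1 keeps away from the possible singularity at w = 2, and for w > 1 the
  polynomial of degree below N is itself at most a multiple of w^N. So one bound holds for all w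
  \<ge> 0, as integration over the whole half line requires.\<close>

lemma one_minus_half_powr_expansion:
  fixes \<gamma> :: real
  shows "\<exists>C\<ge>0. \<forall>w\<ge>0. \<bar>(if w \<le> 1 then (1 - w / 2) powr \<gamma> else 0) - (\<Sum>m<N. (\<gamma> gchoose m) * (- 1 / 2) ^ m * w ^ m)\<bar> \<le> C * w ^ N"
proof -
  define c where "c = (\<lambda>m. (\<gamma> gchoose m) * (- 1 / 2) ^ m)"
  have sums: "(\<lambda>m. c m * w ^ m) sums ((1 - w / 2) powr \<gamma>)" if "\<bar>w\<bar> < 2" for w :: real
    using gen_binomial_real[of "- w / 2" \<gamma>] that
    by (simp add: c_def mult.assoc flip: power_mult_distrib)
  \<comment> \<open>A point strictly between 1 and the radius of convergence 2. It gives absolute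
    convergence at 1, where the sum of the absolute values serves as the constant.\<close>
  have "summable (\<lambda>m. c m * (3 / 2) ^ m)" using sums[of "3/2"] by (auto simp: sums_iff)
  from powser_insidea[OF this, of 1] have sm: "summable (\<lambda>m. \<bar>c m\<bar>)" by simp
  define C where "C = (\<Sum>m. \<bar>c m\<bar>)"
  have C: "C \<ge> 0" unfolding C_def by (rule suminf_nonneg[OF sm]) simp
  show ?thesis
  proof (intro exI conjI allI impI)
    fix w :: real assume w: "w \<ge> 0"
    show "\<bar>(if w \<le> 1 then (1 - w / 2) powr \<gamma> else 0) - (\<Sum>m<N. (\<gamma> gchoose m) * (- 1 / 2) ^ m * w ^ m)\<bar> \<le> C * w ^ N"
    proof (cases "w \<le> 1")
      case True
      then have s: "(\<lambda>m. c m * w ^ m) sums ((1 - w / 2) powr \<gamma>)" using w by (intro sums) auto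
      then have s': "(\<lambda>m. c (m + N) * w ^ (m + N)) sums ((1 - w / 2) powr \<gamma> - (\<Sum>m<N. c m * w ^ m))"
        by (subst sums_iff_shift) simp
      have smN: "summable (\<lambda>m. \<bar>c (m + N)\<bar>)" using sm by (subst summable_iff_shift)
      have "norm ((1 - w / 2) powr \<gamma> - (\<Sum>m<N. c m * w ^ m)) \<le> (\<Sum>m. \<bar>c (m + N)\<bar> * w ^ N)"
        unfolding sums_unique[OF s']
      proof (rule norm_suminf_le)
        show "summable (\<lambda>m. \<bar>c (m + N)\<bar> * w ^ N)" using smN by (rule summable_mult2)
        fix m
        have "w ^ m * w ^ N \<le> 1 * w ^ N" using w True by (intro mult_right_mono power_le_one) auto
        then show "norm (c (m + N) * w ^ (m + N)) \<le> \<bar>c (m + N)\<bar> * w ^ N"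
          using w by (simp add: abs_mult power_add mult_left_mono)
      qed
      also have "\<dots> = (\<Sum>m. \<bar>c (m + N)\<bar>) * w ^ N" by (rule suminf_mult2[OF smN, symmetric])
      also have "(\<Sum>m. \<bar>c (m + N)\<bar>) \<le> C"
        unfolding C_def using suminf_split_initial_segment[OF sm, of N] by (simp add: sum_nonneg)
      finally show ?thesis using True w by (simp add: c_def mult_right_mono)
    next
      case False
      have "\<bar>\<Sum>m<N. c m * w ^ m\<bar> \<le> (\<Sum>m<N. \<bar>c m\<bar> * w ^ N)"
        by (rule sum_abs[THEN order_trans], rule sum_mono)
           (use False in \<open>auto simp: abs_mult intro!: mult_left_mono power_increasing\<close>)
      also have "\<dots> = (\<Sum>m<N. \<bar>c m\<bar>) * w ^ N" by (simp add: sum_distrib_right)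
      also have "\<dots> \<le> C * w ^ N"
        unfolding C_def using w by (intro mult_right_mono sum_le_suminf[OF sm]) auto
      finally show ?thesis using False by (simp add: c_def)
    qed
  qed (rule C)
qed

lemma power_le_fact_exp: "z \<ge> 0 \<Longrightarrow> z ^ N \<le> fact N * exp (z::real)"
proof -
  assume z: "z \<ge> 0"
  have "(\<lambda>n. z ^ n /\<^sub>R fact n) sums exp z" by (rule exp_converges)
  then have "z ^ N /\<^sub>R fact N \<le> exp z"
    using sum_le_suminf[of "\<lambda>n. z ^ n /\<^sub>R fact n" "{N}"] z by (auto simp: sums_iff)
  then show ?thesis by (simp add: field_simps)
qed

text \<open>The substitution \<open>y = x (1 - (1 - q / z)\<^sup>2)\<close> with \<open>z = 2 \<surd>(\<theta> x)\<close> in the convolution integral leads to \<open>watson\<close>;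
  the summand \<open>exp (2 (q - z))\<close> is the decaying exponential of the hyperbolic cosine.\<close>

definition watson :: "real \<Rightarrow> real \<Rightarrow> real" where
  "watson \<gamma> z = (\<integral>q. gamma_dens (\<gamma> + 1) q *
     ((if q \<le> z then (1 - q / z / 2) powr \<gamma> else 0) * (1 + exp (2 * (q - z)))) \<partial>lborel)"

text \<open>Watson's lemma with a gamma density of shape \<gamma> + 1 as weight, whose m-th moment
  is (\<gamma> + 1)_m. By the estimate \<open>main\<close>, the cutoff at z and the second
  exponential change the polynomial approximation in q / z only by a multiple of (1 + q^N) z^(-N),
  which is integrable against the weight.\<close>

lemma watson_expansion:
  assumes \<gamma>: "\<gamma> > -1"
  shows "\<exists>C. \<forall>z\<ge>1. \<bar>watson \<gamma> z - (\<Sum>m<N. (\<gamma> gchoose m) * (- 1 / 2) ^ m * pochhammer (\<gamma> + 1) m * inverse z ^ m)\<bar> \<le> C * inverse z ^ N"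
    and "z \<ge> 1 \<Longrightarrow> integrable lborel (\<lambda>q. gamma_dens (\<gamma> + 1) q *
     ((if q \<le> z then (1 - q / z / 2) powr \<gamma> else 0) * (1 + exp (2 * (q - z)))))"
proof -
  define c where "c = (\<lambda>m. (\<gamma> gchoose m) * (- 1 / 2) ^ m)"
  have a: "\<gamma> + 1 > 0" using \<gamma> by simp
  define f where "f = (\<lambda>z q. (if q \<le> z then (1 - q / z / 2) powr \<gamma> else 0) * (1 + exp (2 * (q - z))))"
  have fm [measurable]: "f z \<in> borel_measurable borel" for z unfolding f_def by measurable
  obtain C2 where C2: "C2 \<ge> 0" "\<And>w. w \<ge> 0 \<Longrightarrow> \<bar>if w \<le> 1 then (1 - w / 2) powr \<gamma> else 0\<bar> \<le> C2"
    using one_minus_half_powr_expansion[of \<gamma> 0] by auto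
  have main: "\<exists>C\<ge>0. \<forall>z\<ge>1. \<forall>q\<ge>0. \<bar>f z q - (\<Sum>m<N. c m * inverse z ^ m * q ^ m)\<bar> \<le> C * (1 + q ^ N) * inverse z ^ N" for N
  proof -
    obtain C1 where C1: "C1 \<ge> 0" "\<And>w. w \<ge> 0 \<Longrightarrow> \<bar>(if w \<le> 1 then (1 - w / 2) powr \<gamma> else 0) - (\<Sum>m<N. c m * w ^ m)\<bar> \<le> C1 * w ^ N"
      using one_minus_half_powr_expansion[of \<gamma> N] unfolding c_def by auto
    \<comment> \<open>The second exponential costs N! when 2 q \<le> z, where it is at most exp (-
      z). Otherwise it is at most 1 \<le> (2 q / z)^N below the cutoff, which costs 2^N.\<close>
    define A where "A = (fact N :: real) + 2 ^ N"
    have A: "A > 0" "fact N \<le> A" "2 ^ N \<le> A" by (auto simp: A_def add_pos_pos)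
    show ?thesis
    proof (intro exI conjI allI impI)
      fix z q :: real assume z: "z \<ge> 1" and q: "q \<ge> 0"
      let ?g = "(if q / z \<le> 1 then (1 - q / z / 2) powr \<gamma> else 0)"
      have g: "(if q \<le> z then (1 - q / z / 2) powr \<gamma> else 0) = ?g" using z by simp
      have w: "q / z \<ge> 0" using z q by simp
      have "(\<Sum>m<N. c m * inverse z ^ m * q ^ m) = (\<Sum>m<N. c m * (q / z) ^ m)"
        by (simp add: divide_inverse power_mult_distrib mult_ac)
      then have "f z q - (\<Sum>m<N. c m * inverse z ^ m * q ^ m) = (?g - (\<Sum>m<N. c m * (q / z) ^ m)) + ?g * exp (2 * (q - z))"
        unfolding f_def g by (simp only: algebra_simps mult_1_right)
      then have "\<bar>f z q - (\<Sum>m<N. c m * inverse z ^ m * q ^ m)\<bar> \<le>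
          \<bar>?g - (\<Sum>m<N. c m * (q / z) ^ m)\<bar> + \<bar>?g * exp (2 * (q - z))\<bar>"
        by (simp only: abs_triangle_ineq)
      also have "\<bar>?g - (\<Sum>m<N. c m * (q / z) ^ m)\<bar> \<le> C1 * (q / z) ^ N" by (rule C1(2)[OF w])
      also have "\<dots> = C1 * q ^ N * inverse z ^ N" by (simp add: divide_inverse power_mult_distrib)
      also have "C1 * q ^ N * inverse z ^ N \<le> C1 * (1 + q ^ N) * inverse z ^ N"
        using C1(1) z q by (intro mult_right_mono mult_left_mono) auto
      also have "\<bar>?g * exp (2 * (q - z))\<bar> \<le> C2 * A * (1 + q ^ N) * inverse z ^ N"
      proof (cases "q / z \<le> 1")
        case True
        have "exp (2 * (q - z)) \<le> A * (1 + q ^ N) * inverse z ^ N"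
        proof (cases "2 * q \<le> z")
          case le: True
          have "exp (2 * (q - z)) \<le> exp (- z)" using le by simp
          also have "\<dots> \<le> fact N * inverse z ^ N"
            using power_le_fact_exp[of z N] z by (simp add: exp_minus power_inverse field_simps)
          also have "\<dots> \<le> (A * (1 + q ^ N)) * inverse z ^ N"
            using A q z mult_mono[of "fact N" A 1 "1 + q ^ N"] by (intro mult_right_mono) auto
          finally show ?thesis .
        next
          case False
          have "exp (2 * (q - z)) \<le> 1" using True z by (simp add: divide_le_eq)
          also have "1 \<le> (2 * q / z) ^ N" using False z by (intro one_le_power) (simp add: le_divide_eq)
          also have "\<dots> = 2 ^ N * q ^ N * inverse z ^ N" by (simp add: divide_inverse power_mult_distrib)
          also have "\<dots> \<le> (A * (1 + q ^ N)) * inverse z ^ N"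
            using A q z by (intro mult_right_mono mult_mono) auto
          finally show ?thesis .
        qed
        moreover have "\<bar>?g\<bar> \<le> C2" by (rule C2(2)[OF w])
        ultimately show ?thesis unfolding abs_mult
          using mult_mono[of "\<bar>?g\<bar>" C2 "\<bar>exp (2 * (q - z))\<bar>" "A * (1 + q ^ N) * inverse z ^ N"] C2(1)
          by (simp add: mult.assoc)
      next
        case False
        then show ?thesis using C2 A z q by simp
      qed
      finally show "\<bar>f z q - (\<Sum>m<N. c m * inverse z ^ m * q ^ m)\<bar> \<le> (C1 + C2 * A) * (1 + q ^ N) * inverse z ^ N"
        by (simp add: distrib_right)
    qed (use A C1 C2 in auto)
  qed
  have fint: "integrable lborel (\<lambda>q. gamma_dens (\<gamma> + 1) q * f z q)" if z: "z \<ge> 1" for z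
  proof -
    obtain C where C: "C \<ge> 0" "\<And>q. q \<ge> 0 \<Longrightarrow> \<bar>f z q\<bar> \<le> C * 2" using main[of 0] z by auto
    show ?thesis
    proof (rule Bochner_Integration.integrable_bound)
      show "integrable lborel (\<lambda>q. C * 2 * (gamma_dens (\<gamma> + 1) q * q ^ 0))"
        by (intro integrable_mult_right gamma_dens_moment a)
      show "AE q in lborel. norm (gamma_dens (\<gamma> + 1) q * f z q) \<le> norm (C * 2 * (gamma_dens (\<gamma> + 1) q * q ^ 0))"
      proof (rule AE_I2)
        fix q :: real
        show "norm (gamma_dens (\<gamma> + 1) q * f z q) \<le> norm (C * 2 * (gamma_dens (\<gamma> + 1) q * q ^ 0))"
        proof (cases "q > 0")
          case True
          then show ?thesis using mult_left_mono[OF C(2)[of q] gamma_dens_nonneg[OF a, of q]] gamma_dens_nonneg[OF a, of q] C(1)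
            by (simp add: abs_mult mult_ac)
        qed (simp add: gamma_dens_def)
      qed
    qed measurable
  qed
  then show "z \<ge> 1 \<Longrightarrow> integrable lborel (\<lambda>q. gamma_dens (\<gamma> + 1) q *
     ((if q \<le> z then (1 - q / z / 2) powr \<gamma> else 0) * (1 + exp (2 * (q - z)))))"
    by (simp add: f_def)
  obtain C where C: "C \<ge> 0" "\<And>z q. z \<ge> 1 \<Longrightarrow> q \<ge> 0 \<Longrightarrow> \<bar>f z q - (\<Sum>m<N. c m * inverse z ^ m * q ^ m)\<bar> \<le> C * (1 + q ^ N) * inverse z ^ N"
    using main[of N] by blast
  show "\<exists>C. \<forall>z\<ge>1. \<bar>watson \<gamma> z - (\<Sum>m<N. (\<gamma> gchoose m) * (- 1 / 2) ^ m * pochhammer (\<gamma> + 1) m * inverse z ^ m)\<bar> \<le> C * inverse z ^ N"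
  proof (intro exI allI impI)
    fix z :: real assume z: "z \<ge> 1"
    have w: "watson \<gamma> z = (\<integral>q. gamma_dens (\<gamma> + 1) q * f z q \<partial>lborel)" by (simp add: watson_def f_def)
    have mi: "integrable lborel (\<lambda>q. d * (gamma_dens (\<gamma> + 1) q * q ^ m))" for d m
      by (intro integrable_mult_right gamma_dens_moment a)
    have si: "integrable lborel (\<lambda>q. \<Sum>m<N. (c m * inverse z ^ m) * (gamma_dens (\<gamma> + 1) q * q ^ m))"
      by (rule Bochner_Integration.integrable_sum) (rule mi)
    have "(\<Sum>m<N. (\<gamma> gchoose m) * (- 1 / 2) ^ m * pochhammer (\<gamma> + 1) m * inverse z ^ m)
        = (\<Sum>m<N. (c m * inverse z ^ m) * (\<integral>q. gamma_dens (\<gamma> + 1) q * q ^ m \<partial>lborel))"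
      unfolding gamma_dens_moment(2)[OF a] c_def by (simp only: mult_ac)
    also have "\<dots> = (\<integral>q. (\<Sum>m<N. (c m * inverse z ^ m) * (gamma_dens (\<gamma> + 1) q * q ^ m)) \<partial>lborel)"
      using mi by (subst Bochner_Integration.integral_sum) auto
    finally have d1: "watson \<gamma> z - (\<Sum>m<N. (\<gamma> gchoose m) * (- 1 / 2) ^ m * pochhammer (\<gamma> + 1) m * inverse z ^ m)
        = (\<integral>q. gamma_dens (\<gamma> + 1) q * f z q - (\<Sum>m<N. (c m * inverse z ^ m) * (gamma_dens (\<gamma> + 1) q * q ^ m)) \<partial>lborel)"
      unfolding w by (simp only: Bochner_Integration.integral_diff[OF fint[OF z] si])
    have "norm (\<integral>q. gamma_dens (\<gamma> + 1) q * f z q - (\<Sum>m<N. (c m * inverse z ^ m) * (gamma_dens (\<gamma> + 1) q * q ^ m)) \<partial>lborel)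
        \<le> (\<integral>q. C * inverse z ^ N * (gamma_dens (\<gamma> + 1) q * q ^ 0 + gamma_dens (\<gamma> + 1) q * q ^ N) \<partial>lborel)"
    proof (rule order_trans[OF integral_norm_bound Bochner_Integration.integral_mono])
      show "integrable lborel (\<lambda>q. norm (gamma_dens (\<gamma> + 1) q * f z q - (\<Sum>m<N. (c m * inverse z ^ m) * (gamma_dens (\<gamma> + 1) q * q ^ m))))"
        by (intro integrable_norm Bochner_Integration.integrable_diff fint z si)
      show "integrable lborel (\<lambda>q. C * inverse z ^ N * (gamma_dens (\<gamma> + 1) q * q ^ 0 + gamma_dens (\<gamma> + 1) q * q ^ N))"
        by (intro integrable_mult_right Bochner_Integration.integrable_add gamma_dens_moment a)
      fix q :: real
      show "norm (gamma_dens (\<gamma> + 1) q * f z q - (\<Sum>m<N. (c m * inverse z ^ m) * (gamma_dens (\<gamma> + 1) q * q ^ m)))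
          \<le> C * inverse z ^ N * (gamma_dens (\<gamma> + 1) q * q ^ 0 + gamma_dens (\<gamma> + 1) q * q ^ N)"
      proof (cases "q > 0")
        case True
        have "gamma_dens (\<gamma> + 1) q * f z q - (\<Sum>m<N. (c m * inverse z ^ m) * (gamma_dens (\<gamma> + 1) q * q ^ m))
            = gamma_dens (\<gamma> + 1) q * (f z q - (\<Sum>m<N. c m * inverse z ^ m * q ^ m))"
          unfolding right_diff_distrib sum_distrib_left by (simp only: mult_ac)
        also have "norm \<dots> \<le> gamma_dens (\<gamma> + 1) q * (C * (1 + q ^ N) * inverse z ^ N)"
          using C(2)[OF z, of q] True gamma_dens_nonneg[OF a, of q] by (simp add: abs_mult mult_left_mono)
        also have "\<dots> = C * inverse z ^ N * (gamma_dens (\<gamma> + 1) q * q ^ 0 + gamma_dens (\<gamma> + 1) q * q ^ N)"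
          by (simp add: algebra_simps)
        finally show ?thesis .
      qed (simp add: gamma_dens_def)
    qed
    also have "\<dots> = C * inverse z ^ N * (1 + pochhammer (\<gamma> + 1) N)"
      by (simp only: integral_mult_right_zero gamma_dens_moment(2)[OF a] pochhammer_0
          Bochner_Integration.integral_add[OF gamma_dens_moment(1)[OF a] gamma_dens_moment(1)[OF a]])
    finally show "\<bar>watson \<gamma> z - (\<Sum>m<N. (\<gamma> gchoose m) * (- 1 / 2) ^ m * pochhammer (\<gamma> + 1) m * inverse z ^ m)\<bar>
      \<le> (C * (1 + pochhammer (\<gamma> + 1) N)) * inverse z ^ N" unfolding d1 real_norm_def by (simp only: mult_ac)
  qed
qed

text \<open>With u = 1 - q / z one has x - y = x u^2, so the root 2 sqrt (\<theta> (x - y)) becomes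
  z - q, linear in q, and exp (- (x - y)) exp (- y) = exp (- x) leaves the integral. The growing
  half of the cosine is exp z exp (- q) up to a constant: the growth of the model density times the
  decay of the gamma weight. The bound on a makes the shape a - 1/2 of the central part
  positive.\<close>

lemma ncg_dens_watson:
  assumes a: "a > 1 / 2" and \<theta>: "\<theta> > 0" and x: "x > 0" and z: "2 * sqrt (\<theta> * x) \<ge> 1"
  shows "ncg_dens a \<theta> x = exp (- \<theta>) * \<theta> powr (- (a - 1 / 2) / 2) / (2 * sqrt pi) *
    dens (a / 2 - 3 / 4) (2 * sqrt \<theta>) 1 x * watson (a - 3 / 2) (2 * sqrt (\<theta> * x))"
proof -
  define z where "z = 2 * sqrt (\<theta> * x)"
  define \<gamma> where "\<gamma> = a - 3 / 2"
  have zp: "z > 0" "z \<ge> 1" using assms by (auto simp: z_def)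
  have G: "Gamma (\<gamma> + 1) > 0" using a by (intro Gamma_real_pos) (simp add: \<gamma>_def)
  define K where "K = exp (- \<theta>) * \<theta> powr (- (a - 1 / 2) / 2) / (2 * sqrt pi) * dens (a / 2 - 3 / 4) (2 * sqrt \<theta>) 1 x"
  have K: "K \<ge> 0" by (simp add: K_def dens_nonneg)
  define h where "h = (\<lambda>q. gamma_dens (\<gamma> + 1) q * ((if q \<le> z then (1 - q / z / 2) powr \<gamma> else 0) * (1 + exp (2 * (q - z)))))"
  define f where "f = (\<lambda>y. ncg_dens (1 / 2) \<theta> (x - y) * gamma_dens (a - 1 / 2) y)"
  define g where "g = (\<lambda>q. x * (1 - (1 - q / z)\<^sup>2))"
  have g0: "g 0 = 0" "g z = x" using zp by (auto simp: g_def)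
  have fm [measurable]: "f \<in> borel_measurable borel" unfolding f_def by measurable
  have "ennreal (ncg_dens a \<theta> x) = (\<integral>\<^sup>+y. ennreal (f y) \<partial>lborel)"
    using ncg_dens_convolution[of "1 / 2" "a - 1 / 2" \<theta> 0 x] a \<theta>
    by (simp add: ncg_dens_0 f_def ennreal_mult' ncg_dens_nonneg)
  \<comment> \<open>Outside the interval from 0 to x one of the two densities vanishes, so the
    integral lives on the range of the substitution g.\<close>
  also have "\<dots> = (\<integral>\<^sup>+y. f y * indicator {g 0..g z} y \<partial>lborel)"
    by (intro nn_integral_cong) (auto simp: g0 f_def gamma_dens_def ncg_dens_nonpos split: split_indicator)
  also have "\<dots> = (\<integral>\<^sup>+q. f (g q) * (2 * x * (1 - q / z) / z) * indicator {0..z} q \<partial>lborel)"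
  proof (rule nn_integral_substitution)
    show "set_borel_measurable borel {g 0..g z} f" unfolding set_borel_measurable_def by measurable
    show "(g has_real_derivative 2 * x * (1 - q / z) / z) (at q)" for q
      unfolding g_def power2_eq_square using zp by (auto intro!: derivative_eq_intros simp: field_simps)
    show "continuous_on {0..z} (\<lambda>q. 2 * x * (1 - q / z) / z)" using zp by (intro continuous_intros) auto
    show "0 \<le> 2 * x * (1 - q / z) / z" if "q \<in> {0..z}" for q using that zp x by (simp add: divide_le_eq)
  qed (use zp in simp)
  also have "\<dots> = (\<integral>\<^sup>+q. ennreal (K * h q) \<partial>lborel)"
  proof (rule nn_integral_cong_AE)
    have "AE q in lborel. q \<noteq> 0 \<and> q \<noteq> z" by (intro AE_conjI AE_lborel_singleton)
    then show "AE q in lborel. ennreal (f (g q) * (2 * x * (1 - q / z) / z) * indicator {0..z} q) = ennreal (K * h q)"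
    proof eventually_elim
      case (elim q)
      show ?case
      proof (cases "0 < q \<and> q < z")
        case q: True
        define u where "u = 1 - q / z"
        have u: "0 < u" "u < 1" using q zp by (auto simp: u_def)
        have xg: "x - g q = x * u\<^sup>2" by (simp add: g_def u_def algebra_simps)
        have gq: "g q = x * (2 / z) * q * (1 - q / z / 2)" using zp by (simp add: g_def field_simps power2_eq_square)
        have v: "1 - q / z / 2 > 0" using q zp by (simp add: field_simps)
        have gp: "g q > 0" unfolding gq using x zp q v by simp
        have zu: "2 * sqrt (\<theta> * (x * u\<^sup>2)) = z - q"
        proof -
          have "2 * sqrt (\<theta> * (x * u\<^sup>2)) = z * u" using u by (simp add: z_def real_sqrt_mult)
          also have "\<dots> = z - q" using zp by (simp add: u_def field_simps)
          finally show ?thesis .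
        qed
        have n: "ncg_dens (1 / 2) \<theta> (x - g q) = exp (- \<theta> - (x - g q)) * cosh (z - q) / (sqrt pi * sqrt x * u)"
          unfolding xg using ncg_dens_half[of "x * u\<^sup>2" \<theta>, unfolded zu] x u \<theta> by (simp add: real_sqrt_mult)
        have gm: "gamma_dens (a - 1 / 2) (g q) = (x * (2 / z)) powr \<gamma> * q powr \<gamma> * (1 - q / z / 2) powr \<gamma> * exp (- g q) / Gamma (\<gamma> + 1)"
        proof -
          have "a - 1 / 2 - 1 = \<gamma>" "a - 1 / 2 = \<gamma> + 1" by (auto simp: \<gamma>_def)
          moreover have "g q powr \<gamma> = (x * (2 / z)) powr \<gamma> * q powr \<gamma> * (1 - q / z / 2) powr \<gamma>"
            unfolding gq using x zp q v by (simp only: powr_mult) 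
          ultimately show ?thesis using gp by (simp add: gamma_dens_def)
        qed
        have c: "cosh (z - q) = exp z / 2 * (exp (- q) * (1 + exp (2 * (q - z))))"
        proof -
          have "exp z * (exp (- q) * exp (2 * (q - z))) = exp (- (z - q))" by (simp flip: exp_add)
          moreover have "exp z * exp (- q) = exp (z - q)" by (simp flip: exp_add)
          ultimately show ?thesis by (simp add: cosh_field_def algebra_simps)
        qed
        have xe: "exp (- \<theta> - (x - g q)) * exp (- g q) = exp (- \<theta>) * exp (- x)" by (simp flip: exp_add)
        have sx: "2 * x * u / z / (sqrt pi * sqrt x * u) = 2 / z * sqrt x / sqrt pi"
          using u x zp by (simp add: field_simps)
        have cst: "2 / z * sqrt x * (x * (2 / z)) powr \<gamma> = \<theta> powr (- (a - 1 / 2) / 2) * x powr (a / 2 - 3 / 4)"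
        proof -
          have "2 / z = (\<theta> * x) powr (- (1 / 2))"
            using \<theta> x by (simp add: z_def powr_minus_divide powr_half_sqrt)
          then have z2: "2 / z = \<theta> powr (- (1 / 2)) * x powr (- (1 / 2))" using \<theta> x by (simp add: powr_mult)
          have "(x * (2 / z)) powr \<gamma> = x powr \<gamma> * (\<theta> powr (- (1 / 2)) * x powr (- (1 / 2))) powr \<gamma>"
            unfolding z2 using \<theta> x by (simp add: powr_mult)
          also have "\<dots> = x powr \<gamma> * (\<theta> powr (- (1 / 2) * \<gamma>) * x powr (- (1 / 2) * \<gamma>))"
            using \<theta> x by (simp only: powr_mult powr_powr powr_ge_zero)
          finally have "2 / z * sqrt x * (x * (2 / z)) powr \<gamma> =
              (\<theta> powr (- (1 / 2)) * \<theta> powr (- (1 / 2) * \<gamma>)) * (x powr (- (1 / 2)) * x powr (1 / 2) * x powr \<gamma> * x powr (- (1 / 2) * \<gamma>))"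
            unfolding z2 using x by (simp only: powr_half_sqrt mult_ac)
          also have "\<dots> = \<theta> powr (- (1 / 2) + - (1 / 2) * \<gamma>) * x powr (- (1 / 2) + 1 / 2 + \<gamma> + - (1 / 2) * \<gamma>)"
            by (simp only: powr_add)
          also have "- (1 / 2) + - (1 / 2) * \<gamma> = - (a - 1 / 2) / 2" by (simp add: \<gamma>_def field_simps)
          also have "- (1 / 2) + 1 / 2 + \<gamma> + - (1 / 2) * \<gamma> = a / 2 - 3 / 4" by (simp add: \<gamma>_def field_simps)
          finally show ?thesis .
        qed
        have zx: "exp (- x) * exp z = exp (2 * sqrt \<theta> * sqrt x - x / 1)"
          by (simp add: z_def real_sqrt_mult flip: exp_add)
        have hq: "h q = q powr \<gamma> * exp (- q) / Gamma (\<gamma> + 1) * ((1 - q / z / 2) powr \<gamma> * (1 + exp (2 * (q - z))))"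
          using q by (simp add: h_def gamma_dens_def)
        define e1 where "e1 = 1 + exp (2 * (q - z))"
        have "f (g q) * (2 * x * u / z) =
           (exp (- \<theta> - (x - g q)) * exp (- g q)) * (2 * x * u / z / (sqrt pi * sqrt x * u)) * (x * (2 / z)) powr \<gamma>
             * (exp z / 2) * (q powr \<gamma> * exp (- q) / Gamma (\<gamma> + 1) * ((1 - q / z / 2) powr \<gamma> * (1 + exp (2 * (q - z)))))"
          unfolding f_def n gm c e1_def[symmetric] by (simp add: mult_ac)
        also have "\<dots> = exp (- \<theta>) * (exp (- x) * exp z) * (2 / z * sqrt x * (x * (2 / z)) powr \<gamma>) / (2 * sqrt pi) * h q"
          unfolding xe sx hq by simp
        also have "\<dots> = K * h q"
          unfolding cst zx K_def dens_def by simp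
        finally show ?thesis using q by (simp add: u_def)
      next
        case False
        then have "q < 0 \<or> q > z" using elim by auto
        then show ?thesis using zp by (auto simp: h_def gamma_dens_def)
      qed
    qed
  qed
  also have "\<dots> = ennreal (K * watson \<gamma> z)"
  proof -
    have hi: "integrable lborel (\<lambda>q. K * h q)"
      using watson_expansion(2)[of \<gamma> z] zp a unfolding h_def by (intro integrable_mult_right) (auto simp: \<gamma>_def)
    have "h q \<ge> 0" for q
      using gamma_dens_nonneg[of "\<gamma> + 1" q] a by (auto simp: h_def \<gamma>_def intro!: mult_nonneg_nonneg)
    then have "AE q in lborel. 0 \<le> K * h q" using K by auto
    from nn_integral_eq_integral[OF hi this] show ?thesis by (simp add: watson_def h_def)
  qed
  finally have "ncg_dens a \<theta> x = K * watson \<gamma> z"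
  proof (subst (asm) ennreal_inj)
    show "0 \<le> ncg_dens a \<theta> x" using a \<theta> by (simp add: ncg_dens_nonneg)
    show "0 \<le> K * watson \<gamma> z" unfolding watson_def using a
      by (intro mult_nonneg_nonneg K Bochner_Integration.integral_nonneg gamma_dens_nonneg) (auto simp: \<gamma>_def)
  qed auto
  then show ?thesis by (simp add: K_def \<gamma>_def z_def)
qed

text \<open>The coefficient of z^(-m) in the large argument expansion of the modified Bessel
  function I of order a - 1, relative to exp z / sqrt (2 pi z).\<close>

definition bessel_coeff :: "real \<Rightarrow> nat \<Rightarrow> real" where
  "bessel_coeff a m = pochhammer (3 / 2 - a) m * pochhammer (a - 1 / 2) m / (fact m * 2 ^ m)"

lemma bigo_exp_neg_sqrt:
  assumes "c > 0"
  shows "(\<lambda>x. exp (- (c * sqrt x))) \<in> O(\<lambda>x. inverse (sqrt x) ^ N)"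
proof (rule bigoI[of _ "fact N / c ^ N"])
  show "\<forall>\<^sub>F x in at_top. norm (exp (- (c * sqrt x))) \<le> fact N / c ^ N * norm (inverse (sqrt x) ^ N)"
    using eventually_gt_at_top[of 0]
  proof eventually_elim
    case (elim x)
    have "(c * sqrt x) ^ N \<le> fact N * exp (c * sqrt x)"
      using elim assms by (intro power_le_fact_exp) auto
    then show ?case using elim assms by (simp add: exp_minus power_inverse power_mult_distrib field_simps)
  qed
qed

text \<open>For a > 1/2 this is the expansion of \<open>watson\<close>. For a = 1/2, the case n = 1,
  there is no central part to convolve with: the density is the cosine itself, all
  \<open>bessel_coeff\<close> beyond the first vanish because (a - 1/2)_m does, and the error is
  exponentially small.\<close>

lemma asy_ncg_dens:
  assumes a: "a \<ge> 1 / 2" and \<theta>: "\<theta> > 0"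
  shows "asy (\<lambda>x. ncg_dens a \<theta> x / (exp (- \<theta>) * \<theta> powr (- (a - 1 / 2) / 2) / (2 * sqrt pi) *
      dens (a / 2 - 3 / 4) (2 * sqrt \<theta>) 1 x)) (\<lambda>m. bessel_coeff a m * inverse (2 * sqrt \<theta>) ^ m)"
proof (cases "a = 1 / 2")
  case True
  have "asy (\<lambda>x. 1 + exp (- (4 * sqrt \<theta> * sqrt x))) (\<lambda>m. bessel_coeff a m * inverse (2 * sqrt \<theta>) ^ m)"
    unfolding asy_def
  proof
    fix N
    show "(\<lambda>x. 1 + exp (- (4 * sqrt \<theta> * sqrt x)) - (\<Sum>l<N. bessel_coeff a l * inverse (2 * sqrt \<theta>) ^ l * inverse (sqrt x) ^ l))
        \<in> O(\<lambda>x. inverse (sqrt x) ^ N)"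
    proof (cases N)
      case 0
      have "((\<lambda>x. 1 + exp (- (4 * sqrt \<theta> * sqrt x))) \<longlongrightarrow> 1) at_top" using \<theta> by real_asymp
      then show ?thesis using 0 by (auto intro!: bigoI_tendsto[where c = 1])
    next
      case (Suc N')
      have "bessel_coeff a l = (if l = 0 then 1 else 0)" for l
        unfolding bessel_coeff_def True by (cases l) (auto simp: pochhammer_rec)
      then have "(\<Sum>l<N. bessel_coeff a l * inverse (2 * sqrt \<theta>) ^ l * inverse (sqrt x) ^ l) = 1" for x
        unfolding Suc sum.lessThan_Suc_shift by simp
      then show ?thesis using bigo_exp_neg_sqrt[of "4 * sqrt \<theta>" N] \<theta> by simp
    qed
  qed
  then show ?thesis
  proof (rule asy_cong)
    show "\<forall>\<^sub>F x in at_top. 1 + exp (- (4 * sqrt \<theta> * sqrt x)) = ncg_dens a \<theta> x / (exp (- \<theta>) * \<theta> powr (- (a - 1 / 2) / 2) / (2 * sqrt pi) *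
      dens (a / 2 - 3 / 4) (2 * sqrt \<theta>) 1 x)"
      using eventually_gt_at_top[of 0]
    proof eventually_elim
      case (elim x)
      define z where "z = 2 * sqrt \<theta> * sqrt x"
      have "dens (a / 2 - 3 / 4) (2 * sqrt \<theta>) 1 x = exp z * exp (- x) / sqrt x"
      proof -
        have "x powr (a / 2 - 3 / 4) = 1 / sqrt x"
          using elim by (simp add: True powr_minus_divide powr_half_sqrt)
        moreover have "exp (2 * sqrt \<theta> * sqrt x - x / 1) = exp z * exp (- x)" by (simp add: z_def flip: exp_add)
        ultimately show ?thesis by (simp add: dens_def)
      qed
      moreover have "ncg_dens a \<theta> x = exp (- \<theta>) * exp (- x) * cosh z / (sqrt pi * sqrt x)"
        using ncg_dens_half[OF elim, of \<theta>] \<theta> unfolding True by (simp add: z_def real_sqrt_mult mult.assoc flip: exp_add)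
      moreover have "cosh z = exp z / 2 * (1 + exp (- (4 * sqrt \<theta> * sqrt x)))"
        by (simp add: cosh_field_def z_def algebra_simps flip: exp_add)
      ultimately show ?case using elim \<theta> unfolding True by simp
    qed
  qed
next
  case False
  then have a: "a > 1 / 2" using a by simp
  define \<gamma> where "\<gamma> = a - 3 / 2"
  have \<gamma>: "\<gamma> > -1" using a by (simp add: \<gamma>_def)
  have "asy (\<lambda>x. watson \<gamma> (2 * sqrt (\<theta> * x))) (\<lambda>m. bessel_coeff a m * inverse (2 * sqrt \<theta>) ^ m)"
    unfolding asy_def
  proof
    fix N
    obtain C where C: "\<And>z. z \<ge> 1 \<Longrightarrow> \<bar>watson \<gamma> z - (\<Sum>m<N. (\<gamma> gchoose m) * (- 1 / 2) ^ m * pochhammer (\<gamma> + 1) m * inverse z ^ m)\<bar> \<le> C * inverse z ^ N"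
      using watson_expansion(1)[OF \<gamma>, of N] by blast
    have co: "(\<gamma> gchoose m) * (- 1 / 2) ^ m * pochhammer (\<gamma> + 1) m = bessel_coeff a m" for m
    proof -
      have "(\<gamma> gchoose m) = (- 1) ^ m * pochhammer (3 / 2 - a) m / fact m"
        by (simp add: gbinomial_pochhammer \<gamma>_def)
      moreover have "\<gamma> + 1 = a - 1 / 2" by (simp add: \<gamma>_def)
      moreover have "(- 1 / 2 :: real) ^ m = (- 1) ^ m / 2 ^ m" by (rule power_divide)
      ultimately have "(\<gamma> gchoose m) * (- 1 / 2) ^ m * pochhammer (\<gamma> + 1) m =
          ((- 1) ^ m * (- 1) ^ m) * (pochhammer (3 / 2 - a) m * pochhammer (a - 1 / 2) m / (fact m * 2 ^ m))"
        by (simp only: times_divide_eq_left times_divide_eq_right divide_divide_eq_left mult_ac)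
      also have "(- 1 :: real) ^ m * (- 1) ^ m = 1" by (simp flip: power_mult_distrib)
      finally show ?thesis by (simp add: bessel_coeff_def)
    qed
    have "filterlim (\<lambda>x. 2 * sqrt (\<theta> * x)) at_top at_top" using \<theta> by real_asymp
    then have ev: "\<forall>\<^sub>F x in at_top. 1 \<le> 2 * sqrt (\<theta> * x)" by (simp add: filterlim_at_top)
    show "(\<lambda>x. watson \<gamma> (2 * sqrt (\<theta> * x)) - (\<Sum>l<N. bessel_coeff a l * inverse (2 * sqrt \<theta>) ^ l * inverse (sqrt x) ^ l))
        \<in> O(\<lambda>x. inverse (sqrt x) ^ N)"
    proof (rule bigoI[of _ "C * inverse (2 * sqrt \<theta>) ^ N"])
      show "\<forall>\<^sub>F x in at_top. norm (watson \<gamma> (2 * sqrt (\<theta> * x)) - (\<Sum>l<N. bessel_coeff a l * inverse (2 * sqrt \<theta>) ^ l * inverse (sqrt x) ^ l))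
        \<le> C * inverse (2 * sqrt \<theta>) ^ N * norm (inverse (sqrt x) ^ N)"
        using ev eventually_gt_at_top[of 0]
      proof eventually_elim
        case (elim x)
        have "inverse (2 * sqrt (\<theta> * x)) ^ m = inverse (2 * sqrt \<theta>) ^ m * inverse (sqrt x) ^ m" for m
          unfolding power_mult_distrib[symmetric] by (simp add: real_sqrt_mult)
        then show ?case using C[OF elim(1)] elim(2) unfolding co by (simp add: mult.assoc)
      qed
    qed
  qed
  then show ?thesis
  proof (rule asy_cong)
    have "filterlim (\<lambda>x. 2 * sqrt (\<theta> * x)) at_top at_top" using \<theta> by real_asymp
    then have ev: "\<forall>\<^sub>F x in at_top. 1 \<le> 2 * sqrt (\<theta> * x)" by (simp add: filterlim_at_top)
    show "\<forall>\<^sub>F x in at_top. watson \<gamma> (2 * sqrt (\<theta> * x)) = ncg_dens a \<theta> x / (exp (- \<theta>) * \<theta> powr (- (a - 1 / 2) / 2) / (2 * sqrt pi) *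
      dens (a / 2 - 3 / 4) (2 * sqrt \<theta>) 1 x)"
      using ev eventually_gt_at_top[of 0]
    proof eventually_elim
      case (elim x)
      have "exp (- \<theta>) * \<theta> powr (- (a - 1 / 2) / 2) / (2 * sqrt pi) * dens (a / 2 - 3 / 4) (2 * sqrt \<theta>) 1 x > 0"
        using \<theta> elim dens_pos by (intro mult_pos_pos divide_pos_pos) auto
      from less_imp_neq[OF this] show ?case
        unfolding ncg_dens_watson[OF a \<theta> elim(2,1)] \<gamma>_def
        by (intro nonzero_mult_div_cancel_left[symmetric]) (rule not_sym)
    qed
  qed
qed

subsection \<open>The law of the sum as a difference of independent noncentral gamma variables\<close>

definition scaled_dens :: "real \<Rightarrow> real \<Rightarrow> real \<Rightarrow> real \<Rightarrow> ennreal" where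
  "scaled_dens \<kappa> a \<theta> p = ennreal (ncg_dens a \<theta> (p / \<kappa>) / \<kappa>)"

lemma scaled_dens_measurable [measurable]: "scaled_dens \<kappa> a \<theta> \<in> borel_measurable borel"
  unfolding scaled_dens_def[abs_def] by measurable

lemma scaled_dens_eq:
  "a > 0 \<Longrightarrow> \<theta> \<ge> 0 \<Longrightarrow> \<kappa> > 0 \<Longrightarrow> scaled_dens \<kappa> a \<theta> p = ennreal (1 / \<kappa>) * ennreal (ncg_dens a \<theta> (p / \<kappa>))"
  by (simp add: scaled_dens_def ennreal_mult'[symmetric] ncg_dens_nonneg)

lemma nn_integral_scaled_dens:
  assumes "a > 0" "\<theta> \<ge> 0" "\<kappa> > 0"
  shows "(\<integral>\<^sup>+p. scaled_dens \<kappa> a \<theta> p \<partial>lborel) = 1"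
proof -
  have "(\<integral>\<^sup>+p. scaled_dens \<kappa> a \<theta> p \<partial>lborel) = ennreal \<bar>\<kappa>\<bar> * (\<integral>\<^sup>+u. scaled_dens \<kappa> a \<theta> (0 + \<kappa> * u) \<partial>lborel)"
    using assms by (intro nn_integral_real_affine) auto
  also have "\<dots> = ennreal \<kappa> * (ennreal (1 / \<kappa>) * 1)"
    using assms by (simp add: scaled_dens_eq nn_integral_cmult nn_integral_ncg_dens)
  also have "\<dots> = 1" using assms by (simp add: ennreal_mult'[symmetric])
  finally show ?thesis .
qed

lemma scaled_dens_convolution:
  assumes "a > 0" "b > 0" "\<theta> \<ge> 0" "\<mu> \<ge> 0" "\<kappa> > 0"
  shows "(\<integral>\<^sup>+y. scaled_dens \<kappa> a \<theta> (x - y) * scaled_dens \<kappa> b \<mu> y \<partial>lborel) = scaled_dens \<kappa> (a + b) (\<theta> + \<mu>) x"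
proof -
  have "(\<integral>\<^sup>+y. scaled_dens \<kappa> a \<theta> (x - y) * scaled_dens \<kappa> b \<mu> y \<partial>lborel)
      = ennreal \<bar>\<kappa>\<bar> * (\<integral>\<^sup>+u. scaled_dens \<kappa> a \<theta> (x - (0 + \<kappa> * u)) * scaled_dens \<kappa> b \<mu> (0 + \<kappa> * u) \<partial>lborel)"
    using assms by (intro nn_integral_real_affine) auto
  also have "\<dots> = ennreal \<kappa> * (\<integral>\<^sup>+u. ennreal (1 / \<kappa>) * ennreal (1 / \<kappa>) * (ennreal (ncg_dens a \<theta> (x / \<kappa> - u)) * ennreal (ncg_dens b \<mu> u)) \<partial>lborel)"
    using assms by (simp add: scaled_dens_eq diff_divide_distrib mult_ac)
  also have "\<dots> = ennreal \<kappa> * (ennreal (1 / \<kappa>) * ennreal (1 / \<kappa>) * ennreal (ncg_dens (a + b) (\<theta> + \<mu>) (x / \<kappa>)))"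
    using assms by (simp add: nn_integral_cmult ncg_dens_convolution)
  also have "\<dots> = (ennreal \<kappa> * ennreal (1 / \<kappa>)) * scaled_dens \<kappa> (a + b) (\<theta> + \<mu>) x"
    using assms by (simp add: scaled_dens_eq mult_ac)
  also have "ennreal \<kappa> * ennreal (1 / \<kappa>) = 1" using assms by (simp add: ennreal_mult'[symmetric])
  finally show ?thesis by simp
qed

section \<open>The laws of P and - Q and their convolutions\<close>

definition ncg_law :: "real \<Rightarrow> real \<Rightarrow> real \<Rightarrow> real measure" where
  "ncg_law \<kappa> a \<theta> = density lborel (scaled_dens \<kappa> a \<theta>)"

definition neg_ncg_law :: "real \<Rightarrow> real \<Rightarrow> real \<Rightarrow> real measure" where
  "neg_ncg_law \<kappa> a \<theta> = density lborel (\<lambda>y. scaled_dens \<kappa> a \<theta> (- y))"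

lemma nn_integral_uminus:
  "f \<in> borel_measurable borel \<Longrightarrow> (\<integral>\<^sup>+y. f (- y) \<partial>lborel) = (\<integral>\<^sup>+(y::real). f y \<partial>lborel)"
  using nn_integral_real_affine[of f "-1" 0] by simp

lemma sets_ncg_law [simp, measurable_cong]: "sets (ncg_law \<kappa> a \<theta>) = sets borel" "sets (neg_ncg_law \<kappa> a \<theta>) = sets borel"
  by (simp_all add: ncg_law_def neg_ncg_law_def)

lemma finite_ncg_law:
  assumes "a > 0" "\<theta> \<ge> 0" "\<kappa> > 0"
  shows "finite_measure (ncg_law \<kappa> a \<theta>)" "finite_measure (neg_ncg_law \<kappa> a \<theta>)"
proof -
  have "(\<integral>\<^sup>+y. scaled_dens \<kappa> a \<theta> (- y) \<partial>lborel) = 1"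
    using nn_integral_uminus[of "scaled_dens \<kappa> a \<theta>"] nn_integral_scaled_dens[OF assms] by simp
  then show "finite_measure (ncg_law \<kappa> a \<theta>)" "finite_measure (neg_ncg_law \<kappa> a \<theta>)"
    using nn_integral_scaled_dens[OF assms]
    by (auto intro!: finite_measureI simp: ncg_law_def neg_ncg_law_def emeasure_density)
qed

lemma ncg_law_convolution:
  assumes "a > 0" "b > 0" "\<theta> \<ge> 0" "\<mu> \<ge> 0" "\<kappa> > 0"
  shows "convolution (ncg_law \<kappa> a \<theta>) (ncg_law \<kappa> b \<mu>) = ncg_law \<kappa> (a + b) (\<theta> + \<mu>)"
    and "convolution (neg_ncg_law \<kappa> a \<theta>) (neg_ncg_law \<kappa> b \<mu>) = neg_ncg_law \<kappa> (a + b) (\<theta> + \<mu>)"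
proof -
  note f = finite_ncg_law[OF assms(1,3,5)] finite_ncg_law[OF assms(2,4,5)]
  show "convolution (ncg_law \<kappa> a \<theta>) (ncg_law \<kappa> b \<mu>) = ncg_law \<kappa> (a + b) (\<theta> + \<mu>)"
    using f unfolding ncg_law_def by (subst convolution_density) (auto simp: scaled_dens_convolution assms)
  have "(\<integral>\<^sup>+y. scaled_dens \<kappa> a \<theta> (- (x - y)) * scaled_dens \<kappa> b \<mu> (- y) \<partial>lborel) = scaled_dens \<kappa> (a + b) (\<theta> + \<mu>) (- x)" for x
  proof -
    have "(\<integral>\<^sup>+y. scaled_dens \<kappa> a \<theta> (- (x - y)) * scaled_dens \<kappa> b \<mu> (- y) \<partial>lborel) =
      (\<integral>\<^sup>+y. (\<lambda>y. scaled_dens \<kappa> a \<theta> (- x - y) * scaled_dens \<kappa> b \<mu> y) (- y) \<partial>lborel)" by simp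
    also have "\<dots> = (\<integral>\<^sup>+y. scaled_dens \<kappa> a \<theta> (- x - y) * scaled_dens \<kappa> b \<mu> y \<partial>lborel)"
      by (rule nn_integral_uminus) measurable
    finally show ?thesis by (simp add: scaled_dens_convolution assms)
  qed
  then show "convolution (neg_ncg_law \<kappa> a \<theta>) (neg_ncg_law \<kappa> b \<mu>) = neg_ncg_law \<kappa> (a + b) (\<theta> + \<mu>)"
    using f unfolding neg_ncg_law_def by (subst convolution_density) auto
qed

lemma distr_uminus_ncg_law: "distr (ncg_law \<kappa> a \<theta>) borel uminus = neg_ncg_law \<kappa> a \<theta>"
proof (rule measure_eqI)
  fix A assume "A \<in> sets (distr (ncg_law \<kappa> a \<theta>) borel uminus)"
  then have [measurable]: "A \<in> sets borel" by simp
  have "emeasure (distr (ncg_law \<kappa> a \<theta>) borel uminus) A = (\<integral>\<^sup>+p. indicator A (- p) \<partial>ncg_law \<kappa> a \<theta>)"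
    by (subst nn_integral_indicator[symmetric], simp) (subst nn_integral_distr, auto)
  also have "\<dots> = (\<integral>\<^sup>+p. scaled_dens \<kappa> a \<theta> p * indicator A (- p) \<partial>lborel)"
    unfolding ncg_law_def by (subst nn_integral_density) auto
  also have "\<dots> = (\<integral>\<^sup>+p. (\<lambda>p. scaled_dens \<kappa> a \<theta> (- p) * indicator A p) (- p) \<partial>lborel)" by simp
  also have "\<dots> = (\<integral>\<^sup>+p. scaled_dens \<kappa> a \<theta> (- p) * indicator A p \<partial>lborel)"
    by (rule nn_integral_uminus) measurable
  finally show "emeasure (distr (ncg_law \<kappa> a \<theta>) borel uminus) A = emeasure (neg_ncg_law \<kappa> a \<theta>) A"
    by (simp add: neg_ncg_law_def emeasure_density)
qed simp

section \<open>Squares of normal variables and the rotation of the normal pair\<close>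

lemma normal_density_sqrt_half:
  "\<kappa> > 0 \<Longrightarrow> normal_density m (sqrt (\<kappa> / 2)) u = exp (- ((u - m)\<^sup>2 / \<kappa>)) / sqrt (pi * \<kappa>)"
  by (simp add: normal_density_def)

text \<open>Both square roots of p contribute, and the sum of the two normal densities is the cosine
  of \<open>ncg_dens_half\<close>. The standard deviation sqrt (\<kappa> / 2) makes the square
  divided by \<kappa> one half of a noncentral chi-square variable. Equality of the laws is checked
  on distribution functions.\<close>

lemma distr_normal_square:
  assumes \<kappa>: "\<kappa> > 0"
  shows "distr (density lborel (\<lambda>u. ennreal (normal_density m (sqrt (\<kappa> / 2)) u))) borel (\<lambda>u. u\<^sup>2) = ncg_law \<kappa> (1 / 2) (m\<^sup>2 / \<kappa>)"
    (is "?L = ?R")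
proof -
  define nd where "nd = normal_density m (sqrt (\<kappa> / 2))"
  have nd: "nd u = exp (- ((u - m)\<^sup>2 / \<kappa>)) / sqrt (pi * \<kappa>)" for u
    using \<kappa> by (simp add: nd_def normal_density_sqrt_half)
  have nd0: "nd u \<ge> 0" for u by (simp add: nd_def)
  have [measurable]: "nd \<in> borel_measurable borel" by (simp add: nd_def)
  interpret N: prob_space "density lborel (\<lambda>u. ennreal (nd u))"
    unfolding nd_def using \<kappa> by (intro prob_space_normal_density) simp
  interpret L: real_distribution ?L
    unfolding nd_def[symmetric] by (intro real_distribution.intro N.prob_space_distr) (auto simp: real_distribution_axioms_def)
  interpret R: real_distribution ?R
  proof (intro real_distribution.intro prob_spaceI)
    show "emeasure ?R (space ?R) = 1"
      using \<kappa> nn_integral_scaled_dens[of "1/2" "m\<^sup>2 / \<kappa>" \<kappa>] by (simp add: ncg_law_def emeasure_density)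
  qed (auto simp: real_distribution_axioms_def ncg_law_def)
  have em: "emeasure ?L {..x} = emeasure ?R {..x}" for x
  proof (cases "x \<ge> 0")
    case True
    define w where "w = sqrt x"
    have w: "w \<ge> 0" "w\<^sup>2 = x" using True by (auto simp: w_def)
    define k where "k = (\<lambda>p. ncg_dens (1 / 2) (m\<^sup>2 / \<kappa>) (p / \<kappa>) / \<kappa>)"
    have [measurable]: "k \<in> borel_measurable borel" unfolding k_def by measurable
    have k0: "k p \<ge> 0" for p using \<kappa> by (simp add: k_def ncg_dens_nonneg)
    have ku: "k (u\<^sup>2) * (2 * u) = nd u + nd (- u)" if u: "u > 0" for u
    proof -
      have s: "sqrt (m\<^sup>2 / \<kappa> * (u\<^sup>2 / \<kappa>)) = \<bar>m\<bar> * u / \<kappa>"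
        using \<kappa> u by (simp add: real_sqrt_mult real_sqrt_divide)
      have cm: "cosh (2 * (\<bar>m\<bar> * u / \<kappa>)) = cosh (2 * m * u / \<kappa>)" by (cases "m \<ge> 0") auto
      have e: "exp (- (m\<^sup>2 / \<kappa>) - u\<^sup>2 / \<kappa>) * (exp (2 * m * u / \<kappa>) + exp (- (2 * m * u / \<kappa>)))
          = exp (- ((u - m)\<^sup>2 / \<kappa>)) + exp (- ((- u - m)\<^sup>2 / \<kappa>))"
      proof -
        have "- (m\<^sup>2 / \<kappa>) - u\<^sup>2 / \<kappa> + 2 * m * u / \<kappa> = - ((u - m)\<^sup>2 / \<kappa>)"
          "- (m\<^sup>2 / \<kappa>) - u\<^sup>2 / \<kappa> + - (2 * m * u / \<kappa>) = - ((- u - m)\<^sup>2 / \<kappa>)"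
          by (simp_all add: power2_eq_square algebra_simps add_divide_distrib diff_divide_distrib)
        then show ?thesis by (simp only: distrib_left exp_add[symmetric])
      qed
      have "ncg_dens (1 / 2) (m\<^sup>2 / \<kappa>) (u\<^sup>2 / \<kappa>) = exp (- (m\<^sup>2 / \<kappa>) - u\<^sup>2 / \<kappa>) * cosh (2 * m * u / \<kappa>) / sqrt (pi * (u\<^sup>2 / \<kappa>))"
        using ncg_dens_half[of "u\<^sup>2 / \<kappa>" "m\<^sup>2 / \<kappa>"] \<kappa> u unfolding s cm by simp
      also have "cosh (2 * m * u / \<kappa>) = (exp (2 * m * u / \<kappa>) + exp (- (2 * m * u / \<kappa>))) / 2" by (simp add: cosh_field_def)
      also have "sqrt (pi * (u\<^sup>2 / \<kappa>)) = sqrt (pi * \<kappa>) * u / \<kappa>"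
        using \<kappa> u by (simp add: real_sqrt_mult real_sqrt_divide field_simps) 
      finally have "k (u\<^sup>2) * (2 * u) = (exp (- (m\<^sup>2 / \<kappa>) - u\<^sup>2 / \<kappa>) * (exp (2 * m * u / \<kappa>) + exp (- (2 * m * u / \<kappa>)))) / sqrt (pi * \<kappa>)"
        using \<kappa> u by (simp add: k_def)
      then show ?thesis unfolding e by (simp add: nd add_divide_distrib)
    qed
    have "emeasure ?L {..x} = emeasure (density lborel (\<lambda>u. ennreal (nd u))) ((\<lambda>u. u\<^sup>2) -` {..x})"
      unfolding nd_def[symmetric] by (subst emeasure_distr) auto
    also have "(\<lambda>u. u\<^sup>2) -` {..x} = {-w..w}"
    proof (rule set_eqI)
      fix u
      show "u \<in> (\<lambda>u. u\<^sup>2) -` {..x} \<longleftrightarrow> u \<in> {-w..w}"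
        using w abs_le_square_iff[of u w] by (simp add: abs_le_iff) auto
    qed
    also have "emeasure (density lborel (\<lambda>u. ennreal (nd u))) {-w..w} = (\<integral>\<^sup>+u. ennreal (nd u) * indicator {-w..w} u \<partial>lborel)"
      by (rule emeasure_density) auto
    \<comment> \<open>The origin is counted twice on the right, so the integrands agree only almost
      everywhere.\<close>
    also have "\<dots> = (\<integral>\<^sup>+u. ennreal (nd u) * indicator {0..w} u + ennreal (nd u) * indicator {0..w} (- u) \<partial>lborel)"
      by (rule nn_integral_cong_AE, use AE_lborel_singleton[of 0] in eventually_elim) (auto split: split_indicator)
    also have "\<dots> = (\<integral>\<^sup>+u. ennreal (nd u) * indicator {0..w} u \<partial>lborel) + (\<integral>\<^sup>+u. (\<lambda>u. ennreal (nd (- u)) * indicator {0..w} u) (- u) \<partial>lborel)"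
      by (subst nn_integral_add) auto
    also have "(\<integral>\<^sup>+u. (\<lambda>u. ennreal (nd (- u)) * indicator {0..w} u) (- u) \<partial>lborel) = (\<integral>\<^sup>+u. ennreal (nd (- u)) * indicator {0..w} u \<partial>lborel)"
      by (rule nn_integral_uminus) measurable
    also have "(\<integral>\<^sup>+u. ennreal (nd u) * indicator {0..w} u \<partial>lborel) + (\<integral>\<^sup>+u. ennreal (nd (- u)) * indicator {0..w} u \<partial>lborel)
        = (\<integral>\<^sup>+u. ennreal (nd u) * indicator {0..w} u + ennreal (nd (- u)) * indicator {0..w} u \<partial>lborel)"
      by (rule nn_integral_add[symmetric]) auto
    also have "\<dots> = (\<integral>\<^sup>+u. ennreal (k (u\<^sup>2) * (2 * u) * indicator {0..w} u) \<partial>lborel)"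
    proof (rule nn_integral_cong_AE, use AE_lborel_singleton[of 0] in eventually_elim)
      case (elim u)
      then show ?case using ku[of u] nd0[of u] nd0[of "- u"]
        by (auto split: split_indicator simp: ennreal_plus[symmetric] simp del: ennreal_plus)
    qed
    also have "\<dots> = (\<integral>\<^sup>+p. ennreal (k p * indicator {0\<^sup>2..w\<^sup>2} p) \<partial>lborel)"
      by (rule nn_integral_substitution[symmetric])
         (use w in \<open>auto intro!: derivative_eq_intros continuous_intros simp: set_borel_measurable_def\<close>)
    also have "\<dots> = (\<integral>\<^sup>+p. ennreal (k p) * indicator {..x} p \<partial>lborel)"
      by (intro nn_integral_cong) (auto simp: w k_def ncg_dens_nonpos \<kappa> divide_nonpos_pos split: split_indicator)
    also have "\<dots> = emeasure ?R {..x}"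
      by (simp add: ncg_law_def emeasure_density scaled_dens_def[abs_def] k_def)
    finally show ?thesis .
  next
    case False
    have "(\<lambda>u. u\<^sup>2) -` {..x} = {}" using False by (auto simp: not_le) (meson less_le_trans not_less zero_le_power2)
    then have "emeasure ?L {..x} = 0" by (subst emeasure_distr) auto
    moreover have "(\<integral>\<^sup>+p. scaled_dens \<kappa> (1 / 2) (m\<^sup>2 / \<kappa>) p * indicator {..x} p \<partial>lborel) = (\<integral>\<^sup>+(p::real). 0 \<partial>lborel)"
      using False \<kappa> by (intro nn_integral_cong) (auto simp: scaled_dens_def ncg_dens_nonpos divide_nonpos_pos split: split_indicator)
    then have "emeasure ?R {..x} = 0" by (simp add: ncg_law_def emeasure_density)
    ultimately show ?thesis by simp
  qed
  show ?thesis
    by (rule cdf_unique) (auto simp: L.real_distribution_axioms R.real_distribution_axioms cdf_def measure_def em fun_eq_iff)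
qed

text \<open>In the centred coordinates the quadratic form is diagonal, and 1 - \<rho>^2 = (1 +
  \<rho>) (1 - \<rho>) separates it into u'^2 / (1 + \<rho>) and v'^2 / (1 - \<rho>). The factor 2
  \<open>\<sigma>X * \<sigma>Y\<close> is the Jacobian of the map from (u, v) to the pair at which
  the density is taken.\<close>

lemma bivariate_normal_density_rotate:
  assumes "\<sigma>X > 0" "\<sigma>Y > 0" "-1 < \<rho>" "\<rho> < 1"
  shows "2 * (\<sigma>X * \<sigma>Y) * bivariate_normal_density \<mu>X \<mu>Y \<sigma>X \<sigma>Y \<rho> (\<sigma>X * (u + v), \<sigma>Y * (u - v)) =
    normal_density ((\<mu>X / \<sigma>X + \<mu>Y / \<sigma>Y) / 2) (sqrt ((1 + \<rho>) / 2)) u *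
    normal_density ((\<mu>X / \<sigma>X - \<mu>Y / \<sigma>Y) / 2) (sqrt ((1 - \<rho>) / 2)) v"
proof -
  define u' where "u' = u - (\<mu>X / \<sigma>X + \<mu>Y / \<sigma>Y) / 2"
  define v' where "v' = v - (\<mu>X / \<sigma>X - \<mu>Y / \<sigma>Y) / 2"
  have x: "(\<sigma>X * (u + v) - \<mu>X) / \<sigma>X = u' + v'" and y: "(\<sigma>Y * (u - v) - \<mu>Y) / \<sigma>Y = u' - v'"
    using assms by (simp_all add: u'_def v'_def field_simps)
  have r: "1 - \<rho>\<^sup>2 = (1 + \<rho>) * (1 - \<rho>)" by (simp add: power2_eq_square algebra_simps)
  have pos: "1 + \<rho> > 0" "1 - \<rho> > 0" using assms by auto
  have "(u' + v')\<^sup>2 - 2 * \<rho> * (u' + v') * (u' - v') + (u' - v')\<^sup>2 = 2 * ((1 - \<rho>) * u'\<^sup>2 + (1 + \<rho>) * v'\<^sup>2)"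
    by (simp add: power2_eq_square algebra_simps)
  then have "((u' + v')\<^sup>2 - 2 * \<rho> * (u' + v') * (u' - v') + (u' - v')\<^sup>2) / (2 * (1 - \<rho>\<^sup>2))
      = ((1 - \<rho>) * u'\<^sup>2 + (1 + \<rho>) * v'\<^sup>2) / ((1 + \<rho>) * (1 - \<rho>))"
    by (simp only: r mult_divide_mult_cancel_left_if) simp
  also have "\<dots> = u'\<^sup>2 / (1 + \<rho>) + v'\<^sup>2 / (1 - \<rho>)" using pos by (simp add: add_divide_distrib)
  finally have F: "((u' + v')\<^sup>2 - 2 * \<rho> * (u' + v') * (u' - v') + (u' - v')\<^sup>2) / (2 * (1 - \<rho>\<^sup>2)) = u'\<^sup>2 / (1 + \<rho>) + v'\<^sup>2 / (1 - \<rho>)" .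
  have e: "exp (- ((u' + v')\<^sup>2 - 2 * \<rho> * (u' + v') * (u' - v') + (u' - v')\<^sup>2) / (2 * (1 - \<rho>\<^sup>2)))
      = exp (- (u'\<^sup>2 / (1 + \<rho>))) * exp (- (v'\<^sup>2 / (1 - \<rho>)))"
    unfolding minus_divide_left[symmetric] F by (simp only: minus_add_distrib exp_add)
  have b: "bivariate_normal_density \<mu>X \<mu>Y \<sigma>X \<sigma>Y \<rho> (\<sigma>X * (u + v), \<sigma>Y * (u - v)) =
      exp (- (u'\<^sup>2 / (1 + \<rho>))) * exp (- (v'\<^sup>2 / (1 - \<rho>))) / (2 * pi * \<sigma>X * \<sigma>Y * (sqrt (1 + \<rho>) * sqrt (1 - \<rho>)))"
    unfolding bivariate_normal_density_def prod.case x y e unfolding r real_sqrt_mult ..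
  have n: "normal_density ((\<mu>X / \<sigma>X + \<mu>Y / \<sigma>Y) / 2) (sqrt ((1 + \<rho>) / 2)) u = exp (- (u'\<^sup>2 / (1 + \<rho>))) / (sqrt pi * sqrt (1 + \<rho>))"
    "normal_density ((\<mu>X / \<sigma>X - \<mu>Y / \<sigma>Y) / 2) (sqrt ((1 - \<rho>) / 2)) v = exp (- (v'\<^sup>2 / (1 - \<rho>))) / (sqrt pi * sqrt (1 - \<rho>))"
    using pos by (simp_all only: normal_density_sqrt_half u'_def v'_def real_sqrt_mult)
  have "sqrt pi * sqrt pi = pi" by simp
  then show ?thesis unfolding b n using assms by (simp add: mult_ac)
qed

lemma bivariate_normal_density_nonneg:
  assumes "\<sigma>X > 0" "\<sigma>Y > 0" "-1 < \<rho>" "\<rho> < 1"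
  shows "bivariate_normal_density \<mu>X \<mu>Y \<sigma>X \<sigma>Y \<rho> p \<ge> 0"
proof -
  have "1 - \<rho>\<^sup>2 \<ge> 0" using assms by (simp add: abs_square_le_1 abs_le_iff)
  then show ?thesis using assms by (cases p) (simp add: bivariate_normal_density_def)
qed

lemma bivariate_normal_density_measurable [measurable]:
  "(\<lambda>p. bivariate_normal_density \<mu>X \<mu>Y \<sigma>X \<sigma>Y \<rho> p) \<in> borel_measurable (borel \<Otimes>\<^sub>M borel)"
  unfolding bivariate_normal_density_def by measurable

text \<open>The linear change of variables is done one coordinate at a time,
  \<open>x = \<sigma>X * (2 * u - y / \<sigma>Y)\<close> for fixed y and then
  \<open>y = \<sigma>Y * (u - v)\<close> for fixed u. So one-dimensional affine substitutions and
  Fubini's theorem suffice, and the Jacobian appears as the product of 2 \<open>\<sigma>X\<close>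
  and \<open>\<sigma>Y\<close>.\<close>

lemma distr_product_normal:
  assumes "prob_space M" and p: "\<sigma>X > 0" "\<sigma>Y > 0" "-1 < \<rho>" "\<rho> < 1"
    and bn: "bivariate_normal M X Y \<mu>X \<mu>Y \<sigma>X \<sigma>Y \<rho>"
  shows "distr M borel (\<lambda>\<omega>. X \<omega> * Y \<omega> / (\<sigma>X * \<sigma>Y)) =
    convolution (ncg_law (1 + \<rho>) (1 / 2) (((\<mu>X / \<sigma>X + \<mu>Y / \<sigma>Y) / 2)\<^sup>2 / (1 + \<rho>)))
      (neg_ncg_law (1 - \<rho>) (1 / 2) (((\<mu>X / \<sigma>X - \<mu>Y / \<sigma>Y) / 2)\<^sup>2 / (1 - \<rho>)))"
proof (rule measure_eqI)
  interpret prob_space M by fact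
  define s where "s = \<sigma>X * \<sigma>Y"
  have s: "s > 0" using p by (simp add: s_def)
  let ?b = "bivariate_normal_density \<mu>X \<mu>Y \<sigma>X \<sigma>Y \<rho>"
  let ?N1 = "normal_density ((\<mu>X / \<sigma>X + \<mu>Y / \<sigma>Y) / 2) (sqrt ((1 + \<rho>) / 2))"
  let ?N2 = "normal_density ((\<mu>X / \<sigma>X - \<mu>Y / \<sigma>Y) / 2) (sqrt ((1 - \<rho>) / 2))"
  let ?M1 = "density lborel (\<lambda>u. ennreal (?N1 u))" and ?M2 = "density lborel (\<lambda>u. ennreal (?N2 u))"
  let ?L1 = "ncg_law (1 + \<rho>) (1 / 2) (((\<mu>X / \<sigma>X + \<mu>Y / \<sigma>Y) / 2)\<^sup>2 / (1 + \<rho>))"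
  let ?L2 = "ncg_law (1 - \<rho>) (1 / 2) (((\<mu>X / \<sigma>X - \<mu>Y / \<sigma>Y) / 2)\<^sup>2 / (1 - \<rho>))"
  let ?K2 = "neg_ncg_law (1 - \<rho>) (1 / 2) (((\<mu>X / \<sigma>X - \<mu>Y / \<sigma>Y) / 2)\<^sup>2 / (1 - \<rho>))"
  have L1: "distr ?M1 borel (\<lambda>u. u\<^sup>2) = ?L1" using p by (intro distr_normal_square) auto
  have L2: "distr ?M2 borel (\<lambda>u. u\<^sup>2) = ?L2" using p by (intro distr_normal_square) auto
  have D: "distributed M (lborel \<Otimes>\<^sub>M lborel) (\<lambda>\<omega>. (X \<omega>, Y \<omega>)) (\<lambda>z. ennreal (?b z))"
    using bn by (simp add: bivariate_normal_def)
  have rv: "(\<lambda>\<omega>. (X \<omega>, Y \<omega>)) \<in> measurable M (borel \<Otimes>\<^sub>M borel)"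
    using distributed_measurable[OF D] by (simp cong: measurable_cong_sets)
  have X [measurable]: "random_variable borel X" and Y [measurable]: "random_variable borel Y"
    using measurable_compose[OF rv measurable_fst] measurable_compose[OF rv measurable_snd] by simp_all
  fix A assume "A \<in> sets (distr M borel (\<lambda>\<omega>. X \<omega> * Y \<omega> / (\<sigma>X * \<sigma>Y)))"
  then have A [measurable]: "A \<in> sets borel" by simp
  have "emeasure (distr M borel (\<lambda>\<omega>. X \<omega> * Y \<omega> / s)) A = (\<integral>\<^sup>+\<omega>. indicator A (X \<omega> * Y \<omega> / s) \<partial>M)"
    by (subst nn_integral_indicator[symmetric], simp) (subst nn_integral_distr, auto)
  also have "\<dots> = (\<integral>\<^sup>+\<omega>. (\<lambda>(x, y). indicator A (x * y / s)) (X \<omega>, Y \<omega>) \<partial>M)" by simp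
  also have "\<dots> = (\<integral>\<^sup>+z. ennreal (?b z) * (\<lambda>(x, y). indicator A (x * y / s)) z \<partial>(lborel \<Otimes>\<^sub>M lborel))"
    by (rule distributed_nn_integral[OF D, symmetric]) measurable
  also have "\<dots> = (\<integral>\<^sup>+y. (\<integral>\<^sup>+x. ennreal (?b (x, y)) * indicator A (x * y / s) \<partial>lborel) \<partial>lborel)"
    by (subst lborel_pair.nn_integral_snd[symmetric]) auto
  also have "\<dots> = (\<integral>\<^sup>+y. (\<integral>\<^sup>+u. ennreal (2 * \<sigma>X) * (ennreal (?b (\<sigma>X * (2 * u - y / \<sigma>Y), y)) * indicator A (\<sigma>X * (2 * u - y / \<sigma>Y) * y / s)) \<partial>lborel) \<partial>lborel)"
  proof (rule nn_integral_cong)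
    fix y
    have "(\<integral>\<^sup>+x. ennreal (?b (x, y)) * indicator A (x * y / s) \<partial>lborel)
      = ennreal \<bar>2 * \<sigma>X\<bar> * (\<integral>\<^sup>+u. ennreal (?b (- (\<sigma>X * y / \<sigma>Y) + 2 * \<sigma>X * u, y)) * indicator A ((- (\<sigma>X * y / \<sigma>Y) + 2 * \<sigma>X * u) * y / s) \<partial>lborel)"
      using p by (intro nn_integral_real_affine) auto
    moreover have "- (\<sigma>X * y / \<sigma>Y) + 2 * \<sigma>X * u = \<sigma>X * (2 * u - y / \<sigma>Y)" for u
      by (simp add: algebra_simps)
    ultimately show "(\<integral>\<^sup>+x. ennreal (?b (x, y)) * indicator A (x * y / s) \<partial>lborel) =
      (\<integral>\<^sup>+u. ennreal (2 * \<sigma>X) * (ennreal (?b (\<sigma>X * (2 * u - y / \<sigma>Y), y)) * indicator A (\<sigma>X * (2 * u - y / \<sigma>Y) * y / s)) \<partial>lborel)"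
      using p by (subst nn_integral_cmult) auto
  qed
  also have "\<dots> = (\<integral>\<^sup>+u. (\<integral>\<^sup>+y. ennreal (2 * \<sigma>X) * (ennreal (?b (\<sigma>X * (2 * u - y / \<sigma>Y), y)) * indicator A (\<sigma>X * (2 * u - y / \<sigma>Y) * y / s)) \<partial>lborel) \<partial>lborel)"
    by (rule lborel_pair.Fubini') measurable
  also have "\<dots> = (\<integral>\<^sup>+u. (\<integral>\<^sup>+v. ennreal (?N1 u) * (ennreal (?N2 v) * indicator A (u\<^sup>2 + - v\<^sup>2)) \<partial>lborel) \<partial>lborel)"
  proof (rule nn_integral_cong)
    fix u
    let ?f = "\<lambda>y. ennreal (2 * \<sigma>X) * (ennreal (?b (\<sigma>X * (2 * u - y / \<sigma>Y), y)) * indicator A (\<sigma>X * (2 * u - y / \<sigma>Y) * y / s))"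
    have "(\<integral>\<^sup>+y. ?f y \<partial>lborel) = ennreal \<bar>- \<sigma>Y\<bar> * (\<integral>\<^sup>+v. ?f (\<sigma>Y * u + - \<sigma>Y * v) \<partial>lborel)"
      using p by (intro nn_integral_real_affine) auto
    also have "\<dots> = (\<integral>\<^sup>+v. ennreal \<sigma>Y * ?f (\<sigma>Y * (u - v)) \<partial>lborel)"
      using p by (subst nn_integral_cmult) (auto simp: right_diff_distrib)
    also have "\<dots> = (\<integral>\<^sup>+v. ennreal (?N1 u) * (ennreal (?N2 v) * indicator A (u\<^sup>2 + - v\<^sup>2)) \<partial>lborel)"
    proof (rule nn_integral_cong)
      fix v
      have 1: "2 * u - \<sigma>Y * (u - v) / \<sigma>Y = u + v" using p by simp
      have 2: "\<sigma>X * (u + v) * (\<sigma>Y * (u - v)) / s = u\<^sup>2 + - v\<^sup>2"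
        using p by (simp add: s_def power2_eq_square field_simps)
      have "ennreal \<sigma>Y * (ennreal (2 * \<sigma>X) * ennreal (?b (\<sigma>X * (u + v), \<sigma>Y * (u - v)))) = ennreal (2 * (\<sigma>X * \<sigma>Y) * ?b (\<sigma>X * (u + v), \<sigma>Y * (u - v)))"
        using p by (simp add: ennreal_mult'[symmetric] mult_ac bivariate_normal_density_nonneg)
      also have "\<dots> = ennreal (?N1 u) * ennreal (?N2 v)"
        unfolding bivariate_normal_density_rotate[OF p] by (simp add: ennreal_mult')
      finally have "ennreal \<sigma>Y * (ennreal (2 * \<sigma>X) * ennreal (?b (\<sigma>X * (u + v), \<sigma>Y * (u - v)))) = ennreal (?N1 u) * ennreal (?N2 v)" .
      then show "ennreal \<sigma>Y * ?f (\<sigma>Y * (u - v)) = ennreal (?N1 u) * (ennreal (?N2 v) * indicator A (u\<^sup>2 + - v\<^sup>2))"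
        unfolding 1 2 by (simp only: mult.assoc[symmetric])
    qed
    finally show "(\<integral>\<^sup>+y. ?f y \<partial>lborel) = (\<integral>\<^sup>+v. ennreal (?N1 u) * (ennreal (?N2 v) * indicator A (u\<^sup>2 + - v\<^sup>2)) \<partial>lborel)" .
  qed
  also have "\<dots> = (\<integral>\<^sup>+u. ennreal (?N1 u) * (\<integral>\<^sup>+v. indicator A (u\<^sup>2 + - v\<^sup>2) \<partial>?M2) \<partial>lborel)"
    by (intro nn_integral_cong) (simp add: nn_integral_cmult nn_integral_density)
  also have "\<dots> = (\<integral>\<^sup>+u. (\<integral>\<^sup>+v. indicator A (u\<^sup>2 + - v\<^sup>2) \<partial>?M2) \<partial>?M1)"
    by (subst nn_integral_density) (auto simp: nn_integral_density)
  also have "\<dots> = (\<integral>\<^sup>+u. (\<integral>\<^sup>+q. indicator A (u\<^sup>2 + - q) \<partial>?L2) \<partial>?M1)"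
    unfolding L2[symmetric] by (intro nn_integral_cong) (subst nn_integral_distr, auto)
  also have "\<dots> = (\<integral>\<^sup>+u. (\<integral>\<^sup>+q. indicator A (u\<^sup>2 + q) \<partial>?K2) \<partial>?M1)"
    unfolding distr_uminus_ncg_law[symmetric] by (intro nn_integral_cong) (subst nn_integral_distr, auto)
  also have "\<dots> = (\<integral>\<^sup>+p. (\<integral>\<^sup>+q. indicator A (p + q) \<partial>?K2) \<partial>?L1)"
  proof -
    define g :: "real \<Rightarrow> ennreal" where "g = (\<lambda>p. \<integral>\<^sup>+q. indicator A (p + q) \<partial>?K2)"
    interpret K: finite_measure ?K2 using p by (intro finite_ncg_law) auto
    have [measurable]: "g \<in> borel_measurable borel"
      unfolding g_def by (intro K.borel_measurable_nn_integral) measurable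
    have "(\<integral>\<^sup>+p. g p \<partial>distr ?M1 borel (\<lambda>u. u\<^sup>2)) = (\<integral>\<^sup>+u. g (u\<^sup>2) \<partial>?M1)"
      by (rule nn_integral_distr) measurable
    then show ?thesis unfolding L1 by (simp add: g_def)
  qed
  also have "\<dots> = emeasure (convolution ?L1 ?K2) A"
    by (rule convolution_emeasure'[symmetric]) (use p in \<open>auto intro!: finite_ncg_law\<close>)
  finally show "emeasure (distr M borel (\<lambda>\<omega>. X \<omega> * Y \<omega> / (\<sigma>X * \<sigma>Y))) A = emeasure (convolution ?L1 ?K2) A"
    by (simp add: s_def)
qed simp

text \<open>Convolution is commutative and associative, so the positive parts and the negative parts
  can be regrouped; within each group the scale is the same, and shapes and noncentralities add
  up.\<close>

lemma distr_sum_product_normal: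
  assumes "prob_space M" and p: "\<kappa>1 > 0" "\<kappa>2 > 0" "\<theta>1 \<ge> 0" "\<theta>2 \<ge> 0" "n \<ge> 1"
    and ind: "prob_space.indep_vars M (\<lambda>_. borel) Z {1..n}"
    and id: "\<And>i. i \<in> {1..n} \<Longrightarrow> distr M borel (Z i) = convolution (ncg_law \<kappa>1 (1 / 2) \<theta>1) (neg_ncg_law \<kappa>2 (1 / 2) \<theta>2)"
  shows "distr M borel (\<lambda>\<omega>. \<Sum>i=1..n. Z i \<omega>) =
    convolution (ncg_law \<kappa>1 (real n / 2) (real n * \<theta>1)) (neg_ncg_law \<kappa>2 (real n / 2) (real n * \<theta>2))"
proof -
  interpret prob_space M by fact
  have rv [measurable]: "random_variable borel (Z i)" if "i \<in> {1..n}" for i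
    using ind that by (auto simp: indep_vars_def)
  have "distr M borel (\<lambda>\<omega>. \<Sum>i=1..k. Z i \<omega>) =
    convolution (ncg_law \<kappa>1 (real k / 2) (real k * \<theta>1)) (neg_ncg_law \<kappa>2 (real k / 2) (real k * \<theta>2))" if "1 \<le> k" "k \<le> n" for k
    using that
  proof (induction k rule: dec_induct)
    case base
    then show ?case using id[of 1] by simp
  next
    case (step k)
    let ?P = "ncg_law \<kappa>1 (real k / 2) (real k * \<theta>1)" and ?Q = "neg_ncg_law \<kappa>2 (real k / 2) (real k * \<theta>2)"
    let ?P1 = "ncg_law \<kappa>1 (1 / 2) \<theta>1" and ?Q1 = "neg_ncg_law \<kappa>2 (1 / 2) \<theta>2"
    have k: "real k / 2 > 0" "real k * \<theta>1 \<ge> 0" "real k * \<theta>2 \<ge> 0" using step p by auto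
    have fin [simp]: "finite_measure ?P" "finite_measure ?Q" "finite_measure ?P1" "finite_measure ?Q1"
      using p k by (auto intro!: finite_ncg_law)
    have "indep_vars (\<lambda>_. borel) Z (insert (Suc k) {1..k})"
      by (rule indep_vars_subset[OF ind]) (use step in auto)
    then have iv: "indep_var borel (Z (Suc k)) borel (\<lambda>\<omega>. \<Sum>i\<in>{1..k}. Z i \<omega>)"
      by (intro indep_vars_sum) auto
    have "distr M borel (\<lambda>\<omega>. \<Sum>i=1..Suc k. Z i \<omega>) = distr M borel (\<lambda>\<omega>. Z (Suc k) \<omega> + (\<Sum>i=1..k. Z i \<omega>))"
      by (simp add: add.commute)
    also have "\<dots> = convolution (distr M borel (Z (Suc k))) (distr M borel (\<lambda>\<omega>. \<Sum>i=1..k. Z i \<omega>))"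
      using step by (intro sum_indep_random_variable[OF iv]) (auto intro!: borel_measurable_sum rv)
    also have "\<dots> = convolution (convolution ?P1 ?Q1) (convolution ?P ?Q)"
      using step id[of "Suc k"] by simp
    also have "\<dots> = convolution ?P1 (convolution ?Q1 (convolution ?P ?Q))"
      by (rule convolution_associative[symmetric]) (auto intro!: convolution_finite)
    also have "convolution ?Q1 (convolution ?P ?Q) = convolution (convolution ?Q1 ?P) ?Q"
      by (rule convolution_associative) auto
    also have "convolution ?Q1 ?P = convolution ?P ?Q1"
      by (rule convolution_commutative) auto
    also have "convolution (convolution ?P ?Q1) ?Q = convolution ?P (convolution ?Q1 ?Q)"
      by (rule convolution_associative[symmetric]) auto
    also have "convolution ?P1 (convolution ?P (convolution ?Q1 ?Q)) = convolution (convolution ?P1 ?P) (convolution ?Q1 ?Q)"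
      by (rule convolution_associative) (auto intro!: convolution_finite)
    also have "convolution ?P1 ?P = ncg_law \<kappa>1 (1 / 2 + real k / 2) (\<theta>1 + real k * \<theta>1)"
      using p k by (intro ncg_law_convolution) auto
    also have "convolution ?Q1 ?Q = neg_ncg_law \<kappa>2 (1 / 2 + real k / 2) (\<theta>2 + real k * \<theta>2)"
      using p k by (intro ncg_law_convolution) auto
    finally show ?case by (simp add: algebra_simps add_divide_distrib)
  qed
  from this[OF p(5) order_refl] show ?thesis .
qed

section \<open>The density of the difference P - Q\<close>

definition diff_dens :: "real \<Rightarrow> real \<Rightarrow> real \<Rightarrow> real \<Rightarrow> real \<Rightarrow> real \<Rightarrow> ennreal" where
  "diff_dens a \<kappa>1 \<theta>1 \<kappa>2 \<theta>2 y = (\<integral>\<^sup>+q. scaled_dens \<kappa>1 a \<theta>1 (y + q) * scaled_dens \<kappa>2 a \<theta>2 q \<partial>lborel)"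

lemma diff_dens_measurable [measurable]: "diff_dens a \<kappa>1 \<theta>1 \<kappa>2 \<theta>2 \<in> borel_measurable borel"
  unfolding diff_dens_def[abs_def] by measurable

text \<open>A translation of the integration variable by y. It is the symmetry through which the
  left tail is read off from a right tail.\<close>

lemma diff_dens_uminus: "diff_dens a \<kappa>1 \<theta>1 \<kappa>2 \<theta>2 (- y) = diff_dens a \<kappa>2 \<theta>2 \<kappa>1 \<theta>1 y"
proof -
  have "diff_dens a \<kappa>1 \<theta>1 \<kappa>2 \<theta>2 (- y) = ennreal \<bar>1\<bar> * (\<integral>\<^sup>+q. scaled_dens \<kappa>1 a \<theta>1 (- y + (y + 1 * q)) * scaled_dens \<kappa>2 a \<theta>2 (y + 1 * q) \<partial>lborel)"
    unfolding diff_dens_def by (rule nn_integral_real_affine) auto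
  then show ?thesis by (simp add: diff_dens_def mult.commute)
qed

lemma convolution_neg_ncg_law:
  assumes "a > 0" "\<theta>1 \<ge> 0" "\<theta>2 \<ge> 0" "\<kappa>1 > 0" "\<kappa>2 > 0"
  shows "convolution (ncg_law \<kappa>1 a \<theta>1) (neg_ncg_law \<kappa>2 a \<theta>2) = density lborel (diff_dens a \<kappa>1 \<theta>1 \<kappa>2 \<theta>2)"
proof -
  have "(\<integral>\<^sup>+y. scaled_dens \<kappa>1 a \<theta>1 (x - y) * scaled_dens \<kappa>2 a \<theta>2 (- y) \<partial>lborel) = diff_dens a \<kappa>1 \<theta>1 \<kappa>2 \<theta>2 x" for x
    using nn_integral_uminus[of "\<lambda>q. scaled_dens \<kappa>1 a \<theta>1 (x + q) * scaled_dens \<kappa>2 a \<theta>2 q"] by (simp add: diff_dens_def)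
  then show ?thesis
    using finite_ncg_law[OF assms(1,2,4)] finite_ncg_law[OF assms(1,3,5)]
    unfolding ncg_law_def neg_ncg_law_def by (subst convolution_density) auto
qed

subsection \<open>Exponentially tilted moments\<close>

text \<open>Apart from the factor exp z, these are the factorial moments of the Poisson law divided
  by j!.\<close>

lemma exp_moment_choose_sums:
  fixes z :: real
  shows "(\<lambda>r. real (r choose j) * (z ^ r / fact r)) sums (z ^ j / fact j * exp z)"
proof -
  have "(\<lambda>r. z ^ j / fact j * (z ^ r /\<^sub>R fact r)) sums (z ^ j / fact j * exp z)"
    by (intro sums_mult exp_converges)
  also have "(\<lambda>r. z ^ j / fact j * (z ^ r /\<^sub>R fact r)) = (\<lambda>r. real (r + j choose j) * (z ^ (r + j) / fact (r + j)))"
  proof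
    fix r
    have "real (r + j choose j) = fact (r + j) / (fact j * fact r)"
      using binomial_fact[of j "r + j", where 'a = real] by simp
    then show "z ^ j / fact j * (z ^ r /\<^sub>R fact r) = real (r + j choose j) * (z ^ (r + j) / fact (r + j))"
      by (simp add: power_add divide_inverse mult_ac)
  qed
  finally have "(\<lambda>r. real (r choose j) * (z ^ r / fact r)) sums (z ^ j / fact j * exp z + (\<Sum>r<j. real (r choose j) * (z ^ r / fact r)))"
    by (subst (asm) sums_iff_shift) simp
  moreover have "(\<Sum>r<j. real (r choose j) * (z ^ r / fact r)) = 0"
    by (rule sum.neutral) (simp add: binomial_eq_0)
  ultimately show ?thesis by simp
qed

lemma pochhammer_ratio_swap:
  assumes "b > (0::real)"
  shows "pochhammer (b + real k) r / pochhammer b r = pochhammer (b + real r) k / pochhammer b k"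
proof -
  have "pochhammer b (k + r) = pochhammer b k * pochhammer (b + real k) r"
    "pochhammer b (r + k) = pochhammer b r * pochhammer (b + real r) k"
    by (simp_all add: pochhammer_product')
  moreover have "pochhammer b k > 0" "pochhammer b r > 0" using assms by (auto simp: pochhammer_pos)
  ultimately show ?thesis by (simp add: field_simps)
qed

text \<open>Kummer's transformation M(b + k, b, z) = exp z M(- k, b, - z), whose right side
  terminates. Vandermonde's identity expands (b + r)_k in the binomials r choose j, and these have
  the exponential series z^j / j! exp z. The formula turns the Kummer functions of the moments into
  the finite sum of \<open>d_coeff\<close>.\<close>

lemma kummer_M_nat_shift:
  assumes b: "b > 0"
  shows "kummer_M (b + real k) b z = exp z * (\<Sum>j\<le>k. real (k choose j) * (z ^ j / pochhammer b j))"
proof -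
  have v: "pochhammer (b + real r) k = (\<Sum>j\<le>k. fact k / fact (k - j) * pochhammer (b + real j) (k - j) * real (r choose j))" for r
  proof -
    have "pochhammer (b + real r) k / fact k = (real r + (b + real k - 1)) gchoose k"
      using gbinomial_pochhammer'[of "real r + (b + real k - 1)" k] by (simp add: algebra_simps)
    also have "\<dots> = (\<Sum>j=0..k. (real r gchoose j) * ((b + real k - 1) gchoose (k - j)))"
      by (rule gbinomial_Vandermonde[symmetric])
    also have "\<dots> = (\<Sum>j\<le>k. real (r choose j) * (pochhammer (b + real j) (k - j) / fact (k - j)))"
    proof (intro sum.cong)
      fix j assume "j \<in> {..k}"
      then have "b + real k - 1 - real (k - j) + 1 = b + real j" by (simp add: of_nat_diff)
      then show "(real r gchoose j) * ((b + real k - 1) gchoose (k - j)) = real (r choose j) * (pochhammer (b + real j) (k - j) / fact (k - j))"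
        by (simp add: gbinomial_pochhammer' binomial_gbinomial)
    qed auto
    finally show ?thesis by (simp add: divide_eq_eq sum_distrib_right mult_ac sum_distrib_left)
  qed
  have pk: "pochhammer b j > 0" for j using b by (simp add: pochhammer_pos)
  have "(\<lambda>r. \<Sum>j\<le>k. fact k / fact (k - j) * pochhammer (b + real j) (k - j) / pochhammer b k * (real (r choose j) * (z ^ r / fact r)))
      sums (\<Sum>j\<le>k. fact k / fact (k - j) * pochhammer (b + real j) (k - j) / pochhammer b k * (z ^ j / fact j * exp z))"
    by (intro sums_sum sums_mult exp_moment_choose_sums)
  moreover have "(\<Sum>j\<le>k. fact k / fact (k - j) * pochhammer (b + real j) (k - j) / pochhammer b k * (real (r choose j) * (z ^ r / fact r)))
      = pochhammer (b + real k) r / pochhammer b r * (z ^ r / fact r)" for r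
    unfolding pochhammer_ratio_swap[OF b, of k r] v sum_divide_distrib sum_distrib_right
    by (intro sum.cong refl) (simp add: mult_ac)
  moreover have "(\<Sum>j\<le>k. fact k / fact (k - j) * pochhammer (b + real j) (k - j) / pochhammer b k * (z ^ j / fact j * exp z))
      = exp z * (\<Sum>j\<le>k. real (k choose j) * (z ^ j / pochhammer b j))"
    unfolding sum_distrib_left
  proof (intro sum.cong refl)
    fix j assume j: "j \<in> {..k}"
    then have "pochhammer b k = pochhammer b j * pochhammer (b + real j) (k - j)"
      by (simp add: pochhammer_product)
    moreover have "pochhammer (b + real j) (k - j) > 0" using b by (intro pochhammer_pos) auto
    ultimately have "pochhammer (b + real j) (k - j) / pochhammer b k = 1 / pochhammer b j" by simp
    moreover have "real (k choose j) = fact k / (fact j * fact (k - j))" using j by (intro binomial_fact) auto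
    moreover have "fact k / fact (k - j) * pochhammer (b + real j) (k - j) / pochhammer b k * (z ^ j / fact j * exp z)
      = fact k / fact (k - j) * (pochhammer (b + real j) (k - j) / pochhammer b k) * (z ^ j / fact j * exp z)" by simp
    ultimately show "fact k / fact (k - j) * pochhammer (b + real j) (k - j) / pochhammer b k * (z ^ j / fact j * exp z)
      = exp z * (real (k choose j) * (z ^ j / pochhammer b j))"
      by (simp only:) (simp add: field_simps)
  qed
  ultimately show ?thesis by (simp add: kummer_M_def sums_iff)
qed

lemma kummer_M_same: "b > 0 \<Longrightarrow> kummer_M b b z = exp z"
  using kummer_M_nat_shift[of b 0 z] by simp

text \<open>Induction on k through (b + r)_(k+1) = b (b + 1 + r)_k + r (b + 1 + r)_k; the factor r
  is absorbed by the factorial after an index shift.\<close>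

lemma summable_kummer_M_shift:
  assumes "b > 0"
  shows "summable (\<lambda>r. pochhammer (b + real k) r / pochhammer b r * (z ^ r / fact r))"
proof -
  have "summable (\<lambda>r. pochhammer (b + real r) k / pochhammer b k * (z ^ r / fact r))"
  proof -
    define f where "f = (\<lambda>k. \<lambda>r::nat. pochhammer (b + real r) k * (z ^ r / fact r))"
    have "summable (\<lambda>r. pochhammer (b + real r) k * (z ^ r / fact r))" using assms
    proof (induction k arbitrary: b)
      case 0
      show ?case using summable_exp[of z] by (simp add: divide_inverse mult.commute)
    next
      case (Suc k)
      have s1: "summable (\<lambda>r. b * (pochhammer (b + 1 + real r) k * (z ^ r / fact r)))"
        using Suc.IH[of "b + 1"] Suc.prems by (intro summable_mult) auto
      have "summable (\<lambda>r. z * (pochhammer (b + 2 + real r) k * (z ^ r / fact r)))"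
        using Suc.IH[of "b + 2"] Suc.prems by (intro summable_mult) auto
      also have "(\<lambda>r. z * (pochhammer (b + 2 + real r) k * (z ^ r / fact r))) =
          (\<lambda>r. real (Suc r) * (pochhammer (b + 1 + real (Suc r)) k * (z ^ Suc r / fact (Suc r))))"
      proof
        fix r
        have "b + 2 + real r = b + 1 + real (Suc r)" by simp
        moreover have "z ^ Suc r / fact (Suc r) * real (Suc r) = z * (z ^ r / fact r)"
          by (simp add: fact_Suc del: of_nat_Suc)
        moreover have "z * (pochhammer (b + 2 + real r) k * (z ^ r / fact r)) = pochhammer (b + 2 + real r) k * (z * (z ^ r / fact r))"
          by (simp only: mult.left_commute)
        ultimately show "z * (pochhammer (b + 2 + real r) k * (z ^ r / fact r)) =
          real (Suc r) * (pochhammer (b + 1 + real (Suc r)) k * (z ^ Suc r / fact (Suc r)))"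
          by (metis mult.commute mult.assoc)
      qed
      finally have s2: "summable (\<lambda>r. real r * (pochhammer (b + 1 + real r) k * (z ^ r / fact r)))"
        by (subst (asm) summable_Suc_iff[of "\<lambda>r. real r * (pochhammer (b + 1 + real r) k * (z ^ r / fact r))"])
      have "pochhammer (b + real r) (Suc k) * (z ^ r / fact r) =
        b * (pochhammer (b + 1 + real r) k * (z ^ r / fact r)) + real r * (pochhammer (b + 1 + real r) k * (z ^ r / fact r))" for r
        by (simp add: pochhammer_rec algebra_simps)
      then show ?case using summable_add[OF s1 s2] by (simp only:)
    qed
    from summable_mult[OF this, of "1 / pochhammer b k"] show ?thesis by simp
  qed
  then show ?thesis unfolding pochhammer_ratio_swap[OF assms] .
qed

lemma nn_integral_gamma_dens_exp:
  assumes "a > 0" "c \<ge> 0"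
  shows "(\<integral>\<^sup>+u. ennreal (gamma_dens a u * (u ^ i * exp (- (c * u)))) \<partial>lborel) = ennreal (pochhammer a i / (1 + c) powr (a + real i))"
proof -
  have p: "pochhammer a i > 0" using assms by (simp add: pochhammer_pos)
  define K where "K = pochhammer a i / (1 + c) powr (a + real i)"
  have K: "K > 0" using p assms by (simp add: K_def)
  have e: "gamma_dens a u * (u ^ i * exp (- (c * u))) = (1 + c) * K * gamma_dens (a + real i) ((1 + c) * u)" for u
  proof (cases "u > 0")
    case True
    have h1: "gamma_dens a u * u ^ i = pochhammer a i * gamma_dens (a + real i) u"
      using gamma_dens_add_nat[OF assms(1) True, of i] p by simp
    have h2: "gamma_dens (a + real i) u * exp (- (c * u)) = (1 + c) / (1 + c) powr (a + real i) * gamma_dens (a + real i) ((1 + c) * u)"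
    proof -
      have "((1 + c) * u) powr (a + real i - 1) = (1 + c) powr (a + real i) / (1 + c) * u powr (a + real i - 1)"
        using assms True by (simp add: powr_mult powr_diff)
      moreover have "exp (- ((1 + c) * u)) = exp (- u) * exp (- (c * u))" by (simp add: algebra_simps flip: exp_add)
      moreover have "(1 + c) * u > 0" "1 + c > 0" using assms True by auto
      ultimately show ?thesis using True by (simp add: gamma_dens_def)
    qed
    have "gamma_dens a u * (u ^ i * exp (- (c * u))) = (gamma_dens a u * u ^ i) * exp (- (c * u))"
      by (simp only: mult.assoc)
    then have "gamma_dens a u * (u ^ i * exp (- (c * u))) = pochhammer a i * (gamma_dens (a + real i) u * exp (- (c * u)))"
      by (simp only: h1 mult.assoc)
    then show ?thesis unfolding h2 K_def by simp
  next
    case False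
    then have "\<not> 0 < (1 + c) * u" using assms by (simp add: zero_less_mult_iff)
    then show ?thesis using False by (simp add: gamma_dens_def)
  qed
  have "(\<integral>\<^sup>+u. ennreal (gamma_dens a u * (u ^ i * exp (- (c * u)))) \<partial>lborel)
      = ennreal K * (ennreal \<bar>1 + c\<bar> * (\<integral>\<^sup>+u. ennreal (gamma_dens (a + real i) (0 + (1 + c) * u)) \<partial>lborel))"
    unfolding e using assms K gamma_dens_nonneg[of "a + real i"]
    by (simp add: ennreal_mult nn_integral_cmult mult_ac)
  also have "ennreal \<bar>1 + c\<bar> * (\<integral>\<^sup>+u. ennreal (gamma_dens (a + real i) (0 + (1 + c) * u)) \<partial>lborel) = (\<integral>\<^sup>+u. ennreal (gamma_dens (a + real i) u) \<partial>lborel)"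
    using assms by (intro nn_integral_real_affine[symmetric]) auto
  also have "\<dots> = 1" using assms by (simp add: nn_integral_gamma_dens)
  finally show ?thesis by (simp add: K_def)
qed

text \<open>Up to the scale, component k of the mixture has the tilted moment (a + k)_i (\<kappa>1 /
  2) powr (a + k + i). The k-th power of \<kappa>1 / 2 joins \<theta>^k, and (a + k)_i / (a)_i = (a
  + i)_k / (a)_k makes the mixture Kummer's series.\<close>

lemma nn_integral_scaled_dens_tilted:
  assumes "a > 0" "\<theta> \<ge> 0" "\<kappa>1 > 0" "\<kappa>2 > 0" "\<kappa>1 + \<kappa>2 = 2"
  shows "(\<integral>\<^sup>+q. scaled_dens \<kappa>2 a \<theta> q * ennreal (q ^ i * exp (- (q / \<kappa>1))) \<partial>lborel) =
    ennreal ((\<kappa>1 / 2) powr a * exp (- \<theta>) * pochhammer a i * (\<kappa>1 * \<kappa>2 / 2) ^ i * kummer_M (a + real i) a (\<theta> * \<kappa>1 / 2))"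
proof -
  \<comment> \<open>In units of \<kappa>2 the tilt exp (- q / \<kappa>1) is exp (- c u). The sum 2
    of the scales turns 1 + c into 2 / \<kappa>1.\<close>
  define c where "c = \<kappa>2 / \<kappa>1"
  have c: "c \<ge> 0" "1 + c = 2 / \<kappa>1" using assms by (auto simp: c_def field_simps)
  have "(\<integral>\<^sup>+q. scaled_dens \<kappa>2 a \<theta> q * ennreal (q ^ i * exp (- (q / \<kappa>1))) \<partial>lborel)
      = ennreal \<bar>\<kappa>2\<bar> * (\<integral>\<^sup>+u. scaled_dens \<kappa>2 a \<theta> (0 + \<kappa>2 * u) * ennreal ((0 + \<kappa>2 * u) ^ i * exp (- ((0 + \<kappa>2 * u) / \<kappa>1))) \<partial>lborel)"
    using assms by (intro nn_integral_real_affine) auto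
  also have "(\<integral>\<^sup>+u. scaled_dens \<kappa>2 a \<theta> (0 + \<kappa>2 * u) * ennreal ((0 + \<kappa>2 * u) ^ i * exp (- ((0 + \<kappa>2 * u) / \<kappa>1))) \<partial>lborel)
     = (\<integral>\<^sup>+u. ennreal (\<kappa>2 ^ i / \<kappa>2) * (\<Sum>k. ennreal (poisson_weight \<theta> k) * ennreal (gamma_dens (a + real k) u * (u ^ i * exp (- (c * u))))) \<partial>lborel)"
  proof (rule nn_integral_cong)
    fix u :: real
    show "scaled_dens \<kappa>2 a \<theta> (0 + \<kappa>2 * u) * ennreal ((0 + \<kappa>2 * u) ^ i * exp (- ((0 + \<kappa>2 * u) / \<kappa>1))) =
      ennreal (\<kappa>2 ^ i / \<kappa>2) * (\<Sum>k. ennreal (poisson_weight \<theta> k) * ennreal (gamma_dens (a + real k) u * (u ^ i * exp (- (c * u)))))"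
    proof (cases "u > 0")
      case True
      have 1: "ennreal (gamma_dens (a + real k) u * (u ^ i * exp (- (c * u)))) = ennreal (gamma_dens (a + real k) u) * ennreal (u ^ i * exp (- (c * u)))" for k
        using True assms gamma_dens_nonneg by (simp add: ennreal_mult)
      have "(\<Sum>k. ennreal (poisson_weight \<theta> k) * ennreal (gamma_dens (a + real k) u * (u ^ i * exp (- (c * u)))))
          = ennreal (ncg_dens a \<theta> u) * ennreal (u ^ i * exp (- (c * u)))"
        unfolding 1 ennreal_ncg_dens[OF assms(1,2)] by (simp add: mult.assoc[symmetric])
      moreover have "scaled_dens \<kappa>2 a \<theta> (\<kappa>2 * u) = ennreal (1 / \<kappa>2) * ennreal (ncg_dens a \<theta> u)"
        using assms by (simp add: scaled_dens_eq)
      moreover have "ennreal ((\<kappa>2 * u) ^ i * exp (- ((\<kappa>2 * u) / \<kappa>1))) = ennreal (\<kappa>2 ^ i) * ennreal (u ^ i * exp (- (c * u)))"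
        using assms True by (simp add: ennreal_mult[symmetric] power_mult_distrib c_def mult.assoc)
      moreover have "ennreal (\<kappa>2 ^ i / \<kappa>2) = ennreal (1 / \<kappa>2) * ennreal (\<kappa>2 ^ i)"
        using assms by (simp add: ennreal_mult[symmetric])
      ultimately show ?thesis by (simp add: mult_ac)
    next
      case False
      have "ncg_dens a \<theta> u = 0" using False by (intro ncg_dens_nonpos) auto
      moreover have "gamma_dens (a + real k) u = 0" for k using False by (simp add: gamma_dens_def)
      ultimately show ?thesis using assms by (simp add: scaled_dens_def)
    qed
  qed
  also have "\<dots> = ennreal (\<kappa>2 ^ i / \<kappa>2) * (\<Sum>k. ennreal (poisson_weight \<theta> k) * ennreal (pochhammer (a + real k) i / (1 + c) powr (a + real k + real i)))"
    using assms c by (simp add: nn_integral_cmult nn_integral_suminf nn_integral_gamma_dens_exp)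
  also have "(\<Sum>k. ennreal (poisson_weight \<theta> k) * ennreal (pochhammer (a + real k) i / (1 + c) powr (a + real k + real i)))
      = ennreal ((\<kappa>1 / 2) powr a * exp (- \<theta>) * pochhammer a i * (\<kappa>1 / 2) ^ i * kummer_M (a + real i) a (\<theta> * \<kappa>1 / 2))"
  proof -
    define E where "E = (\<kappa>1 / 2) powr a * exp (- \<theta>) * pochhammer a i * (\<kappa>1 / 2) ^ i"
    have E: "E \<ge> 0" using assms by (simp add: E_def pochhammer_pos less_imp_le)
    have t: "ennreal (poisson_weight \<theta> k) * ennreal (pochhammer (a + real k) i / (1 + c) powr (a + real k + real i)) =
      ennreal (E * (pochhammer (a + real i) k / pochhammer a k * ((\<theta> * \<kappa>1 / 2) ^ k / fact k)))" for k
    proof -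
      have "1 / (1 + c) powr (a + real k + real i) = (\<kappa>1 / 2) powr (a + real k + real i)"
        unfolding c(2) using assms by (simp add: powr_divide)
      also have "\<dots> = (\<kappa>1 / 2) powr a * (\<kappa>1 / 2) ^ k * (\<kappa>1 / 2) ^ i" using assms by (simp add: powr_add powr_realpow)
      finally have 1: "pochhammer (a + real k) i / (1 + c) powr (a + real k + real i) =
        pochhammer (a + real k) i * ((\<kappa>1 / 2) powr a * (\<kappa>1 / 2) ^ k * (\<kappa>1 / 2) ^ i)"
        by (simp only: divide_inverse mult_1_left)
      have "pochhammer a i > 0" using assms by (simp add: pochhammer_pos)
      then have 2: "pochhammer (a + real k) i = pochhammer a i * (pochhammer (a + real i) k / pochhammer a k)"
        using pochhammer_ratio_swap[OF assms(1), of i k] by (simp add: field_simps)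
      have 3: "(\<theta> * \<kappa>1 / 2) ^ k = \<theta> ^ k * (\<kappa>1 / 2) ^ k" by (simp add: power_mult_distrib power_divide)
      have "poisson_weight \<theta> k * (pochhammer (a + real k) i / (1 + c) powr (a + real k + real i)) =
         E * (pochhammer (a + real i) k / pochhammer a k * ((\<theta> * \<kappa>1 / 2) ^ k / fact k))"
        unfolding 1 unfolding 2 3 E_def poisson_weight_def by (simp add: mult_ac)
      then show ?thesis using assms by (subst ennreal_mult'[symmetric]) (auto simp: poisson_weight_nonneg)
    qed
    have sm: "summable (\<lambda>k. pochhammer (a + real i) k / pochhammer a k * ((\<theta> * \<kappa>1 / 2) ^ k / fact k))"
      by (rule summable_kummer_M_shift[OF assms(1)])
    have nn: "pochhammer (a + real i) k / pochhammer a k * ((\<theta> * \<kappa>1 / 2) ^ k / fact k) \<ge> 0" for k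
      using assms by (intro mult_nonneg_nonneg divide_nonneg_nonneg) (auto intro!: pochhammer_nonneg)
    have "(\<Sum>k. ennreal (E * (pochhammer (a + real i) k / pochhammer a k * ((\<theta> * \<kappa>1 / 2) ^ k / fact k))))
      = ennreal (\<Sum>k. E * (pochhammer (a + real i) k / pochhammer a k * ((\<theta> * \<kappa>1 / 2) ^ k / fact k)))"
      by (rule suminf_ennreal2[OF mult_nonneg_nonneg[OF E nn] summable_mult[OF sm]])
    also have "(\<Sum>k. E * (pochhammer (a + real i) k / pochhammer a k * ((\<theta> * \<kappa>1 / 2) ^ k / fact k))) = E * kummer_M (a + real i) a (\<theta> * \<kappa>1 / 2)"
      unfolding kummer_M_def using sm by (rule suminf_mult)
    finally show ?thesis unfolding t by (simp add: E_def)
  qed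
  also have "ennreal \<bar>\<kappa>2\<bar> * (ennreal (\<kappa>2 ^ i / \<kappa>2) * ennreal ((\<kappa>1 / 2) powr a * exp (- \<theta>) * pochhammer a i * (\<kappa>1 / 2) ^ i * kummer_M (a + real i) a (\<theta> * \<kappa>1 / 2)))
    = ennreal ((\<kappa>1 / 2) powr a * exp (- \<theta>) * pochhammer a i * (\<kappa>1 * \<kappa>2 / 2) ^ i * kummer_M (a + real i) a (\<theta> * \<kappa>1 / 2))"
  proof -
    have "(\<kappa>1 * \<kappa>2 / 2) ^ i = \<kappa>2 * (\<kappa>2 ^ i / \<kappa>2) * (\<kappa>1 / 2) ^ i"
      using assms by (simp add: power_mult_distrib power_divide)
    then show ?thesis using assms
      by (simp add: ennreal_mult'[symmetric] mult_ac)
  qed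
  finally show ?thesis .
qed

subsection \<open>Tail expansion of the difference\<close>

lemma (in subexp_measure) integrable_tilt_shifted:
  assumes C: "\<And>p. p \<ge> y \<Longrightarrow> \<bar>f p\<bar> \<le> C" and [measurable]: "f \<in> borel_measurable borel" and y: "y \<ge> 1"
  shows "integrable \<nu> (\<lambda>q. tilt \<beta> b q (inverse (sqrt y)) * f (y + q))"
proof (rule Bochner_Integration.integrable_bound)
  have t: "inverse (sqrt y) \<in> {0..1}" using y by (simp add: inverse_le_1_iff)
  have "integrable \<nu> (\<lambda>q. tilt \<beta> b q (inverse (sqrt y)))"
    by (rule integrable_subexp[OF smooth_subexp[OF smooth_tilt[of 0]] t]) measurable
  then show "integrable \<nu> (\<lambda>q. \<bar>C\<bar> * tilt \<beta> b q (inverse (sqrt y)))" by (rule integrable_mult_right)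
  show "AE q in \<nu>. norm (tilt \<beta> b q (inverse (sqrt y)) * f (y + q)) \<le> norm (\<bar>C\<bar> * tilt \<beta> b q (inverse (sqrt y)))"
    using nonneg_AE
  proof eventually_elim
    case (elim q)
    have "\<bar>f (y + q)\<bar> \<le> \<bar>C\<bar>" using C[of "y + q"] elim by auto
    then have "tilt \<beta> b q (inverse (sqrt y)) * \<bar>f (y + q)\<bar> \<le> tilt \<beta> b q (inverse (sqrt y)) * \<bar>C\<bar>"
      by (rule mult_left_mono[OF _ tilt_nonneg])
    moreover have "\<bar>tilt \<beta> b q (inverse (sqrt y))\<bar> = tilt \<beta> b q (inverse (sqrt y))" by (simp add: tilt_nonneg)
    ultimately show ?case by (simp only: real_norm_def abs_mult abs_abs mult.commute)
  qed
qed measurable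

text \<open>Half of the decay dominates the polynomial, by the exponential series; the other half
  dominates exp (K sqrt q), by completing a square.\<close>

lemma subexp_exp_bounded:
  assumes "\<kappa> > (0::real)"
  shows "\<exists>C>0. \<forall>q\<ge>0. (1 + q) ^ M * exp (K * sqrt q) * exp (- (q / \<kappa>)) \<le> C"
proof -
  define c where "c = 1 / (2 * \<kappa>)"
  have c: "c > 0" using assms by (simp add: c_def)
  have "(1 + q) ^ M * exp (K * sqrt q) * exp (- (q / \<kappa>)) \<le> fact M / c ^ M * exp (c + K\<^sup>2 / (4 * c))" if q: "q \<ge> 0" for q
  proof -
    have "(c * (1 + q)) ^ M \<le> fact M * exp (c * (1 + q))" using c q by (intro power_le_fact_exp) auto
    then have "c ^ M * (1 + q) ^ M / c ^ M \<le> fact M * exp (c * (1 + q)) / c ^ M"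
      unfolding power_mult_distrib using c by (intro divide_right_mono) auto
    then have 1: "(1 + q) ^ M \<le> fact M / c ^ M * exp (c * (1 + q))"
      using c by simp
    have "0 \<le> (2 * c * sqrt q - K)\<^sup>2 / (4 * c)" using c by simp
    also have "\<dots> = c * q + K\<^sup>2 / (4 * c) - K * sqrt q"
      using c q by (simp add: field_simps power2_diff) (simp add: power2_eq_square)
    finally have 2: "exp (K * sqrt q) \<le> exp (c * q + K\<^sup>2 / (4 * c))" by simp
    have "(1 + q) ^ M * exp (K * sqrt q) * exp (- (q / \<kappa>)) \<le>
      fact M / c ^ M * exp (c * (1 + q)) * exp (c * q + K\<^sup>2 / (4 * c)) * exp (- (q / \<kappa>))"
      using 1 2 c q by (intro mult_right_mono mult_mono) auto
    also have "\<dots> = fact M / c ^ M * exp (c * (1 + q) + (c * q + K\<^sup>2 / (4 * c)) + - (q / \<kappa>))"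
      by (simp only: exp_add mult.assoc)
    also have "c * (1 + q) + (c * q + K\<^sup>2 / (4 * c)) + - (q / \<kappa>) = c + K\<^sup>2 / (4 * c)"
      by (simp add: c_def algebra_simps add_divide_distrib[symmetric])
    finally show ?thesis .
  qed
  moreover have "fact M / c ^ M * exp (c + K\<^sup>2 / (4 * c)) > 0" using c by simp
  ultimately show ?thesis by blast
qed

text \<open>The law of Q weighted by the factor exp (- q / \<kappa>1) that the move from y to y + q
  splits off. It is left unnormalised; its total mass becomes the constant D of the tail
  results.\<close>

definition tilted_law :: "real \<Rightarrow> real \<Rightarrow> real \<Rightarrow> real \<Rightarrow> real measure" where
  "tilted_law a \<kappa>1 \<kappa>2 \<theta> = density lborel (\<lambda>q. ennreal (ncg_dens a \<theta> (q / \<kappa>2) / \<kappa>2 * exp (- (q / \<kappa>1))))"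

lemma integrable_scaled_ncg_dens:
  assumes "a > 0" "\<theta> \<ge> 0" "\<kappa> > 0"
  shows "integrable lborel (\<lambda>q. ncg_dens a \<theta> (q / \<kappa>) / \<kappa>)"
  using nn_integral_scaled_dens[OF assms] assms
  by (intro integrableI_nonneg) (auto simp: scaled_dens_def ncg_dens_nonneg)

lemma subexp_measure_tilted_law:
  assumes "a > 0" "\<theta> \<ge> 0" "\<kappa>1 > 0" "\<kappa>2 > 0"
  shows "subexp_measure (tilted_law a \<kappa>1 \<kappa>2 \<theta>)"
proof
  have nn: "ncg_dens a \<theta> (q / \<kappa>2) / \<kappa>2 \<ge> 0" for q using assms by (simp add: ncg_dens_nonneg)
  show "sets (tilted_law a \<kappa>1 \<kappa>2 \<theta>) = sets borel" by (simp add: tilted_law_def)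
  have z: "ncg_dens a \<theta> (q / \<kappa>2) = 0" if "q < 0" for q
    using that assms by (intro ncg_dens_nonpos) (simp add: divide_nonpos_pos)
  show "AE q in tilted_law a \<kappa>1 \<kappa>2 \<theta>. q \<ge> 0"
    unfolding tilted_law_def
  proof (subst AE_density, measurable, rule AE_I2, rule impI, rule ccontr)
    fix q assume "0 < ennreal (ncg_dens a \<theta> (q / \<kappa>2) / \<kappa>2 * exp (- (q / \<kappa>1)))" "\<not> 0 \<le> q"
    then show False using z[of q] by simp
  qed
  fix M K
  obtain C where C: "C > 0" "\<And>q. q \<ge> 0 \<Longrightarrow> (1 + q) ^ M * exp (K * sqrt q) * exp (- (q / \<kappa>1)) \<le> C"
    using subexp_exp_bounded[OF assms(3), of M K] by blast
  have "integrable lborel (\<lambda>q. (ncg_dens a \<theta> (q / \<kappa>2) / \<kappa>2 * exp (- (q / \<kappa>1))) * ((1 + q) ^ M * exp (K * sqrt q)))"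
  proof (rule Bochner_Integration.integrable_bound)
    show "integrable lborel (\<lambda>q. C * (ncg_dens a \<theta> (q / \<kappa>2) / \<kappa>2))"
      by (intro integrable_mult_right integrable_scaled_ncg_dens assms)
    show "AE q in lborel. norm ((ncg_dens a \<theta> (q / \<kappa>2) / \<kappa>2 * exp (- (q / \<kappa>1))) * ((1 + q) ^ M * exp (K * sqrt q)))
        \<le> norm (C * (ncg_dens a \<theta> (q / \<kappa>2) / \<kappa>2))"
    proof (rule AE_I2)
      fix q :: real
      show "norm ((ncg_dens a \<theta> (q / \<kappa>2) / \<kappa>2 * exp (- (q / \<kappa>1))) * ((1 + q) ^ M * exp (K * sqrt q)))
        \<le> norm (C * (ncg_dens a \<theta> (q / \<kappa>2) / \<kappa>2))"
      proof (cases "q < 0")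
        case False
        then have q: "q \<ge> 0" by simp
        have "norm ((ncg_dens a \<theta> (q / \<kappa>2) / \<kappa>2 * exp (- (q / \<kappa>1))) * ((1 + q) ^ M * exp (K * sqrt q)))
          = ncg_dens a \<theta> (q / \<kappa>2) / \<kappa>2 * ((1 + q) ^ M * exp (K * sqrt q) * exp (- (q / \<kappa>1)))"
          using q nn[of q] by (simp only: real_norm_def abs_mult abs_of_nonneg abs_exp_cancel power_abs[symmetric] add_nonneg_nonneg zero_le_one zero_le_power mult_ac)
        also have "\<dots> \<le> ncg_dens a \<theta> (q / \<kappa>2) / \<kappa>2 * C" by (intro mult_left_mono C q nn)
        also have "\<dots> = norm (C * (ncg_dens a \<theta> (q / \<kappa>2) / \<kappa>2))"
          using C(1) nn[of q] by (simp only: real_norm_def abs_mult abs_of_nonneg less_imp_le mult.commute)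
        finally show ?thesis .
      qed (simp add: z)
    qed
  qed measurable
  then show "integrable (tilted_law a \<kappa>1 \<kappa>2 \<theta>) (\<lambda>q. (1 + q) ^ M * exp (K * sqrt q))"
    unfolding tilted_law_def using nn
    by (subst integrable_real_density) (auto intro!: AE_I2 mult_nonneg_nonneg simp del: times_divide_eq_left)
qed

lemma tilted_law_moment:
  assumes "a > 0" "\<theta> \<ge> 0" "\<kappa>1 > 0" "\<kappa>2 > 0" "\<kappa>1 + \<kappa>2 = 2"
  shows "(\<integral>q. q ^ i \<partial>tilted_law a \<kappa>1 \<kappa>2 \<theta>) =
    (\<kappa>1 / 2) powr a * exp (- \<theta>) * pochhammer a i * (\<kappa>1 * \<kappa>2 / 2) ^ i * kummer_M (a + real i) a (\<theta> * \<kappa>1 / 2)" (is "_ = ?v")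
proof -
  have nn: "ncg_dens a \<theta> (q / \<kappa>2) / \<kappa>2 \<ge> 0" for q using assms by (simp add: ncg_dens_nonneg)
  have z: "ncg_dens a \<theta> (q / \<kappa>2) = 0" if "q \<le> 0" for q
    using that assms by (intro ncg_dens_nonpos) (simp add: divide_nonpos_pos)
  have M: "kummer_M (a + real i) a (\<theta> * \<kappa>1 / 2) \<ge> 0"
    unfolding kummer_M_def using assms
    by (intro suminf_nonneg summable_kummer_M_shift mult_nonneg_nonneg divide_nonneg_nonneg) (auto intro!: pochhammer_nonneg)
  then have v: "?v \<ge> 0" using assms by (intro mult_nonneg_nonneg) (auto intro!: pochhammer_nonneg)
  have "(\<integral>q. q ^ i \<partial>tilted_law a \<kappa>1 \<kappa>2 \<theta>) = (\<integral>q. (ncg_dens a \<theta> (q / \<kappa>2) / \<kappa>2 * exp (- (q / \<kappa>1))) * q ^ i \<partial>lborel)"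
    unfolding tilted_law_def using nn
    by (subst integral_real_density) (auto intro!: AE_I2 mult_nonneg_nonneg simp del: times_divide_eq_left)
  also have "\<dots> = ?v"
  proof (rule has_bochner_integral_integral_eq, rule has_bochner_integral_nn_integral)
    have p: "0 \<le> (ncg_dens a \<theta> (q / \<kappa>2) / \<kappa>2 * exp (- (q / \<kappa>1))) * q ^ i" for q
    proof (cases "q > 0")
      case True
      then show ?thesis by (intro mult_nonneg_nonneg nn) auto
    qed (simp add: z)
    then show "AE q in lborel. 0 \<le> (ncg_dens a \<theta> (q / \<kappa>2) / \<kappa>2 * exp (- (q / \<kappa>1))) * q ^ i" by simp
    have "(\<integral>\<^sup>+q. ennreal ((ncg_dens a \<theta> (q / \<kappa>2) / \<kappa>2 * exp (- (q / \<kappa>1))) * q ^ i) \<partial>lborel) =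
      (\<integral>\<^sup>+q. scaled_dens \<kappa>2 a \<theta> q * ennreal (q ^ i * exp (- (q / \<kappa>1))) \<partial>lborel)"
    proof (rule nn_integral_cong)
      fix q
      show "ennreal ((ncg_dens a \<theta> (q / \<kappa>2) / \<kappa>2 * exp (- (q / \<kappa>1))) * q ^ i) = scaled_dens \<kappa>2 a \<theta> q * ennreal (q ^ i * exp (- (q / \<kappa>1)))"
        unfolding scaled_dens_def using nn[of q] by (subst ennreal_mult'[symmetric]) (simp_all only: mult_ac)
    qed
    also have "\<dots> = ennreal ?v" by (rule nn_integral_scaled_dens_tilted[OF assms])
    finally show "(\<integral>\<^sup>+q. ennreal ((ncg_dens a \<theta> (q / \<kappa>2) / \<kappa>2 * exp (- (q / \<kappa>1))) * q ^ i) \<partial>lborel) = ennreal ?v" .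
  qed (use v in auto)
  finally show ?thesis .
qed

text \<open>With t = 1 / sqrt y and R = sqrt (1 + q t^2), the identity R^2 - 1 = q t^2 gives sqrt (y
  + q) = sqrt y + q t / (R + 1). This is an exact formula, and the reason why the Puiseux
  coefficients enter.\<close>

lemma dens_add:
  assumes "y > 0" "q \<ge> 0"
  shows "dens \<beta> b \<kappa> (y + q) = dens \<beta> b \<kappa> y * (tilt \<beta> b q (inverse (sqrt y)) * exp (- (q / \<kappa>)))"
proof -
  define t where "t = inverse (sqrt y)"
  have t: "t > 0" using assms by (simp add: t_def)
  have yq: "y + q = y * (1 + q * t\<^sup>2)" using assms by (simp add: t_def power_inverse field_simps)
  define R where "R = sqrt (1 + q * t\<^sup>2)"
  have pos: "1 + q * t\<^sup>2 > 0" using assms by (simp add: add_pos_nonneg)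
  then have R: "R > 0" "R * R = 1 + q * t\<^sup>2" by (simp_all add: R_def)
  have "(y + q) powr \<beta> = y powr \<beta> * (1 + q * t\<^sup>2) powr \<beta>"
    unfolding yq using assms pos by (simp add: powr_mult)
  moreover have "b * sqrt (y + q) - (y + q) / \<kappa> = (b * sqrt y - y / \<kappa>) + b * (q * t / (R + 1)) + - (q / \<kappa>)"
  proof -
    have "(R - 1) * (R + 1) = q * t * t" using R(2) by (simp add: algebra_simps power2_eq_square)
    then have "R - 1 = q * t * t / (R + 1)" using R(1) by (intro eq_divide_imp) auto
    then have "sqrt y * (R - 1) = sqrt y * t * (q * t / (R + 1))" by (simp only:) (simp add: mult_ac)
    then have "sqrt y * R - sqrt y = sqrt y * t * (q * t / (R + 1))" by (simp only: right_diff_distrib mult_1_right)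
    moreover have "sqrt y * t = 1" using assms by (simp add: t_def)
    moreover have "sqrt (y + q) = sqrt y * R" unfolding yq R_def by (rule real_sqrt_mult)
    ultimately have "sqrt (y + q) = sqrt y + q * t / (R + 1)" by simp
    then show ?thesis by (simp only: add_divide_distrib distrib_left)
  qed
  ultimately show ?thesis
    unfolding dens_def tilt_def t_def[symmetric] R_def[symmetric] by (simp only: exp_add mult_ac)
qed

text \<open>The density at y is K times the model density times B y, the average over the tilted law
  of the tilt times the correction r (y + q). \<open>asy_average\<close> expands B and
  \<open>asy_set_integral_dens\<close> its tail integral. The sign of W belongs to the conclusion
  because the equality is stated in \<open>ennreal\<close> and has to be carried over to real
  numbers.\<close>

lemma diff_dens_tail_expansion:
  assumes a: "a > 0" "\<theta>1 \<ge> 0" "\<theta>2 \<ge> 0" "\<kappa>1 > 0" "\<kappa>2 > 0" "\<kappa>1 + \<kappa>2 = 2" and K: "K > 0" and m: "m \<ge> 0"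
    and r: "asy r A" and [measurable]: "r \<in> borel_measurable borel"
    and fP: "\<And>p. p > 0 \<Longrightarrow> ncg_dens a \<theta>1 (p / \<kappa>1) / \<kappa>1 = K * dens \<beta> (2 * m / \<kappa>1) \<kappa>1 p * r p"
  defines "\<mu> \<equiv> \<lambda>i. (\<kappa>1 / 2) powr a * exp (- \<theta>2) * pochhammer a i * (\<kappa>1 * \<kappa>2 / 2) ^ i * kummer_M (a + real i) a (\<theta>2 * \<kappa>1 / 2)"
  defines "c \<equiv> \<lambda>l. \<Sum>j\<le>l. A j * (\<Sum>i = nat \<lceil>real (l - j) / 2\<rceil>..l - j. g_coeff i (l - j) (\<beta> - real j / 2) (2 * m / \<kappa>1) * \<mu> i)"
  obtains W where "asy W (\<lambda>p. \<Sum>l\<le>p. c l * tail_coeff (\<beta> - real l / 2) m \<kappa>1 (p - l))"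
    and "\<forall>\<^sub>F x in at_top. (\<integral>\<^sup>+y. diff_dens a \<kappa>1 \<theta>1 \<kappa>2 \<theta>2 y * indicator {x..} y \<partial>lborel) = ennreal (K * \<kappa>1 * dens \<beta> (2 * m / \<kappa>1) \<kappa>1 x * W x) \<and> W x \<ge> 0"
proof -
  define b where "b = 2 * m / \<kappa>1"
  define \<nu> where "\<nu> = tilted_law a \<kappa>1 \<kappa>2 \<theta>2"
  interpret subexp_measure \<nu> unfolding \<nu>_def using a by (intro subexp_measure_tilted_law)
  define B where "B = (\<lambda>y. \<integral>q. tilt \<beta> b q (inverse (sqrt y)) * r (y + q) \<partial>\<nu>)"
  have mu: "(\<integral>q. q ^ i \<partial>\<nu>) = \<mu> i" for i unfolding \<nu>_def \<mu>_def using a by (intro tilted_law_moment)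
  have B: "asy B c" using asy_average[OF r, of \<beta> b] unfolding B_def c_def mu b_def by simp
  \<comment> \<open>Measurability of the parameter integral B asks for a sigma-finite measure;
    integrability of the moment of order 0 gives finiteness.\<close>
  have sf: "sigma_finite_measure \<nu>"
  proof -
    have "integrable \<nu> (\<lambda>q. 1 :: real)" using integrable_power[of 0] by simp
    then have "emeasure \<nu> (space \<nu>) \<noteq> \<infinity>" by (auto simp: integrable_iff_bounded)
    then interpret finite_measure \<nu> by (intro finite_measureI) auto
    show ?thesis by unfold_locales
  qed
  interpret sigma_finite_measure \<nu> by (rule sf)
  have Bm: "B \<in> borel_measurable borel"
    unfolding B_def tilt_def by measurable
  obtain C0 where C0: "C0 > 0" "\<forall>\<^sub>F x in at_top. norm (r x) \<le> C0 * norm (1::real)"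
    using asy_bounded[OF r] by (rule landau_o.bigE)
  from C0(2) obtain y0 where y0: "y0 \<ge> 1" "\<And>x. x \<ge> y0 \<Longrightarrow> norm (r x) \<le> C0 * norm (1::real)"
    by (rule eventually_at_top_ge_oneE) blast
  \<comment> \<open>The correction inherits its sign from the density of P, since the model density
    and K are positive.\<close>
  have r0: "r p \<ge> 0" if "p > 0" for p
  proof -
    have "0 \<le> K * dens \<beta> b \<kappa>1 p * r p"
      using fP[OF that] a unfolding b_def[symmetric] by (metis ncg_dens_nonneg divide_nonneg_pos)
    moreover have "K * dens \<beta> b \<kappa>1 p > 0" using K dens_pos[OF that] by simp
    ultimately show ?thesis by (simp add: zero_le_mult_iff)
  qed
  have dd: "diff_dens a \<kappa>1 \<theta>1 \<kappa>2 \<theta>2 y = ennreal (K * (dens \<beta> b \<kappa>1 y * B y))" and B0: "B y \<ge> 0" if y: "y \<ge> y0" for y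
  proof -
    have yp: "y > 0" "y \<ge> 1" using y y0 by auto
    define T where "T = (\<lambda>q. tilt \<beta> b q (inverse (sqrt y)) * r (y + q))"
    have Ti: "integrable \<nu> T" unfolding T_def
      by (rule integrable_tilt_shifted[where C = C0]) (use y0(2) y yp in \<open>auto intro: order_trans[OF y0(2)[simplified]]\<close>)
    have T0: "AE q in \<nu>. 0 \<le> T q"
      using nonneg_AE by eventually_elim (use yp in \<open>auto simp: T_def intro!: mult_nonneg_nonneg tilt_nonneg r0\<close>)
    show "B y \<ge> 0" unfolding B_def T_def[symmetric] by (rule integral_nonneg_AE[OF T0])
    have "diff_dens a \<kappa>1 \<theta>1 \<kappa>2 \<theta>2 y = (\<integral>\<^sup>+q. ennreal (K * dens \<beta> b \<kappa>1 y) * (ennreal (ncg_dens a \<theta>2 (q / \<kappa>2) / \<kappa>2 * exp (- (q / \<kappa>1))) * ennreal (T q)) \<partial>lborel)"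
      unfolding diff_dens_def
    proof (rule nn_integral_cong)
      fix q :: real
      show "scaled_dens \<kappa>1 a \<theta>1 (y + q) * scaled_dens \<kappa>2 a \<theta>2 q =
        ennreal (K * dens \<beta> b \<kappa>1 y) * (ennreal (ncg_dens a \<theta>2 (q / \<kappa>2) / \<kappa>2 * exp (- (q / \<kappa>1))) * ennreal (T q))"
      proof (cases "q > 0")
        case True
        have q: "y + q > 0" "q \<ge> 0" using True yp by auto
        have k2: "ncg_dens a \<theta>2 (q / \<kappa>2) / \<kappa>2 \<ge> 0" using a by (simp add: ncg_dens_nonneg)
        have Tq: "T q \<ge> 0" using q by (auto simp: T_def intro!: mult_nonneg_nonneg tilt_nonneg r0)
        have Kd: "K * dens \<beta> b \<kappa>1 y \<ge> 0" using K by (simp add: dens_nonneg)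
        have "ncg_dens a \<theta>1 ((y + q) / \<kappa>1) / \<kappa>1 * (ncg_dens a \<theta>2 (q / \<kappa>2) / \<kappa>2) =
          K * dens \<beta> b \<kappa>1 y * (ncg_dens a \<theta>2 (q / \<kappa>2) / \<kappa>2 * exp (- (q / \<kappa>1)) * T q)"
          unfolding fP[OF q(1)] b_def[symmetric] dens_add[OF yp(1) q(2)] T_def by (simp only: mult_ac)
        moreover have "ncg_dens a \<theta>1 ((y + q) / \<kappa>1) / \<kappa>1 \<ge> 0" using a by (simp add: ncg_dens_nonneg)
        ultimately show ?thesis using k2 Tq Kd unfolding scaled_dens_def
          by (simp only: ennreal_mult[symmetric] mult_nonneg_nonneg exp_ge_zero)
      next
        case False
        then have "ncg_dens a \<theta>2 (q / \<kappa>2) = 0" using a by (intro ncg_dens_nonpos) (simp add: divide_nonpos_pos)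
        then show ?thesis by (simp add: scaled_dens_def)
      qed
    qed
    also have "\<dots> = ennreal (K * dens \<beta> b \<kappa>1 y) * (\<integral>\<^sup>+q. ennreal (ncg_dens a \<theta>2 (q / \<kappa>2) / \<kappa>2 * exp (- (q / \<kappa>1))) * ennreal (T q) \<partial>lborel)"
      unfolding T_def by (rule nn_integral_cmult) measurable
    also have "(\<integral>\<^sup>+q. ennreal (ncg_dens a \<theta>2 (q / \<kappa>2) / \<kappa>2 * exp (- (q / \<kappa>1))) * ennreal (T q) \<partial>lborel) = (\<integral>\<^sup>+q. ennreal (T q) \<partial>\<nu>)"
      unfolding \<nu>_def tilted_law_def T_def by (rule nn_integral_density[symmetric]) measurable
    also have "\<dots> = ennreal (B y)" unfolding B_def T_def[symmetric] by (rule nn_integral_eq_integral[OF Ti T0])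
    also have "ennreal (K * dens \<beta> b \<kappa>1 y) * ennreal (B y) = ennreal (K * (dens \<beta> b \<kappa>1 y * B y))"
      using K dens_nonneg[of \<beta> b \<kappa>1 y] by (subst ennreal_mult'[symmetric]) (auto simp: mult_ac)
    finally show "diff_dens a \<kappa>1 \<theta>1 \<kappa>2 \<theta>2 y = ennreal (K * (dens \<beta> b \<kappa>1 y * B y))" .
  qed
  define W where "W = (\<lambda>x. (LBINT y:{x..}. dens \<beta> b \<kappa>1 y * B y) / (\<kappa>1 * dens \<beta> b \<kappa>1 x))"
  show ?thesis
  proof
    show "asy W (\<lambda>p. \<Sum>l\<le>p. c l * tail_coeff (\<beta> - real l / 2) m \<kappa>1 (p - l))"
      unfolding W_def b_def by (rule asy_set_integral_dens(1)[OF a(4) m B Bm])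
    have int: "\<forall>\<^sub>F x in at_top. set_integrable lborel {x..} (\<lambda>y. dens \<beta> b \<kappa>1 y * B y)"
      unfolding b_def by (rule asy_set_integral_dens(2)[OF a(4) m B Bm])
    then show "\<forall>\<^sub>F x in at_top. (\<integral>\<^sup>+y. diff_dens a \<kappa>1 \<theta>1 \<kappa>2 \<theta>2 y * indicator {x..} y \<partial>lborel) = ennreal (K * \<kappa>1 * dens \<beta> (2 * m / \<kappa>1) \<kappa>1 x * W x) \<and> W x \<ge> 0"
      unfolding b_def[symmetric] using eventually_ge_at_top[of y0]
    proof eventually_elim
      case (elim x)
      have "(\<integral>\<^sup>+y. diff_dens a \<kappa>1 \<theta>1 \<kappa>2 \<theta>2 y * indicator {x..} y \<partial>lborel) = (\<integral>\<^sup>+y. ennreal (indicator {x..} y *\<^sub>R (K * (dens \<beta> b \<kappa>1 y * B y))) \<partial>lborel)"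
        by (intro nn_integral_cong) (use elim dd in \<open>auto split: split_indicator\<close>)
      also have "\<dots> = ennreal (LBINT y:{x..}. K * (dens \<beta> b \<kappa>1 y * B y))"
        unfolding set_lebesgue_integral_def
      proof (rule nn_integral_eq_integral)
        show "integrable lborel (\<lambda>y. indicator {x..} y *\<^sub>R (K * (dens \<beta> b \<kappa>1 y * B y)))"
          using set_integrable_mult_right[OF elim(1), of K] by (simp add: set_integrable_def)
        show "AE y in lborel. 0 \<le> indicator {x..} y *\<^sub>R (K * (dens \<beta> b \<kappa>1 y * B y))"
          by (rule AE_I2) (use elim(2) B0 K dens_nonneg in \<open>auto split: split_indicator intro!: mult_nonneg_nonneg\<close>)
      qed
      also have "(LBINT y:{x..}. K * (dens \<beta> b \<kappa>1 y * B y)) = K * \<kappa>1 * dens \<beta> b \<kappa>1 x * W x"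
      proof -
        have "dens \<beta> b \<kappa>1 x > 0" using elim(2) y0(1) by (intro dens_pos) auto
        then show ?thesis using a by (simp add: W_def)
      qed
      finally have "(\<integral>\<^sup>+y. diff_dens a \<kappa>1 \<theta>1 \<kappa>2 \<theta>2 y * indicator {x..} y \<partial>lborel) = ennreal (K * \<kappa>1 * dens \<beta> b \<kappa>1 x * W x)" .
      moreover have "(LBINT y:{x..}. dens \<beta> b \<kappa>1 y * B y) \<ge> 0"
        unfolding set_lebesgue_integral_def
        by (rule Bochner_Integration.integral_nonneg) (use elim(2) B0 dens_nonneg in \<open>auto split: split_indicator intro!: mult_nonneg_nonneg\<close>)
      then have "W x \<ge> 0" unfolding W_def using a dens_nonneg by (intro divide_nonneg_nonneg mult_nonneg_nonneg) auto
      ultimately show ?case by blast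
    qed
  qed
qed

subsection \<open>The expansions of the two tails\<close>

lemma asy_scale:
  assumes f: "asy f A" and \<kappa>: "\<kappa> > 0"
  shows "asy (\<lambda>x. f (x / \<kappa>)) (\<lambda>m. A m * sqrt \<kappa> ^ m)"
  unfolding asy_def
proof
  fix N
  obtain C where C: "\<forall>\<^sub>F x in at_top. norm (f x - (\<Sum>l<N. A l * inverse (sqrt x) ^ l)) \<le> C * norm (inverse (sqrt x) ^ N)"
    using asyD[OF f, of N] by (rule landau_o.bigE)
  have "filterlim (\<lambda>x. x / \<kappa>) at_top at_top" using \<kappa> by real_asymp
  from eventually_compose_filterlim[OF C this]
  have *: "\<forall>\<^sub>F x in at_top. norm (f (x / \<kappa>) - (\<Sum>l<N. A l * inverse (sqrt (x / \<kappa>)) ^ l)) \<le> C * norm (inverse (sqrt (x / \<kappa>)) ^ N)" .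
  have i: "inverse (sqrt (x / \<kappa>)) ^ l = sqrt \<kappa> ^ l * inverse (sqrt x) ^ l" for x l
  proof -
    have "inverse (sqrt (x / \<kappa>)) = inverse (sqrt x / sqrt \<kappa>)" by (simp only: real_sqrt_divide)
    also have "\<dots> = sqrt \<kappa> * inverse (sqrt x)" by (simp add: divide_inverse mult.commute)
    finally show ?thesis by (simp only: power_mult_distrib)
  qed
  show "(\<lambda>x. f (x / \<kappa>) - (\<Sum>l<N. A l * sqrt \<kappa> ^ l * inverse (sqrt x) ^ l)) \<in> O(\<lambda>x. inverse (sqrt x) ^ N)"
  proof (rule bigoI[of _ "C * sqrt \<kappa> ^ N"])
    show "\<forall>\<^sub>F x in at_top. norm (f (x / \<kappa>) - (\<Sum>l<N. A l * sqrt \<kappa> ^ l * inverse (sqrt x) ^ l)) \<le> C * sqrt \<kappa> ^ N * norm (inverse (sqrt x) ^ N)"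
      using * unfolding i
    proof eventually_elim
      case (elim x)
      then show ?case using \<kappa> by (simp only: mult.assoc norm_mult norm_power) simp
    qed
  qed
qed

lemma poincare_expansion_at_top:
  assumes W: "asy W a" and s: "s > 0" and G: "\<forall>\<^sub>F x in at_top. G x = \<phi> x * W (x / s)"
  shows "poincare_expansion G \<phi> (\<lambda>p. a p * s powr (real p / 2)) (1 / 2) at_top"
  unfolding poincare_expansion_def
proof (intro allI impI)
  fix N :: nat
  have e: "inverse (sqrt x) ^ l = \<bar>x\<bar> powr (- (real l * (1 / 2)))" if "x > 0" for x l
    using that by (simp add: powr_minus powr_half_sqrt[symmetric] powr_power power_inverse mult.commute)
  have sp: "sqrt s ^ l = s powr (real l / 2)" for l
    using s by (simp add: powr_half_sqrt[symmetric] powr_power mult.commute)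
  define R where "R = (\<lambda>x. W (x / s) - (\<Sum>l<N. a l * sqrt s ^ l * inverse (sqrt x) ^ l))"
  have R: "R \<in> O(\<lambda>x. inverse (sqrt x) ^ N)"
    unfolding R_def using asyD[OF asy_scale[OF W s], of N] .
  have "R \<in> O(\<lambda>x. \<bar>x\<bar> powr (- (real N * (1 / 2))))"
  proof -
    have "\<forall>\<^sub>F x in at_top. inverse (sqrt x) ^ N = \<bar>x\<bar> powr (- (real N * (1 / 2)))"
      using eventually_gt_at_top[of 0] by eventually_elim (rule e)
    from landau_o.big.cong[OF this] R show ?thesis by simp
  qed
  moreover have "\<forall>\<^sub>F x in at_top. G x = \<phi> x * ((\<Sum>l<N. a l * s powr (real l / 2) * \<bar>x\<bar> powr (- (real l * (1 / 2)))) + R x)"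
    using G eventually_gt_at_top[of 0]
  proof eventually_elim
    case (elim x)
    have "W (x / s) = (\<Sum>l<N. a l * s powr (real l / 2) * \<bar>x\<bar> powr (- (real l * (1 / 2)))) + R x"
      unfolding R_def sp e[OF elim(2)] by simp
    then show ?case using elim(1) by simp
  qed
  ultimately show "\<exists>R. R \<in> O(\<lambda>x. \<bar>x\<bar> powr (- (real N * (1 / 2)))) \<and>
      (\<forall>\<^sub>F x in at_top. G x = \<phi> x * ((\<Sum>l<N. a l * s powr (real l / 2) * \<bar>x\<bar> powr (- (real l * (1 / 2)))) + R x))"
    by blast
qed

lemma poincare_expansion_at_bot:
  assumes "poincare_expansion (\<lambda>x. G (- x)) (\<lambda>x. \<phi> (- x)) a \<kappa> at_top"
  shows "poincare_expansion G \<phi> a \<kappa> at_bot"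
  unfolding poincare_expansion_def
proof (intro allI impI)
  fix N :: nat assume "N \<ge> 1"
  then obtain R where R: "R \<in> O(\<lambda>x. \<bar>x\<bar> powr (- (real N * \<kappa>)))"
      "\<forall>\<^sub>F x in at_top. G (- x) = \<phi> (- x) * ((\<Sum>l<N. a l * \<bar>x\<bar> powr (- (real l * \<kappa>))) + R x)"
    using assms unfolding poincare_expansion_def by blast
  have f: "filterlim (uminus :: real \<Rightarrow> real) at_top at_bot" by (rule filterlim_uminus_at_top_at_bot)
  have "(\<lambda>x. R (- x)) \<in> O[at_bot](\<lambda>x. \<bar>- x\<bar> powr (- (real N * \<kappa>)))"
    by (rule landau_o.big.compose[OF R(1) f])
  then have "(\<lambda>x. R (- x)) \<in> O[at_bot](\<lambda>x. \<bar>x\<bar> powr (- (real N * \<kappa>)))" by simp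
  moreover have "\<forall>\<^sub>F x in at_bot. G (- (- x)) = \<phi> (- (- x)) * ((\<Sum>l<N. a l * \<bar>- x\<bar> powr (- (real l * \<kappa>))) + R (- x))"
    by (rule eventually_compose_filterlim[OF R(2) f])
  ultimately show "\<exists>R. R \<in> O[at_bot](\<lambda>x. \<bar>x\<bar> powr (- (real N * \<kappa>))) \<and>
      (\<forall>\<^sub>F x in at_bot. G x = \<phi> x * ((\<Sum>l<N. a l * \<bar>x\<bar> powr (- (real l * \<kappa>))) + R x))"
    by (intro exI[of _ "\<lambda>x. R (- x)"]) simp
qed

text \<open>Order N in 1 / x is order 2 N in 1 / sqrt x, and the vanishing odd coefficients leave N
  terms of the longer sum.\<close>

lemma poincare_expansion_even:
  assumes P: "poincare_expansion G \<phi> (\<lambda>p. a p * s powr (real p / 2)) (1 / 2) L" and s: "s > 0"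
    and odd: "\<And>k. a (2 * k + 1) = 0"
  shows "poincare_expansion G \<phi> (\<lambda>k. a (2 * k) * s ^ k) 1 L"
  unfolding poincare_expansion_def
proof (intro allI impI)
  fix N :: nat assume "N \<ge> 1"
  then have "2 * N \<ge> 1" by simp
  then obtain R where R: "R \<in> O[L](\<lambda>x. \<bar>x\<bar> powr (- (real (2 * N) * (1 / 2))))"
      "\<forall>\<^sub>F x in L. G x = \<phi> x * ((\<Sum>l<2 * N. a l * s powr (real l / 2) * \<bar>x\<bar> powr (- (real l * (1 / 2)))) + R x)"
    using P unfolding poincare_expansion_def by blast
  have "(\<Sum>l<2 * N. a l * s powr (real l / 2) * \<bar>x\<bar> powr (- (real l * (1 / 2)))) = (\<Sum>k<N. a (2 * k) * s ^ k * \<bar>x\<bar> powr (- (real k * 1)))" for x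
  proof (induction N)
    case (Suc N)
    have "2 * Suc N = Suc (Suc (2 * N))" by simp
    then show ?case using Suc odd[of N] s by (simp add: powr_realpow)
  qed simp
  with R show "\<exists>R. R \<in> O[L](\<lambda>x. \<bar>x\<bar> powr (- (real N * 1))) \<and>
      (\<forall>\<^sub>F x in L. G x = \<phi> x * ((\<Sum>l<N. a (2 * l) * s ^ l * \<bar>x\<bar> powr (- (real l * 1))) + R x))"
    by (intro exI[of _ R]) simp
qed

text \<open>The index i is determined by the others and r stands for 2 j, so the quadruples unfold
  into nested triangular sums, the form that repeated use of \<open>asy_diagonal\<close>
  produces.\<close>

lemma sum_four_indices:
  fixes f :: "nat \<Rightarrow> nat \<Rightarrow> nat \<Rightarrow> nat \<Rightarrow> 'a :: comm_monoid_add"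
  shows "(\<Sum>(i, j, k, l) \<in> {(i, j, k, l). i + 2 * j + k + l = p}. f i j k l) =
    (\<Sum>l\<le>p. \<Sum>k\<le>p - l. \<Sum>r\<le>p - l - k. if even r then f (p - l - k - r) (r div 2) k l else 0)"
proof -
  define S where "S = (SIGMA l:{..p}. SIGMA k:{..p - l}. {r. r \<le> p - l - k \<and> even r})"
  have "(\<Sum>l\<le>p. \<Sum>k\<le>p - l. \<Sum>r\<le>p - l - k. if even r then f (p - l - k - r) (r div 2) k l else 0) =
    (\<Sum>l\<le>p. \<Sum>k\<le>p - l. \<Sum>r\<in>{r. r \<le> p - l - k \<and> even r}. f (p - l - k - r) (r div 2) k l)"
    by (intro sum.cong refl sum.mono_neutral_cong_right) auto
  also have "\<dots> = (\<Sum>(l, k, r)\<in>S. f (p - l - k - r) (r div 2) k l)"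
    unfolding S_def by (subst sum.Sigma, simp, simp, subst sum.Sigma) (auto simp: case_prod_unfold)
  also have "\<dots> = (\<Sum>(i, j, k, l) \<in> {(i, j, k, l). i + 2 * j + k + l = p}. f i j k l)"
    by (rule sum.reindex_bij_witness[where i = "\<lambda>(i, j, k, l). (l, k, 2 * j)" and j = "\<lambda>(l, k, r). (p - l - k - r, r div 2, k, l)"])
       (auto simp: S_def)
  finally show ?thesis ..
qed

text \<open>The four indices are the four sources of powers: l the expansion of the density, k the
  binomial series of power and Jacobian, j the integrations by parts, i the return from v to
  x.\<close>

lemma sum_tail_coeff:
  "(\<Sum>l\<le>p. c l * tail_coeff (\<beta> - real l / 2) m \<kappa> (p - l)) =
    (\<Sum>(i, j, k, l) \<in> {(i, j, k, l). i + 2 * j + k + l = p}.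
        (- 1) ^ (j + i) * c l * ((2 * \<beta> + 1 - real l) gchoose k) * ((2 * \<beta> - real l - real k - 2 * real j) gchoose i)
        * pochhammer ((real l + real k) / 2 - \<beta>) j * \<kappa> ^ j * m ^ (k + i))"
  unfolding sum_four_indices tail_coeff_def shift_coeff_def sum_distrib_left
proof (intro sum.cong refl)
  fix l k r
  have 1: "2 * (\<beta> - real l / 2) + 1 = 2 * \<beta> + 1 - real l"
    "2 * (\<beta> - real l / 2 - real k / 2) - real r = 2 * \<beta> - real l - real k - real r"
    "- (\<beta> - real l / 2 - real k / 2) = (real l + real k) / 2 - \<beta>" by (simp_all add: field_simps)
  have 2: "(- m) ^ n = (- 1) ^ n * m ^ n" for n :: nat by (simp flip: power_mult_distrib)
  have 3: "2 * real (r div 2) = real r" if "even r" using that by auto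
  show "c l * (((2 * (\<beta> - real l / 2) + 1) gchoose k) * m ^ k *
      ((if even r then (- 1) ^ (r div 2) * pochhammer (- (\<beta> - real l / 2 - real k / 2)) (r div 2) * \<kappa> ^ (r div 2) else 0) *
        ((2 * (\<beta> - real l / 2 - real k / 2) - real r) gchoose (p - l - k - r)) * (- m) ^ (p - l - k - r))) =
    (if even r then (- 1) ^ (r div 2 + (p - l - k - r)) * c l * ((2 * \<beta> + 1 - real l) gchoose k) *
      ((2 * \<beta> - real l - real k - 2 * real (r div 2)) gchoose (p - l - k - r)) *
      pochhammer ((real l + real k) / 2 - \<beta>) (r div 2) * \<kappa> ^ (r div 2) * m ^ (k + (p - l - k - r)) else 0)"
  proof (cases "even r")
    case True
    show ?thesis unfolding 1 2 3[OF True] power_add using True by (simp add: mult_ac)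
  qed simp
qed

text \<open>At u = 0 the generating function is constantly 1, and the term of order 0 contains only
  this coefficient.\<close>

lemma g_coeff_0_0: "g_coeff 0 0 a b = 1"
proof -
  have "(\<lambda>t. tilt a b 0 t - (\<Sum>j<1. (\<Sum>i = nat \<lceil>real j / 2\<rceil>..j. g_coeff i j a b * 0 ^ i) * t ^ j)) \<in> O[at_right 0](\<lambda>t. t ^ 1)"
    by (rule tilt_expansion) simp
  also have "(\<lambda>t. tilt a b 0 t - (\<Sum>j<1. (\<Sum>i = nat \<lceil>real j / 2\<rceil>..j. g_coeff i j a b * 0 ^ i) * t ^ j)) = (\<lambda>t. \<Sum>j<1. (1 - g_coeff 0 0 a b) * t ^ j)"
    by (simp add: tilt_def)
  finally have "1 - g_coeff 0 0 a b = 0" by (rule poly_bigo_unique) simp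
  then show ?thesis by simp
qed

text \<open>For b = 0 the exponential disappears and the generating function is the binomial series
  in u y, which contains only integral powers of y.\<close>

lemma g_coeff_0_right: "g_coeff i j a 0 = (if j = 2 * i then a gchoose i else 0)"
proof -
  define g where "g = (\<lambda>i j. if j = 2 * i then a gchoose i else 0 :: real)"
  have "puiseux_coeffs a 0 g"
    unfolding puiseux_coeffs_def
  proof (intro conjI allI impI)
    fix i j assume "i \<notin> {nat \<lceil>real j / 2\<rceil>..j}"
    then show "g i j = 0" by (auto simp: g_def)
  next
    fix u :: real
    have "((\<lambda>y. \<bar>u * y\<bar>) \<longlongrightarrow> 0) (at_right 0)" by (auto intro!: tendsto_eq_intros)
    then have "\<forall>\<^sub>F y in at_right 0. \<bar>u * y\<bar> < 1" by (rule order_tendstoD) simp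
    moreover have "\<forall>\<^sub>F y in at_right (0::real). y > 0" by (rule eventually_at_right_less)
    ultimately show "\<forall>\<^sub>F y in at_right 0. (\<lambda>j. (\<Sum>i = nat \<lceil>real j / 2\<rceil>..j. g i j * u ^ i) * y powr (real j / 2)) sums
        ((1 + u * y) powr a * exp (0 * y powr (- 1 / 2) * (sqrt (1 + u * y) - 1)))"
    proof eventually_elim
      case (elim y)
      let ?f = "\<lambda>j. (\<Sum>i = nat \<lceil>real j / 2\<rceil>..j. g i j * u ^ i) * y powr (real j / 2)"
      have f0: "?f j = 0" if "j \<notin> range (\<lambda>i. 2 * i)" for j
        using that by (auto simp: g_def intro!: sum.neutral)
      have f2: "?f (2 * i) = (a gchoose i) * (u * y) ^ i" for i
      proof -
        have "(\<Sum>i' = nat \<lceil>real (2 * i) / 2\<rceil>..2 * i. g i' (2 * i) * u ^ i') = (\<Sum>i'\<in>{i}. g i' (2 * i) * u ^ i')"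
          by (rule sum.mono_neutral_right) (auto simp: g_def)
        then show ?thesis using elim by (simp add: g_def power_mult_distrib powr_realpow)
      qed
      have "(\<lambda>i. ?f (2 * i)) sums (1 + u * y) powr a"
        unfolding f2 using elim by (intro gen_binomial_real) auto
      then have "?f sums (1 + u * y) powr a"
        by (subst (asm) sums_mono_reindex[of "\<lambda>i. 2 * i" ?f]) (use f0 in \<open>auto simp: strict_mono_def\<close>)
      then show ?case by simp
    qed
  qed
  with puiseux_coeffs_unique_existence[of a 0] puiseux_coeffs_g_coeff[of a 0] have "(\<lambda>i j. g_coeff i j a 0) = g" by blast
  then show ?thesis by (simp add: g_def fun_eq_iff)
qed

section \<open>The right tail for rX + rY nonzero\<close>

lemma right_tail_constant:
  fixes \<kappa> m x :: real and n :: nat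
  assumes "\<kappa> > 0" "m > 0"
  shows "(m\<^sup>2 / \<kappa>) powr (- (real n / 2 - 1 / 2) / 2) / (2 * sqrt pi) * \<kappa> powr (- ((real n - 3) / 4)) * (\<kappa> / 2) powr (real n / 2)
    = \<kappa> / (2 * sqrt (2 * pi)) * (\<kappa> / (2 * m)) powr ((real n - 1) / 2)"
\<comment> \<open>Both sides are positive, and on taking logarithms the identity becomes linear in
  the logarithms of 2, pi, \<kappa> and m.\<close>
proof (rule ln_inj_iff[THEN iffD1])
  show "ln ((m\<^sup>2 / \<kappa>) powr (- (real n / 2 - 1 / 2) / 2) / (2 * sqrt pi) * \<kappa> powr (- ((real n - 3) / 4)) * (\<kappa> / 2) powr (real n / 2))
    = ln (\<kappa> / (2 * sqrt (2 * pi)) * (\<kappa> / (2 * m)) powr ((real n - 1) / 2))"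
    using assms by (simp add: ln_mult ln_div ln_powr ln_sqrt ln_realpow) (simp add: field_simps)
qed (use assms in auto)

lemma right_tail_nonzero:
  assumes \<rho>: "-1 < \<rho>" "\<rho> < 1" and n: "n \<ge> 1" and r: "rX + rY \<noteq> 0"
  obtains W where "asy W (\<lambda>p. gamma_coeff p rX rY \<rho> n)"
    and "\<forall>\<^sub>F x in at_top. (\<integral>\<^sup>+y. diff_dens (real n / 2) (1 + \<rho>) (real n * (((rX + rY) / 2)\<^sup>2 / (1 + \<rho>)))
        (1 - \<rho>) (real n * (((rX - rY) / 2)\<^sup>2 / (1 - \<rho>))) y * indicator {x..} y \<partial>lborel) =
      ennreal ((1 + \<rho>) * C_const rX rY \<rho> n / (2 * sqrt (2 * pi))
             * ((1 + \<rho>) / (\<bar>rX + rY\<bar> * sqrt (real n))) powr ((real n - 1) / 2)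
             * exp (real n / 8 * ((1 + \<rho>) / (1 - \<rho>)) * (rX - rY)\<^sup>2)
             * x powr ((real n - 3) / 4)
             * exp (\<bar>rX + rY\<bar> / (1 + \<rho>) * sqrt (real n * x) - x / (1 + \<rho>)) * W x) \<and> W x \<ge> 0"
proof -
  define \<kappa>1 \<kappa>2 where "\<kappa>1 = 1 + \<rho>" and "\<kappa>2 = 1 - \<rho>"
  define a where "a = real n / 2"
  \<comment> \<open>The shift that completes the square: 2 m / \<kappa>1 is the coefficient |rX +
    rY| sqrt n / (1 + \<rho>) of sqrt x in the exponent, and \<theta>1 becomes m^2 /
    \<kappa>1.\<close>
  define m where "m = \<bar>rX + rY\<bar> * sqrt (real n) / 2"
  define \<theta>1 where "\<theta>1 = real n * (((rX + rY) / 2)\<^sup>2 / (1 + \<rho>))"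
  define \<theta>2 where "\<theta>2 = real n * (((rX - rY) / 2)\<^sup>2 / (1 - \<rho>))"
  define z where "z = real n / 8 * ((1 + \<rho>) / (1 - \<rho>)) * (rX - rY)\<^sup>2"
  define \<beta> where "\<beta> = (real n - 3) / 4"
  define K1 where "K1 = exp (- \<theta>1) * \<theta>1 powr (- (a - 1 / 2) / 2) / (2 * sqrt pi)"
  \<comment> \<open>Rescaling by \<kappa>1: the density gains 1 / \<kappa>1, and the power (p /
    \<kappa>1) powr \<beta> contributes \<kappa>1 powr (- \<beta>).\<close>
  define K where "K = K1 * \<kappa>1 powr (- \<beta>) / \<kappa>1"
  have \<kappa>: "\<kappa>1 > 0" "\<kappa>2 > 0" "\<kappa>1 + \<kappa>2 = 2" using \<rho> by (auto simp: \<kappa>1_def \<kappa>2_def)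
  have a: "a > 0" "a \<ge> 1 / 2" using n by (auto simp: a_def)
  have m: "m > 0" using r n by (simp add: m_def)
  have \<theta>1: "\<theta>1 = m\<^sup>2 / \<kappa>1" by (simp add: \<theta>1_def m_def \<kappa>1_def power_mult_distrib power_divide)
  have \<theta>1p: "\<theta>1 > 0" using m \<kappa> by (simp add: \<theta>1)
  have \<theta>2p: "\<theta>2 \<ge> 0" using \<rho> by (simp add: \<theta>2_def)
  have zz: "\<theta>2 * \<kappa>1 / 2 = z" using \<rho> by (simp add: \<theta>2_def z_def \<kappa>1_def power_divide)
  have \<beta>a: "\<beta> = a / 2 - 3 / 4" by (simp add: \<beta>_def a_def field_simps)
  have K1: "K1 > 0" using \<theta>1p by (simp add: K1_def)
  have K: "K > 0" using K1 \<kappa> by (simp add: K_def)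
  define r' where "r' = (\<lambda>x. ncg_dens a \<theta>1 x / (K1 * dens \<beta> (2 * sqrt \<theta>1) 1 x))"
  have r'm [measurable]: "r' \<in> borel_measurable borel" unfolding r'_def by measurable
  have "asy r' (\<lambda>j. bessel_coeff a j * inverse (2 * sqrt \<theta>1) ^ j)"
    unfolding r'_def K1_def \<beta>a by (rule asy_ncg_dens[OF a(2) \<theta>1p])
  from asy_scale[OF this \<kappa>(1)]
  have rA: "asy (\<lambda>p. r' (p / \<kappa>1)) (\<lambda>j. bessel_coeff a j * inverse (2 * sqrt \<theta>1) ^ j * sqrt \<kappa>1 ^ j)" .
  have st: "sqrt \<theta>1 = m / sqrt \<kappa>1" using m by (simp add: \<theta>1 real_sqrt_divide)
  define A where "A = (\<lambda>j. bessel_coeff a j * inverse (2 * sqrt \<theta>1) ^ j * sqrt \<kappa>1 ^ j)"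
  have Aj: "A j = bessel_coeff a j * (\<kappa>1 / (2 * m)) ^ j" for j
  proof -
    have "inverse (2 * sqrt \<theta>1) * sqrt \<kappa>1 = \<kappa>1 / (2 * m)" using \<kappa> m by (simp add: st field_simps)
    then show ?thesis by (simp only: A_def mult.assoc power_mult_distrib[symmetric])
  qed
  have fP: "ncg_dens a \<theta>1 (p / \<kappa>1) / \<kappa>1 = K * dens \<beta> (2 * m / \<kappa>1) \<kappa>1 p * r' (p / \<kappa>1)" if p: "p > 0" for p
  proof -
    have "2 * sqrt \<theta>1 * sqrt (p / \<kappa>1) = 2 * m / \<kappa>1 * sqrt p"
      using \<kappa> by (simp add: st real_sqrt_divide)
    moreover have "(p / \<kappa>1) powr \<beta> = p powr \<beta> * \<kappa>1 powr (- \<beta>)"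
      using p \<kappa> by (simp add: powr_divide powr_minus_divide)
    ultimately have d: "dens \<beta> (2 * sqrt \<theta>1) 1 (p / \<kappa>1) = \<kappa>1 powr (- \<beta>) * dens \<beta> (2 * m / \<kappa>1) \<kappa>1 p"
      by (simp add: dens_def)
    have "dens \<beta> (2 * m / \<kappa>1) \<kappa>1 p > 0" using p by (rule dens_pos)
    then show ?thesis using K1 \<kappa> by (simp add: r'_def d K_def)
  qed
  define \<mu> where "\<mu> = (\<lambda>i. (\<kappa>1 / 2) powr a * exp (- \<theta>2) * pochhammer a i * (\<kappa>1 * \<kappa>2 / 2) ^ i * kummer_M (a + real i) a (\<theta>2 * \<kappa>1 / 2))"
  define c where "c = (\<lambda>l. \<Sum>j\<le>l. A j * (\<Sum>i = nat \<lceil>real (l - j) / 2\<rceil>..l - j. g_coeff i (l - j) (\<beta> - real j / 2) (2 * m / \<kappa>1) * \<mu> i))"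
  obtain W0 where W0: "asy W0 (\<lambda>p. \<Sum>l\<le>p. c l * tail_coeff (\<beta> - real l / 2) m \<kappa>1 (p - l))"
    "\<forall>\<^sub>F x in at_top. (\<integral>\<^sup>+y. diff_dens a \<kappa>1 \<theta>1 \<kappa>2 \<theta>2 y * indicator {x..} y \<partial>lborel) = ennreal (K * \<kappa>1 * dens \<beta> (2 * m / \<kappa>1) \<kappa>1 x * W0 x) \<and> W0 x \<ge> 0"
    unfolding c_def \<mu>_def
    by (rule diff_dens_tail_expansion[OF a(1) less_imp_le[OF \<theta>1p] \<theta>2p \<kappa> K less_imp_le[OF m] rA[folded A_def] _ fP]) measurable
  \<comment> \<open>The total mass of the tilted law, because \<open>kummer_M a a z\<close> is exp
    z. Dividing by it makes the leading coefficient 1.\<close>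
  define D where "D = (\<kappa>1 / 2) powr a * exp (- \<theta>2) * exp z"
  have D: "D > 0" using \<kappa> by (simp add: D_def)
  \<comment> \<open>The Bessel index is j in c and l - j in \<open>h_coeff\<close>, so the two sums
    are mirror images of each other. The factor exp z of D cancels the exponential in front of the
    sum in \<open>c_coeff\<close>.\<close>
  have cl: "c l = D * c_coeff l rX rY \<rho> n" for l
  proof -
    have b: "2 * m / \<kappa>1 = \<bar>rX + rY\<bar> / (1 + \<rho>) * sqrt (real n)" by (simp add: m_def \<kappa>1_def)
    have h: "A j * (\<Sum>i = nat \<lceil>real (l - j) / 2\<rceil>..l - j. g_coeff i (l - j) (\<beta> - real j / 2) (2 * m / \<kappa>1) * \<mu> i)
      = (\<kappa>1 / 2) powr a * exp (- \<theta>2) * h_coeff (l - j) l rX rY \<rho> n" if "j \<le> l" for j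
    proof -
      have lj: "l - (l - j) = j" using that by simp
      have nn: "real n powr (real j / 2) = sqrt (real n) ^ j"
        using n by (simp add: powr_half_sqrt[symmetric] powr_power mult.commute)
      have "A j = pochhammer ((3 - real n) / 2) j * pochhammer ((real n - 1) / 2) j / (fact j * 2 ^ j * real n powr (real j / 2)) * ((1 + \<rho>) / \<bar>rX + rY\<bar>) ^ j"
      proof -
        have 1: "3 / 2 - a = (3 - real n) / 2" "a - 1 / 2 = (real n - 1) / 2" by (simp_all add: a_def field_simps)
        have 2: "\<kappa>1 / (2 * m) = (1 + \<rho>) / \<bar>rX + rY\<bar> / sqrt (real n)" by (simp add: m_def \<kappa>1_def)
        show ?thesis unfolding Aj bessel_coeff_def nn 1 2 power_divide by simp
      qed
      moreover have "(\<Sum>i = nat \<lceil>real (l - j) / 2\<rceil>..l - j. g_coeff i (l - j) (\<beta> - real j / 2) (2 * m / \<kappa>1) * \<mu> i)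
        = (\<kappa>1 / 2) powr a * exp (- \<theta>2) * (\<Sum>i = nat \<lceil>real (l - j) / 2\<rceil>..l - j.
          pochhammer (real n / 2) i * ((1 - \<rho>\<^sup>2) / 2) ^ i
          * kummer_M (real n / 2 + real i) (real n / 2) z
          * g_coeff i (l - j) ((real n - 3) / 4 - real j / 2) (\<bar>rX + rY\<bar> / (1 + \<rho>) * sqrt (real n)))"
        unfolding sum_distrib_left
      proof (intro sum.cong refl)
        fix i
        have kk: "\<kappa>1 * \<kappa>2 = 1 - \<rho>\<^sup>2" by (simp add: \<kappa>1_def \<kappa>2_def power2_eq_square algebra_simps)
        show "g_coeff i (l - j) (\<beta> - real j / 2) (2 * m / \<kappa>1) * \<mu> i = (\<kappa>1 / 2) powr a * exp (- \<theta>2) * (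
          pochhammer (real n / 2) i * ((1 - \<rho>\<^sup>2) / 2) ^ i
          * kummer_M (real n / 2 + real i) (real n / 2) z
          * g_coeff i (l - j) ((real n - 3) / 4 - real j / 2) (\<bar>rX + rY\<bar> / (1 + \<rho>) * sqrt (real n)))"
          unfolding \<mu>_def zz kk b \<beta>_def a_def by (simp only: mult_ac)
      qed
      ultimately show ?thesis unfolding h_coeff_def lj z_def[symmetric] by (simp only: mult_ac)
    qed
    have "c l = (\<Sum>j\<le>l. (\<kappa>1 / 2) powr a * exp (- \<theta>2) * h_coeff (l - j) l rX rY \<rho> n)"
      unfolding c_def using h by (intro sum.cong) auto
    also have "\<dots> = (\<kappa>1 / 2) powr a * exp (- \<theta>2) * (\<Sum>j=0..l. h_coeff j l rX rY \<rho> n)"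
      unfolding sum_distrib_left
      by (rule sum.reindex_bij_witness[where i = "\<lambda>j. l - j" and j = "\<lambda>j. l - j"]) auto
    also have "(\<Sum>j=0..l. h_coeff j l rX rY \<rho> n) = exp z * c_coeff l rX rY \<rho> n"
    proof (cases "l = 0")
      case True
      have "h_coeff 0 0 rX rY \<rho> n = exp z"
        unfolding h_coeff_def z_def[symmetric] using n by (simp add: g_coeff_0_0 kummer_M_same)
      then show ?thesis using True by (simp add: c_coeff_def)
    next
      case False
      have "exp z * exp (- z) = 1" by (simp flip: exp_add)
      then show ?thesis unfolding c_coeff_def z_def[symmetric] using False by (simp flip: mult.assoc)
    qed
    finally show ?thesis by (simp add: D_def)
  qed
  have co: "(\<Sum>l\<le>p. c l * tail_coeff (\<beta> - real l / 2) m \<kappa>1 (p - l)) = D * gamma_coeff p rX rY \<rho> n" for p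
  proof -
    have 1: "2 * \<beta> + 1 - real l = (real n - 1) / 2 - real l" "2 * \<beta> - real l = (real n - 3) / 2 - real l" for l
      by (simp_all add: \<beta>_def field_simps)
    have "(\<Sum>l\<le>p. c l * tail_coeff (\<beta> - real l / 2) m \<kappa>1 (p - l)) =
      D * (\<Sum>(i, j, k, l) \<in> {(i, j, k, l). i + 2 * j + k + l = p}.
        (- 1) ^ (j + i) * c_coeff l rX rY \<rho> n
        * (((real n - 1) / 2 - real l) gchoose k)
        * (((real n - 3) / 2 - real l - real k - 2 * real j) gchoose i)
        * pochhammer ((real l + real k) / 2 - (real n - 3) / 4) j
        * (1 + \<rho>) ^ j * (\<bar>rX + rY\<bar> * sqrt (real n) / 2) ^ (k + i))"
      unfolding sum_tail_coeff sum_distrib_left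
      by (intro sum.cong refl) (auto simp: cl 1 \<beta>_def[symmetric] m_def[symmetric] \<kappa>1_def[symmetric])
    also have "\<dots> = D * gamma_coeff p rX rY \<rho> n"
    \<comment> \<open>The value 1 fixed for p = 0 agrees with the general sum, whose only quadruple
      is then (0, 0, 0, 0).\<close>
    proof (cases "p = 0")
      case True
      have "{(i, j, k, l). i + 2 * j + k + l = (0::nat)} = {(0, 0, 0, 0)}" by auto
      then show ?thesis using True by (simp add: gamma_coeff_def c_coeff_def)
    qed (simp add: gamma_coeff_def)
    finally show ?thesis .
  qed
  \<comment> \<open>The quadratic form in \<open>C_const\<close> is \<theta>1 + \<theta>2, its
    decomposition along the two rotated axes.\<close>
  have C: "C_const rX rY \<rho> n = exp (- \<theta>1) * exp (- \<theta>2)"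
  proof -
    have r: "1 - \<rho>\<^sup>2 = (1 + \<rho>) * (1 - \<rho>)" by (simp add: power2_eq_square algebra_simps)
    have t: "\<theta>1 * (1 + \<rho>) = real n * ((rX + rY) / 2)\<^sup>2" "\<theta>2 * (1 - \<rho>) = real n * ((rX - rY) / 2)\<^sup>2"
      using \<rho> by (simp_all add: \<theta>1_def \<theta>2_def)
    have "(\<theta>1 + \<theta>2) * (2 * ((1 + \<rho>) * (1 - \<rho>))) = 2 * (\<theta>1 * (1 + \<rho>) * (1 - \<rho>) + \<theta>2 * (1 - \<rho>) * (1 + \<rho>))"
      by (simp add: algebra_simps)
    also have "\<dots> = real n * (rX\<^sup>2 + rY\<^sup>2 - 2 * \<rho> * rX * rY)"
      unfolding t by (simp add: power2_eq_square field_simps)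
    finally have "real n * (rX\<^sup>2 + rY\<^sup>2 - 2 * \<rho> * rX * rY) / (2 * (1 - \<rho>\<^sup>2)) = \<theta>1 + \<theta>2"
      unfolding r using \<rho> by (simp add: divide_eq_eq)
    then show ?thesis by (simp add: C_const_def flip: exp_add)
  qed
  show ?thesis
  proof
    show "asy (\<lambda>x. W0 x / D) (\<lambda>p. gamma_coeff p rX rY \<rho> n)"
      using asy_cmult[OF W0(1), of "1 / D"] D unfolding co by simp
    show "\<forall>\<^sub>F x in at_top. (\<integral>\<^sup>+y. diff_dens (real n / 2) (1 + \<rho>) (real n * (((rX + rY) / 2)\<^sup>2 / (1 + \<rho>)))
        (1 - \<rho>) (real n * (((rX - rY) / 2)\<^sup>2 / (1 - \<rho>))) y * indicator {x..} y \<partial>lborel) =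
      ennreal ((1 + \<rho>) * C_const rX rY \<rho> n / (2 * sqrt (2 * pi))
             * ((1 + \<rho>) / (\<bar>rX + rY\<bar> * sqrt (real n))) powr ((real n - 1) / 2)
             * exp (real n / 8 * ((1 + \<rho>) / (1 - \<rho>)) * (rX - rY)\<^sup>2)
             * x powr ((real n - 3) / 4)
             * exp (\<bar>rX + rY\<bar> / (1 + \<rho>) * sqrt (real n * x) - x / (1 + \<rho>)) * (W0 x / D)) \<and> W0 x / D \<ge> 0"
      unfolding \<theta>1_def[symmetric] \<theta>2_def[symmetric] z_def[symmetric]
      unfolding a_def[symmetric] \<beta>_def[symmetric] \<kappa>1_def[symmetric] \<kappa>2_def[symmetric]
      using W0(2)
    proof eventually_elim
      case (elim x)
      have m2: "\<bar>rX + rY\<bar> * sqrt (real n) = 2 * m" by (simp add: m_def)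
      have ex: "\<bar>rX + rY\<bar> / \<kappa>1 * sqrt (real n * x) = 2 * m / \<kappa>1 * sqrt x" by (simp add: m_def real_sqrt_mult)
      have cst: "K1 * \<kappa>1 powr (- \<beta>) * (\<kappa>1 / 2) powr a = exp (- \<theta>1) * (\<kappa>1 / (2 * sqrt (2 * pi)) * (\<kappa>1 / (2 * m)) powr ((real n - 1) / 2))"
        unfolding right_tail_constant[OF \<kappa>(1) m, symmetric] K1_def \<theta>1[symmetric] a_def \<beta>_def by simp
      have "\<kappa>1 * C_const rX rY \<rho> n / (2 * sqrt (2 * pi)) * (\<kappa>1 / (2 * m)) powr ((real n - 1) / 2) * exp z * x powr \<beta> * exp (2 * m / \<kappa>1 * sqrt x - x / \<kappa>1)
        = (exp (- \<theta>1) * (\<kappa>1 / (2 * sqrt (2 * pi)) * (\<kappa>1 / (2 * m)) powr ((real n - 1) / 2))) * (exp (- \<theta>2) * exp z) * dens \<beta> (2 * m / \<kappa>1) \<kappa>1 x"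
        unfolding C dens_def by simp
      also have "\<dots> = K * \<kappa>1 * dens \<beta> (2 * m / \<kappa>1) \<kappa>1 x * D"
        unfolding cst[symmetric] K_def D_def using \<kappa> by simp
      finally show ?case using elim D unfolding m2 ex by (simp only:) (simp add: mult.assoc)
    qed
  qed
qed

section \<open>The right tail for rX + rY = 0\<close>

lemma sum_even_atMost:
  "(\<Sum>l\<le>2 * k. if even l then f (l div 2) else 0) = (\<Sum>j\<le>k. f j)"
  for f :: "nat \<Rightarrow> 'a :: comm_monoid_add"
  using sum_even_reindex[of f "Suc (2 * k)"] by (simp add: lessThan_Suc_atMost)

lemma tail_coeff_0:
  "tail_coeff \<beta> 0 \<kappa> p = (if even p then (- 1) ^ (p div 2) * pochhammer (- \<beta>) (p div 2) * \<kappa> ^ (p div 2) else 0)"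
proof -
  have "shift_coeff \<beta> 0 \<kappa> p = (\<Sum>r\<in>{p}. (if even r then (- 1) ^ (r div 2) * pochhammer (- \<beta>) (r div 2) * \<kappa> ^ (r div 2) else 0)
      * ((2 * \<beta> - real r) gchoose (p - r)) * (- 0) ^ (p - r))"
    unfolding shift_coeff_def by (rule sum.mono_neutral_right) (auto simp: power_0_left)
  moreover have "tail_coeff \<beta> 0 \<kappa> p = (\<Sum>k\<in>{0}. ((2 * \<beta> + 1) gchoose k) * 0 ^ k * shift_coeff (\<beta> - real k / 2) 0 \<kappa> (p - k))"
    unfolding tail_coeff_def by (rule sum.mono_neutral_right) (auto simp: power_0_left)
  ultimately show ?thesis by simp
qed

text \<open>Here \<theta>1 = 0, so P is a central gamma variable and its density is exactly of the
  model form with b = 0. The Bessel expansion, whose terms carry negative powers of sqrt \<theta>1,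
  is replaced by the constant correction 1, and only integral powers of x survive.\<close>

lemma right_tail_zero:
  assumes \<rho>: "-1 < \<rho>" "\<rho> < 1" and n: "n \<ge> 1" and r: "rX + rY = 0"
  obtains W where "asy W (\<lambda>p. if even p then delta_coeff (p div 2) rX \<rho> n else 0)"
    and "\<forall>\<^sub>F x in at_top. (\<integral>\<^sup>+y. diff_dens (real n / 2) (1 + \<rho>) (real n * (((rX + rY) / 2)\<^sup>2 / (1 + \<rho>)))
        (1 - \<rho>) (real n * (((rX - rY) / 2)\<^sup>2 / (1 - \<rho>))) y * indicator {x..} y \<partial>lborel) =
      ennreal ((1 + \<rho>) / (2 powr (real n / 2) * Gamma (real n / 2)) * x powr (real n / 2 - 1)
        * exp (- (real n * rX\<^sup>2 / 2) - x / (1 + \<rho>)) * W x) \<and> W x \<ge> 0"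
proof -
  define \<kappa>1 \<kappa>2 where "\<kappa>1 = 1 + \<rho>" and "\<kappa>2 = 1 - \<rho>"
  define a where "a = real n / 2"
  define \<theta>2 where "\<theta>2 = real n * (((rX - rY) / 2)\<^sup>2 / (1 - \<rho>))"
  define z where "z = real n / 2 * ((1 + \<rho>) / (1 - \<rho>)) * rX\<^sup>2"
  define K where "K = 1 / (\<kappa>1 powr a * Gamma a)"
  have \<kappa>: "\<kappa>1 > 0" "\<kappa>2 > 0" "\<kappa>1 + \<kappa>2 = 2" using \<rho> by (auto simp: \<kappa>1_def \<kappa>2_def)
  have a: "a > 0" using n by (auto simp: a_def)
  have G: "Gamma a > 0" using a by (rule Gamma_real_pos)
  have \<theta>2p: "\<theta>2 \<ge> 0" using \<rho> by (simp add: \<theta>2_def)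
  have rr: "(rX - rY) / 2 = rX" using r by simp
  have \<theta>2: "\<theta>2 = real n * (rX\<^sup>2 / (1 - \<rho>))" unfolding \<theta>2_def rr ..
  have zz: "\<theta>2 * \<kappa>1 / 2 = z" using \<rho> by (simp add: \<theta>2 z_def \<kappa>1_def mult_ac)
  have K: "K > 0" using \<kappa> G by (simp add: K_def)
  define A where "A = (\<lambda>j::nat. if j = 0 then 1 else 0 :: real)"
  \<comment> \<open>The constant 1 is the case m = 0 of the binomial expansion, with 0^0 =
    1.\<close>
  have "(\<lambda>k. (1 gchoose k) * 0 ^ k) = A" by (auto simp: A_def power_0_left fun_eq_iff)
  then have rA: "asy (\<lambda>_. 1) A" using asy_one_plus_powr[of 0 1] by simp
  have fP: "ncg_dens a 0 (p / \<kappa>1) / \<kappa>1 = K * dens (a - 1) (2 * 0 / \<kappa>1) \<kappa>1 p * 1" if p: "p > 0" for p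
  proof -
    have "(p / \<kappa>1) powr (a - 1) = p powr (a - 1) * \<kappa>1 / \<kappa>1 powr a"
      using p \<kappa> by (simp add: powr_divide powr_diff)
    then show ?thesis using p \<kappa> by (simp add: ncg_dens_0 gamma_dens_def dens_def K_def)
  qed
  define \<mu> where "\<mu> = (\<lambda>i. (\<kappa>1 / 2) powr a * exp (- \<theta>2) * pochhammer a i * (\<kappa>1 * \<kappa>2 / 2) ^ i * kummer_M (a + real i) a (\<theta>2 * \<kappa>1 / 2))"
  define c where "c = (\<lambda>l. \<Sum>j\<le>l. A j * (\<Sum>i = nat \<lceil>real (l - j) / 2\<rceil>..l - j. g_coeff i (l - j) ((a - 1) - real j / 2) (2 * 0 / \<kappa>1) * \<mu> i))"
  obtain W0 where W0: "asy W0 (\<lambda>p. \<Sum>l\<le>p. c l * tail_coeff ((a - 1) - real l / 2) 0 \<kappa>1 (p - l))"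
    "\<forall>\<^sub>F x in at_top. (\<integral>\<^sup>+y. diff_dens a \<kappa>1 0 \<kappa>2 \<theta>2 y * indicator {x..} y \<partial>lborel) = ennreal (K * \<kappa>1 * dens (a - 1) (2 * 0 / \<kappa>1) \<kappa>1 x * W0 x) \<and> W0 x \<ge> 0"
    unfolding c_def \<mu>_def
    by (rule diff_dens_tail_expansion[OF a order_refl \<theta>2p \<kappa> K order_refl rA _ fP]) measurable
  define D where "D = (\<kappa>1 / 2) powr a * exp (- \<theta>2) * exp z"
  have D: "D > 0" using \<kappa> by (simp add: D_def)
  \<comment> \<open>The binomial (a - 1) gchoose j is (-1)^j (1 - a)_j / j!, the sign and the first
    Pochhammer symbol of \<open>d_coeff\<close>. The moment supplies (a)_j, the power of (1 -
    \<rho>^2) / 2 and, through Kummer's transformation, the finite sum.\<close>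
  have mu: "((a - 1) gchoose j) * \<mu> j = D * d_coeff j rX \<rho> n" for j
  proof -
    have kk: "\<kappa>1 * \<kappa>2 = 1 - \<rho>\<^sup>2" by (simp add: \<kappa>1_def \<kappa>2_def power2_eq_square algebra_simps)
    have g: "(a - 1) gchoose j = (- 1) ^ j * pochhammer (1 - a) j / fact j"
      using gbinomial_pochhammer[of "a - 1" j] by simp
    have "z ^ i = (real n / 2) ^ i * (((1 + \<rho>) / (1 - \<rho>)) ^ i * rX ^ (2 * i))" for i
      by (simp only: z_def power_mult_distrib power_mult mult.assoc)
    then have s: "(\<Sum>i\<le>j. real (j choose i) * (z ^ i / pochhammer a i)) =
      (\<Sum>i=0..j. (real n / 2) ^ i / pochhammer (real n / 2) i * real (j choose i) * ((1 + \<rho>) / (1 - \<rho>)) ^ i * rX ^ (2 * i))"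
      unfolding a_def by (intro sum.cong) auto
    have "((a - 1) gchoose j) * \<mu> j = D * ((- 1) ^ j * (pochhammer (1 - a) j * pochhammer a j / fact j) * ((1 - \<rho>\<^sup>2) / 2) ^ j
      * (\<Sum>i\<le>j. real (j choose i) * (z ^ i / pochhammer a i)))"
      unfolding \<mu>_def zz kummer_M_nat_shift[OF a] g kk D_def by simp
    also have "\<dots> = D * d_coeff j rX \<rho> n"
      unfolding s by (cases "j = 0") (simp_all add: d_coeff_def a_def)
    finally show ?thesis .
  qed
  \<comment> \<open>For b = 0 the Puiseux coefficients live on l = 2 i, so even orders keep a single
    term and odd orders vanish.\<close>
  have cl: "c l = (if even l then D * d_coeff (l div 2) rX \<rho> n else 0)" for l
  proof -
    have "c l = (\<Sum>j\<in>{0}. A j * (\<Sum>i = nat \<lceil>real (l - j) / 2\<rceil>..l - j. g_coeff i (l - j) ((a - 1) - real j / 2) (2 * 0 / \<kappa>1) * \<mu> i))"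
      unfolding c_def by (rule sum.mono_neutral_right) (auto simp: A_def)
    then have *: "c l = (\<Sum>i = nat \<lceil>real l / 2\<rceil>..l. g_coeff i l (a - 1) 0 * \<mu> i)" by (simp add: A_def)
    show ?thesis
    proof (cases "even l")
      case True
      then obtain h where h: "l = 2 * h" by auto
      have "c l = (\<Sum>i\<in>{h}. g_coeff i l (a - 1) 0 * \<mu> i)"
        unfolding * by (rule sum.mono_neutral_right) (auto simp: g_coeff_0_right h)
      then show ?thesis by (simp add: h g_coeff_0_right mu)
    next
      case False
      then show ?thesis unfolding * by (auto simp: g_coeff_0_right intro!: sum.neutral)
    qed
  qed
  have co: "(\<Sum>l\<le>p. c l * tail_coeff ((a - 1) - real l / 2) 0 \<kappa>1 (p - l)) = D * (if even p then delta_coeff (p div 2) rX \<rho> n else 0)" for p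
  proof (cases "even p")
    case True
    then obtain k where k: "p = 2 * k" by auto
    have "(\<Sum>l\<le>p. c l * tail_coeff ((a - 1) - real l / 2) 0 \<kappa>1 (p - l)) =
      (\<Sum>l\<le>2 * k. if even l then D * ((- 1) ^ (k - l div 2) * d_coeff (l div 2) rX \<rho> n * pochhammer (real (l div 2) + 1 - real n / 2) (k - l div 2) * (1 + \<rho>) ^ (k - l div 2)) else 0)"
      unfolding k
    proof (intro sum.cong refl)
      fix l assume "l \<in> {..2 * k}"
      show "c l * tail_coeff ((a - 1) - real l / 2) 0 \<kappa>1 (2 * k - l) = (if even l then D * ((- 1) ^ (k - l div 2) * d_coeff (l div 2) rX \<rho> n * pochhammer (real (l div 2) + 1 - real n / 2) (k - l div 2) * (1 + \<rho>) ^ (k - l div 2)) else 0)"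
      proof (cases "even l")
        case True
        then obtain h where h: "l = 2 * h" by auto
        have "2 * k - 2 * h = 2 * (k - h)" by simp
        \<comment> \<open>The order l = 2 h of the density lowers the exponent a - 1 by h. So the
          Pochhammer symbol is based at the summation index h and not at the order k of the
          coefficient.\<close>
        moreover have arg: "- ((a - 1) - real (2 * h) / 2) = real h + 1 - real n / 2" by (simp add: a_def)
        ultimately show ?thesis unfolding h tail_coeff_0 cl arg by (simp add: \<kappa>1_def)
      qed (simp add: cl)
    qed
    also have "\<dots> = (\<Sum>j\<le>k. D * ((- 1) ^ (k - j) * d_coeff j rX \<rho> n * pochhammer (real j + 1 - real n / 2) (k - j) * (1 + \<rho>) ^ (k - j)))"
      by (rule sum_even_atMost)
    also have "\<dots> = D * delta_coeff k rX \<rho> n"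
      by (cases "k = 0") (simp_all add: delta_coeff_def d_coeff_def sum_distrib_left atLeast0AtMost)
    finally show ?thesis by (simp add: k)
  next
    case False
    have "c l * tail_coeff ((a - 1) - real l / 2) 0 \<kappa>1 (p - l) = 0" if "l \<le> p" for l
      using that False by (cases "even l") (auto simp: cl tail_coeff_0)
    then have "(\<Sum>l\<le>p. c l * tail_coeff ((a - 1) - real l / 2) 0 \<kappa>1 (p - l)) = 0" by (intro sum.neutral) auto
    then show ?thesis using False by simp
  qed
  have \<theta>1: "real n * (((rX + rY) / 2)\<^sup>2 / (1 + \<rho>)) = 0" using r by simp
  show ?thesis
  proof
    show "asy (\<lambda>x. W0 x / D) (\<lambda>p. if even p then delta_coeff (p div 2) rX \<rho> n else 0)"
      using asy_cmult[OF W0(1), of "1 / D"] D unfolding co by simp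
    show "\<forall>\<^sub>F x in at_top. (\<integral>\<^sup>+y. diff_dens (real n / 2) (1 + \<rho>) (real n * (((rX + rY) / 2)\<^sup>2 / (1 + \<rho>)))
        (1 - \<rho>) (real n * (((rX - rY) / 2)\<^sup>2 / (1 - \<rho>))) y * indicator {x..} y \<partial>lborel) =
      ennreal ((1 + \<rho>) / (2 powr (real n / 2) * Gamma (real n / 2)) * x powr (real n / 2 - 1)
        * exp (- (real n * rX\<^sup>2 / 2) - x / (1 + \<rho>)) * (W0 x / D)) \<and> W0 x / D \<ge> 0"
      unfolding \<theta>1 \<theta>2_def[symmetric]
      unfolding a_def[symmetric] \<kappa>1_def[symmetric] \<kappa>2_def[symmetric]
      using W0(2)
    proof eventually_elim
      case (elim x)
      have t: "\<theta>2 * (1 - \<rho>) = real n * rX\<^sup>2" "z * (1 - \<rho>) = real n / 2 * (1 + \<rho>) * rX\<^sup>2"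
      proof -
        have nz: "1 - \<rho> \<noteq> 0" using \<rho> by simp
        then show "\<theta>2 * (1 - \<rho>) = real n * rX\<^sup>2" by (simp add: \<theta>2)
        have "z * (1 - \<rho>) = real n / 2 * ((1 + \<rho>) / (1 - \<rho>) * (1 - \<rho>)) * rX\<^sup>2" by (simp only: z_def mult_ac)
        also have "(1 + \<rho>) / (1 - \<rho>) * (1 - \<rho>) = 1 + \<rho>" using nz by (rule nonzero_eq_divide_eq[THEN iffD1, OF _ refl])
        finally show "z * (1 - \<rho>) = real n / 2 * (1 + \<rho>) * rX\<^sup>2" .
      qed
      \<comment> \<open>Both exponents are multiples of n rX^2 / (1 - \<rho>), with factors -1 and
        (1 + \<rho>) / 2. Their sum is - n rX^2 / 2.\<close>
      have "(- \<theta>2 + z + real n * rX\<^sup>2 / 2) * (1 - \<rho>) = - (\<theta>2 * (1 - \<rho>)) + z * (1 - \<rho>) + real n * rX\<^sup>2 / 2 * (1 - \<rho>)"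
        by (simp add: algebra_simps)
      also have "\<dots> = 0" unfolding t by (simp add: field_simps)
      finally have "- \<theta>2 + z = - (real n * rX\<^sup>2 / 2)" using \<rho> by simp
      then have e: "exp (- \<theta>2) * exp z = exp (- (real n * rX\<^sup>2 / 2))" by (simp flip: exp_add)
      have "exp (- (real n * rX\<^sup>2 / 2) - x / \<kappa>1) = (exp (- \<theta>2) * exp z) * exp (- (x / \<kappa>1))"
        unfolding e by (simp flip: exp_add)
      moreover have "(\<kappa>1 / 2) powr a = \<kappa>1 powr a / 2 powr a" using \<kappa> by (simp add: powr_divide)
      ultimately have "\<kappa>1 / (2 powr a * Gamma a) * x powr (a - 1) * exp (- (real n * rX\<^sup>2 / 2) - x / \<kappa>1) = K * \<kappa>1 * dens (a - 1) (2 * 0 / \<kappa>1) \<kappa>1 x * D"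
        using \<kappa> unfolding K_def D_def dens_def by (simp add: mult_ac)
      then show ?case using elim D by (simp only:) (simp add: mult.assoc)
    qed
  qed
qed

section \<open>From the density of the scaled sum to its distribution function\<close>

lemma distr_scaled_sum:
  assumes "prob_space M" and p: "\<sigma>X > 0" "\<sigma>Y > 0" "-1 < \<rho>" "\<rho> < 1" "n \<ge> 1"
    and bn: "bivariate_normal M X Y \<mu>X \<mu>Y \<sigma>X \<sigma>Y \<rho>"
    and ind: "prob_space.indep_vars M (\<lambda>_. borel) Z {1..n}"
    and id: "\<forall>i\<in>{1..n}. distr M borel (Z i) = distr M borel (\<lambda>\<omega>. X \<omega> * Y \<omega>)"
  shows "distr M borel (\<lambda>\<omega>. (\<Sum>i=1..n. Z i \<omega>) / (\<sigma>X * \<sigma>Y)) =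
    density lborel (diff_dens (real n / 2) (1 + \<rho>) (real n * (((\<mu>X / \<sigma>X + \<mu>Y / \<sigma>Y) / 2)\<^sup>2 / (1 + \<rho>)))
      (1 - \<rho>) (real n * (((\<mu>X / \<sigma>X - \<mu>Y / \<sigma>Y) / 2)\<^sup>2 / (1 - \<rho>))))"
proof -
  interpret prob_space M by fact
  have D: "distributed M (lborel \<Otimes>\<^sub>M lborel) (\<lambda>\<omega>. (X \<omega>, Y \<omega>)) (\<lambda>z. ennreal (bivariate_normal_density \<mu>X \<mu>Y \<sigma>X \<sigma>Y \<rho> z))"
    using bn by (simp add: bivariate_normal_def)
  have rv: "(\<lambda>\<omega>. (X \<omega>, Y \<omega>)) \<in> measurable M (borel \<Otimes>\<^sub>M borel)"
    using distributed_measurable[OF D] by (simp cong: measurable_cong_sets)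
  have X [measurable]: "random_variable borel X" and Y [measurable]: "random_variable borel Y"
    using measurable_compose[OF rv measurable_fst] measurable_compose[OF rv measurable_snd] by simp_all
  define s where "s = \<sigma>X * \<sigma>Y"
  have Z: "random_variable borel (Z i)" if "i \<in> {1..n}" for i
    using ind that by (auto simp: indep_vars_def)
  have ind': "indep_vars (\<lambda>_. borel) (\<lambda>i \<omega>. Z i \<omega> / s) {1..n}"
    using indep_vars_compose2[OF ind, of "\<lambda>_ x. x / s" "\<lambda>_. borel"] by simp
  have law: "distr M borel (\<lambda>\<omega>. Z i \<omega> / s) = convolution (ncg_law (1 + \<rho>) (1 / 2) (((\<mu>X / \<sigma>X + \<mu>Y / \<sigma>Y) / 2)\<^sup>2 / (1 + \<rho>)))
      (neg_ncg_law (1 - \<rho>) (1 / 2) (((\<mu>X / \<sigma>X - \<mu>Y / \<sigma>Y) / 2)\<^sup>2 / (1 - \<rho>)))" if i: "i \<in> {1..n}" for i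
  proof -
    have [measurable]: "random_variable borel (Z i)" using Z[OF i] .
    have "distr M borel (\<lambda>\<omega>. Z i \<omega> / s) = distr (distr M borel (Z i)) borel (\<lambda>x. x / s)"
      by (subst distr_distr) (auto simp: o_def)
    also have "\<dots> = distr (distr M borel (\<lambda>\<omega>. X \<omega> * Y \<omega>)) borel (\<lambda>x. x / s)" using id i by simp
    also have "\<dots> = distr M borel (\<lambda>\<omega>. X \<omega> * Y \<omega> / s)" by (subst distr_distr) (auto simp: o_def)
    also note distr_product_normal[OF assms(1) p(1-4) bn, folded s_def]
    finally show ?thesis .
  qed
  have "distr M borel (\<lambda>\<omega>. (\<Sum>i=1..n. Z i \<omega>) / s) = distr M borel (\<lambda>\<omega>. \<Sum>i=1..n. Z i \<omega> / s)"
    by (simp add: sum_divide_distrib)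
  also have "\<dots> = convolution (ncg_law (1 + \<rho>) (real n / 2) (real n * (((\<mu>X / \<sigma>X + \<mu>Y / \<sigma>Y) / 2)\<^sup>2 / (1 + \<rho>))))
      (neg_ncg_law (1 - \<rho>) (real n / 2) (real n * (((\<mu>X / \<sigma>X - \<mu>Y / \<sigma>Y) / 2)\<^sup>2 / (1 - \<rho>))))"
    using p by (intro distr_sum_product_normal[OF assms(1) _ _ _ _ p(5) ind' law]) auto
  also have "\<dots> = density lborel (diff_dens (real n / 2) (1 + \<rho>) (real n * (((\<mu>X / \<sigma>X + \<mu>Y / \<sigma>Y) / 2)\<^sup>2 / (1 + \<rho>)))
      (1 - \<rho>) (real n * (((\<mu>X / \<sigma>X - \<mu>Y / \<sigma>Y) / 2)\<^sup>2 / (1 - \<rho>))))"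
    using p by (intro convolution_neg_ncg_law) auto
  finally show ?thesis by (simp add: s_def)
qed

lemma tails_from_density:
  fixes S :: "'a \<Rightarrow> real"
  assumes "prob_space M" and [measurable]: "S \<in> borel_measurable M" and s: "s > 0"
    and law: "distr M borel (\<lambda>\<omega>. S \<omega> / s) = density lborel (diff_dens a \<kappa>1 \<theta>1 \<kappa>2 \<theta>2)"
  shows "ennreal (1 - cdf (distr M borel S) x) = (\<integral>\<^sup>+y. diff_dens a \<kappa>1 \<theta>1 \<kappa>2 \<theta>2 y * indicator {x / s..} y \<partial>lborel)"
    and "ennreal (cdf (distr M borel S) x) = (\<integral>\<^sup>+y. diff_dens a \<kappa>2 \<theta>2 \<kappa>1 \<theta>1 y * indicator {- x / s..} y \<partial>lborel)"
    and "0 \<le> cdf (distr M borel S) x" "cdf (distr M borel S) x \<le> 1"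
proof -
  interpret prob_space M by fact
  have c: "cdf (distr M borel S) x = prob {\<omega> \<in> space M. S \<omega> \<le> x}"
    unfolding cdf_def by (subst measure_distr) (auto intro!: arg_cong[where f = prob])
  show "0 \<le> cdf (distr M borel S) x" "cdf (distr M borel S) x \<le> 1" by (simp_all add: c)
  have "1 - cdf (distr M borel S) x = prob (space M - {\<omega> \<in> space M. S \<omega> \<le> x})"
    unfolding c by (rule prob_compl[symmetric]) measurable
  also have "space M - {\<omega> \<in> space M. S \<omega> \<le> x} = (\<lambda>\<omega>. S \<omega> / s) -` {x / s<..} \<inter> space M"
    using s by (auto simp: divide_less_cancel)
  finally have "ennreal (1 - cdf (distr M borel S) x) = emeasure (distr M borel (\<lambda>\<omega>. S \<omega> / s)) {x / s<..}"
    by (subst emeasure_distr) (auto simp: emeasure_eq_measure)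
  also have "\<dots> = (\<integral>\<^sup>+y. diff_dens a \<kappa>1 \<theta>1 \<kappa>2 \<theta>2 y * indicator {x / s<..} y \<partial>lborel)"
    unfolding law by (rule emeasure_density) auto
  \<comment> \<open>A single point is a null set, so the half line may be closed to match the tail
    results.\<close>
  also have "\<dots> = (\<integral>\<^sup>+y. diff_dens a \<kappa>1 \<theta>1 \<kappa>2 \<theta>2 y * indicator {x / s..} y \<partial>lborel)"
    by (rule nn_integral_cong_AE, use AE_lborel_singleton[of "x / s"] in eventually_elim) (auto split: split_indicator)
  finally show "ennreal (1 - cdf (distr M borel S) x) = (\<integral>\<^sup>+y. diff_dens a \<kappa>1 \<theta>1 \<kappa>2 \<theta>2 y * indicator {x / s..} y \<partial>lborel)" .
  have "{\<omega> \<in> space M. S \<omega> \<le> x} = (\<lambda>\<omega>. S \<omega> / s) -` {..x / s} \<inter> space M"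
    using s by (auto simp: divide_le_cancel)
  then have "ennreal (cdf (distr M borel S) x) = emeasure (distr M borel (\<lambda>\<omega>. S \<omega> / s)) {..x / s}"
    unfolding c by (subst emeasure_distr) (auto simp: emeasure_eq_measure)
  also have "\<dots> = (\<integral>\<^sup>+y. diff_dens a \<kappa>1 \<theta>1 \<kappa>2 \<theta>2 y * indicator {..x / s} y \<partial>lborel)"
    unfolding law by (rule emeasure_density) auto
  also have "\<dots> = (\<integral>\<^sup>+y. (\<lambda>y. diff_dens a \<kappa>1 \<theta>1 \<kappa>2 \<theta>2 y * indicator {..x / s} y) (- y) \<partial>lborel)"
    by (rule nn_integral_uminus[symmetric]) measurable
  also have "\<dots> = (\<integral>\<^sup>+y. diff_dens a \<kappa>2 \<theta>2 \<kappa>1 \<theta>1 y * indicator {- x / s..} y \<partial>lborel)"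
    by (intro nn_integral_cong) (auto simp: diff_dens_uminus split: split_indicator)
  finally show "ennreal (cdf (distr M borel S) x) = (\<integral>\<^sup>+y. diff_dens a \<kappa>2 \<theta>2 \<kappa>1 \<theta>1 y * indicator {- x / s..} y \<partial>lborel)" .
qed

theorem theorem3p5:
  fixes M :: "'a measure" and X Y :: "'a \<Rightarrow> real" and Z :: "nat \<Rightarrow> 'a \<Rightarrow> real"
    and \<mu>X \<mu>Y \<sigma>X \<sigma>Y \<rho> rX rY s :: real and n :: nat
    and S :: "'a \<Rightarrow> real" and F Fbar :: "real \<Rightarrow> real"
  assumes "prob_space M"
    and "\<sigma>X > 0" and "\<sigma>Y > 0" and "-1 < \<rho>" and "\<rho> < 1" and "n \<ge> 1"
    and "bivariate_normal M X Y \<mu>X \<mu>Y \<sigma>X \<sigma>Y \<rho>"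
    and "prob_space.indep_vars M (\<lambda>_. borel) Z {1..n}"
    and "\<forall>i\<in>{1..n}. distr M borel (Z i) = distr M borel (\<lambda>\<omega>. X \<omega> * Y \<omega>)"
  defines "S \<equiv> (\<lambda>\<omega>. \<Sum>i=1..n. Z i \<omega>)"
    and "F \<equiv> (\<lambda>x. cdf (distr M borel S) x)"
    and "Fbar \<equiv> (\<lambda>x. 1 - F x)"
    and "rX \<equiv> \<mu>X / \<sigma>X" and "rY \<equiv> \<mu>Y / \<sigma>Y" and "s \<equiv> \<sigma>X * \<sigma>Y"
  shows "(rX + rY \<noteq> 0 \<longrightarrow>
      poincare_expansion Fbar
        (\<lambda>x. (1 + \<rho>) * C_const rX rY \<rho> n / (2 * sqrt (2 * pi))
             * ((1 + \<rho>) / (\<bar>rX + rY\<bar> * sqrt (real n))) powr ((real n - 1) / 2)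
             * exp (real n / 8 * ((1 + \<rho>) / (1 - \<rho>)) * (rX - rY)\<^sup>2)
             * (x / s) powr ((real n - 3) / 4)
             * exp (\<bar>rX + rY\<bar> / (1 + \<rho>) * sqrt (real n * x / s) - x / (s * (1 + \<rho>))))
        (\<lambda>p. gamma_coeff p rX rY \<rho> n * s powr (real p / 2)) (1 / 2) at_top) \<and>
    (rX + rY = 0 \<longrightarrow>
      poincare_expansion Fbar
        (\<lambda>x. (1 + \<rho>) / (2 powr (real n / 2) * Gamma (real n / 2))
             * (x / s) powr (real n / 2 - 1)
             * exp (- (real n * rX\<^sup>2 / 2) - x / (s * (1 + \<rho>))))
        (\<lambda>k. delta_coeff k rX \<rho> n * s ^ k) 1 at_top) \<and>
    (rX - rY \<noteq> 0 \<longrightarrow>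
      poincare_expansion F
        (\<lambda>x. (1 - \<rho>) * C_const rX rY \<rho> n / (2 * sqrt (2 * pi))
             * ((1 - \<rho>) / (\<bar>rX - rY\<bar> * sqrt (real n))) powr ((real n - 1) / 2)
             * exp (real n / 8 * ((1 - \<rho>) / (1 + \<rho>)) * (rX + rY)\<^sup>2)
             * (\<bar>x\<bar> / s) powr ((real n - 3) / 4)
             * exp (\<bar>rX - rY\<bar> / (1 - \<rho>) * sqrt (real n * \<bar>x\<bar> / s) + x / (s * (1 - \<rho>))))
        (\<lambda>p. gamma_coeff p rX (- rY) (- \<rho>) n * s powr (real p / 2)) (1 / 2) at_bot) \<and>
    (rX - rY = 0 \<longrightarrow>
      poincare_expansion F
        (\<lambda>x. (1 - \<rho>) / (2 powr (real n / 2) * Gamma (real n / 2))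
             * (\<bar>x\<bar> / s) powr (real n / 2 - 1)
             * exp (- (real n * rX\<^sup>2 / 2) + x / (s * (1 - \<rho>))))
        (\<lambda>k. delta_coeff k rX (- \<rho>) n * s ^ k) 1 at_bot)"
proof -
  interpret prob_space M by fact
  have s: "s > 0" using assms by (simp add: s_def)
  have [measurable]: "S \<in> borel_measurable M"
    unfolding S_def using \<open>indep_vars (\<lambda>_. borel) Z {1..n}\<close> by (intro borel_measurable_sum) (auto simp: indep_vars_def)
  define \<theta>1 where "\<theta>1 = real n * (((rX + rY) / 2)\<^sup>2 / (1 + \<rho>))"
  define \<theta>2 where "\<theta>2 = real n * (((rX - rY) / 2)\<^sup>2 / (1 - \<rho>))"
  have law: "distr M borel (\<lambda>\<omega>. S \<omega> / s) = density lborel (diff_dens (real n / 2) (1 + \<rho>) \<theta>1 (1 - \<rho>) \<theta>2)"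
    unfolding S_def s_def \<theta>1_def \<theta>2_def rX_def rY_def by (rule distr_scaled_sum[OF assms(1-9)])
  note tails = tails_from_density[OF assms(1) \<open>S \<in> borel_measurable M\<close> s law]
  have div: "filterlim (\<lambda>x. x / s) at_top at_top" using s by real_asymp
  \<comment> \<open>Nonnegativity on both sides allows leaving \<open>ennreal\<close>; for Fbar it
    holds because a distribution function is at most 1.\<close>
  have right: "\<forall>\<^sub>F x in at_top. Fbar x = \<phi> (x / s) * W (x / s)"
    if ev: "\<forall>\<^sub>F x in at_top. (\<integral>\<^sup>+y. diff_dens (real n / 2) (1 + \<rho>) \<theta>1 (1 - \<rho>) \<theta>2 y * indicator {x..} y \<partial>lborel) = ennreal (\<phi> x * W x) \<and> W x \<ge> 0"
      and nn: "\<And>x. \<phi> x \<ge> 0" for \<phi> W :: "real \<Rightarrow> real"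
    using eventually_compose_filterlim[OF ev div]
  proof eventually_elim
    case (elim x)
    then have "ennreal (Fbar x) = ennreal (\<phi> (x / s) * W (x / s))" using tails(1)[of x] by (simp add: Fbar_def F_def)
    then show ?case using tails(4)[of x] nn[of "x / s"] elim by (subst (asm) ennreal_inj) (auto simp: Fbar_def F_def)
  qed
  have left: "\<forall>\<^sub>F x in at_top. F (- x) = \<phi> (x / s) * W (x / s)"
    if ev: "\<forall>\<^sub>F x in at_top. (\<integral>\<^sup>+y. diff_dens (real n / 2) (1 - \<rho>) \<theta>2 (1 + \<rho>) \<theta>1 y * indicator {x..} y \<partial>lborel) = ennreal (\<phi> x * W x) \<and> W x \<ge> 0"
      and nn: "\<And>x. \<phi> x \<ge> 0" for \<phi> W :: "real \<Rightarrow> real"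
    using eventually_compose_filterlim[OF ev div]
  proof eventually_elim
    case (elim x)
    then have "ennreal (F (- x)) = ennreal (\<phi> (x / s) * W (x / s))" using tails(2)[of "- x"] by (simp add: F_def)
    then show ?case using tails(3)[of "- x"] nn[of "x / s"] elim by (subst (asm) ennreal_inj) (auto simp: F_def)
  qed
  have C': "C_const rX (- rY) (- \<rho>) n = C_const rX rY \<rho> n" by (simp add: C_const_def)
  have Cp: "C_const rX rY \<rho> n > 0" by (simp add: C_const_def)
  show ?thesis
  proof (intro conjI impI)
    assume r: "rX + rY \<noteq> 0"
    obtain W where W: "asy W (\<lambda>p. gamma_coeff p rX rY \<rho> n)" and ev: "\<forall>\<^sub>F x in at_top. (\<integral>\<^sup>+y. diff_dens (real n / 2) (1 + \<rho>) \<theta>1 (1 - \<rho>) \<theta>2 y * indicator {x..} y \<partial>lborel) =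
      ennreal ((1 + \<rho>) * C_const rX rY \<rho> n / (2 * sqrt (2 * pi))
             * ((1 + \<rho>) / (\<bar>rX + rY\<bar> * sqrt (real n))) powr ((real n - 1) / 2)
             * exp (real n / 8 * ((1 + \<rho>) / (1 - \<rho>)) * (rX - rY)\<^sup>2)
             * x powr ((real n - 3) / 4)
             * exp (\<bar>rX + rY\<bar> / (1 + \<rho>) * sqrt (real n * x) - x / (1 + \<rho>)) * W x) \<and> W x \<ge> 0"
      unfolding \<theta>1_def \<theta>2_def by (rule right_tail_nonzero[OF assms(4-6) r])
    have "\<forall>\<^sub>F x in at_top. Fbar x = (1 + \<rho>) * C_const rX rY \<rho> n / (2 * sqrt (2 * pi))
             * ((1 + \<rho>) / (\<bar>rX + rY\<bar> * sqrt (real n))) powr ((real n - 1) / 2)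
             * exp (real n / 8 * ((1 + \<rho>) / (1 - \<rho>)) * (rX - rY)\<^sup>2)
             * (x / s) powr ((real n - 3) / 4)
             * exp (\<bar>rX + rY\<bar> / (1 + \<rho>) * sqrt (real n * (x / s)) - x / s / (1 + \<rho>)) * W (x / s)"
      by (rule right[OF ev]) (use assms(4) Cp in \<open>auto intro!: mult_nonneg_nonneg divide_nonneg_nonneg\<close>)
    then show "poincare_expansion Fbar
        (\<lambda>x. (1 + \<rho>) * C_const rX rY \<rho> n / (2 * sqrt (2 * pi))
             * ((1 + \<rho>) / (\<bar>rX + rY\<bar> * sqrt (real n))) powr ((real n - 1) / 2)
             * exp (real n / 8 * ((1 + \<rho>) / (1 - \<rho>)) * (rX - rY)\<^sup>2)
             * (x / s) powr ((real n - 3) / 4)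
             * exp (\<bar>rX + rY\<bar> / (1 + \<rho>) * sqrt (real n * x / s) - x / (s * (1 + \<rho>))))
        (\<lambda>p. gamma_coeff p rX rY \<rho> n * s powr (real p / 2)) (1 / 2) at_top"
      by (intro poincare_expansion_at_top[OF W s]) (simp only: times_divide_eq_right divide_divide_eq_left)
  next
    assume r: "rX + rY = 0"
    obtain W where W: "asy W (\<lambda>p. if even p then delta_coeff (p div 2) rX \<rho> n else 0)" and ev: "\<forall>\<^sub>F x in at_top. (\<integral>\<^sup>+y. diff_dens (real n / 2) (1 + \<rho>) \<theta>1 (1 - \<rho>) \<theta>2 y * indicator {x..} y \<partial>lborel) =
      ennreal ((1 + \<rho>) / (2 powr (real n / 2) * Gamma (real n / 2)) * x powr (real n / 2 - 1)
        * exp (- (real n * rX\<^sup>2 / 2) - x / (1 + \<rho>)) * W x) \<and> W x \<ge> 0"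
      unfolding \<theta>1_def \<theta>2_def by (rule right_tail_zero[OF assms(4-6) r])
    have "\<forall>\<^sub>F x in at_top. Fbar x = (1 + \<rho>) / (2 powr (real n / 2) * Gamma (real n / 2)) * (x / s) powr (real n / 2 - 1)
        * exp (- (real n * rX\<^sup>2 / 2) - x / s / (1 + \<rho>)) * W (x / s)"
      by (rule right[OF ev]) (use assms(4,6) in \<open>auto intro!: mult_nonneg_nonneg divide_nonneg_nonneg Gamma_real_nonneg\<close>)
    then have "poincare_expansion Fbar
        (\<lambda>x. (1 + \<rho>) / (2 powr (real n / 2) * Gamma (real n / 2)) * (x / s) powr (real n / 2 - 1)
             * exp (- (real n * rX\<^sup>2 / 2) - x / (s * (1 + \<rho>))))
        (\<lambda>p. (if even p then delta_coeff (p div 2) rX \<rho> n else 0) * s powr (real p / 2)) (1 / 2) at_top"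
      by (intro poincare_expansion_at_top[OF W s]) (simp only: divide_divide_eq_left)
    from poincare_expansion_even[OF this s]
    show "poincare_expansion Fbar
        (\<lambda>x. (1 + \<rho>) / (2 powr (real n / 2) * Gamma (real n / 2)) * (x / s) powr (real n / 2 - 1)
             * exp (- (real n * rX\<^sup>2 / 2) - x / (s * (1 + \<rho>))))
        (\<lambda>k. delta_coeff k rX \<rho> n * s ^ k) 1 at_top" by simp
  next
    assume r: "rX - rY \<noteq> 0"
    \<comment> \<open>Replacing (rY, \<rho>) by (- rY, - \<rho>) exchanges 1 + \<rho> with 1 -
      \<rho> and \<theta>1 with \<theta>2 and leaves \<open>C_const\<close> unchanged. So the result
      for the right tail applies to the reflected law.\<close>
    then have r': "rX + - rY \<noteq> 0" by simp
    have \<rho>': "-1 < - \<rho>" "- \<rho> < 1" using assms(4,5) by auto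
    obtain W where W: "asy W (\<lambda>p. gamma_coeff p rX (- rY) (- \<rho>) n)" and ev: "\<forall>\<^sub>F x in at_top. (\<integral>\<^sup>+y. diff_dens (real n / 2) (1 - \<rho>) \<theta>2 (1 + \<rho>) \<theta>1 y * indicator {x..} y \<partial>lborel) =
      ennreal ((1 - \<rho>) * C_const rX rY \<rho> n / (2 * sqrt (2 * pi))
             * ((1 - \<rho>) / (\<bar>rX - rY\<bar> * sqrt (real n))) powr ((real n - 1) / 2)
             * exp (real n / 8 * ((1 - \<rho>) / (1 + \<rho>)) * (rX + rY)\<^sup>2)
             * x powr ((real n - 3) / 4)
             * exp (\<bar>rX - rY\<bar> / (1 - \<rho>) * sqrt (real n * x) - x / (1 - \<rho>)) * W x) \<and> W x \<ge> 0"
      using right_tail_nonzero[OF \<rho>' assms(6) r'] unfolding C' \<theta>1_def \<theta>2_def by auto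
    have "\<forall>\<^sub>F x in at_top. F (- x) = (1 - \<rho>) * C_const rX rY \<rho> n / (2 * sqrt (2 * pi))
             * ((1 - \<rho>) / (\<bar>rX - rY\<bar> * sqrt (real n))) powr ((real n - 1) / 2)
             * exp (real n / 8 * ((1 - \<rho>) / (1 + \<rho>)) * (rX + rY)\<^sup>2)
             * (x / s) powr ((real n - 3) / 4)
             * exp (\<bar>rX - rY\<bar> / (1 - \<rho>) * sqrt (real n * (x / s)) - x / s / (1 - \<rho>)) * W (x / s)"
      by (rule left[OF ev]) (use assms(5) Cp in \<open>auto intro!: mult_nonneg_nonneg divide_nonneg_nonneg\<close>)
    then have "\<forall>\<^sub>F x in at_top. F (- x) = (1 - \<rho>) * C_const rX rY \<rho> n / (2 * sqrt (2 * pi))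
             * ((1 - \<rho>) / (\<bar>rX - rY\<bar> * sqrt (real n))) powr ((real n - 1) / 2)
             * exp (real n / 8 * ((1 - \<rho>) / (1 + \<rho>)) * (rX + rY)\<^sup>2)
             * (\<bar>- x\<bar> / s) powr ((real n - 3) / 4)
             * exp (\<bar>rX - rY\<bar> / (1 - \<rho>) * sqrt (real n * \<bar>- x\<bar> / s) + - x / (s * (1 - \<rho>))) * W (x / s)"
      using eventually_gt_at_top[of 0] by eventually_elim simp
    then show "poincare_expansion F
        (\<lambda>x. (1 - \<rho>) * C_const rX rY \<rho> n / (2 * sqrt (2 * pi))
             * ((1 - \<rho>) / (\<bar>rX - rY\<bar> * sqrt (real n))) powr ((real n - 1) / 2)
             * exp (real n / 8 * ((1 - \<rho>) / (1 + \<rho>)) * (rX + rY)\<^sup>2)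
             * (\<bar>x\<bar> / s) powr ((real n - 3) / 4)
             * exp (\<bar>rX - rY\<bar> / (1 - \<rho>) * sqrt (real n * \<bar>x\<bar> / s) + x / (s * (1 - \<rho>))))
        (\<lambda>p. gamma_coeff p rX (- rY) (- \<rho>) n * s powr (real p / 2)) (1 / 2) at_bot"
      by (intro poincare_expansion_at_bot poincare_expansion_at_top[OF W s])
  next
    assume r: "rX - rY = 0"
    then have r': "rX + - rY = 0" by simp
    have \<rho>': "-1 < - \<rho>" "- \<rho> < 1" using assms(4,5) by auto
    obtain W where W: "asy W (\<lambda>p. if even p then delta_coeff (p div 2) rX (- \<rho>) n else 0)" and ev: "\<forall>\<^sub>F x in at_top. (\<integral>\<^sup>+y. diff_dens (real n / 2) (1 - \<rho>) \<theta>2 (1 + \<rho>) \<theta>1 y * indicator {x..} y \<partial>lborel) =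
      ennreal ((1 - \<rho>) / (2 powr (real n / 2) * Gamma (real n / 2)) * x powr (real n / 2 - 1)
        * exp (- (real n * rX\<^sup>2 / 2) - x / (1 - \<rho>)) * W x) \<and> W x \<ge> 0"
      using right_tail_zero[OF \<rho>' assms(6) r'] unfolding \<theta>1_def \<theta>2_def by auto
    have "\<forall>\<^sub>F x in at_top. F (- x) = (1 - \<rho>) / (2 powr (real n / 2) * Gamma (real n / 2)) * (x / s) powr (real n / 2 - 1)
        * exp (- (real n * rX\<^sup>2 / 2) - x / s / (1 - \<rho>)) * W (x / s)"
      by (rule left[OF ev]) (use assms(5,6) in \<open>auto intro!: mult_nonneg_nonneg divide_nonneg_nonneg Gamma_real_nonneg\<close>)
    then have "\<forall>\<^sub>F x in at_top. F (- x) = (1 - \<rho>) / (2 powr (real n / 2) * Gamma (real n / 2)) * (\<bar>- x\<bar> / s) powr (real n / 2 - 1)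
        * exp (- (real n * rX\<^sup>2 / 2) + - x / (s * (1 - \<rho>))) * W (x / s)"
      using eventually_gt_at_top[of 0] by eventually_elim simp
    then have "poincare_expansion F
        (\<lambda>x. (1 - \<rho>) / (2 powr (real n / 2) * Gamma (real n / 2)) * (\<bar>x\<bar> / s) powr (real n / 2 - 1)
             * exp (- (real n * rX\<^sup>2 / 2) + x / (s * (1 - \<rho>))))
        (\<lambda>p. (if even p then delta_coeff (p div 2) rX (- \<rho>) n else 0) * s powr (real p / 2)) (1 / 2) at_bot"
      by (intro poincare_expansion_at_bot poincare_expansion_at_top[OF W s])
    from poincare_expansion_even[OF this s]
    show "poincare_expansion F
        (\<lambda>x. (1 - \<rho>) / (2 powr (real n / 2) * Gamma (real n / 2)) * (\<bar>x\<bar> / s) powr (real n / 2 - 1)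
             * exp (- (real n * rX\<^sup>2 / 2) + x / (s * (1 - \<rho>))))
        (\<lambda>k. delta_coeff k rX (- \<rho>) n * s ^ k) 1 at_bot" by simp
  qed
qed

end
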